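(* Let $m\in\mathbb{N}$ and $f\in L_2(\mathbb{T}^m)$. Let $a\in L_\infty(\mathbb{I}^\infty,W^1_\infty(\mathbb{T}^m))$ satisfy $0<r<a(\mathbf{x},\mathbf{y})\le R<\infty$ for all $\mathbf{x}\in\mathbb{T}^m$, $\mathbf{y}\in\mathbb{I}^\infty$, and be affinely dependent on $\mathbf{y}$: $$a(\mathbf{y})(\mathbf{x})=\overline{a}(\mathbf{x})+\sum_{j=1}^\infty y_j\,\psi_j(\mathbf{x}),\qquad \mathbf{x}\in\mathbb{T}^m,\ \mathbf{y}\in\mathbb{I}^\infty,\quad \overline{a},\psi_j\in W^1_\infty(\mathbb{T}^m).$$ Let $u$ be the solution of the parametric elliptic problem $-\operatorname{div}(a(\mathbf{y})\nabla u(\mathbf{y}))=f$ (in the weak sense in $V$, see context). Put $$K:=\frac1r\left(1+\left(1+\frac{|a|_{L_\infty(\mathbb{I}^\infty,W^1_\infty(\mathbb{T}^m))}}{r}\right)\right)\|f\|_{L_2(\mathbb{T}^m)},$$ $$d_j:=\frac{1}{r\sqrt3}\left(\left(\frac{|a|_{L_\infty(\mathbb{I}^\infty,W^1_\infty(\mathbb{T}^m))}}{r}+2\right)\|\psi_j\|_{L_\infty(\mathbb{T}^m)}+|\psi_j|_{W^1_\infty(\mathbb{T}^m)}\right),\quad j\in\mathbb{N}.$$ Let $\mathbf{c}=(c_j)_{j\in\mathbb{N}}$ be any positive sequence such that $c_j>1$, such that $\mathbf{c}^{-1}=(c_j^{-1})_{j\in\mathbb{N}}$ belongs to $\ell_2(\mathbb{N})$,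 and such that the sequence $\mathbf{b}:=(b_j)_{j\in\mathbb{N}}$, $b_j:=c_jd_j$, satisfies $$\begin{cases}\|\mathbf{b}\|_{\ell_1(\mathbb{N})}<1, & m=1,\\ \|\mathbf{b}\|_{\ell_1(\mathbb{N})}\le1, & m>1.\end{cases}$$ For any $T\ge1$ put $n:=|E_{1,\mathbf{b}}(T)|$, $\mathcal{V}_n:=\mathcal{V}(E_{1,\mathbf{b}}(T))$, $\mathcal{P}_n:=\mathcal{S}_{E_{1,\mathbf{b}}(T)}$ and let $u_n:=u_{E_{1,\mathbf{b}}(T)}$ be the Galerkin approximation of $u$ in $\mathcal{V}_n$. Then $\mathcal{P}_n$ is the orthogonal projector from $L_2(\mathbb{I}^\infty,V,\mu)$ onto the space $\mathcal{V}_n$ of dimension $n$, and $$\|u-u_n\|_{L_2(\mathbb{I}^\infty,V,\mu)}\le\sqrt{\frac Rr}\,\|u-\mathcal{P}_nu\|_{L_2(\mathbb{I}^\infty,V,\mu)}\le B\,n^{-1/m},$$ where $$B:=4\pi\,C^{1/m}\sqrt{\frac{mR}{r}}\,K\,\|\mathbf{c}^{-1}\|_{\ell_2(\mathbb{F})},\qquad C:=\left(\tfrac32\right)^{2m}\sum_{\mathbf{s}\in\mathbb{F}}\left(\frac{|\mathbf{s}|_1!}{\mathbf{s}!}\,\mathbf{b}^{\mathbf{s}}\right)^{m}.$$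
   Context: Index sets. $\mathbb{F}$ is the set of all sequences $\mathbf{s}=(s_j)_{j=1}^\infty$ of nonnegative integers with finite support $\operatorname{supp}(\mathbf{s})$; $\mathbf{s}!:=\prod_j s_j!$, $|\mathbf{s}|_1:=\sum_j s_j$, $\mathbf{b}^{\mathbf{s}}:=\prod_j b_j^{s_j}$, $\mathbf{b}^{-\mathbf{s}}:=\prod_j b_j^{-s_j}$. $\|\mathbf{c}^{-1}\|_{\ell_2(\mathbb{F})}:=\big(\sum_{\mathbf{s}\in\mathbb{F}}\mathbf{c}^{-2\mathbf{s}}\big)^{1/2}$. $\mathbb{Z}^m_*:=\{\mathbf{k}\in\mathbb{Z}^m:k_j\ne0,\ j=1,\dots,m\}$, $|\mathbf{k}|_\infty:=\max_j|k_j|$, $|\mathbf{k}|_2$ the Euclidean norm. For a sequence $\mathbf{b}$ with $b_j>0$ (a standing requirement), $\rho_{1,\mathbf{b}}(\mathbf{k},\mathbf{s}):=|\mathbf{k}|_\infty\frac{\mathbf{s}!}{|\mathbf{s}|_1!}\mathbf{b}^{-\mathbf{s}}$ and $E_{1,\mathbf{b}}(T):=\{(\mathbf{k},\mathbf{s})\in\mathbb{Z}^m_*\times\mathbb{F}:\rho_{1,\mathbf{b}}(\mathbf{k},\mathbf{s})\le T\}$; $|E|$ is cardinality. Spaces. $\mathbb{T}^m$ is the $m$-dimensional torus (functions on it are $1$-periodic in each variable) with normalized Lebesgue measure; $\mathbb{I}=[-1,1]$; $\mathbb{I}^\infty$ is the set of sequences with entries in $\mathbb{I}$, with the infinite product $\mu$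 of the uniform probability measures $\frac12dy_j$. $W^1_\infty(\mathbb{T}^m)$ has semi-norm $|v|_{W^1_\infty}:=\max_{1\le i\le m}\|\partial_{x_i}v\|_{L_\infty(\mathbb{T}^m)}$ and norm $\|v\|_{L_\infty}+|v|_{W^1_\infty}$; $|a|_{L_\infty(\mathbb{I}^\infty,W^1_\infty)}$ is the (essential) supremum over $\mathbf{y}\in\mathbb{I}^\infty$ of $|a(\mathbf{y})|_{W^1_\infty}$. With $e_{\mathbf{k}}(\mathbf{x})=\prod_{j=1}^m e^{2\pi ik_jx_j}$, the space $V=H^1_0(\mathbb{T}^m)$ consists of the functions $v=\sum_{\mathbf{k}\in\mathbb{Z}^m_*}v_{\mathbf{k}}e_{\mathbf{k}}$ with $\|v\|_V^2:=\sum_{i=1}^m\|\partial_iv\|_{L_2(\mathbb{T}^m)}^2=(2\pi)^2\sum_{\mathbf{k}\in\mathbb{Z}^m_*}|\mathbf{k}|_2^2|v_{\mathbf{k}}|^2<\infty$. $L_2(\mathbb{I}^\infty,V,\mu)$ is the Bochner space of square-integrable $V$-valued functions. Parametric problem. For every $\mathbf{y}\in\mathbb{I}^\infty$, $u(\mathbf{y})\in V$ is the unique solution of $\int_{\mathbb{T}^m}a(\mathbf{x},\mathbf{y})\nabla u(\mathbf{y})(\mathbf{x})\cdot\nabla v(\mathbf{x})\,d\mathbf{x}=\int_{\mathbb{T}^m}f(\mathbf{x})v(\mathbf{x})\,d\mathbf{x}$ for all $v\in V$, where $a(\mathbf{x},\mathbf{y})=a(\mathbf{y})(\mathbf{x})$;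 $u\in L_2(\mathbb{I}^\infty,V,\mu)$. Galerkin approximation. $L_{(\mathbf{k},\mathbf{s})}(\mathbf{x},\mathbf{y}):=e_{\mathbf{k}}(\mathbf{x})L_{\mathbf{s}}(\mathbf{y})$, $L_{\mathbf{s}}(\mathbf{y})=\prod_{j\in\operatorname{supp}(\mathbf{s})}L_{s_j}(y_j)$, with $L_0,L_1,\dots$ the univariate Legendre polynomials, orthonormal in $L_2(\mathbb{I},\frac12dy)$. For finite $G\subset\mathbb{Z}^m_*\times\mathbb{F}$, $\mathcal{V}(G)$ is the span of $\{L_{(\mathbf{k},\mathbf{s})}:(\mathbf{k},\mathbf{s})\in G\}$ and $\mathcal{S}_Gv:=\sum_{(\mathbf{k},\mathbf{s})\in G}v_{\mathbf{k},\mathbf{s}}L_{(\mathbf{k},\mathbf{s})}$, where $v_{\mathbf{k},\mathbf{s}}$ is the coefficient of $v$ in $L_2(\mathbb{T}^m\times\mathbb{I}^\infty)=L_2(\mathbb{T}^m)\otimes L_2(\mathbb{I}^\infty,\mu)$ with respect to $L_{(\mathbf{k},\mathbf{s})}$. The Galerkin approximation $u_G\in\mathcal{V}(G)$ is the unique element with $B(u_G,v)=F(v)$ for all $v\in\mathcal{V}(G)$, where the bilinear form is $B(u,v):=\int_{\mathbb{I}^\infty}\int_{\mathbb{T}^m}a(\mathbf{x},\mathbf{y})\nabla u(\mathbf{x},\mathbf{y})\cdot\nabla v(\mathbf{x},\mathbf{y})\,d\mathbf{x}\,d\mu(\mathbf{y})$ (gradients in $\mathbf{x}$) and $F(v):=\int_{\mathbb{I}^\infty}\int_{\mathbb{T}^m}f(\mathbf{x})v(\mathbf{x},\mathbf{y})\,d\mathbf{x}\,d\mu(\mathbf{y})$.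 (The constant $B$ in the claim is a number, unrelated to this form.) *)

theory Defs
  imports
    "HOL-Probability.Probability"
    "HOL-Computational_Algebra.Polynomial"
    "HOL-Library.Function_Algebras"
begin

section \<open>Multi-indices\<close>

text \<open>Sequences are indexed by \<open>j = 0, 1, 2, \<dots>\<close> instead of \<open>j = 1, 2, \<dots>\<close>.\<close>

definition finsupp :: "(nat \<Rightarrow> nat) set" where
  "finsupp = {s. finite {j. s j \<noteq> 0}}"

definition mfact :: "(nat \<Rightarrow> nat) \<Rightarrow> nat" where
  "mfact s = (\<Prod>j | s j \<noteq> 0. fact (s j))"

definition msize :: "(nat \<Rightarrow> nat) \<Rightarrow> nat" where
  "msize s = (\<Sum>j | s j \<noteq> 0. s j)"

definition mpow :: "(nat \<Rightarrow> real) \<Rightarrow> (nat \<Rightarrow> nat) \<Rightarrow> real" where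
  "mpow b s = (\<Prod>j | s j \<noteq> 0. b j ^ s j)"

definition Zstar :: "(int ^ 'm) set" where
  "Zstar = {k. \<forall>j. k $ j \<noteq> 0}"

definition abs_inf :: "int ^ 'm \<Rightarrow> real" where
  "abs_inf k = real_of_int (Max (range (\<lambda>j. \<bar>k $ j\<bar>)))"

definition abs_2 :: "int ^ 'm \<Rightarrow> real" where
  "abs_2 k = norm (\<chi> j. real_of_int (k $ j))"

definition rho1 :: "(nat \<Rightarrow> real) \<Rightarrow> int ^ 'm \<Rightarrow> (nat \<Rightarrow> nat) \<Rightarrow> real" where
  "rho1 b k s = abs_inf k * (real (mfact s) / fact (msize s)) * mpow (\<lambda>j. inverse (b j)) s"

definition E1 :: "(nat \<Rightarrow> real) \<Rightarrow> real \<Rightarrow> ((int ^ 'm) \<times> (nat \<Rightarrow> nat)) set" where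
  "E1 b T = {(k, s). k \<in> Zstar \<and> s \<in> finsupp \<and> rho1 b k s \<le> T}"

definition l2_finsupp_norm_inverse :: "(nat \<Rightarrow> real) \<Rightarrow> real" where
  "l2_finsupp_norm_inverse c = sqrt (\<Sum>\<^sub>\<infinity>s\<in>finsupp. (mpow (\<lambda>j. inverse (c j)) s)\<^sup>2)"


section \<open>The torus and function spaces on it\<close>

text \<open>Functions on the torus are \<open>1\<close>-periodic functions on \<open>real ^ 'm\<close>; they are integrated over
  the unit cube. The elements of the function spaces below are functions, not equivalence classes,
  so that the norms vanish on functions that are zero almost everywhere.\<close>

definition torus :: "(real ^ 'm) measure" where
  "torus = restrict_space lborel {x. \<forall>i. 0 \<le> x $ i \<and> x $ i < 1}"

definition periodic :: "(real ^ 'm \<Rightarrow> 'a) \<Rightarrow> bool" where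
  "periodic v \<longleftrightarrow> (\<forall>x i. v (x + axis i 1) = v x)"

definition L2_torus :: "(real ^ 'm \<Rightarrow> complex) set" where
  "L2_torus = {v. periodic v \<and> v \<in> borel_measurable torus \<and> integrable torus (\<lambda>x. (norm (v x))\<^sup>2)}"

definition L2_norm :: "(real ^ 'm \<Rightarrow> complex) \<Rightarrow> real" where
  "L2_norm v = sqrt (\<integral>x. (norm (v x))\<^sup>2 \<partial>torus)"

definition Linf_torus :: "(real ^ 'm \<Rightarrow> real) set" where
  "Linf_torus = {v. periodic v \<and> v \<in> borel_measurable torus \<and>
     esssup torus (\<lambda>x. ereal \<bar>v x\<bar>) < \<infinity>}"

definition Linf_norm :: "(real ^ 'm \<Rightarrow> real) \<Rightarrow> real" where
  "Linf_norm v = real_of_ereal (esssup torus (\<lambda>x. ereal \<bar>v x\<bar>))"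

text \<open>\<open>D \<alpha>\<close> is the iterated partial derivative of \<open>\<phi>\<close> along the list of directions \<open>\<alpha>\<close>.\<close>

definition smooth_derivs :: "(real ^ 'm \<Rightarrow> real) \<Rightarrow> ('m list \<Rightarrow> real ^ 'm \<Rightarrow> real) \<Rightarrow> bool" where
  "smooth_derivs \<phi> D \<longleftrightarrow> D [] = \<phi> \<and> (\<forall>\<alpha>. continuous_on UNIV (D \<alpha>)) \<and>
     (\<forall>\<alpha> i x. ((\<lambda>t. D \<alpha> (x + t *\<^sub>R axis i 1)) has_real_derivative D (i # \<alpha>) x) (at 0))"

definition weak_partial ::
  "'m \<Rightarrow> (real ^ 'm \<Rightarrow> 'a :: {banach, second_countable_topology}) \<Rightarrow> (real ^ 'm \<Rightarrow> 'a) \<Rightarrow> bool" where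
  "weak_partial i v w \<longleftrightarrow> (\<forall>\<phi> D. periodic \<phi> \<and> smooth_derivs \<phi> D \<longrightarrow>
     (\<integral>x. D [i] x *\<^sub>R v x \<partial>torus) = - (\<integral>x. \<phi> x *\<^sub>R w x \<partial>torus))"

text \<open>The weak partial derivative, determined only up to a set of measure zero.\<close>

definition wpartial ::
  "'m \<Rightarrow> (real ^ 'm \<Rightarrow> 'a :: {banach, second_countable_topology}) \<Rightarrow> real ^ 'm \<Rightarrow> 'a" where
  "wpartial i v = (SOME w. periodic w \<and> integrable torus w \<and> weak_partial i v w)"

definition W1inf :: "(real ^ 'm \<Rightarrow> real) set" where
  "W1inf = {v \<in> Linf_torus. \<forall>i. \<exists>w \<in> Linf_torus. weak_partial i v w}"

definition W1inf_seminorm :: "(real ^ 'm \<Rightarrow> real) \<Rightarrow> real" where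
  "W1inf_seminorm v = Max (range (\<lambda>i. Linf_norm (wpartial i v)))"

definition W1inf_norm :: "(real ^ 'm \<Rightarrow> real) \<Rightarrow> real" where
  "W1inf_norm v = Linf_norm v + W1inf_seminorm v"

definition efun :: "int ^ 'm \<Rightarrow> real ^ 'm \<Rightarrow> complex" where
  "efun k x = (\<Prod>j\<in>UNIV. exp (2 * of_real pi * \<i> * of_int (k $ j) * of_real (x $ j)))"

text \<open>The space \<open>V\<close>: the expansion in the \<open>efun k\<close> is meant as an unconditionally convergent
  series in \<open>L2_torus\<close>.\<close>

definition V_space :: "(real ^ 'm \<Rightarrow> complex) set" where
  "V_space = {v \<in> L2_torus. \<exists>c.
     ((\<lambda>F. L2_norm (\<lambda>x. v x - (\<Sum>k\<in>F. c k * efun k x))) \<longlongrightarrow> 0) (finite_subsets_at_top Zstar) \<and>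
     (\<lambda>k. (abs_2 k)\<^sup>2 * (norm (c k))\<^sup>2) summable_on Zstar}"

definition V_inner :: "(real ^ 'm \<Rightarrow> complex) \<Rightarrow> (real ^ 'm \<Rightarrow> complex) \<Rightarrow> complex" where
  "V_inner v w = (\<Sum>i\<in>UNIV. \<integral>x. wpartial i v x * cnj (wpartial i w x) \<partial>torus)"

definition V_norm :: "(real ^ 'm \<Rightarrow> complex) \<Rightarrow> real" where
  "V_norm v = sqrt (\<Sum>i\<in>UNIV. (L2_norm (wpartial i v))\<^sup>2)"


section \<open>The parameter domain and Bochner spaces\<close>

definition Iinf :: "(nat \<Rightarrow> real) set" where
  "Iinf = {y. \<forall>j. y j \<in> {-1..1}}"

definition mu :: "(nat \<Rightarrow> real) measure" where
  "mu = (\<Pi>\<^sub>M j\<in>UNIV. scale_measure (1/2) (restrict_space lborel {-1..1}))"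

lemma space_mu: "space mu = Iinf"
  by (auto simp: mu_def Iinf_def space_PiM space_scale_measure space_restrict_space PiE_iff)

text \<open>Strong measurability of \<open>g\<close> with values in the space \<open>X\<close> with norm \<open>N\<close>. As \<open>mu\<close> is not
  complete, the limit is required everywhere; every function that is only an almost everywhere
  limit of simple functions agrees almost everywhere with one of this kind.\<close>

definition strongly_measurable ::
  "'y measure \<Rightarrow> ('x \<Rightarrow> 'a :: ab_group_add) set \<Rightarrow> (('x \<Rightarrow> 'a) \<Rightarrow> real) \<Rightarrow> ('y \<Rightarrow> 'x \<Rightarrow> 'a) \<Rightarrow> bool" where
  "strongly_measurable M X N g \<longleftrightarrow> (\<exists>h. (\<forall>n. simple_function M (h n) \<and> h n ` space M \<subseteq> X) \<and>
     (\<forall>y\<in>space M. (\<lambda>n. N (\<lambda>x. h n y x - g y x)) \<longlonglongrightarrow> 0))"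

definition Linf_W1inf :: "((nat \<Rightarrow> real) \<Rightarrow> real ^ 'm \<Rightarrow> real) set" where
  "Linf_W1inf = {a. (\<forall>y\<in>Iinf. a y \<in> W1inf) \<and> strongly_measurable mu W1inf W1inf_norm a \<and>
     esssup mu (\<lambda>y. ereal (W1inf_norm (a y))) < \<infinity>}"

definition Linf_W1inf_seminorm :: "((nat \<Rightarrow> real) \<Rightarrow> real ^ 'm \<Rightarrow> real) \<Rightarrow> real" where
  "Linf_W1inf_seminorm a = real_of_ereal (esssup mu (\<lambda>y. ereal (W1inf_seminorm (a y))))"

definition L2V :: "((nat \<Rightarrow> real) \<Rightarrow> real ^ 'm \<Rightarrow> complex) set" where
  "L2V = {v. (\<forall>y\<in>Iinf. v y \<in> V_space) \<and> strongly_measurable mu V_space V_norm v \<and>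
     integrable mu (\<lambda>y. (V_norm (v y))\<^sup>2)}"

definition L2V_inner ::
  "((nat \<Rightarrow> real) \<Rightarrow> real ^ 'm \<Rightarrow> complex) \<Rightarrow> ((nat \<Rightarrow> real) \<Rightarrow> real ^ 'm \<Rightarrow> complex) \<Rightarrow> complex" where
  "L2V_inner v w = (\<integral>y. V_inner (v y) (w y) \<partial>mu)"

definition L2V_norm :: "((nat \<Rightarrow> real) \<Rightarrow> real ^ 'm \<Rightarrow> complex) \<Rightarrow> real" where
  "L2V_norm v = sqrt (\<integral>y. (V_norm (v y))\<^sup>2 \<partial>mu)"

definition L2V_orthogonal_projector ::
  "(((nat \<Rightarrow> real) \<Rightarrow> real ^ 'm \<Rightarrow> complex) \<Rightarrow> ((nat \<Rightarrow> real) \<Rightarrow> real ^ 'm \<Rightarrow> complex)) \<Rightarrow>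
   ((nat \<Rightarrow> real) \<Rightarrow> real ^ 'm \<Rightarrow> complex) set \<Rightarrow> bool" where
  "L2V_orthogonal_projector P U \<longleftrightarrow> U \<subseteq> L2V \<and>
     (\<forall>v\<in>L2V. P v \<in> U \<and> (\<forall>w\<in>U. L2V_inner (v - P v) w = 0))"


section \<open>The parametric problem and its Galerkin approximation\<close>

definition parametric_solution ::
  "((nat \<Rightarrow> real) \<Rightarrow> real ^ 'm \<Rightarrow> real) \<Rightarrow> (real ^ 'm \<Rightarrow> complex) \<Rightarrow>
   ((nat \<Rightarrow> real) \<Rightarrow> real ^ 'm \<Rightarrow> complex) \<Rightarrow> bool" where
  "parametric_solution a f u \<longleftrightarrow> (\<forall>y\<in>Iinf. u y \<in> V_space \<and>
     (\<forall>v\<in>V_space. (\<integral>x. of_real (a y x) * (\<Sum>i\<in>UNIV. wpartial i (u y) x * wpartial i v x) \<partial>torus)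
        = (\<integral>x. f x * v x \<partial>torus)))"

text \<open>Rodrigues' formula for the Legendre polynomials, with the factor \<open>sqrt (2 n + 1)\<close> that makes
  them orthonormal for the measure \<open>dy / 2\<close> on \<open>{-1..1}\<close>.\<close>

definition legendre :: "nat \<Rightarrow> real poly" where
  "legendre n = smult (sqrt (2 * real n + 1) / (2 ^ n * fact n)) ((pderiv ^^ n) ([:-1, 0, 1:] ^ n))"

definition mlegendre :: "(nat \<Rightarrow> nat) \<Rightarrow> (nat \<Rightarrow> real) \<Rightarrow> real" where
  "mlegendre s y = (\<Prod>j | s j \<noteq> 0. poly (legendre (s j)) (y j))"

definition Lfun :: "(int ^ 'm) \<times> (nat \<Rightarrow> nat) \<Rightarrow> (nat \<Rightarrow> real) \<Rightarrow> real ^ 'm \<Rightarrow> complex" where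
  "Lfun = (\<lambda>(k, s) y x. efun k x * of_real (mlegendre s y))"

definition cscale ::
  "complex \<Rightarrow> ((nat \<Rightarrow> real) \<Rightarrow> real ^ 'm \<Rightarrow> complex) \<Rightarrow> (nat \<Rightarrow> real) \<Rightarrow> real ^ 'm \<Rightarrow> complex" where
  "cscale c v = (\<lambda>y x. c * v y x)"

lemma vector_space_cscale: "vector_space cscale"
  by unfold_locales (auto simp: cscale_def fun_eq_iff algebra_simps)

interpretation cfun: vector_space cscale
  by (rule vector_space_cscale)

definition galerkin_space ::
  "((int ^ 'm) \<times> (nat \<Rightarrow> nat)) set \<Rightarrow> ((nat \<Rightarrow> real) \<Rightarrow> real ^ 'm \<Rightarrow> complex) set" where
  "galerkin_space G = cfun.span (Lfun ` G)"

definition legendre_coeff ::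
  "((nat \<Rightarrow> real) \<Rightarrow> real ^ 'm \<Rightarrow> complex) \<Rightarrow> (int ^ 'm) \<times> (nat \<Rightarrow> nat) \<Rightarrow> complex" where
  "legendre_coeff v ks = (\<integral>y. (\<integral>x. v y x * cnj (Lfun ks y x) \<partial>torus) \<partial>mu)"

definition partial_sum_op ::
  "((int ^ 'm) \<times> (nat \<Rightarrow> nat)) set \<Rightarrow> ((nat \<Rightarrow> real) \<Rightarrow> real ^ 'm \<Rightarrow> complex) \<Rightarrow>
   ((nat \<Rightarrow> real) \<Rightarrow> real ^ 'm \<Rightarrow> complex)" where
  "partial_sum_op G v = (\<lambda>y x. \<Sum>ks\<in>G. legendre_coeff v ks * Lfun ks y x)"

definition galerkin_form ::
  "((nat \<Rightarrow> real) \<Rightarrow> real ^ 'm \<Rightarrow> real) \<Rightarrow> ((nat \<Rightarrow> real) \<Rightarrow> real ^ 'm \<Rightarrow> complex) \<Rightarrow>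
   ((nat \<Rightarrow> real) \<Rightarrow> real ^ 'm \<Rightarrow> complex) \<Rightarrow> complex" where
  "galerkin_form a u v = (\<integral>y. (\<integral>x. of_real (a y x) *
     (\<Sum>i\<in>UNIV. wpartial i (u y) x * wpartial i (v y) x) \<partial>torus) \<partial>mu)"

definition galerkin_rhs ::
  "(real ^ 'm \<Rightarrow> complex) \<Rightarrow> ((nat \<Rightarrow> real) \<Rightarrow> real ^ 'm \<Rightarrow> complex) \<Rightarrow> complex" where
  "galerkin_rhs f v = (\<integral>y. (\<integral>x. f x * v y x \<partial>torus) \<partial>mu)"

definition galerkin_approximation ::
  "((nat \<Rightarrow> real) \<Rightarrow> real ^ 'm \<Rightarrow> real) \<Rightarrow> (real ^ 'm \<Rightarrow> complex) \<Rightarrow>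
   ((int ^ 'm) \<times> (nat \<Rightarrow> nat)) set \<Rightarrow> ((nat \<Rightarrow> real) \<Rightarrow> real ^ 'm \<Rightarrow> complex) \<Rightarrow> bool" where
  "galerkin_approximation a f G w \<longleftrightarrow> w \<in> galerkin_space G \<and>
     (\<forall>v\<in>galerkin_space G. galerkin_form a w v = galerkin_rhs f v)"

end

theory Submission
  imports Defs
begin

text \<open>
  The estimate \<open>L2V_norm (u - un) <= sqrt (R / r) * ...\<close> is Cea's lemma (\<open>galerkin_quasi_optimal\<close>). The substance
  is the bound for the projection error, and it rests on the decay of the Legendre coefficients \<open>u\<^sub>s\<close>
  of \<open>u\<close> in a norm with two spatial derivatives: if \<open>|u\<^sub>s|\<^sub>2\<close> denotes the \<open>L2\<close> norm of the Laplacian,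
  then \<open>|u\<^sub>s|\<^sub>2 <= K * mcoef d s\<close>, where \<open>mcoef d s = fact (msize s) / mfact s * mpow d s\<close>. An index \<open>(k, s)\<close>
  outside \<open>E1 b T\<close> satisfies \<open>abs_inf k > T * mcoef b s\<close>. Trading one of the two derivatives for this inequality, and
  using \<open>mcoef b s = mpow c s * mcoef d s\<close>, the squared error is at most \<open>(K / (2 * pi * T))\<^sup>2\<close> times the sum over \<open>s\<close>
  of the squares of \<open>1 / mpow c s\<close>. The cardinality of \<open>E1 b T\<close> is at most \<open>(2 * T) ^ m * (\<Sum>\<^sub>\<infinity>s\<in>finsupp. mcoef b s ^ m)\<close>
  (\<open>E1_card\<close>), which translates the rate \<open>1 / T\<close> into \<open>n powr (- 1 / m)\<close> (\<open>rate_from_cardinality\<close>). That the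
  sum is finite even for total mass 1 and \<open>m > 1\<close> is a local limit estimate (\<open>mcoef_decay\<close>).

  The decay of \<open>u\<^sub>s\<close> is obtained as follows. By Rodrigues' formula, a Legendre coefficient is the mean of the
  derivative of order \<open>s\<close> against a nonnegative kernel of mass at most \<open>(1 / sqrt 3) ^ msize s / mfact s\<close>
  (\<open>mu_by_parts\<close>, \<open>integral_omega_le\<close>). As the coefficient is affine in \<open>y\<close>, the derivatives solve the
  recursive elliptic equations \<open>A y (D s) = - (\<Sum>i. s i * A\<^sub>i (D (s - 1\<^sub>i)))\<close>. Testing with the solution and with its Laplacian
  bounds them by \<open>fact (msize s)\<close> times a power of \<open>d\<close> (\<open>W_bound\<close>).

  Regularity theory for the continuous problem is avoided by a discretization in space with finitely
  many frequencies. There, solutions are uniform limits of polynomials in \<open>y\<close>, all derivatives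
  are classical, and testing with the Laplacian is legitimate; the bounds do not depend on the number
  of frequencies (\<open>semidiscrete_error\<close>), which then tends to infinity (\<open>projection_error\<close>).
\<close>

section \<open>Multinomial weights\<close>

definition mcoef :: "(nat => real) => (nat => nat) => real" where
  "mcoef b s = fact (msize s) / real (mfact s) * mpow b s"

lemma finsupp_finite: "s \<in> finsupp ==> finite {j. s j ~= 0}"
  by (simp add: finsupp_def)

lemma finsupp_upd: "s \<in> finsupp ==> s(j := i) \<in> finsupp"
proof -
  assume "s \<in> finsupp"
  then have "finite (insert j {j. s j ~= 0})" by (simp add: finsupp_def)
  moreover have "{k. (s(j := i)) k ~= 0} \<subseteq> insert j {j. s j ~= 0}" by auto
  ultimately show ?thesis unfolding finsupp_def mem_Collect_eq by (rule rev_finite_subset)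
qed

lemma mfact_superset: "finite J ==> {j. s j ~= 0} \<subseteq> J ==> mfact s = (\<Prod>j\<in>J. fact (s j))"
  unfolding mfact_def by (rule prod.mono_neutral_left) auto

lemma msize_superset: "finite J ==> {j. s j ~= 0} \<subseteq> J ==> msize s = (\<Sum>j\<in>J. s j)"
  unfolding msize_def by (rule sum.mono_neutral_left) auto

lemma mpow_superset: "finite J ==> {j. s j ~= 0} \<subseteq> J ==> mpow b s = (\<Prod>j\<in>J. b j ^ s j)"
  unfolding mpow_def by (rule prod.mono_neutral_left) auto

lemma
  assumes "s \<in> finsupp"
  shows msize_inc: "msize (s(j := Suc (s j))) = Suc (msize s)"
    and mfact_inc: "mfact (s(j := Suc (s j))) = Suc (s j) * mfact s"
    and mpow_inc: "mpow b (s(j := Suc (s j))) = b j * mpow b s"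
proof -
  define J where "J = insert j {i. s i ~= 0}"
  have J: "finite J" "{i. s i ~= 0} \<subseteq> J" "{i. (s(j := Suc (s j))) i ~= 0} \<subseteq> J" "j \<in> J"
    using assms by (auto simp: J_def finsupp_def)
  let ?s = "s(j := Suc (s j))"
  have "(\<Sum>i\<in>J. ?s i) = Suc (s j) + (\<Sum>i\<in>J - {j}. s i)"
    by (subst sum.remove[of J j]) (use J in \<open>auto intro!: sum.cong\<close>)
  then show "msize ?s = Suc (msize s)"
    unfolding msize_superset[OF J(1,2)] msize_superset[OF J(1,3)] by (simp add: sum.remove[OF J(1,4)])
  have "(\<Prod>i\<in>J. fact (?s i) :: nat) = fact (Suc (s j)) * (\<Prod>i\<in>J - {j}. fact (s i))"
    by (subst prod.remove[of J j]) (use J in \<open>auto intro!: prod.cong\<close>)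
  then show "mfact ?s = Suc (s j) * mfact s"
    unfolding mfact_superset[OF J(1,2)] mfact_superset[OF J(1,3)] by (simp add: prod.remove[OF J(1,4)] algebra_simps)
  have "(\<Prod>i\<in>J. b i ^ ?s i) = b j ^ Suc (s j) * (\<Prod>i\<in>J - {j}. b i ^ s i)"
    by (subst prod.remove[of J j]) (use J in \<open>auto intro!: prod.cong\<close>)
  then show "mpow b ?s = b j * mpow b s"
    unfolding mpow_superset[OF J(1,2)] mpow_superset[OF J(1,3)] by (simp add: prod.remove[OF J(1,4)] algebra_simps)
qed

lemma mfact_pos: "mfact s > 0"
  unfolding mfact_def by (rule prod_pos) simp

lemma mpow_nonneg: "(!!j. b j \<ge> 0) ==> mpow b s \<ge> 0"
  unfolding mpow_def by (rule prod_nonneg) simp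

lemma mpow_pos: "(!!j. b j > 0) ==> mpow b s > 0"
  unfolding mpow_def by (rule prod_pos) simp

lemma mcoef_nonneg: "(!!j. b j \<ge> 0) ==> mcoef b s \<ge> 0"
  unfolding mcoef_def by (intro mult_nonneg_nonneg mpow_nonneg divide_nonneg_nonneg) auto

lemma mcoef_pos: "(!!j. b j > 0) ==> mcoef b s > 0"
  unfolding mcoef_def by (intro mult_pos_pos mpow_pos divide_pos_pos) (auto simp: mfact_pos)

lemma
  assumes "s \<in> finsupp" "s j ~= 0"
  shows msize_dec: "msize s = Suc (msize (s(j := s j - 1)))"
    and mfact_dec: "mfact s = s j * mfact (s(j := s j - 1))"
    and mpow_dec: "mpow b s = b j * mpow b (s(j := s j - 1))"
proof -
  have s: "s = (s(j := s j - 1))(j := Suc ((s(j := s j - 1)) j))" using assms by auto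
  have f: "s(j := s j - 1) \<in> finsupp" by (rule finsupp_upd[OF assms(1)])
  show "msize s = Suc (msize (s(j := s j - 1)))" using msize_inc[OF f, of j] s by metis
  show "mpow b s = b j * mpow b (s(j := s j - 1))" using mpow_inc[OF f, of b j] s by metis
  show "mfact s = s j * mfact (s(j := s j - 1))" using mfact_inc[OF f, of j] assms(2) s
    by (metis Suc_pred' fun_upd_same gr0I)
qed

text \<open>Pascal's rule: remove one factor, in every possible way.\<close>

lemma mcoef_pascal:
  assumes "s \<in> finsupp" "msize s = Suc n"
  shows "mcoef b s = (\<Sum>j | s j ~= 0. b j * mcoef b (s(j := s j - 1)))"
proof -
  have "b j * mcoef b (s(j := s j - 1)) = real (s j) * (fact n / real (mfact s) * mpow b s)"
    if "s j ~= 0" for j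
  proof -
    have "msize (s(j := s j - 1)) = n" using msize_dec[OF assms(1) that] assms(2) by simp
    then show ?thesis unfolding mcoef_def mpow_dec[OF assms(1) that] mfact_dec[OF assms(1) that]
      using that mfact_pos[of "s(j := s j - 1)"] by (simp add: field_simps)
  qed
  then have "(\<Sum>j | s j ~= 0. b j * mcoef b (s(j := s j - 1)))
      = (\<Sum>j | s j ~= 0. real (s j)) * (fact n / real (mfact s) * mpow b s)"
    unfolding sum_distrib_right by (intro sum.cong) auto
  also have "(\<Sum>j | s j ~= 0. real (s j)) = real (Suc n)"
    using assms(2) unfolding msize_def by (simp flip: of_nat_sum)
  also have "real (Suc n) * (fact n / real (mfact s) * mpow b s) = mcoef b s"
    using assms(2) by (simp add: mcoef_def)
  finally show ?thesis by (rule sym)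
qed

text \<open>The multinomial theorem, as an inequality for the finite parts of one level.\<close>

lemma sum_mcoef_level_le:
  assumes b: "!!j. b j \<ge> 0" "summable b"
  assumes "finite F" "F \<subseteq> finsupp" "!!s. s \<in> F ==> msize s = n"
  shows "(\<Sum>s\<in>F. mcoef b s) <= (\<Sum>j. b j) ^ n"
  using assms(3-)
proof (induction n arbitrary: F)
  case 0
  have "F \<subseteq> {%_. 0}"
  proof
    fix s assume "s \<in> F"
    then have "s \<in> finsupp" "msize s = 0" using 0 by auto
    then show "s \<in> {%_. 0}" by (auto simp: msize_def finsupp_def fun_eq_iff)
  qed
  then have "(\<Sum>s\<in>F. mcoef b s) <= (\<Sum>s\<in>{%_. 0}. mcoef b s)"
    using b by (intro sum_mono2) (auto simp: mcoef_nonneg)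
  also have "... = 1" by (simp add: mcoef_def msize_def mfact_def mpow_def)
  finally show ?case by simp
next
  case (Suc n)
  define J where "J = (\<Union>s\<in>F. {j. s j ~= 0})"
  have J: "finite J" using Suc.prems by (auto simp: J_def finsupp_def)
  have "(\<Sum>s\<in>F. mcoef b s) = (\<Sum>s\<in>F. \<Sum>j | s j ~= 0. b j * mcoef b (s(j := s j - 1)))"
    using Suc.prems by (intro sum.cong refl mcoef_pascal) auto
  also have "... = (\<Sum>s\<in>F. \<Sum>j\<in>J. if s j ~= 0 then b j * mcoef b (s(j := s j - 1)) else 0)"
  proof (rule sum.cong[OF refl])
    fix s assume "s \<in> F"
    then have "J \<inter> {j. s j ~= 0} = {j. s j ~= 0}" by (auto simp: J_def)
    then show "(\<Sum>j | s j ~= 0. b j * mcoef b (s(j := s j - 1))) =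
        (\<Sum>j\<in>J. if s j ~= 0 then b j * mcoef b (s(j := s j - 1)) else 0)"
      using J by (simp add: sum.If_cases)
  qed
  also have "... = (\<Sum>j\<in>J. \<Sum>s\<in>F. if s j ~= 0 then b j * mcoef b (s(j := s j - 1)) else 0)"
    by (rule sum.swap)
  also have "... = (\<Sum>j\<in>J. b j * (\<Sum>s\<in>F \<inter> {s. s j ~= 0}. mcoef b (s(j := s j - 1))))"
    using Suc.prems by (intro sum.cong refl) (simp add: sum.If_cases sum_distrib_left)
  also have "... <= (\<Sum>j\<in>J. b j * (\<Sum>j. b j) ^ n)"
  proof (intro sum_mono mult_left_mono b(1))
    fix j
    have inj: "inj_on (%s. s(j := s j - 1)) (F \<inter> {s. s j ~= 0})"
    proof (rule inj_onI)
      fix s t :: "nat => nat" assume "s \<in> F \<inter> {s. s j ~= 0}" "t \<in> F \<inter> {s. s j ~= 0}"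
        "s(j := s j - 1) = t(j := t j - 1)"
      then have "!!i. (s(j := s j - 1)) i = (t(j := t j - 1)) i" "s j ~= 0" "t j ~= 0" by auto
      then show "s = t" by (intro ext) (metis Suc_pred' fun_upd_apply gr0I)
    qed
    have "(\<Sum>s\<in>F \<inter> {s. s j ~= 0}. mcoef b (s(j := s j - 1)))
        = (\<Sum>t\<in>(%s. s(j := s j - 1)) ` (F \<inter> {s. s j ~= 0}). mcoef b t)"
      using sum.reindex[OF inj, of "mcoef b"] by (simp only: o_def)
    also have "... <= (\<Sum>j. b j) ^ n"
    proof (rule Suc.IH)
      fix t assume "t \<in> (%s. s(j := s j - 1)) ` (F \<inter> {s. s j ~= 0})"
      then obtain s where s: "s \<in> F" "s j ~= 0" "t = s(j := s j - 1)" by auto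
      then show "msize t = n" using msize_dec[of s j] Suc.prems by (metis nat.inject subsetD)
    qed (use Suc.prems in \<open>auto simp: finsupp_upd\<close>)
    finally show "(\<Sum>s\<in>F \<inter> {s. s j ~= 0}. mcoef b (s(j := s j - 1))) <= (\<Sum>j. b j) ^ n" .
  qed
  also have "... = (\<Sum>j\<in>J. b j) * (\<Sum>j. b j) ^ n" by (simp add: sum_distrib_right)
  also have "... <= (\<Sum>j. b j) * (\<Sum>j. b j) ^ n"
    using b J by (intro mult_right_mono sum_le_suminf zero_le_power suminf_nonneg) auto
  finally show ?case by simp
qed

text \<open>Poisson weights increase up to the mode \<open>M\<close> and decrease after it.\<close>

lemma poisson_le_mode:
  fixes l :: real
  assumes "real M <= l" "l < real M + 1"
  shows "l ^ k / fact k <= l ^ M / fact M"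
proof (cases "k <= M")
  case True
  then show ?thesis
  proof (induction rule: inc_induct)
    case (step n)
    have "l ^ n / fact n <= l ^ n / fact n * (l / (real n + 1))"
    proof -
      have "1 <= l / (real n + 1)" using step assms by (simp add: field_simps)
      from mult_left_mono[OF this, of "l ^ n / fact n"] show ?thesis using assms by simp
    qed
    also have "... = l ^ Suc n / fact (Suc n)" by (simp add: field_simps)
    finally show ?case using step.IH by linarith
  qed simp
next
  case False
  then have "M <= k" by simp
  then show ?thesis
  proof (induction rule: dec_induct)
    case (step n)
    have "l ^ Suc n / fact (Suc n) = l ^ n / fact n * (l / (real n + 1))" by (simp add: field_simps)
    also have "... <= l ^ n / fact n * 1"
      using step assms by (intro mult_left_mono) (auto simp: field_simps)
    finally show ?case using step.IH by simp
  qed simp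
qed

lemma fourth_power_stirling:
  assumes "k \<ge> 1"
  shows "real k * (real k ^ k * exp (- real k) / fact k) ^ 4 <= 1"
  using assms
proof (induction rule: dec_induct)
  case base
  have "exp (-1 :: real) <= 1" by simp
  then show ?case by (simp add: power_le_one)
next
  case (step k)
  let ?x = "4 / (4 * real k + 1)"
  have k: "real k \<ge> 1" using step by simp
  have "1 + 1 / real k <= 1 + ?x + ?x\<^sup>2 / 2"
  proof -
    have "?x + ?x\<^sup>2 / 2 - 1 / real k = (4 * real k - 1) / (real k * (4 * real k + 1)\<^sup>2)"
      using k by (simp add: divide_simps add_eq_0_iff) (simp add: power2_eq_square algebra_simps)?
    also have "... \<ge> 0" using k by (intro divide_nonneg_nonneg mult_nonneg_nonneg) auto
    finally show ?thesis by simp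
  qed
  also have "... <= exp ?x" using k by (intro exp_lower_Taylor_quadratic) auto
  finally have "(1 + 1 / real k) ^ (4 * k + 1) <= exp ?x ^ (4 * k + 1)"
    using k by (intro power_mono) auto
  also have "... = exp (real (4 * k + 1) * ?x)" by (rule exp_of_nat_mult[symmetric])
  also have "real (4 * k + 1) * ?x = 4" using k by (simp add: field_simps)
  finally have *: "(1 + 1 / real k) ^ (4 * k + 1) <= exp 4" .
  have "real (Suc k) * (real (Suc k) ^ Suc k * exp (- real (Suc k)) / fact (Suc k)) ^ 4
     = real (Suc k) * (real (Suc k) ^ k * exp (- real k) * exp (-1) / fact k) ^ 4"
  proof -
    have "exp (- real (Suc k)) = exp (- real k) * exp (-1)" by (simp add: exp_add[symmetric])
    then show ?thesis unfolding power_Suc fact_Suc of_nat_mult by (simp del: of_nat_Suc add: mult.assoc)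
  qed
  also have "... = ((1 + 1 / real k) * real k) * (((1 + 1 / real k) * real k) ^ k * exp (- real k) * exp (-1) / fact k) ^ 4"
  proof -
    have "real (Suc k) = (1 + 1 / real k) * real k" using k by (simp add: field_simps)
    then show ?thesis by (simp only:)
  qed
  also have "((1 + 1 / real k) * real k) * (((1 + 1 / real k) * real k) ^ k * exp (- real k) * exp (-1) / fact k) ^ 4
    = (real k * (real k ^ k * exp (- real k) / fact k) ^ 4) * ((1 + 1 / real k) ^ (4 * k + 1) * exp (-1) ^ 4)"
    by (simp add: power_mult_distrib power_divide power_add power_mult[symmetric] mult.commute[of 4 k])
  also have "... <= 1 * (exp 4 * exp (-1) ^ 4)"
    using step.IH k * by (intro mult_mono) auto
  also have "exp 4 * exp (-1) ^ 4 = (1::real)"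
    by (simp flip: exp_of_nat_mult exp_add)
  finally show ?case by simp
qed

text \<open>A Poisson weight is of order \<open>1 / sqrt l\<close>; the order \<open>l powr (-1/4)\<close> obtained here is all that the
  decay of multinomial weights requires, and it follows from an elementary induction at the mode.\<close>

lemma poisson_fourth_power_le:
  fixes l :: real
  assumes "l > 0"
  shows "(l ^ k * exp (- l) / fact k) ^ 4 <= 2 / l"
proof (cases "l < 1")
  case True
  have "l ^ k / fact k = (\<Sum>i\<in>{k}. l ^ i / fact i)" by simp
  also have "... <= (\<Sum>i. l ^ i / fact i)"
    using assms summable_exp[of l] by (intro sum_le_suminf) (auto simp: field_simps)
  also have "... = exp l" by (simp add: exp_def field_simps)
  finally have "l ^ k * exp (- l) / fact k <= 1" by (simp add: exp_minus field_simps)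
  then have "(l ^ k * exp (- l) / fact k) ^ 4 <= 1" using assms by (intro power_le_one) auto
  also have "1 <= 2 / l" using True assms by simp
  finally show ?thesis .
next
  case False
  define M where "M = nat \<lfloor>l\<rfloor>"
  have M: "real M <= l" "l < real M + 1" "M \<ge> 1" using False by (auto simp: M_def le_nat_iff)
  have "l ^ k * exp (- l) / fact k <= l ^ M * exp (- l) / fact M"
    using poisson_le_mode[OF M(1,2), of k] by (simp add: field_simps)
  also have "l ^ M * exp (- l) <= real M ^ M * exp (- real M)"
  proof -
    have "l / real M <= exp (l / real M - 1)" using exp_ge_add_one_self[of "l / real M - 1"] by simp
    then have "(l / real M) ^ M <= exp (l / real M - 1) ^ M" using assms by (intro power_mono) auto
    also have "... = exp (l - real M)" using M by (simp flip: exp_of_nat_mult add: field_simps)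
    finally show ?thesis using M by (simp add: field_simps power_divide exp_diff exp_minus)
  qed
  finally have "(l ^ k * exp (- l) / fact k) ^ 4 <= (real M ^ M * exp (- real M) / fact M) ^ 4"
    using assms by (intro power_mono) (auto simp: divide_right_mono)
  also have "... <= 1 / real M" using fourth_power_stirling[OF M(3)] M by (simp add: field_simps)
  also have "... <= 2 / l" using M by (simp add: field_simps)
  finally show ?thesis .
qed

lemma fact_le_stirling:
  assumes "n \<ge> 1"
  shows "fact n * exp (real n) / real n ^ n <= exp 1 * real n"
  using assms
proof (induction rule: dec_induct)
  case (step n)
  have n: "real n \<ge> 1" using step by simp
  have "1 - 1 / (real n + 1) <= exp (- (1 / (real n + 1)))" using exp_ge_add_one_self[of "- (1 / (real n + 1))"] by simp
  then have "exp (1 / (real n + 1)) <= 1 + 1 / real n"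
    using n by (simp add: exp_minus field_simps)
  then have "exp (1 / (real n + 1)) ^ Suc n <= (1 + 1 / real n) ^ Suc n" by (intro power_mono) auto
  also have "exp (1 / (real n + 1)) ^ Suc n = exp 1" using n by (subst exp_of_nat_mult[symmetric]) (simp add: field_simps)
  finally have *: "exp 1 <= (1 + 1 / real n) ^ Suc n" .
  have "fact (Suc n) * exp (real (Suc n)) / real (Suc n) ^ Suc n = fact n * exp (real n) * exp 1 / real (Suc n) ^ n"
  proof -
    have "exp (real (Suc n)) = exp (real n) * exp 1" by (simp add: exp_add[symmetric])
    then show ?thesis by (simp del: of_nat_Suc)
  qed
  also have "... = fact n * exp (real n) * exp 1 / ((1 + 1 / real n) * real n) ^ n"
  proof -
    have "real (Suc n) = (1 + 1 / real n) * real n" using n by (simp add: field_simps)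
    then show ?thesis by (simp only:)
  qed
  also have "fact n * exp (real n) * exp 1 / ((1 + 1 / real n) * real n) ^ n =
     (fact n * exp (real n) / real n ^ n) * (exp 1 / (1 + 1 / real n) ^ n)"
    by (simp add: power_mult_distrib)
  also have "... <= (exp 1 * real n) * (1 + 1 / real n)"
    using n step.IH * by (intro mult_mono) (auto simp: divide_le_eq add_pos_pos)
  also have "... = exp 1 * real (Suc n)" using n by (simp add: field_simps)
  finally show ?case .
qed simp

text \<open>Divided by \<open>fact n * (exp 1 / n) ^ n\<close>, which is of order at most \<open>n\<close>, the weight of an index of size \<open>n\<close>
  is at most the product of the Poisson weights with means \<open>n * b j\<close>. Twelve of these factors, each of order
  \<open>n powr (-1/4)\<close>, leave a decay of order \<open>n powr (-2)\<close>; this is the reason for the number 12.\<close>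

lemma mcoef_decay:
  assumes b: "!!j. b j > 0" "summable b" "(\<Sum>j. b j) <= 1"
  shows "\<exists>D\<ge>0. \<forall>s\<in>finsupp. msize s \<ge> 1 \<longrightarrow> mcoef b s <= D / (real (msize s))\<^sup>2"
proof -
  define D where "D = exp 4 * (\<Prod>j<12. 2 / b j)"
  have D: "D \<ge> 0" unfolding D_def by (intro mult_nonneg_nonneg prod_nonneg) (use b in \<open>auto intro: less_imp_le\<close>)
  have "mcoef b s <= max 1 D / (real (msize s))\<^sup>2" if s: "s \<in> finsupp" "msize s \<ge> 1" for s
  proof -
  define n where "n = msize s"
  define S where "S = {j. s j ~= 0} \<union> {..<12}"
  have n: "real n \<ge> 1" using s by (simp add: n_def)
  have S: "finite S" "{j. s j ~= 0} \<subseteq> S" using s by (auto simp: S_def finsupp_def)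
  define P where "P j = (real n * b j) ^ s j * exp (- (real n * b j)) / fact (s j)" for j
  have P0: "P j \<ge> 0" for j unfolding P_def using b(1)[of j] by simp
  have P1: "P j <= 1" for j
  proof -
    have "(real n * b j) ^ s j / fact (s j) = (\<Sum>i\<in>{s j}. (real n * b j) ^ i / fact i)" by simp
    also have "... <= (\<Sum>i. (real n * b j) ^ i / fact i)"
      using b(1)[of j] summable_exp[of "real n * b j"] by (intro sum_le_suminf) (auto simp: field_simps)
    also have "... = exp (real n * b j)" by (simp add: exp_def field_simps)
    finally show ?thesis by (simp add: P_def exp_minus field_simps)
  qed
  have "mcoef b s = fact n / real n ^ n * (real n ^ n / real (mfact s) * mpow b s)"
    using n by (simp add: mcoef_def n_def)
  also have "real n ^ n / real (mfact s) * mpow b s = (\<Prod>j\<in>S. (real n * b j) ^ s j / fact (s j))"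
  proof -
    have "real n ^ n = (\<Prod>j\<in>S. real n ^ s j)"
      by (simp add: n_def msize_superset[OF S] power_sum)
    then show ?thesis
      by (simp add: mfact_superset[OF S] mpow_superset[OF S] power_mult_distrib prod_dividef prod.distrib)
  qed
  also have "(\<Prod>j\<in>S. (real n * b j) ^ s j / fact (s j)) = (\<Prod>j\<in>S. exp (real n * b j) * P j)"
    by (intro prod.cong) (auto simp: P_def exp_minus)
  also have "... = exp (\<Sum>j\<in>S. real n * b j) * (\<Prod>j\<in>S. P j)"
    by (simp add: prod.distrib exp_sum[OF S(1)])
  also have "fact n / real n ^ n * ... <= fact n / real n ^ n * (exp (real n) * (\<Prod>j<12. P j))"
  proof (intro mult_left_mono mult_mono)
    have "(\<Sum>j\<in>S. b j) <= 1"
      using sum_le_suminf[OF b(2) S(1)] b(1,3) order.trans by (metis less_imp_le)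
    then show "exp (\<Sum>j\<in>S. real n * b j) <= exp (real n)"
      using n by (simp flip: sum_distrib_left)
    have "(\<Prod>j\<in>S. P j) = (\<Prod>j\<in>{..<12}. P j) * (\<Prod>j\<in>S - {..<12}. P j)"
      by (subst prod.union_disjoint[symmetric]) (use S in \<open>auto simp: S_def intro!: prod.cong\<close>)
    also have "... <= (\<Prod>j\<in>{..<12}. P j) * 1"
      by (intro mult_left_mono prod_le_1 prod_nonneg) (auto simp: P0 P1)
    finally show "(\<Prod>j\<in>S. P j) <= (\<Prod>j<12. P j)" by simp
  qed (auto intro!: prod_nonneg P0)
  also have "... = (fact n * exp (real n) / real n ^ n) * (\<Prod>j<12. P j)" by simp
  also have "... <= (exp 1 * real n) * (\<Prod>j<12. P j)"
    using n by (intro mult_right_mono fact_le_stirling prod_nonneg P0) auto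
  finally have le: "mcoef b s <= exp 1 * real n * (\<Prod>j<12. P j)" .
  have "(mcoef b s) ^ 4 <= (exp 1 * real n * (\<Prod>j<12. P j)) ^ 4"
    using le b by (intro power_mono mcoef_nonneg) (auto intro: less_imp_le)
  also have "... = exp 4 * real n ^ 4 * (\<Prod>j<12. P j ^ 4)"
    by (simp add: power_mult_distrib prod_power_distrib exp_of_nat_mult[of 4 1, simplified, symmetric])
  also have "... <= exp 4 * real n ^ 4 * (\<Prod>j<12. 2 / (real n * b j))"
    unfolding P_def using n b by (intro mult_left_mono prod_mono conjI poisson_fourth_power_le) auto
  also have "(\<Prod>j<12. 2 / (real n * b j)) = (\<Prod>j<12. 2 / b j) / real n ^ 12"
  proof -
    have "(\<Prod>j<12. 2 / (real n * b j)) = (\<Prod>j<12. (2 / b j) * (1 / real n))" by (intro prod.cong) auto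
    also have "... = (\<Prod>j<12. 2 / b j) * (1 / real n) ^ 12" by (simp only: prod.distrib prod_constant card_lessThan)
    finally show ?thesis by (simp add: power_divide)
  qed
  also have "exp 4 * real n ^ 4 * ... = D / real n ^ 8"
  proof -
    have "real n ^ 12 = real n ^ 4 * real n ^ 8" by (simp flip: power_add)
    moreover have "e * x * (p / (x * y)) = e * p / y" if "x > 0" for e x y p :: real using that by simp
    ultimately show ?thesis using n unfolding D_def by (simp only: zero_less_power)
  qed
  finally have "(mcoef b s * (real n)\<^sup>2) ^ 4 <= D"
    using n by (simp add: power_mult_distrib field_simps flip: power_mult)
  then have "mcoef b s * (real n)\<^sup>2 <= max 1 D"
  proof (cases "mcoef b s * (real n)\<^sup>2 <= 1")
    case False
    then have "(mcoef b s * (real n)\<^sup>2) ^ 1 <= (mcoef b s * (real n)\<^sup>2) ^ 4" by (intro power_increasing) auto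
    then show ?thesis using \<open>(mcoef b s * (real n)\<^sup>2) ^ 4 <= D\<close> by simp
  qed simp
  then show "mcoef b s <= max 1 D / (real (msize s))\<^sup>2"
    using n by (simp add: field_simps n_def)
  qed
  then show ?thesis by (intro exI[of _ "max 1 D"]) auto
qed

text \<open>The powers of the weights are summable: for a contraction by the geometric series, and for
  total mass one because of the decay of the individual weights.\<close>

lemma summable_mcoef_power:
  assumes b: "!!j. b j > 0" "summable b"
    and m: "m \<ge> 1" "m = 1 ==> (\<Sum>j. b j) < 1" "m > 1 ==> (\<Sum>j. b j) <= 1"
  shows "(%s. mcoef b s ^ m) summable_on finsupp"
proof -
  have b0: "b j \<ge> 0" for j using b(1)[of j] by simp
  have "\<exists>g. summable g \<and> (\<forall>n. g n \<ge> 0) \<and>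
      (\<forall>n F. finite F \<longrightarrow> F \<subseteq> finsupp \<longrightarrow> (\<forall>s\<in>F. msize s = n) \<longrightarrow> (\<Sum>s\<in>F. mcoef b s ^ m) <= g n)"
  proof (cases "m = 1")
    case True
    have "summable (%n. (\<Sum>j. b j) ^ n)"
      using True m(2) b0 suminf_nonneg[OF b(2)] by (intro summable_geometric) auto
    moreover have "(\<Sum>s\<in>F. mcoef b s ^ m) <= (\<Sum>j. b j) ^ n"
      if "finite F" "F \<subseteq> finsupp" "\<forall>s\<in>F. msize s = n" for n F
      using sum_mcoef_level_le[OF b0 b(2), of F n] that True by auto
    ultimately show ?thesis
      using suminf_nonneg[OF b(2)] b0 by (intro exI[of _ "%n. (\<Sum>j. b j) ^ n"]) auto
  next
    case False
    then have m2: "m \<ge> 2" and le1: "(\<Sum>j. b j) <= 1" using m by auto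
    obtain D where D: "D \<ge> 0" "\<forall>s\<in>finsupp. msize s \<ge> 1 \<longrightarrow> mcoef b s <= D / (real (msize s))\<^sup>2"
      using mcoef_decay[OF b le1] by auto
    have pow: "(\<Sum>j. b j) ^ n <= 1" for n
      using le1 suminf_nonneg[OF b(2)] b0 by (intro power_le_one) auto
    have one: "mcoef b s <= 1" if "s \<in> finsupp" for s
      using sum_mcoef_level_le[OF b0 b(2), of "{s}" "msize s"] that pow[of "msize s"] by auto
    define g where "g n = (if n = 0 then 1 else D / (real n)\<^sup>2)" for n
    have "summable (%n. D / (real n)\<^sup>2)"
      using summable_mult[OF inverse_power_summable[OF order.refl], of D] by (simp add: field_simps)
    then have "summable g"
      by (rule summable_cong[THEN iffD1, rotated])
         (auto simp: g_def intro!: eventually_at_top_linorderI[of 1])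
    moreover have "(\<Sum>s\<in>F. mcoef b s ^ m) <= g n"
      if F: "finite F" "F \<subseteq> finsupp" "\<forall>s\<in>F. msize s = n" for n F
    proof -
      have "mcoef b s ^ m <= g n * mcoef b s" if "s \<in> F" for s
      proof -
        have s: "s \<in> finsupp" "msize s = n" using that F by auto
        have "mcoef b s ^ m <= mcoef b s ^ 2"
          using m2 one[OF s(1)] by (intro power_decreasing mcoef_nonneg b0) auto
        also have "... = mcoef b s * mcoef b s" by (simp add: power2_eq_square)
        also have "... <= g n * mcoef b s"
          using D s one[OF s(1)] by (intro mult_right_mono mcoef_nonneg b0) (auto simp: g_def)
        finally show ?thesis .
      qed
      then have "(\<Sum>s\<in>F. mcoef b s ^ m) <= g n * (\<Sum>s\<in>F. mcoef b s)"
        by (simp add: sum_distrib_left sum_mono)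
      also have "... <= g n * 1"
        using sum_mcoef_level_le[OF b0 b(2), of F n] F pow[of n] D
        by (intro mult_left_mono) (auto simp: g_def)
      finally show ?thesis by simp
    qed
    ultimately show ?thesis using D by (intro exI[of _ g]) (auto simp: g_def)
  qed
  then obtain g where g: "summable g" "!!n. g n \<ge> 0"
    "!!n F. finite F ==> F \<subseteq> finsupp ==> (\<forall>s\<in>F. msize s = n) ==> (\<Sum>s\<in>F. mcoef b s ^ m) <= g n"
    by metis
  show ?thesis
  proof (rule nonneg_bdd_above_summable_on)
    show "bdd_above (sum (%s. mcoef b s ^ m) ` {F. F \<subseteq> finsupp \<and> finite F})"
    proof (rule bdd_aboveI2)
      fix F assume "F \<in> {F. F \<subseteq> finsupp \<and> finite F}"
      then have F: "F \<subseteq> finsupp" "finite F" by auto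
      have "(\<Sum>s\<in>F. mcoef b s ^ m) = (\<Sum>n\<in>msize ` F. \<Sum>s | s \<in> F \<and> msize s = n. mcoef b s ^ m)"
        by (rule sum.image_gen[OF F(2)])
      also have "... <= (\<Sum>n\<in>msize ` F. g n)"
        using F by (intro sum_mono g(3)) auto
      also have "... <= suminf g" using F g by (intro sum_le_suminf) auto
      finally show "(\<Sum>s\<in>F. mcoef b s ^ m) <= suminf g" .
    qed
  qed (intro zero_le_power mcoef_nonneg b0)
qed

text \<open>The generating function of all monomials is the product of geometric series.\<close>

lemma summable_mpow:
  assumes x: "!!j. 0 <= x j" "!!j. x j < 1" "summable x"
  shows "mpow x summable_on finsupp"
proof (rule nonneg_bdd_above_summable_on)
  have "summable (%j. x j / (1 - x j))"
  proof (rule summable_comparison_test_ev)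
    have "\<forall>\<^sub>F j in sequentially. x j < 1 / 2"
      using summable_LIMSEQ_zero[OF x(3)] by (rule order_tendstoD) simp
    then show "\<forall>\<^sub>F j in sequentially. norm (x j / (1 - x j)) <= 2 * x j"
    proof eventually_elim
      case (elim j)
      have "x j * 1 <= x j * (2 * (1 - x j))" using elim x by (intro mult_left_mono) auto
      then show ?case using elim x(2)[of j] x(1)[of j] by (simp add: field_simps)
    qed
    show "summable (%j. 2 * x j)" by (intro summable_mult x)
  qed
  define Z where "Z = (\<Sum>j. x j / (1 - x j))"
  show "bdd_above (sum (mpow x) ` {F. F \<subseteq> finsupp \<and> finite F})"
  proof (rule bdd_aboveI2)
    fix F assume "F \<in> {F. F \<subseteq> finsupp \<and> finite F}"
    then have F: "F \<subseteq> finsupp" "finite F" by auto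
    define J where "J = (\<Union>s\<in>F. {j. s j ~= 0})"
    have J: "finite J" using F by (auto simp: J_def finsupp_def)
    define N where "N = Max (insert 0 (\<Union>s\<in>F. s ` J))"
    have N: "s j <= N" if "s \<in> F" "j \<in> J" for s j
      unfolding N_def using that F J by (intro Max_ge) auto
    have inj: "inj_on (%s. restrict s J) F"
    proof (rule inj_onI)
      fix s t assume st: "s \<in> F" "t \<in> F" "restrict s J = restrict t J"
      show "s = t"
      proof
        fix j show "s j = t j"
        proof (cases "j \<in> J")
          case True then show ?thesis using st(3) by (metis restrict_apply')
        next
          case False then have "s j = 0" "t j = 0" using st(1,2) unfolding J_def by blast+
          then show ?thesis by simp
        qed
      qed
    qed
    have "(\<Sum>s\<in>F. mpow x s) = (\<Sum>s\<in>F. \<Prod>j\<in>J. x j ^ (restrict s J) j)"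
    proof (intro sum.cong refl)
      fix s assume "s \<in> F"
      then have "mpow x s = (\<Prod>j\<in>J. x j ^ s j)" by (intro mpow_superset J) (auto simp: J_def)
      then show "mpow x s = (\<Prod>j\<in>J. x j ^ (restrict s J) j)" by simp
    qed
    also have "... = (\<Sum>g\<in>(%s. restrict s J) ` F. \<Prod>j\<in>J. x j ^ g j)"
      using sum.reindex[OF inj, of "%g. \<Prod>j\<in>J. x j ^ g j"] by (simp only: o_def)
    also have "... <= (\<Sum>g\<in>PiE J (%_. {..N}). \<Prod>j\<in>J. x j ^ g j)"
      using J N x by (intro sum_mono2 prod_nonneg finite_PiE) (auto simp: PiE_iff)
    also have "... = (\<Prod>j\<in>J. \<Sum>i\<le>N. x j ^ i)"
      by (rule prod_sum_PiE[symmetric]) (use J in auto)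
    also have "... <= (\<Prod>j\<in>J. exp (x j / (1 - x j)))"
    proof (intro prod_mono conjI sum_nonneg)
      fix j
      have "(\<Sum>i\<le>N. x j ^ i) <= (\<Sum>i. x j ^ i)"
        using x by (intro sum_le_suminf summable_geometric) auto
      also have "... = 1 / (1 - x j)" using x by (intro suminf_geometric) auto
      also have "... = 1 + x j / (1 - x j)" using x(2)[of j] by (simp add: field_simps)
      also have "... <= exp (x j / (1 - x j))" by (rule exp_ge_add_one_self)
      finally show "(\<Sum>i\<le>N. x j ^ i) <= exp (x j / (1 - x j))" .
    qed (use x in auto)
    also have "... = exp (\<Sum>j\<in>J. x j / (1 - x j))" by (simp add: exp_sum J)
    also have "... <= exp Z"
      unfolding exp_le_cancel_iff Z_def using x J
      by (intro sum_le_suminf \<open>summable (%j. x j / (1 - x j))\<close>) (auto intro!: divide_nonneg_nonneg simp: less_imp_le)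
    finally show "(\<Sum>s\<in>F. mpow x s) <= exp Z" .
  qed
qed (auto intro: mpow_nonneg x)


section \<open>Counting the hyperbolic cross\<close>

lemma Zstar_box:
  fixes t :: real
  assumes "t \<ge> 0"
  defines "X \<equiv> {k :: int ^ 'm. k \<in> Zstar \<and> abs_inf k <= t}"
  shows "finite X" "real (card X) <= (2 * t) ^ CARD('m)"
proof -
  define S where "S = {- \<lfloor>t\<rfloor>..\<lfloor>t\<rfloor>} - {0}"
  have card_S: "real (card S) <= 2 * t" "finite S"
  proof -
    have "card S = card {- \<lfloor>t\<rfloor>..\<lfloor>t\<rfloor>} - 1" unfolding S_def using assms by (subst card_Diff_singleton) auto
    also have "... = nat (2 * \<lfloor>t\<rfloor>)" using assms by (simp add: nat_diff_distrib)
    finally have "real (card S) = 2 * of_int \<lfloor>t\<rfloor>" using assms by simp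
    then show "real (card S) <= 2 * t" by linarith
  qed (simp add: S_def)
  have sub: "X \<subseteq> (%g. \<chi> j. g j) ` PiE UNIV (%_. S)"
  proof
    fix k assume k: "k \<in> X"
    have "k $ j \<in> S" for j
    proof -
      have "\<bar>k $ j\<bar> <= Max (range (%j. \<bar>k $ j\<bar>))" by (intro Max_ge) auto
      also have "... <= \<lfloor>t\<rfloor>" using k by (simp add: X_def abs_inf_def le_floor_iff)
      finally show ?thesis using k by (auto simp: S_def X_def Zstar_def)
    qed
    then show "k \<in> (%g. \<chi> j. g j) ` PiE UNIV (%_. S)"
      by (intro image_eqI[of _ _ "%j. k $ j"]) (auto simp: vec_eq_iff)
  qed
  have fin: "finite (PiE (UNIV :: 'm set) (%_. S))" using card_S by (intro finite_PiE) auto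
  then show "finite X" using sub finite_surj by blast
  have "card X <= card (PiE (UNIV :: 'm set) (%_. S))"
    using sub fin by (rule surj_card_le[rotated])
  also have "... = card S ^ CARD('m)" by (simp add: card_PiE)
  finally have "real (card X) <= real (card S) ^ CARD('m)" by (metis of_nat_le_iff of_nat_power)
  also have "... <= (2 * t) ^ CARD('m)" using card_S by (intro power_mono) auto
  finally show "real (card X) <= (2 * t) ^ CARD('m)" .
qed

lemma abs_inf_ge_1:
  fixes k :: "int ^ 'm"
  assumes "k \<in> Zstar"
  shows "abs_inf k \<ge> 1"
proof -
  fix j :: 'm
  have "1 <= \<bar>k $ j\<bar>" using assms by (auto simp: Zstar_def dest!: spec[of _ j])
  also have "... <= Max (range (%j. \<bar>k $ j\<bar>))" by (intro Max_ge) auto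
  finally show ?thesis by (simp add: abs_inf_def)
qed

lemma rho1_eq: "rho1 b k s = abs_inf k / mcoef b s"
proof -
  have "mpow (%j. inverse (b j)) s = inverse (mpow b s)"
    by (simp add: mpow_def power_inverse prod_inversef[symmetric])
  then show ?thesis by (simp add: rho1_def mcoef_def field_simps)
qed

text \<open>Count column by column: for fixed \<open>s\<close> the frequencies lie in a box of half width \<open>T * mcoef b s\<close>.\<close>

lemma E1_card:
  fixes T :: real and b :: "nat => real"
  assumes b: "!!j. b j > 0" and T: "T \<ge> 1"
    and summ: "(%s. mcoef b s ^ CARD('m)) summable_on finsupp"
  defines "X \<equiv> (E1 b T :: ((int ^ 'm) \<times> (nat => nat)) set)"
  shows "finite X" "real (card X) <= (2 * T) ^ CARD('m) * (\<Sum>\<^sub>\<infinity>s\<in>finsupp. mcoef b s ^ CARD('m))"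
    "card X > 0"
proof -
  let ?m = "CARD('m)"
  have b0: "mcoef b s \<ge> 0" for s using b by (intro mcoef_nonneg) (simp add: less_imp_le)
  let ?M = "\<Sum>\<^sub>\<infinity>s\<in>finsupp. mcoef b s ^ ?m"
  define S where "S = {s \<in> finsupp. 1 <= T * mcoef b s}"
  have fS: "finite S"
  proof (rule ccontr)
    assume "infinite S"
    obtain N :: nat where N: "real N > T ^ ?m * ?M" using reals_Archimedean2 by blast
    obtain F where F: "F \<subseteq> S" "finite F" "card F = N" using infinite_arbitrarily_large[OF \<open>infinite S\<close>, of N] by auto
    have "real N = (\<Sum>s\<in>F. 1)" using F by simp
    also have "... <= (\<Sum>s\<in>F. (T * mcoef b s) ^ ?m)"
      using F by (intro sum_mono one_le_power) (auto simp: S_def)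
    also have "... = T ^ ?m * (\<Sum>s\<in>F. mcoef b s ^ ?m)" by (simp add: power_mult_distrib sum_distrib_left)
    also have "... <= T ^ ?m * ?M"
      using T F b0 by (intro mult_left_mono finite_sum_le_infsum summ) (auto simp: S_def)
    finally show False using N by simp
  qed
  have X: "X = (%(s, k). (k, s)) ` (SIGMA s:S. {k. k \<in> Zstar \<and> abs_inf k <= T * mcoef b s})"
  proof -
    have "rho1 b k s <= T \<longleftrightarrow> abs_inf k <= T * mcoef b s" for k :: "int ^ 'm" and s
      using mcoef_pos[of b s] b by (simp add: rho1_eq field_simps)
    moreover have "1 <= T * mcoef b s" if "k \<in> Zstar" "abs_inf k <= T * mcoef b s" for k :: "int ^ 'm" and s
      using abs_inf_ge_1[OF that(1)] that(2) by linarith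
    ultimately show ?thesis unfolding X_def E1_def S_def image_def by (auto simp: Bex_def)
  qed
  have pos: "0 <= T * mcoef b s" for s using T b0 by simp
  have fin: "finite (SIGMA s:S. {k :: int ^ 'm. k \<in> Zstar \<and> abs_inf k <= T * mcoef b s})"
    using fS Zstar_box(1)[OF pos] by auto
  then show "finite X" unfolding X by simp
  have "card X <= card (SIGMA s:S. {k :: int ^ 'm. k \<in> Zstar \<and> abs_inf k <= T * mcoef b s})"
    unfolding X using fin by (rule card_image_le)
  also have "... = (\<Sum>s\<in>S. card {k :: int ^ 'm. k \<in> Zstar \<and> abs_inf k <= T * mcoef b s})"
    using fS Zstar_box(1)[OF pos] by (subst card_SigmaI) auto
  finally have "real (card X) <= (\<Sum>s\<in>S. real (card {k :: int ^ 'm. k \<in> Zstar \<and> abs_inf k <= T * mcoef b s}))"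
    by (simp flip: of_nat_sum)
  also have "... <= (\<Sum>s\<in>S. (2 * (T * mcoef b s)) ^ ?m)" by (intro sum_mono Zstar_box(2) pos)
  also have "... = (2 * T) ^ ?m * (\<Sum>s\<in>S. mcoef b s ^ ?m)"
    by (simp add: power_mult_distrib sum_distrib_left mult.assoc)
  also have "... <= (2 * T) ^ ?m * ?M"
    using T fS b0 by (intro mult_left_mono finite_sum_le_infsum summ) (auto simp: S_def)
  finally show "real (card X) <= (2 * T) ^ ?m * ?M" .
  have "((\<chi> j. 1), %_. 0) \<in> X"
    using T by (simp add: X_def E1_def Zstar_def finsupp_def rho1_def abs_inf_def mfact_def msize_def mpow_def)
  then show "card X > 0" using \<open>finite X\<close> card_gt_0_iff by blast
qed


section \<open>Legendre polynomials\<close>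

definition nu :: "real measure" where
  "nu = scale_measure (1/2) (restrict_space lborel {-1..1})"

lemma mu_eq: "mu = PiM UNIV (%_. nu)"
  by (simp add: mu_def nu_def)

lemma space_nu [simp]: "space nu = {-1..1}"
  by (simp add: nu_def space_scale_measure space_restrict_space)

lemma sets_nu: "sets nu = sets (restrict_space borel {-1..1})"
  by (simp add: nu_def sets_restrict_space)

lemma nu_measurable: "f \<in> borel_measurable borel ==> f \<in> borel_measurable nu"
  by (subst measurable_cong_sets[OF sets_nu refl]) (rule measurable_restrict_space1)

lemma nu_measurable_cont: "continuous_on {-1..1} f ==> f \<in> borel_measurable nu"
  by (subst measurable_cong_sets[OF sets_nu refl]) (rule borel_measurable_continuous_on_restrict)

lemma nu_density: "nu = density (restrict_space lborel {-1..1}) (%_. ennreal (1/2))"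
  unfolding nu_def
  by (rule measure_eqI) (auto simp: emeasure_density_const ennreal_divide_numeral divide_ennreal_def)

lemma prob_space_nu: "prob_space nu"
proof (rule prob_spaceI)
  have "emeasure nu (space nu) = ennreal (1/2) * emeasure (restrict_space lborel {-1..1::real}) {-1..1}"
    unfolding nu_density by (subst emeasure_density_const) (auto simp: space_restrict_space sets_restrict_space)
  also have "emeasure (restrict_space lborel {-1..1::real}) {-1..1} = ennreal 2"
    by (subst emeasure_restrict_space) auto
  also have "ennreal (1/2) * ennreal 2 = 1" by (subst ennreal_mult[symmetric]) auto
  finally show "emeasure nu (space nu) = 1" .
qed

interpretation nu: prob_space nu by (rule prob_space_nu)

lemma integral_nu:
  fixes f :: "real => 'a :: {banach, second_countable_topology}"
  assumes "continuous_on {-1..1} f"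
  shows "(\<integral>t. f t \<partial>nu) = (1/2) *\<^sub>R (\<integral>t. indicator {-1..1} t *\<^sub>R f t \<partial>lborel)" "integrable nu f"
proof -
  have m: "f \<in> borel_measurable (restrict_space lborel {-1..1})"
    using nu_measurable_cont[OF assms] by (simp add: nu_def)
  have "(\<integral>t. f t \<partial>nu) = (\<integral>t. (1/2) *\<^sub>R f t \<partial>restrict_space lborel {-1..1})"
    unfolding nu_density by (rule integral_density[OF m]) auto
  also have "... = (1/2) *\<^sub>R (\<integral>t. indicator {-1..1} t *\<^sub>R f t \<partial>lborel)"
    by (simp add: integral_restrict_space)
  finally show "(\<integral>t. f t \<partial>nu) = (1/2) *\<^sub>R (\<integral>t. indicator {-1..1} t *\<^sub>R f t \<partial>lborel)" .
  have "integrable lborel (%t. indicator {-1..1} t *\<^sub>R f t)"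
    by (rule borel_integrable_compact) (use assms in auto)
  then show "integrable nu f"
    unfolding nu_density by (subst integrable_density[OF m]) (auto simp: integrable_restrict_space mult.commute)
qed

lemma nu_by_parts:
  fixes F F' :: "real => complex"
  assumes F: "!!t. t \<in> {-1..1} ==> (F has_vector_derivative F' t) (at t within {-1..1})"
    and F': "continuous_on {-1..1} F'" and p: "poly p 1 = 0" "poly p (-1) = 0"
  shows "(\<integral>t. F' t * of_real (poly p t) \<partial>nu) = - (\<integral>t. F t * of_real (poly (pderiv p) t) \<partial>nu)"
proof -
  have cF: "continuous_on {-1..1} F"
    unfolding continuous_on_eq_continuous_within using F has_vector_derivative_continuous by blast
  have c1: "continuous_on {-1..1} (%t. F' t * of_real (poly p t))"
    and c2: "continuous_on {-1..1} (%t. F t * of_real (poly (pderiv p) t))"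
    by (intro continuous_intros F' cF)+
  have "(\<integral>t. F' t * of_real (poly p t) + F t * of_real (poly (pderiv p) t) \<partial>nu) =
      (1/2) *\<^sub>R (\<integral>t. indicator {-1..1} t *\<^sub>R (F' t * of_real (poly p t) + F t * of_real (poly (pderiv p) t)) \<partial>lborel)"
    by (rule integral_nu) (intro continuous_on_add c1 c2)
  also have "(\<integral>t. indicator {-1..1} t *\<^sub>R (F' t * of_real (poly p t) + F t * of_real (poly (pderiv p) t)) \<partial>lborel)
      = F 1 * of_real (poly p 1) - F (-1) * of_real (poly p (-1))"
  proof (rule integral_FTC_Icc)
    fix t :: real assume t: "-1 <= t" "t <= 1"
    have "((%t. of_real (poly p t) :: complex) has_vector_derivative of_real (poly (pderiv p) t)) (at t within {-1..1})"
      by (intro has_vector_derivative_of_real has_vector_derivative_at_within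
           has_real_derivative_iff_has_vector_derivative[THEN iffD1] poly_DERIV)
    from has_vector_derivative_mult[OF F this] t
    show "((%t. F t * of_real (poly p t)) has_vector_derivative
        F' t * of_real (poly p t) + F t * of_real (poly (pderiv p) t)) (at t within {-1..1})"
      by (simp add: add.commute)
  qed (auto intro!: continuous_on_add c1 c2)
  finally have "(\<integral>t. F' t * of_real (poly p t) + F t * of_real (poly (pderiv p) t) \<partial>nu) = 0" by (simp add: p)
  then show ?thesis
    by (subst (asm) Bochner_Integration.integral_add) (auto intro: integral_nu c1 c2 simp: add_eq_0_iff2)
qed

lemma pderiv_power_dvd:
  fixes g p :: "real poly"
  assumes "g ^ Suc k dvd p"
  shows "g ^ k dvd pderiv p"
proof -
  obtain h where "p = g ^ Suc k * h" using assms by (rule dvdE)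
  then have "pderiv p = g ^ k * (smult (of_nat (Suc k)) (pderiv g * h) + g * pderiv h)"
    by (simp add: pderiv_mult pderiv_power_Suc algebra_simps del: power_Suc) (simp add: algebra_simps)
  then show ?thesis by simp
qed

lemma legendre_roots:
  assumes "i < n" "x \<in> {-1, 1}"
  shows "poly ((pderiv ^^ i) ([:-1, 0, 1:] ^ n :: real poly)) x = 0"
proof -
  have "i <= n ==> [:-1, 0, 1:] ^ (n - i) dvd (pderiv ^^ i) ([:-1, 0, 1:] ^ n :: real poly)" for i
  proof (induction i)
    case (Suc i)
    then have "[:-1, 0, 1:] ^ Suc (n - Suc i) dvd (pderiv ^^ i) ([:-1, 0, 1:] ^ n :: real poly)"
      by (simp add: Suc_diff_Suc del: power_Suc)
    from pderiv_power_dvd[OF this] show ?case by simp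
  qed simp
  then obtain h where "(pderiv ^^ i) ([:-1, 0, 1:] ^ n :: real poly) = [:-1, 0, 1:] ^ (n - i) * h"
    using assms(1) by (meson dvdE less_imp_le)
  then show ?thesis using assms by (auto simp: poly_power)
qed

definition kap :: "nat => real" where
  "kap n = sqrt (2 * real n + 1) / (2 ^ n * fact n)"

lemma kap_pos: "kap n > 0"
  by (simp add: kap_def)

lemma legendre_kap: "legendre n = smult (kap n) ((pderiv ^^ n) ([:-1, 0, 1:] ^ n))"
  by (simp add: legendre_def kap_def)

text \<open>Rodrigues' formula and repeated integration by parts: the boundary terms vanish because the
  derivatives of \<open>(t\<^sup>2 - 1) ^ n\<close> of order less than \<open>n\<close> vanish at both end points.\<close>

lemma nu_legendre:
  fixes f :: "nat => real => complex"
  assumes f: "!!i t. i < n ==> t \<in> {-1..1} ==> (f i has_vector_derivative f (Suc i) t) (at t within {-1..1})"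
    and fc: "!!i. i <= n ==> continuous_on {-1..1} (f i)"
  shows "(\<integral>t. f 0 t * of_real (poly (legendre n) t) \<partial>nu) =
     (\<integral>t. f n t * of_real (kap n * (1 - t\<^sup>2) ^ n) \<partial>nu)"
proof -
  let ?q = "[:-1, 0, 1:] ^ n :: real poly"
  have "i <= n ==> (\<integral>t. f 0 t * of_real (poly ((pderiv ^^ n) ?q) t) \<partial>nu) =
     (-1) ^ i * (\<integral>t. f i t * of_real (poly ((pderiv ^^ (n - i)) ?q) t) \<partial>nu)" for i
  proof (induction i)
    case (Suc i)
    let ?p = "(pderiv ^^ (n - Suc i)) ?q"
    have "(pderiv ^^ (n - i)) ?q = pderiv ?p"
    proof -
      have "n - i = Suc (n - Suc i)" using Suc.prems by simp
      then show ?thesis by (simp only: funpow.simps o_def)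
    qed
    moreover have "(\<integral>t. f (Suc i) t * of_real (poly ?p t) \<partial>nu) = - (\<integral>t. f i t * of_real (poly (pderiv ?p) t) \<partial>nu)"
      using Suc.prems by (intro nu_by_parts f fc legendre_roots) auto
    ultimately show ?case using Suc by simp
  qed simp
  from this[of n] have *: "(\<integral>t. f 0 t * of_real (poly ((pderiv ^^ n) ?q) t) \<partial>nu) =
     (-1) ^ n * (\<integral>t. f n t * of_real (poly ?q t) \<partial>nu)" by simp
  have "(\<integral>t. f 0 t * of_real (poly (legendre n) t) \<partial>nu) =
      (\<integral>t. of_real (kap n) * (f 0 t * of_real (poly ((pderiv ^^ n) ?q) t)) \<partial>nu)"
    by (intro Bochner_Integration.integral_cong) (auto simp: legendre_kap)
  also have "... = of_real (kap n) * (-1) ^ n * (\<integral>t. f n t * of_real (poly ?q t) \<partial>nu)"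
    by (simp add: *)
  also have "... = (\<integral>t. (of_real (kap n) * (-1) ^ n) * (f n t * of_real (poly ?q t)) \<partial>nu)"
    by simp
  also have "... = (\<integral>t. f n t * of_real (kap n * (1 - t\<^sup>2) ^ n) \<partial>nu)"
  proof (intro Bochner_Integration.integral_cong refl)
    fix t :: real
    have "(-1) ^ n * poly ?q t = (1 - t\<^sup>2) ^ n"
      by (simp add: poly_power power2_eq_square flip: power_mult_distrib)
    then have "of_real ((-1) ^ n * poly ?q t) = (of_real ((1 - t\<^sup>2) ^ n) :: complex)" by simp
    then show "(of_real (kap n) * (-1) ^ n) * (f n t * of_real (poly ?q t)) = f n t * of_real (kap n * (1 - t\<^sup>2) ^ n)"
      by (simp add: algebra_simps)
  qed
  finally show ?thesis .
qed

text \<open>The total mass of the kernel that appears after \<open>n\<close> integrations by parts.\<close>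

definition legj :: "nat => real" where
  "legj n = (\<integral>t. (1 - t\<^sup>2) ^ n \<partial>nu)"

lemma legj_0: "legj 0 = 1"
  by (simp add: legj_def nu.prob_space[simplified])

lemma legj_Suc: "(2 * real n + 3) * legj (Suc n) = 2 * (real n + 1) * legj n"
proof -
  have c: "continuous_on {-1..1} (%t::real. (1 - t\<^sup>2) ^ k)" for k by (intro continuous_intros)
  let ?g = "%t::real. (2 * real n + 3) * (1 - t\<^sup>2) ^ Suc n - 2 * (real n + 1) * (1 - t\<^sup>2) ^ n"
  have "(\<integral>t. ?g t \<partial>nu) = (1/2) *\<^sub>R (\<integral>t. indicator {-1..1} t *\<^sub>R ?g t \<partial>lborel)"
    by (rule integral_nu) (intro continuous_intros)
  also have "(\<integral>t. indicator {-1..1} t *\<^sub>R ?g t \<partial>lborel) = 1 * (1 - 1\<^sup>2) ^ Suc n - (-1) * (1 - (-1)\<^sup>2) ^ Suc n"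
  proof (rule integral_FTC_Icc)
    fix t :: real
    have "((%t. t * (1 - t\<^sup>2) ^ Suc n) has_real_derivative
        1 * (1 - t\<^sup>2) ^ Suc n + (real (Suc n) * (1 - t\<^sup>2) ^ n * (- (2 * t))) * t) (at t within {-1..1})"
      by (rule DERIV_mult) (auto intro!: derivative_eq_intros simp del: power_Suc)
    moreover have "1 * (1 - t\<^sup>2) ^ Suc n + (real (Suc n) * (1 - t\<^sup>2) ^ n * (- (2 * t))) * t = ?g t"
      by (simp add: algebra_simps power2_eq_square)
    ultimately have "((%t. t * (1 - t\<^sup>2) ^ Suc n) has_real_derivative ?g t) (at t within {-1..1})" by simp
    then show "((%t. t * (1 - t\<^sup>2) ^ Suc n) has_vector_derivative ?g t) (at t within {-1..1})"
      by (simp add: has_real_derivative_iff_has_vector_derivative)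
  qed (auto intro!: continuous_intros)
  finally have "(\<integral>t. ?g t \<partial>nu) = 0" by simp
  moreover have "(\<integral>t. ?g t \<partial>nu) = (2 * real n + 3) * legj (Suc n) - 2 * (real n + 1) * legj n"
    unfolding legj_def by (subst Bochner_Integration.integral_diff) (auto intro!: integral_nu continuous_intros)
  ultimately show ?thesis by simp
qed

lemma legj_closed: "legj n * fact (2 * n + 1) = 4 ^ n * (fact n)\<^sup>2"
proof (induction n)
  case (Suc n)
  have "legj (Suc n) * fact (2 * Suc n + 1) = ((2 * real n + 3) * legj (Suc n)) * (2 * (real n + 1)) * fact (2 * n + 1)"
    by (simp add: algebra_simps)
  also have "... = (2 * (real n + 1))\<^sup>2 * (legj n * fact (2 * n + 1))"
    unfolding legj_Suc by (simp add: power2_eq_square)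
  also have "... = 4 ^ Suc n * (fact (Suc n))\<^sup>2"
    unfolding Suc.IH by (simp add: power2_eq_square algebra_simps)
  finally show ?case .
qed (simp add: legj_0)

lemma legj_pos: "legj n > 0"
proof -
  have "legj n * fact (2 * n + 1) > 0" unfolding legj_closed by simp
  moreover have "fact (2 * n + 1) > (0::real)" by (rule fact_gt_zero)
  ultimately show ?thesis by (rule zero_less_mult_pos2)
qed

text \<open>The factor lost in passing from a Legendre coefficient to the \<open>n\<close>-th derivative; equality
  holds for \<open>n <= 1\<close>.\<close>

lemma kap_legj_le: "kap n * legj n <= (1 / sqrt 3) ^ n / fact n"
proof -
  define A where "A n = sqrt (2 * real n + 1) / 2 ^ n * legj n" for n
  have A: "kap n * legj n = A n / fact n" by (simp add: A_def kap_def field_simps)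
  have "A n <= (1 / sqrt 3) ^ n"
  proof (induction n)
    case 0 then show ?case by (simp add: A_def legj_0)
  next
    case (Suc n)
    have s: "sqrt (2 * real n + 3) * sqrt (2 * real n + 3) = 2 * real n + 3" by simp
    have "legj (Suc n) = 2 * (real n + 1) / (2 * real n + 3) * legj n"
      using legj_Suc[of n] by (simp add: field_simps)
    then have "A (Suc n) = A n * ((real n + 1) / (sqrt (2 * real n + 1) * sqrt (2 * real n + 3)))"
      using s by (simp add: A_def field_simps)
    also have "... <= A n * (1 / sqrt 3)"
    proof (intro mult_left_mono)
      have "sqrt 3 * (real n + 1) = sqrt (3 * (real n + 1)\<^sup>2)" by (simp add: real_sqrt_mult)
      also have "... <= sqrt ((2 * real n + 1) * (2 * real n + 3))"
        by (intro real_sqrt_le_mono) (simp add: power2_eq_square algebra_simps)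
      finally show "(real n + 1) / (sqrt (2 * real n + 1) * sqrt (2 * real n + 3)) <= 1 / sqrt 3"
        unfolding real_sqrt_mult by (simp add: divide_le_eq le_divide_eq mult.commute)
      show "0 <= A n" using legj_pos[of n] by (simp add: A_def)
    qed
    also have "... <= (1 / sqrt 3) ^ n * (1 / sqrt 3)" using Suc by (intro mult_right_mono) auto
    finally show ?case by simp
  qed
  then show ?thesis unfolding A by (simp add: divide_right_mono)
qed

lemma degree_base: "degree ([:-1, 0, 1:] ^ n :: real poly) = 2 * n" "lead_coeff ([:-1, 0, 1:] ^ n :: real poly) = 1"
proof -
  show d: "degree ([:-1, 0, 1:] ^ n :: real poly) = 2 * n" by (simp add: degree_power_eq)
  have "lead_coeff ([:-1, 0, 1:] ^ n :: real poly) = lead_coeff [:-1, 0, 1::real:] ^ n" by (rule lead_coeff_power)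
  then show "lead_coeff ([:-1, 0, 1:] ^ n :: real poly) = 1" by simp
qed

lemma degree_legendre: "degree (legendre n) = n"
proof (rule antisym)
  show "degree (legendre n) <= n"
    by (rule degree_le) (auto simp: legendre_kap coeff_higher_pderiv intro!: coeff_eq_0 simp: degree_base)
  have "coeff (legendre n) n ~= 0"
    using degree_base[of n] kap_pos[of n] by (simp add: legendre_kap coeff_higher_pderiv mult_2 pochhammer_eq_0_iff)
  then show "n <= degree (legendre n)" by (rule le_degree)
qed

lemma legendre_0: "legendre 0 = 1"
  by (simp add: legendre_def)

lemma legendre_expansion:
  assumes "degree p <= n"
  shows "\<exists>\<alpha>. p = (\<Sum>i\<le>n. smult (\<alpha> i) (legendre i))"
  using assms
proof (induction n arbitrary: p)
  case 0
  then obtain c where "p = [:c:]" by (metis degree_eq_zeroE le_zero_eq)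
  then show ?case by (intro exI[of _ "%_. c"]) (simp add: legendre_0)
next
  case (Suc n)
  define c where "c = coeff p (Suc n) / coeff (legendre (Suc n)) (Suc n)"
  have nz: "coeff (legendre (Suc n)) (Suc n) ~= 0"
    using degree_legendre[of "Suc n"] by (metis degree_0 leading_coeff_0_iff nat.distinct(1))
  have "degree (p - smult c (legendre (Suc n))) <= n"
  proof (rule degree_le, intro allI impI)
    fix i assume i: "n < i"
    show "coeff (p - smult c (legendre (Suc n))) i = 0"
    proof (cases "i = Suc n")
      case False
      then have "coeff p i = 0" "coeff (legendre (Suc n)) i = 0"
        using i Suc.prems degree_legendre[of "Suc n"] by (auto intro!: coeff_eq_0)
      then show ?thesis by simp
    qed (use nz in \<open>simp add: c_def\<close>)
  qed
  then obtain \<alpha> where \<alpha>: "p - smult c (legendre (Suc n)) = (\<Sum>i\<le>n. smult (\<alpha> i) (legendre i))"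
    using Suc.IH by blast
  then have "p = (\<Sum>i\<le>n. smult (\<alpha> i) (legendre i)) + smult c (legendre (Suc n))"
    by (simp add: algebra_simps)
  also have "... = (\<Sum>i\<le>Suc n. smult ((\<alpha>(Suc n := c)) i) (legendre i))" by simp
  finally show ?case by blast
qed

lemma higher_pderiv_legendre_self: "(pderiv ^^ n) (legendre n) = [:kap n * fact (2 * n):]"
proof (rule poly_eqI)
  fix k
  let ?q = "[:-1, 0, 1:] ^ n :: real poly"
  have e: "(pderiv ^^ n) (legendre n) = smult (kap n) ((pderiv ^^ (n + n)) ?q)"
    unfolding legendre_kap higher_pderiv_smult funpow_add o_def ..
  show "coeff ((pderiv ^^ n) (legendre n)) k = coeff [:kap n * fact (2 * n):] k"
  proof (cases k)
    case 0
    have "coeff ?q (n + n) = 1" using degree_base[of n] by (simp only: mult_2)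
    moreover have "pochhammer (1::real) (n + n) = fact (2 * n)" unfolding pochhammer_fact mult_2 ..
    moreover have "coeff (smult (kap n) ((pderiv ^^ (n + n)) ?q)) 0 = kap n * (pochhammer 1 (n + n) * coeff ?q (n + n))"
      unfolding coeff_smult coeff_higher_pderiv by (simp only: add_0_left add_0_right of_nat_1 One_nat_def[symmetric] plus_1_eq_Suc[symmetric])
    ultimately show ?thesis unfolding e 0 by (simp only: mult_1_right coeff_pCons_0)
  next
    case (Suc i)
    have "coeff ?q (n + n + k) = 0" using degree_base(1)[of n] Suc by (intro coeff_eq_0) simp
    then show ?thesis unfolding e coeff_smult coeff_higher_pderiv by (simp add: Suc add_ac)
  qed
qed

lemma nu_legendre_poly:
  "(\<integral>t. poly p t * poly (legendre n) t \<partial>nu) =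
   (\<integral>t. poly ((pderiv ^^ n) p) t * (kap n * (1 - t\<^sup>2) ^ n) \<partial>nu)"
proof -
  define f where "f = (%i t. complex_of_real (poly ((pderiv ^^ i) p) t))"
  have "(\<integral>t. f 0 t * of_real (poly (legendre n) t) \<partial>nu) =
     (\<integral>t. f n t * complex_of_real (kap n * (1 - t\<^sup>2) ^ n) \<partial>nu)"
  proof (rule nu_legendre)
    fix i t
    show "(f i has_vector_derivative f (Suc i) t) (at t within {-1..1})"
      unfolding f_def funpow.simps o_def
      by (rule has_vector_derivative_of_real[OF has_field_derivative_at_within[OF poly_DERIV]])
  qed (auto simp: f_def intro!: continuous_intros)
  then have "(\<integral>t. complex_of_real (poly p t * poly (legendre n) t) \<partial>nu) =
      (\<integral>t. complex_of_real (poly ((pderiv ^^ n) p) t * (kap n * (1 - t\<^sup>2) ^ n)) \<partial>nu)"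
    by (simp only: f_def funpow_0 of_real_mult)
  then show ?thesis by (simp only: integral_complex_of_real of_real_eq_iff)
qed

lemma legendre_orthogonal:
  assumes "m < n"
  shows "(\<integral>t. poly (legendre m) t * poly (legendre n) t \<partial>nu) = 0"
proof -
  have "(pderiv ^^ n) (legendre m) = 0"
    using assms degree_legendre[of m] by (intro poly_eqI) (auto simp: coeff_higher_pderiv intro!: coeff_eq_0)
  then show ?thesis unfolding nu_legendre_poly by simp
qed

lemma legendre_normalized: "(\<integral>t. poly (legendre n) t * poly (legendre n) t \<partial>nu) = 1"
proof -
  have "(\<integral>t. poly (legendre n) t * poly (legendre n) t \<partial>nu) =
      (\<integral>t. (kap n * fact (2 * n) * kap n) * (1 - t\<^sup>2) ^ n \<partial>nu)"
    unfolding nu_legendre_poly[of "legendre n" n] higher_pderiv_legendre_self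
    by (intro Bochner_Integration.integral_cong) auto
  also have "... = (kap n * fact (2 * n) * kap n) * legj n" unfolding legj_def by (rule integral_mult_right_zero)
  also have "... = (legj n * fact (2 * n + 1)) / (4 ^ n * (fact n)\<^sup>2)"
  proof -
    have 4: "(2 ^ n :: real) * 2 ^ n = 4 ^ n" by (simp flip: power_mult_distrib)
    have k: "kap n * kap n = (2 * real n + 1) / (4 ^ n * (fact n)\<^sup>2)"
      unfolding kap_def 4[symmetric] by (simp add: power2_eq_square)
    have "kap n * fact (2 * n) * kap n * legj n = (kap n * kap n) * (fact (2 * n) * legj n)" by simp
    then show ?thesis unfolding k by (simp add: algebra_simps)
  qed
  also have "... = 1" unfolding legj_closed by simp
  finally show ?thesis .
qed

lemma legendre_orthonormal:
  "(\<integral>t. poly (legendre n) t * poly (legendre m) t \<partial>nu) = (if n = m then 1 else 0)"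
proof (cases n m rule: linorder_cases)
  case less then show ?thesis using legendre_orthogonal[OF less] by simp
next
  case equal then show ?thesis using legendre_normalized by simp
next
  case greater then show ?thesis using legendre_orthogonal[OF greater] by (simp add: mult.commute)
qed


section \<open>Legendre expansions in infinitely many variables\<close>

lemma prob_space_mu: "prob_space mu"
  unfolding mu_eq by (rule prob_space_PiM) (rule prob_space_nu)

interpretation mu: prob_space mu by (rule prob_space_mu)

lemma mu_component: "(%y. y j) \<in> measurable mu nu"
  unfolding mu_eq by (rule measurable_component_singleton) simp

lemma mu_coord [measurable]: "(%y. y j) \<in> borel_measurable mu"
proof -
  have "(%t. t) \<in> borel_measurable nu" by (rule nu_measurable) simp
  from measurable_compose[OF mu_component this] show ?thesis .
qed

lemma Iinf_upd: "y \<in> Iinf ==> t \<in> {-1..1} ==> y(j := t) \<in> Iinf"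
  by (auto simp: Iinf_def)

lemma mu_upd_measurable: "(%(t, y). y(j := t)) \<in> measurable (nu \<Otimes>\<^sub>M mu) mu"
  unfolding mu_eq
proof (rule measurable_PiM_single')
  fix i
  show "(%\<omega>. (case \<omega> of (t, y) => y(j := t)) i) \<in> measurable (nu \<Otimes>\<^sub>M Pi\<^sub>M UNIV (%_. nu)) nu"
  proof (cases "i = j")
    case True
    have "fst \<in> measurable (nu \<Otimes>\<^sub>M Pi\<^sub>M UNIV (%_::nat. nu)) nu" by (rule measurable_fst)
    then show ?thesis using True by (simp add: case_prod_beta' cong: measurable_cong)
  next
    case False
    have "(%\<omega>. snd \<omega> i) \<in> measurable (nu \<Otimes>\<^sub>M Pi\<^sub>M UNIV (%_::nat. nu)) nu"
      by (rule measurable_compose[OF measurable_snd measurable_component_singleton]) simp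
    then show ?thesis using False by (simp add: case_prod_beta' cong: measurable_cong)
  qed
qed (auto simp: space_pair_measure space_PiM PiE_iff split: if_splits)

text \<open>Resampling one coordinate does not change the product measure. This replaces Fubini's theorem
  for a splitting of the infinite product into one factor and the rest.\<close>

lemma mu_distr: "mu = distr (nu \<Otimes>\<^sub>M mu) mu (%(t, y). y(j := t))"
  using distr_pair_PiM_eq_PiM[of UNIV "%_. nu" j] prob_space_nu unfolding mu_eq insert_UNIV by simp

text \<open>Bounded measurable functions on the parameter domain form an algebra of integrable functions.\<close>

definition bm :: "((nat => real) => 'b :: {banach, second_countable_topology}) => bool" where
  "bm g \<longleftrightarrow> g \<in> borel_measurable mu \<and> (\<exists>C. \<forall>y\<in>Iinf. norm (g y) <= C)"

lemma bmI: "g \<in> borel_measurable mu ==> (!!y. y \<in> Iinf ==> norm (g y) <= C) ==> bm g"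
  by (auto simp: bm_def)

lemma bm_measurable: "bm g ==> g \<in> borel_measurable mu"
  by (simp add: bm_def)

lemma bm_bound: "bm g ==> \<exists>C. C \<ge> 0 \<and> (\<forall>y\<in>Iinf. norm (g y) <= C)"
  unfolding bm_def by (meson le_max_iff_disj max.cobounded1)

lemma bm_integrable: "bm g ==> integrable mu g"
  unfolding bm_def by (auto intro!: mu.integrable_const_bound AE_I2 simp: space_mu)

lemma bm_const [intro]: "bm (%_. c)"
  by (rule bmI[of _ "norm c"]) auto

lemma bm_add: "bm f ==> bm g ==> bm (%y. f y + g y)"
proof -
  assume f: "bm f" and g: "bm g"
  obtain C D where "\<forall>y\<in>Iinf. norm (f y) <= C" "\<forall>y\<in>Iinf. norm (g y) <= D" using f g by (auto simp: bm_def)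
  then show ?thesis using f g
    by (intro bmI[of _ "C + D"]) (auto simp: bm_def intro!: order.trans[OF norm_triangle_ineq] add_mono)
qed

lemma bm_mult:
  fixes f g :: "(nat => real) => 'b :: {real_normed_algebra, banach, second_countable_topology}"
  shows "bm f ==> bm g ==> bm (%y. f y * g y)"
proof -
  assume f: "bm f" and g: "bm g"
  obtain C D where "\<forall>y\<in>Iinf. norm (f y) <= C" "C \<ge> 0" "\<forall>y\<in>Iinf. norm (g y) <= D"
    using f g bm_bound by (metis (no_types, lifting))
  then show ?thesis using f g
    by (intro bmI[of _ "C * D"]) (auto simp: bm_def intro!: order.trans[OF norm_mult_ineq] mult_mono)
qed

lemma bm_sum: "finite A ==> (!!i. i \<in> A ==> bm (f i)) ==> bm (%y. \<Sum>i\<in>A. f i y)"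
  by (induction A rule: finite_induct) (auto intro!: bm_add)

lemma bm_of_real: "bm f ==> bm (%y. complex_of_real (f y))"
  unfolding bm_def by auto

lemma bm_cnj: "bm f ==> bm (%y. cnj (f y))"
  unfolding bm_def
  using measurable_compose[OF _ borel_measurable_continuous_onI[OF continuous_on_cnj[OF continuous_on_id]], of f mu] by auto

lemma bm_norm_sq: "bm f ==> bm (%y. (norm (f y))\<^sup>2)"
proof -
  assume f: "bm f"
  then obtain C where "\<forall>y\<in>Iinf. norm (f y) <= C" by (auto simp: bm_def)
  then show ?thesis using f by (intro bmI[of _ "C\<^sup>2"]) (auto simp: bm_def intro!: power_mono)
qed

lemma bm_disint:
  assumes "bm g"
  shows "(\<integral>y. g y \<partial>mu) = (\<integral>y. (\<integral>t. g (y(j := t)) \<partial>nu) \<partial>mu)"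
proof -
  interpret P: pair_prob_space nu mu ..
  obtain C where C: "\<forall>y\<in>Iinf. norm (g y) <= C" using assms by (auto simp: bm_def)
  have m: "(%p. g (case p of (t, y) => y(j := t))) \<in> borel_measurable (nu \<Otimes>\<^sub>M mu)"
    by (rule measurable_compose[OF mu_upd_measurable bm_measurable[OF assms]])
  have i: "integrable (nu \<Otimes>\<^sub>M mu) (case_prod (%t y. g (y(j := t))))"
  proof (rule P.integrable_const_bound)
    show "AE x in nu \<Otimes>\<^sub>M mu. norm (case x of (t, y) => g (y(j := t))) <= C"
      using C by (intro AE_I2) (auto simp: space_pair_measure space_mu Iinf_upd)
    show "(%(t, y). g (y(j := t))) \<in> borel_measurable (nu \<Otimes>\<^sub>M mu)"
      using m by (simp add: case_prod_beta')
  qed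
  have "(\<integral>y. g y \<partial>mu) = (\<integral>p. g (case p of (t, y) => y(j := t)) \<partial>(nu \<Otimes>\<^sub>M mu))"
    by (subst mu_distr[of j]) (rule integral_distr[OF mu_upd_measurable bm_measurable[OF assms]])
  also have "... = (\<integral>p. (case p of (t, y) => g (y(j := t))) \<partial>(nu \<Otimes>\<^sub>M mu))"
    by (simp add: case_prod_beta')
  also have "... = (\<integral>y. (\<integral>t. g (y(j := t)) \<partial>nu) \<partial>mu)"
    by (rule P.integral_snd[OF i, symmetric])
  finally show ?thesis .
qed

subsection \<open>Tensor products of univariate functions\<close>

text \<open>Product of univariate functions along the support of a multi-index.\<close>

definition mprod :: "(nat => real => real) => (nat => nat) => (nat => real) => real" where
  "mprod \<phi> s y = (\<Prod>j | s j ~= 0. \<phi> (s j) (y j))"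

lemma mlegendre_mprod: "mlegendre = mprod (%n. poly (legendre n))"
  by (simp add: mlegendre_def mprod_def fun_eq_iff)

lemma mprod_superset:
  assumes "!!t. \<phi> 0 t = 1" "finite J" "{j. s j ~= 0} \<subseteq> J"
  shows "mprod \<phi> s y = (\<Prod>j\<in>J. \<phi> (s j) (y j))"
  unfolding mprod_def using assms by (intro prod.mono_neutral_left) auto

lemma mprod_split:
  assumes "!!t. \<phi> 0 t = 1" "s \<in> finsupp"
  shows "mprod \<phi> s y = \<phi> (s j) (y j) * mprod \<phi> (s(j := 0)) y"
proof -
  define J where "J = insert j {i. s i ~= 0}"
  have J: "finite J" "{i. s i ~= 0} \<subseteq> J" "{i. (s(j := 0)) i ~= 0} \<subseteq> J - {j}" "j \<in> J"
    using assms by (auto simp: J_def finsupp_def)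
  have "mprod \<phi> s y = \<phi> (s j) (y j) * (\<Prod>i\<in>J - {j}. \<phi> (s i) (y i))"
    unfolding mprod_superset[of \<phi>, OF assms(1) J(1,2)] by (rule prod.remove[OF J(1,4)])
  also have "(\<Prod>i\<in>J - {j}. \<phi> (s i) (y i)) = (\<Prod>i\<in>J - {j}. \<phi> ((s(j := 0)) i) (y i))"
    by (intro prod.cong) auto
  also have "... = mprod \<phi> (s(j := 0)) y"
    using J by (intro mprod_superset[symmetric] assms(1)) auto
  finally show ?thesis .
qed

lemma mprod_upd: "s j = 0 ==> mprod \<phi> s (y(j := t)) = mprod \<phi> s y"
  unfolding mprod_def by (intro prod.cong) auto

lemma mprod_nonneg: "(!!n t. t \<in> {-1..1} ==> \<phi> n t \<ge> 0) ==> y \<in> Iinf ==> mprod \<phi> s y \<ge> 0"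
  unfolding mprod_def by (intro prod_nonneg) (auto simp: Iinf_def)

lemma bm_coord_fun:
  assumes "continuous_on UNIV f"
  shows "bm (%y. f (y j :: real) :: real)"
proof -
  have "compact (f ` {-1..1})" by (intro compact_continuous_image continuous_on_subset[OF assms]) auto
  then obtain C where "\<forall>x\<in>f ` {-1..1}. norm x <= C" using compact_imp_bounded bounded_iff by metis
  then show ?thesis
    using measurable_compose[OF mu_coord borel_measurable_continuous_onI[OF assms], of j]
    by (intro bmI[of _ C]) (auto simp: Iinf_def)
qed

lemma bm_prod: "finite A ==> (!!i. i \<in> A ==> bm (f i)) ==> bm (%y. \<Prod>i\<in>A. f i y :: real)"
  by (induction A rule: finite_induct) (auto intro!: bm_mult)

lemma bm_mprod: "(!!n. continuous_on UNIV (\<phi> n)) ==> s \<in> finsupp ==> bm (mprod \<phi> s)"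
  unfolding mprod_def by (intro bm_prod bm_coord_fun) (auto simp: finsupp_def)

lemma integral_mprod:
  assumes \<phi>: "!!t. \<phi> 0 t = 1" "!!n. continuous_on UNIV (\<phi> n)" and s: "s \<in> finsupp"
  shows "(\<integral>y. mprod \<phi> s y \<partial>mu) = (\<Prod>j | s j ~= 0. \<integral>t. \<phi> (s j) t \<partial>nu)"
proof -
  have "{j. s j ~= 0} = J ==> (\<integral>y. mprod \<phi> s y \<partial>mu) = (\<Prod>j\<in>J. \<integral>t. \<phi> (s j) t \<partial>nu)"
    if "finite J" for J and s :: "nat => nat"
    using that
  proof (induction J arbitrary: s rule: finite_induct)
    case empty
    then show ?case using mu.prob_space by (simp add: mprod_def)
  next
    case (insert j J)
    then have s: "s \<in> finsupp" by (simp add: finsupp_def)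
    have "(\<integral>y. mprod \<phi> s y \<partial>mu) = (\<integral>y. (\<integral>t. mprod \<phi> s (y(j := t)) \<partial>nu) \<partial>mu)"
      by (rule bm_disint[OF bm_mprod[OF \<phi>(2) s]])
    also have "... = (\<integral>y. (\<integral>t. \<phi> (s j) t \<partial>nu) * mprod \<phi> (s(j := 0)) y \<partial>mu)"
      by (subst mprod_split[of \<phi>, OF \<phi>(1) s, of _ j]) (simp add: mprod_upd)
    also have "... = (\<integral>t. \<phi> (s j) t \<partial>nu) * (\<Prod>i\<in>J. \<integral>t. \<phi> ((s(j := 0)) i) t \<partial>nu)"
      using insert.hyps insert.prems by (subst insert.IH[symmetric]) auto
    also have "(\<Prod>i\<in>J. \<integral>t. \<phi> ((s(j := 0)) i) t \<partial>nu) = (\<Prod>i\<in>J. \<integral>t. \<phi> (s i) t \<partial>nu)"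
      using insert.hyps by (intro prod.cong) auto
    finally show ?case using insert.hyps by simp
  qed
  from this[of "{j. s j ~= 0}" s] show ?thesis using s by (simp add: finsupp_def)
qed

lemma bm_mlegendre: "s \<in> finsupp ==> bm (mlegendre s)"
  unfolding mlegendre_mprod by (intro bm_mprod continuous_intros)

lemma mlegendre_split: "s \<in> finsupp ==> mlegendre s y = poly (legendre (s j)) (y j) * mlegendre (s(j := 0)) y"
  unfolding mlegendre_mprod by (rule mprod_split) (simp add: legendre_0)

lemma mlegendre_upd: "s j = 0 ==> mlegendre s (y(j := t)) = mlegendre s y"
  unfolding mlegendre_mprod by (rule mprod_upd)

lemma mlegendre_peel:
  assumes "s \<in> finsupp" "s' \<in> finsupp"
  shows "(\<integral>y. mlegendre s y * mlegendre s' y \<partial>mu) =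
    (if s j = s' j then 1 else 0) * (\<integral>y. mlegendre (s(j := 0)) y * mlegendre (s'(j := 0)) y \<partial>mu)"
proof -
  have "(\<integral>y. mlegendre s y * mlegendre s' y \<partial>mu) =
      (\<integral>y. (\<integral>t. mlegendre s (y(j := t)) * mlegendre s' (y(j := t)) \<partial>nu) \<partial>mu)"
    by (rule bm_disint) (intro bm_mult bm_mlegendre assms)
  also have "... = (\<integral>y. (\<integral>t. (poly (legendre (s j)) t * poly (legendre (s' j)) t) *
      (mlegendre (s(j := 0)) y * mlegendre (s'(j := 0)) y) \<partial>nu) \<partial>mu)"
    by (simp add: mlegendre_split[OF assms(1), of _ j] mlegendre_split[OF assms(2), of _ j] mlegendre_upd mult_ac)
  also have "... = (\<integral>y. (if s j = s' j then 1 else 0) * (mlegendre (s(j := 0)) y * mlegendre (s'(j := 0)) y) \<partial>mu)"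
    by (subst integral_mult_left_zero) (simp only: legendre_orthonormal)
  also have "... = (if s j = s' j then 1 else 0) * (\<integral>y. mlegendre (s(j := 0)) y * mlegendre (s'(j := 0)) y \<partial>mu)"
    by (rule integral_mult_right_zero)
  finally show ?thesis .
qed

lemma mlegendre_orthonormal:
  assumes "s \<in> finsupp" "s' \<in> finsupp"
  shows "(\<integral>y. mlegendre s y * mlegendre s' y \<partial>mu) = (if s = s' then 1 else 0)"
proof (cases "s = s'")
  case False
  then obtain j where "s j ~= s' j" by auto
  then show ?thesis using False by (subst mlegendre_peel[OF assms, of j]) simp
next
  case True
  have "{j. s j ~= 0} = J ==> (\<integral>y. mlegendre s y * mlegendre s y \<partial>mu) = 1"
    if "finite J" for J and s :: "nat => nat"
    using that
  proof (induction J arbitrary: s rule: finite_induct)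
    case empty
    then show ?case using mu.prob_space by (simp add: mlegendre_def)
  next
    case (insert j J)
    then have s: "s \<in> finsupp" by (simp add: finsupp_def)
    have "(\<integral>y. mlegendre (s(j := 0)) y * mlegendre (s(j := 0)) y \<partial>mu) = 1"
      using insert.hyps insert.prems by (intro insert.IH) auto
    then show ?case by (subst mlegendre_peel[OF s s, of j]) simp
  qed
  from this[of "{j. s j ~= 0}" s] show ?thesis using True assms by (simp add: finsupp_def)
qed

subsection \<open>Integration by parts in all variables\<close>

text \<open>The kernel of Rodrigues' formula in all variables.\<close>

definition omega :: "(nat => nat) => (nat => real) => real" where
  "omega = mprod (%n t. kap n * (1 - t\<^sup>2) ^ n)"

lemma kap_0: "kap 0 = 1"
  by (simp add: kap_def)

lemma bm_omega: "s \<in> finsupp ==> bm (omega s)"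
  unfolding omega_def by (intro bm_mprod continuous_intros)

lemma omega_nonneg: "y \<in> Iinf ==> omega s y \<ge> 0"
  unfolding omega_def
proof (rule mprod_nonneg)
  fix n and t :: real assume "t \<in> {-1..1}"
  then have "t\<^sup>2 <= 1" by (simp add: abs_square_le_1 abs_le_iff)
  then show "0 <= kap n * (1 - t\<^sup>2) ^ n" using kap_pos[of n] by simp
qed

lemma omega_split: "s \<in> finsupp ==> omega s y = kap (s j) * (1 - (y j)\<^sup>2) ^ s j * omega (s(j := 0)) y"
  unfolding omega_def by (rule mprod_split) (simp add: kap_0)

lemma omega_upd: "s j = 0 ==> omega s (y(j := t)) = omega s y"
  unfolding omega_def by (rule mprod_upd)

lemma integral_omega_le:
  assumes "s \<in> finsupp"
  shows "(\<integral>y. omega s y \<partial>mu) <= (1 / sqrt 3) ^ msize s / real (mfact s)"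
proof -
  have "(\<integral>y. omega s y \<partial>mu) = (\<Prod>j | s j ~= 0. \<integral>t. kap (s j) * (1 - t\<^sup>2) ^ s j \<partial>nu)"
    unfolding omega_def by (rule integral_mprod) (auto simp: kap_0 assms intro!: continuous_intros)
  also have "... = (\<Prod>j | s j ~= 0. kap (s j) * legj (s j))" by (simp add: legj_def)
  also have "... <= (\<Prod>j | s j ~= 0. (1 / sqrt 3) ^ s j / fact (s j))"
    using kap_legj_le kap_pos legj_pos by (intro prod_mono) (auto intro!: mult_nonneg_nonneg less_imp_le)
  also have "... = (1 / sqrt 3) ^ msize s / real (mfact s)"
    by (simp add: prod_dividef msize_def mfact_def power_sum)
  finally show ?thesis .
qed

text \<open>Integrate by parts in one variable after the other; \<open>\<phi> s\<close> stands for the partial derivative of order \<open>s\<close>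
  of \<open>\<phi> 0\<close>. The Legendre coefficient becomes the mean of a derivative against a nonnegative kernel
  of small mass.\<close>

lemma mu_by_parts:
  fixes \<phi> :: "(nat => nat) => (nat => real) => complex"
  assumes bm: "!!s. s \<in> finsupp ==> bm (\<phi> s)"
    and deriv: "!!s j y t. s \<in> finsupp ==> y \<in> Iinf ==> t \<in> {-1..1} ==>
      ((%t. \<phi> s (y(j := t))) has_vector_derivative \<phi> (s(j := Suc (s j))) (y(j := t))) (at t within {-1..1})"
    and s: "s \<in> finsupp"
  shows "(\<integral>y. \<phi> (%_. 0) y * of_real (mlegendre s y) \<partial>mu) = (\<integral>y. \<phi> s y * of_real (omega s y) \<partial>mu)"
proof -
  have "{j. s j ~= 0} = J ==> r \<in> finsupp ==> (\<forall>j\<in>J. r j = 0) ==>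
      (\<integral>y. \<phi> r y * of_real (omega r y) * of_real (mlegendre s y) \<partial>mu) =
      (\<integral>y. \<phi> (%j. r j + s j) y * of_real (omega (%j. r j + s j) y) \<partial>mu)"
    if "finite J" for J and r s :: "nat => nat"
    using that
  proof (induction J arbitrary: r s rule: finite_induct)
    case empty
    then have "s = (%_. 0)" by auto
    then show ?case by (simp add: mlegendre_def)
  next
    case (insert j J)
    then have s: "s \<in> finsupp" by (simp add: finsupp_def)
    define s0 where "s0 = s(j := 0)"
    define r' where "r' = r(j := s j)"
    have s0: "s0 \<in> finsupp" "s0 j = 0" and r': "r' \<in> finsupp" "r'(j := 0) = r" and rj: "r j = 0"
      using s insert.prems by (auto simp: s0_def r'_def finsupp_upd)
    have "(\<integral>y. \<phi> r y * of_real (omega r y) * of_real (mlegendre s y) \<partial>mu) =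
        (\<integral>y. (\<integral>t. \<phi> r (y(j := t)) * of_real (omega r (y(j := t))) * of_real (mlegendre s (y(j := t))) \<partial>nu) \<partial>mu)"
      by (rule bm_disint) (intro bm_mult bm_of_real bm bm_omega bm_mlegendre s insert.prems)
    also have "... = (\<integral>y. (\<integral>t. \<phi> r' (y(j := t)) * of_real (omega r' (y(j := t))) * of_real (mlegendre s0 (y(j := t))) \<partial>nu) \<partial>mu)"
    proof (rule Bochner_Integration.integral_cong[OF refl])
      fix y assume "y \<in> space mu"
      then have y: "y \<in> Iinf" by (simp add: space_mu)
      define f where "f = (%i t. \<phi> (r(j := i)) (y(j := t)))"
      have fd: "(f i has_vector_derivative f (Suc i) t) (at t within {-1..1})" if "t \<in> {-1..1}" for i t
        using deriv[of "r(j := i)" y t j] that y insert.prems by (simp add: f_def finsupp_upd)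
      have fc: "continuous_on {-1..1} (f i)" for i
        unfolding continuous_on_eq_continuous_within using fd has_vector_derivative_continuous by blast
      have f0: "f 0 t = \<phi> r (y(j := t))" for t using rj by (simp add: f_def fun_upd_idem)
      have "(\<integral>t. \<phi> r (y(j := t)) * of_real (omega r (y(j := t))) * of_real (mlegendre s (y(j := t))) \<partial>nu)
          = (\<integral>t. (f 0 t * of_real (poly (legendre (s j)) t)) * of_real (omega r y * mlegendre s0 y) \<partial>nu)"
        by (intro Bochner_Integration.integral_cong)
           (simp_all add: f0 omega_upd rj mlegendre_split[OF s, of _ j] mlegendre_upd[where s = s0 and j = j, OF s0(2)] s0_def[symmetric])
      also have "... = (\<integral>t. f 0 t * of_real (poly (legendre (s j)) t) \<partial>nu) * of_real (omega r y * mlegendre s0 y)"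
        by (rule integral_mult_left_zero)
      also have "(\<integral>t. f 0 t * of_real (poly (legendre (s j)) t) \<partial>nu) =
          (\<integral>t. f (s j) t * of_real (kap (s j) * (1 - t\<^sup>2) ^ s j) \<partial>nu)"
        by (rule nu_legendre) (auto intro: fd fc)
      also have "... * of_real (omega r y * mlegendre s0 y) =
          (\<integral>t. (f (s j) t * of_real (kap (s j) * (1 - t\<^sup>2) ^ s j)) * of_real (omega r y * mlegendre s0 y) \<partial>nu)"
        by (rule integral_mult_left_zero[symmetric])
      also have "... = (\<integral>t. \<phi> r' (y(j := t)) * of_real (omega r' (y(j := t))) * of_real (mlegendre s0 (y(j := t))) \<partial>nu)"
      proof (intro Bochner_Integration.integral_cong refl)
        fix t
        have "omega r' (y(j := t)) = kap (s j) * (1 - t\<^sup>2) ^ s j * omega r y"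
          unfolding omega_split[OF r'(1), of _ j] r'(2) using rj by (simp add: omega_upd) (simp add: r'_def)
        moreover have "f (s j) t = \<phi> r' (y(j := t))" by (simp add: f_def r'_def)
        ultimately show "(f (s j) t * of_real (kap (s j) * (1 - t\<^sup>2) ^ s j)) * of_real (omega r y * mlegendre s0 y) =
            \<phi> r' (y(j := t)) * of_real (omega r' (y(j := t))) * of_real (mlegendre s0 (y(j := t)))"
          by (simp add: mlegendre_upd[where s = s0 and j = j, OF s0(2)])
      qed
      finally show "(\<integral>t. \<phi> r (y(j := t)) * of_real (omega r (y(j := t))) * of_real (mlegendre s (y(j := t))) \<partial>nu)
        = (\<integral>t. \<phi> r' (y(j := t)) * of_real (omega r' (y(j := t))) * of_real (mlegendre s0 (y(j := t))) \<partial>nu)" .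
    qed
    also have "... = (\<integral>y. \<phi> r' y * of_real (omega r' y) * of_real (mlegendre s0 y) \<partial>mu)"
      by (rule bm_disint[symmetric]) (intro bm_mult bm_of_real bm bm_omega bm_mlegendre s0 r')
    also have "... = (\<integral>y. \<phi> (%j. r' j + s0 j) y * of_real (omega (%j. r' j + s0 j) y) \<partial>mu)"
      using insert.prems insert.hyps by (intro insert.IH r') (auto simp: s0_def r'_def)
    also have "(%j. r' j + s0 j) = (%j. r j + s j)" using rj by (auto simp: r'_def s0_def)
    finally show ?case .
  qed
  from this[of "{j. s j ~= 0}" s "%_. 0"] s show ?thesis
    by (simp add: finsupp_def omega_def mprod_def)
qed

subsection \<open>Uniform limits of polynomials\<close>

inductive_set ypoly :: "((nat => real) => complex) set" where
  const: "(%_. c) \<in> ypoly"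
| coord: "(%y. of_real (y j)) \<in> ypoly"
| add: "p \<in> ypoly ==> q \<in> ypoly ==> (%y. p y + q y) \<in> ypoly"
| mult: "p \<in> ypoly ==> q \<in> ypoly ==> (%y. p y * q y) \<in> ypoly"

lemma bm_ypoly: "p \<in> ypoly ==> bm p"
proof (induction rule: ypoly.induct)
  case (coord j)
  have "bm (%y. y j)" by (rule bm_coord_fun) (rule continuous_on_id)
  then show ?case by (rule bm_of_real)
qed (auto intro: bm_add bm_mult)

inductive_set lspan :: "((nat => real) => complex) set" where
  zero: "(%_. 0) \<in> lspan"
| step: "p \<in> lspan ==> s \<in> finsupp ==> (%y. p y + c * of_real (mlegendre s y)) \<in> lspan"

lemma lspan_add: "p \<in> lspan ==> q \<in> lspan ==> (%y. p y + q y) \<in> lspan"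
proof (induction rule: lspan.induct)
  case (step p s c)
  from lspan.step[OF step.IH[OF step.prems] step.hyps(2), of c] show ?case by (simp add: algebra_simps)
qed simp

lemma lspan_base: "s \<in> finsupp ==> (%y. c * of_real (mlegendre s y)) \<in> lspan"
  using lspan.step[OF lspan.zero, of s c] by simp

lemma lspan_sum: "finite A ==> (!!i. i \<in> A ==> f i \<in> lspan) ==> (%y. \<Sum>i\<in>A. f i y) \<in> lspan"
  by (induction A rule: finite_induct) (auto intro: lspan.zero lspan_add)

lemma lspan_coord_mult: "p \<in> lspan ==> (%y. of_real (y j) * p y) \<in> lspan"
proof (induction rule: lspan.induct)
  case zero then show ?case by (simp add: lspan.zero)
next
  case (step p s c)
  define N where "N = degree ([:0, 1:] * legendre (s j))"
  obtain \<alpha> where \<alpha>: "[:0, 1:] * legendre (s j) = (\<Sum>i\<le>N. smult (\<alpha> i) (legendre i))"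
    using legendre_expansion[of "[:0, 1:] * legendre (s j)" N] by (auto simp: N_def)
  have "y j * mlegendre s y = (\<Sum>i\<le>N. \<alpha> i * mlegendre (s(j := i)) y)" for y
  proof -
    have "y j * poly (legendre (s j)) (y j) = poly ([:0, 1:] * legendre (s j)) (y j)" by simp
    also have "... = (\<Sum>i\<le>N. \<alpha> i * poly (legendre i) (y j))" unfolding \<alpha> by (simp add: poly_sum)
    finally have "y j * mlegendre s y = (\<Sum>i\<le>N. \<alpha> i * poly (legendre i) (y j)) * mlegendre (s(j := 0)) y"
      by (simp add: mlegendre_split[OF step(2), of _ j])
    also have "... = (\<Sum>i\<le>N. \<alpha> i * mlegendre (s(j := i)) y)"
      unfolding sum_distrib_right
    proof (rule sum.cong[OF refl])
      fix i
      show "\<alpha> i * poly (legendre i) (y j) * mlegendre (s(j := 0)) y = \<alpha> i * mlegendre (s(j := i)) y"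
        using mlegendre_split[OF finsupp_upd[OF step(2)], of j i y j] by simp
    qed
    finally show ?thesis .
  qed
  then have "(%y. c * of_real (y j * mlegendre s y)) = (%y. \<Sum>i\<le>N. (c * of_real (\<alpha> i)) * of_real (mlegendre (s(j := i)) y))"
    by (simp add: sum_distrib_left mult.assoc)
  then have "(%y. c * of_real (y j * mlegendre s y)) \<in> lspan"
    by (simp add: lspan_sum lspan_base finsupp_upd step(2))
  from lspan_add[OF step.IH this] show ?case by (simp add: algebra_simps)
qed

lemma lspan_scale: "p \<in> lspan ==> (%y. d * p y) \<in> lspan"
proof (induction rule: lspan.induct)
  case (step p s c)
  from lspan.step[OF step.IH step(2), of "d * c"] show ?case by (simp add: algebra_simps)
qed (simp add: lspan.zero)

lemma lspan_ypoly_mult: "p \<in> ypoly ==> q \<in> lspan ==> (%y. p y * q y) \<in> lspan"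
proof (induction arbitrary: q rule: ypoly.induct)
  case (add p q' q)
  from lspan_add[OF add.IH(1)[OF add.prems] add.IH(2)[OF add.prems]] show ?case by (simp add: algebra_simps)
next
  case (mult p q' q)
  from mult.IH(1)[OF mult.IH(2)[OF mult.prems]] show ?case by (simp add: algebra_simps)
qed (auto intro: lspan_scale lspan_coord_mult)

lemma ypoly_lspan: "p \<in> ypoly ==> p \<in> lspan"
proof -
  assume "p \<in> ypoly"
  moreover have "(%y. 1 * of_real (mlegendre (%_. 0) y)) \<in> lspan"
    by (rule lspan_base) (simp add: finsupp_def)
  ultimately have "(%y. p y * (1 * of_real (mlegendre (%_. 0) y))) \<in> lspan" by (rule lspan_ypoly_mult)
  then show ?thesis by (simp add: mlegendre_def)
qed

lemma lspan_repr:
  assumes "p \<in> lspan"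
  shows "\<exists>S \<beta>. finite S \<and> S \<subseteq> finsupp \<and> (\<forall>y. p y = (\<Sum>s\<in>S. \<beta> s * of_real (mlegendre s y)))"
  using assms
proof (induction rule: lspan.induct)
  case zero
  then show ?case by (intro exI[of _ "{}"]) auto
next
  case (step p s c)
  then obtain S \<beta> where S: "finite S" "S \<subseteq> finsupp" "!!y. p y = (\<Sum>s\<in>S. \<beta> s * of_real (mlegendre s y))" by auto
  define \<beta>' where "\<beta>' t = (if t \<in> S then \<beta> t else 0) + (if t = s then c else 0)" for t
  have "p y + c * of_real (mlegendre s y) = (\<Sum>t\<in>insert s S. \<beta>' t * of_real (mlegendre t y))" for y
  proof -
    have "(\<Sum>t\<in>insert s S. \<beta>' t * of_real (mlegendre t y)) =
        (\<Sum>t\<in>insert s S. (if t \<in> S then \<beta> t * of_real (mlegendre t y) else 0)) +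
        (\<Sum>t\<in>insert s S. (if t = s then c * of_real (mlegendre t y) else 0))"
      unfolding sum.distrib[symmetric] by (intro sum.cong) (auto simp: \<beta>'_def algebra_simps)
    also have "(\<Sum>t\<in>insert s S. (if t \<in> S then \<beta> t * of_real (mlegendre t y) else 0)) = p y"
      unfolding S(3) using S(1) by (intro sum.mono_neutral_cong_right) auto
    finally show ?thesis using S(1) by (simp add: sum.delta)
  qed
  then show ?case using S step by (intro exI[of _ "insert s S"] exI[of _ \<beta>']) auto
qed

text \<open>Uniform limits of polynomials in finitely many coordinates; by the theorem of Stone and
  Weierstrass these are the continuous functions, but closure under the operations below is direct.\<close>

definition upc :: "((nat => real) => complex) => bool" where
  "upc g \<longleftrightarrow> (\<forall>e>0. \<exists>p\<in>ypoly. \<forall>y\<in>Iinf. norm (g y - p y) <= e)"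

lemma upc_ypoly: "p \<in> ypoly ==> upc p"
  by (auto simp: upc_def intro!: bexI[of _ p])

lemma upc_uniform_limit:
  assumes "!!e. e > 0 ==> \<exists>h. upc h \<and> (\<forall>y\<in>Iinf. norm (g y - h y) <= e)"
  shows "upc g"
  unfolding upc_def
proof (intro allI impI)
  fix e :: real assume "e > 0"
  obtain h where h: "upc h" "\<forall>y\<in>Iinf. norm (g y - h y) <= e / 2" using assms[of "e / 2"] \<open>e > 0\<close> by auto
  obtain p where p: "p \<in> ypoly" "\<forall>y\<in>Iinf. norm (h y - p y) <= e / 2"
    using h(1) \<open>e > 0\<close> unfolding upc_def by (meson half_gt_zero)
  have "norm (g y - p y) <= e" if "y \<in> Iinf" for y
    using norm_triangle_ineq[of "g y - h y" "h y - p y"] h(2) p(2) that by fastforce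
  then show "\<exists>p\<in>ypoly. \<forall>y\<in>Iinf. norm (g y - p y) <= e" using p(1) by auto
qed

lemma upc_const: "upc (%_. c)"
  by (rule upc_ypoly) (rule ypoly.const)

lemma upc_bm:
  assumes "upc g"
  shows "bm g"
proof -
  have "\<exists>p. p \<in> ypoly \<and> (\<forall>y\<in>Iinf. norm (g y - p y) <= inverse (real (Suc n)))" for n
    using assms[unfolded upc_def, rule_format, of "inverse (real (Suc n))"] by auto
  then have "\<exists>p. \<forall>n. p n \<in> ypoly \<and> (\<forall>y\<in>Iinf. norm (g y - p n y) <= inverse (real (Suc n)))"
    by (intro choice allI)
  then obtain p where "\<forall>n. p n \<in> ypoly \<and> (\<forall>y\<in>Iinf. norm (g y - p n y) <= inverse (real (Suc n)))" ..
  then have p: "!!n. p n \<in> ypoly" "!!n y. y \<in> Iinf ==> norm (g y - p n y) <= inverse (real (Suc n))"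
    by blast+
  have "(%n. p n y) \<longlonglongrightarrow> g y" if "y \<in> Iinf" for y
  proof (rule LIM_zero_cancel, rule Lim_null_comparison[OF _ LIMSEQ_inverse_real_of_nat], intro always_eventually allI)
    show "norm (p n y - g y) <= inverse (real (Suc n))" for n using p(2)[OF that, of n] by (simp add: norm_minus_commute)
  qed
  then have m: "g \<in> borel_measurable mu"
    unfolding space_mu[symmetric] by (rule borel_measurable_LIMSEQ_metric[OF bm_measurable[OF bm_ypoly[OF p(1)]]])
  obtain C where "\<forall>y\<in>Iinf. norm (p 0 y) <= C" using bm_ypoly[OF p(1)[of 0]] by (auto simp: bm_def)
  have "norm (g y) <= C + 1" if "y \<in> Iinf" for y
  proof -
    have "norm (g y) <= norm (g y - p 0 y) + norm (p 0 y)" using norm_triangle_ineq[of "g y - p 0 y" "p 0 y"] by simp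
    moreover have "norm (p 0 y) <= C" using \<open>\<forall>y\<in>Iinf. norm (p 0 y) <= C\<close> that by blast
    moreover have "norm (g y - p 0 y) <= 1" using p(2)[OF that, of 0] by simp
    ultimately show ?thesis by linarith
  qed
  with m show ?thesis by (rule bmI)
qed

lemma upc_add:
  assumes "upc f" "upc g"
  shows "upc (%y. f y + g y)"
  unfolding upc_def
proof (intro allI impI)
  fix e :: real assume "e > 0"
  then obtain p q where pq: "p \<in> ypoly" "\<forall>y\<in>Iinf. norm (f y - p y) <= e / 2" "q \<in> ypoly" "\<forall>y\<in>Iinf. norm (g y - q y) <= e / 2"
    using assms unfolding upc_def by (meson half_gt_zero)
  have "norm (f y + g y - (p y + q y)) <= e" if "y \<in> Iinf" for y
    using norm_triangle_ineq[of "f y - p y" "g y - q y"] pq(2,4) that by (fastforce simp: algebra_simps)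
  then have "\<forall>y\<in>Iinf. norm (f y + g y - (p y + q y)) <= e" by blast
  then show "\<exists>p\<in>ypoly. \<forall>y\<in>Iinf. norm (f y + g y - p y) <= e" using ypoly.add[OF pq(1,3)] by (rule bexI)
qed

lemma upc_mult:
  assumes "upc f" "upc g"
  shows "upc (%y. f y * g y)"
  unfolding upc_def
proof (intro allI impI)
  fix e :: real assume e: "e > 0"
  obtain C where C: "C \<ge> 0" "\<forall>y\<in>Iinf. norm (f y) <= C" using bm_bound[OF upc_bm[OF assms(1)]] by auto
  obtain q where q: "q \<in> ypoly" "\<forall>y\<in>Iinf. norm (g y - q y) <= e / (2 * (C + 1))"
    using assms(2)[unfolded upc_def, rule_format, of "e / (2 * (C + 1))"] e C(1) by auto
  obtain D where D: "D \<ge> 0" "\<forall>y\<in>Iinf. norm (q y) <= D" using bm_bound[OF bm_ypoly[OF q(1)]] by auto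
  obtain p where p: "p \<in> ypoly" "\<forall>y\<in>Iinf. norm (f y - p y) <= e / (2 * (D + 1))"
    using assms(1)[unfolded upc_def, rule_format, of "e / (2 * (D + 1))"] e D(1) by auto
  have "norm (f y * g y - p y * q y) <= e" if y: "y \<in> Iinf" for y
  proof -
    have "f y * g y - p y * q y = f y * (g y - q y) + (f y - p y) * q y" by (simp add: algebra_simps)
    then have "norm (f y * g y - p y * q y) <= norm (f y) * norm (g y - q y) + norm (f y - p y) * norm (q y)"
      by (metis norm_mult norm_triangle_ineq)
    also have "... <= C * (e / (2 * (C + 1))) + e / (2 * (D + 1)) * D"
      using C D p(2) q(2) y e by (intro add_mono mult_mono) auto
    also have "... <= e / 2 + e / 2"
      using C(1) D(1) e by (intro add_mono) (auto simp: field_simps)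
    finally show ?thesis by simp
  qed
  then have "\<forall>y\<in>Iinf. norm (f y * g y - p y * q y) <= e" by blast
  then show "\<exists>p\<in>ypoly. \<forall>y\<in>Iinf. norm (f y * g y - p y) <= e" using ypoly.mult[OF p(1) q(1)] by (rule bexI)
qed

lemma upc_cmult: "upc f ==> upc (%y. c * f y)"
  by (rule upc_mult[OF upc_const])

lemma upc_minus: "upc f ==> upc (%y. - f y)"
  using upc_cmult[of f "-1"] by simp

lemma upc_diff: "upc f ==> upc g ==> upc (%y. f y - g y)"
  using upc_add[OF _ upc_minus] by fastforce

lemma upc_sum: "finite A ==> (!!i. i \<in> A ==> upc (f i)) ==> upc (%y. \<Sum>i\<in>A. f i y)"
  by (induction A rule: finite_induct) (auto intro!: upc_add upc_const)

subsection \<open>Bessel and Parseval\<close>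

definition lcoef :: "((nat => real) => complex) => (nat => nat) => complex" where
  "lcoef g s = (\<integral>y. g y * of_real (mlegendre s y) \<partial>mu)"

lemma lcoef_sum:
  assumes S: "finite S" "S \<subseteq> finsupp" and t: "t \<in> finsupp"
  shows "lcoef (%y. \<Sum>s\<in>S. \<beta> s * of_real (mlegendre s y)) t = (if t \<in> S then \<beta> t else 0)"
proof -
  have "lcoef (%y. \<Sum>s\<in>S. \<beta> s * of_real (mlegendre s y)) t =
      (\<integral>y. (\<Sum>s\<in>S. \<beta> s * of_real (mlegendre s y * mlegendre t y)) \<partial>mu)"
    by (simp add: lcoef_def sum_distrib_right mult.assoc)
  also have "... = (\<Sum>s\<in>S. \<beta> s * of_real (\<integral>y. mlegendre s y * mlegendre t y \<partial>mu))"
  proof (subst Bochner_Integration.integral_sum)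
    show "integrable mu (%y. \<beta> s * complex_of_real (mlegendre s y * mlegendre t y))" if "s \<in> S" for s
      using that S t by (intro bm_integrable bm_mult[OF bm_const] bm_of_real bm_mult bm_mlegendre) auto
  qed (simp only: integral_mult_right_zero integral_complex_of_real)
  also have "... = (\<Sum>s\<in>S. if s = t then \<beta> t else 0)"
    using S t by (intro sum.cong) (auto simp: mlegendre_orthonormal)
  finally show ?thesis using S by (simp add: sum.delta)
qed

lemma pythagoras:
  assumes g: "bm g" and S: "finite S" "S \<subseteq> finsupp"
  shows "(\<integral>y. (norm (g y - (\<Sum>s\<in>S. \<beta> s * of_real (mlegendre s y))))\<^sup>2 \<partial>mu) =
    (\<integral>y. (norm (g y))\<^sup>2 \<partial>mu) - (\<Sum>s\<in>S. (norm (lcoef g s))\<^sup>2) + (\<Sum>s\<in>S. (norm (lcoef g s - \<beta> s))\<^sup>2)"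
proof -
  define P where "P y = (\<Sum>s\<in>S. \<beta> s * of_real (mlegendre s y))" for y
  have bP: "bm P" unfolding P_def using S by (auto intro!: bm_sum bm_mult bm_of_real bm_mlegendre)
  have inner: "(\<integral>y. h y * cnj (P y) \<partial>mu) = (\<Sum>s\<in>S. cnj (\<beta> s) * lcoef h s)" if "bm h" for h
  proof -
    have "(\<integral>y. h y * cnj (P y) \<partial>mu) = (\<integral>y. (\<Sum>s\<in>S. cnj (\<beta> s) * (h y * of_real (mlegendre s y))) \<partial>mu)"
      by (simp add: P_def cnj_sum sum_distrib_left algebra_simps)
    also have "... = (\<Sum>s\<in>S. cnj (\<beta> s) * lcoef h s)"
      unfolding lcoef_def using S that by (subst Bochner_Integration.integral_sum)
        (auto intro!: bm_integrable bm_mult bm_of_real bm_mlegendre)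
    finally show ?thesis .
  qed
  have lP: "lcoef P s = \<beta> s" if "s \<in> S" for s
    unfolding P_def using lcoef_sum[OF S, of s \<beta>] that S by auto
  have "complex_of_real (\<integral>y. (norm (g y - P y))\<^sup>2 \<partial>mu) = (\<integral>y. of_real ((norm (g y - P y))\<^sup>2) \<partial>mu)"
    by (rule integral_complex_of_real[symmetric])
  also have "... = (\<integral>y. of_real ((norm (g y))\<^sup>2) - g y * cnj (P y) - cnj (g y * cnj (P y)) + P y * cnj (P y) \<partial>mu)"
    by (intro Bochner_Integration.integral_cong refl) (simp only: complex_norm_square, simp add: algebra_simps)
  also have "... = of_real (\<integral>y. (norm (g y))\<^sup>2 \<partial>mu) - (\<integral>y. g y * cnj (P y) \<partial>mu) - cnj (\<integral>y. g y * cnj (P y) \<partial>mu) + (\<integral>y. P y * cnj (P y) \<partial>mu)"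
  proof -
    have i: "integrable mu (%y. complex_of_real ((norm (g y))\<^sup>2))" "integrable mu (%y. g y * cnj (P y))"
      "integrable mu (%y. cnj (g y * cnj (P y)))" "integrable mu (%y. P y * cnj (P y))"
      by (intro bm_integrable bm_of_real bm_norm_sq bm_mult bm_cnj g bP)+
    have c: "(\<integral>y. cnj (g y * cnj (P y)) \<partial>mu) = cnj (\<integral>y. g y * cnj (P y) \<partial>mu)" 
      by (rule Bochner_Integration.integral_cnj[of mu "%y. g y * cnj (P y)"])
    show ?thesis unfolding c[symmetric]
      by (simp only: i Bochner_Integration.integral_add Bochner_Integration.integral_diff
         Bochner_Integration.integrable_diff integral_complex_of_real)
  qed
  also have "... = of_real (\<integral>y. (norm (g y))\<^sup>2 \<partial>mu) +
      (\<Sum>s\<in>S. - (cnj (\<beta> s) * lcoef g s) - (\<beta> s * cnj (lcoef g s)) + cnj (\<beta> s) * \<beta> s)"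
    unfolding inner[OF g] inner[OF bP] by (simp add: cnj_sum sum.distrib sum_subtractf sum_negf lP)
  also have "... = of_real (\<integral>y. (norm (g y))\<^sup>2 \<partial>mu) +
      (\<Sum>s\<in>S. of_real ((norm (lcoef g s - \<beta> s))\<^sup>2 - (norm (lcoef g s))\<^sup>2))"
    by (intro arg_cong2[where f = "(+)"] sum.cong refl) (simp only: of_real_diff complex_norm_square, simp add: algebra_simps)
  also have "... = of_real ((\<integral>y. (norm (g y))\<^sup>2 \<partial>mu) + (\<Sum>s\<in>S. (norm (lcoef g s - \<beta> s))\<^sup>2 - (norm (lcoef g s))\<^sup>2))"
    by simp
  finally have "(\<integral>y. (norm (g y - P y))\<^sup>2 \<partial>mu) = (\<integral>y. (norm (g y))\<^sup>2 \<partial>mu) + (\<Sum>s\<in>S. (norm (lcoef g s - \<beta> s))\<^sup>2 - (norm (lcoef g s))\<^sup>2)"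
    by (simp only: of_real_eq_iff)
  then show ?thesis by (simp add: P_def sum_subtractf)
qed

text \<open>Parseval's identity without infinite sums. The function is within \<open>e\<close> of a Legendre sum over a finite
  set; adding the indices of \<open>S0\<close> to this set and passing to the best approximation only helps.\<close>

lemma parseval_approx:
  assumes g: "upc g" and S0: "finite S0" "S0 \<subseteq> finsupp" and e: "e > 0"
  shows "\<exists>S. finite S \<and> S \<subseteq> finsupp \<and> S0 \<subseteq> S \<and>
    (\<integral>y. (norm (g y - (\<Sum>s\<in>S0. lcoef g s * of_real (mlegendre s y))))\<^sup>2 \<partial>mu) <= e + (\<Sum>s\<in>S - S0. (norm (lcoef g s))\<^sup>2)"
proof -
  have bg: "bm g" by (rule upc_bm[OF g])
  obtain p where p: "p \<in> ypoly" "\<forall>y\<in>Iinf. norm (g y - p y) <= sqrt e"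
    using g[unfolded upc_def, rule_format, of "sqrt e"] e by auto
  from lspan_repr[OF ypoly_lspan[OF p(1)]] obtain S1 \<beta> where
    S1': "finite S1 \<and> S1 \<subseteq> finsupp \<and> (\<forall>y. p y = (\<Sum>s\<in>S1. \<beta> s * of_real (mlegendre s y)))" by (elim exE)
  then have S1: "finite S1" "S1 \<subseteq> finsupp" "!!y. p y = (\<Sum>s\<in>S1. \<beta> s * of_real (mlegendre s y))" by auto
  define S where "S = S0 \<union> S1"
  define \<gamma> where "\<gamma> s = (if s \<in> S1 then \<beta> s else 0)" for s
  have S: "finite S" "S \<subseteq> finsupp" "S0 \<subseteq> S" using S0 S1 by (auto simp: S_def)
  have pS: "p y = (\<Sum>s\<in>S. \<gamma> s * of_real (mlegendre s y))" for y
    unfolding S1(3) \<gamma>_def using S0 S1 by (intro sum.mono_neutral_cong_left) (auto simp: S_def)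
  have A1: "(\<integral>y. (norm (g y))\<^sup>2 \<partial>mu) - (\<Sum>s\<in>S. (norm (lcoef g s))\<^sup>2) <= (\<integral>y. (norm (g y - p y))\<^sup>2 \<partial>mu)"
  proof -
    have "(\<Sum>s\<in>S. (norm (lcoef g s - \<gamma> s))\<^sup>2) \<ge> 0" by (rule sum_nonneg) simp
    moreover have "(\<integral>y. (norm (g y - p y))\<^sup>2 \<partial>mu) =
        (\<integral>y. (norm (g y))\<^sup>2 \<partial>mu) - (\<Sum>s\<in>S. (norm (lcoef g s))\<^sup>2) + (\<Sum>s\<in>S. (norm (lcoef g s - \<gamma> s))\<^sup>2)"
      unfolding pS by (rule pythagoras[OF bg S(1,2)])
    ultimately show ?thesis by linarith
  qed
  have A2: "(\<integral>y. (norm (g y - p y))\<^sup>2 \<partial>mu) <= (\<integral>y. e \<partial>mu)"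
  proof (rule integral_mono)
    have "bm (%y. g y + (-1) * p y)" by (intro bm_add bg bm_mult bm_const bm_ypoly p)
    from bm_integrable[OF bm_norm_sq[OF this]] show "integrable mu (%y. (norm (g y - p y))\<^sup>2)" by simp
    fix y assume "y \<in> space mu"
    then have "(norm (g y - p y))\<^sup>2 <= (sqrt e)\<^sup>2" using p(2) by (intro power_mono) (auto simp: space_mu)
    then show "(norm (g y - p y))\<^sup>2 <= e" using e by simp
  qed simp
  have A3: "(\<integral>y. e \<partial>mu) = e" by (simp add: mu.prob_space)
  have "(\<integral>y. (norm (g y))\<^sup>2 \<partial>mu) - (\<Sum>s\<in>S. (norm (lcoef g s))\<^sup>2) <= e"
    using A1 A2 A3 by linarith
  moreover have "(\<Sum>s\<in>S. (norm (lcoef g s))\<^sup>2) = (\<Sum>s\<in>S - S0. (norm (lcoef g s))\<^sup>2) + (\<Sum>s\<in>S0. (norm (lcoef g s))\<^sup>2)"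
    by (rule sum.subset_diff[OF S(3,1)])
  ultimately have "(\<integral>y. (norm (g y - (\<Sum>s\<in>S0. lcoef g s * of_real (mlegendre s y))))\<^sup>2 \<partial>mu) <= e + (\<Sum>s\<in>S - S0. (norm (lcoef g s))\<^sup>2)"
    using pythagoras[OF bg S0, of "lcoef g"] by simp
  with S show ?thesis by blast
qed


section \<open>Square-integrable functions\<close>

definition l2 :: "'x measure => ('x => 'b :: {banach, second_countable_topology}) => bool" where
  "l2 M f \<longleftrightarrow> f \<in> borel_measurable M \<and> integrable M (%x. (norm (f x))\<^sup>2)"

definition n2 :: "'x measure => ('x => 'b :: {banach, second_countable_topology}) => real" where
  "n2 M f = sqrt (\<integral>x. (norm (f x))\<^sup>2 \<partial>M)"

lemma n2_nonneg: "n2 M f \<ge> 0"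
  by (simp add: n2_def)

lemma n2_sq: "(n2 M f)\<^sup>2 = (\<integral>x. (norm (f x))\<^sup>2 \<partial>M)"
  by (simp add: n2_def)

lemma l2_measurable: "l2 M f ==> f \<in> borel_measurable M"
  by (simp add: l2_def)

lemma l2_norm_mult_integrable:
  assumes "l2 M f" "l2 M g"
  shows "integrable M (%x. norm (f x) * norm (g x))"
proof (rule Bochner_Integration.integrable_bound)
  show "integrable M (%x. (norm (f x))\<^sup>2 + (norm (g x))\<^sup>2)" using assms by (auto simp: l2_def)
  show "(%x. norm (f x) * norm (g x)) \<in> borel_measurable M" using assms by (auto simp: l2_def)
  show "AE x in M. norm (norm (f x) * norm (g x)) <= norm ((norm (f x))\<^sup>2 + (norm (g x))\<^sup>2)"
  proof (rule AE_I2)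
    fix x
    have "2 * (norm (f x) * norm (g x)) <= (norm (f x))\<^sup>2 + (norm (g x))\<^sup>2"
      using sum_squares_bound[of "norm (f x)" "norm (g x)"] by (simp add: mult.assoc)
    moreover have "norm (f x) * norm (g x) \<ge> 0" by simp
    ultimately show "norm (norm (f x) * norm (g x)) <= norm ((norm (f x))\<^sup>2 + (norm (g x))\<^sup>2)"
      unfolding real_norm_def by linarith
  qed
qed

lemma discriminant_bound:
  fixes A B C :: real
  assumes "!!t. A - 2 * t * B + t\<^sup>2 * C \<ge> 0" "C \<ge> 0"
  shows "B\<^sup>2 <= A * C"
proof (cases "C = 0")
  case True
  have "B = 0"
  proof (rule ccontr)
    assume "B ~= 0"
    then have "A - 2 * ((A + 1) / (2 * B)) * B = - 1" by (simp add: field_simps)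
    then show False using assms(1)[of "(A + 1) / (2 * B)"] True by simp
  qed
  then show ?thesis using True by simp
next
  case False
  then have "C > 0" using assms by simp
  then have "0 <= (A - 2 * (B / C) * B + (B / C)\<^sup>2 * C) * C" using assms(1)[of "B / C"] by simp
  also have "... = A * C - B\<^sup>2" using \<open>C > 0\<close> by (simp add: power2_eq_square field_simps)
  finally show ?thesis by simp
qed

text \<open>The discriminant of the nonnegative quadratic \<open>t \<mapsto> n2 M (f - t g)\<^sup>2\<close>.\<close>

lemma l2_cauchy_schwarz:
  assumes f: "l2 M f" and g: "l2 M g"
  shows "(\<integral>x. norm (f x) * norm (g x) \<partial>M) <= n2 M f * n2 M g"
proof -
  have i: "integrable M (%x. (norm (f x))\<^sup>2)" "integrable M (%x. norm (f x) * norm (g x))" "integrable M (%x. (norm (g x))\<^sup>2)"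
    using f g l2_norm_mult_integrable[OF f g] by (auto simp: l2_def)
  have "(\<integral>x. norm (f x) * norm (g x) \<partial>M)\<^sup>2 <= (\<integral>x. (norm (f x))\<^sup>2 \<partial>M) * (\<integral>x. (norm (g x))\<^sup>2 \<partial>M)"
  proof (rule discriminant_bound)
    fix t :: real
    have "0 <= (\<integral>x. (norm (f x) - t * norm (g x))\<^sup>2 \<partial>M)" by simp
    also have "... = (\<integral>x. (norm (f x))\<^sup>2 - (2 * t) * (norm (f x) * norm (g x)) + t\<^sup>2 * (norm (g x))\<^sup>2 \<partial>M)"
      by (intro Bochner_Integration.integral_cong) (auto simp: power2_eq_square algebra_simps)
    also have "... = (\<integral>x. (norm (f x))\<^sup>2 \<partial>M) - 2 * t * (\<integral>x. norm (f x) * norm (g x) \<partial>M) + t\<^sup>2 * (\<integral>x. (norm (g x))\<^sup>2 \<partial>M)"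
      using i by simp
    finally show "0 <= (\<integral>x. (norm (f x))\<^sup>2 \<partial>M) - 2 * t * (\<integral>x. norm (f x) * norm (g x) \<partial>M) + t\<^sup>2 * (\<integral>x. (norm (g x))\<^sup>2 \<partial>M)" .
  qed simp
  then have "(\<integral>x. norm (f x) * norm (g x) \<partial>M)\<^sup>2 <= (n2 M f * n2 M g)\<^sup>2"
    by (simp add: power_mult_distrib n2_sq)
  then show ?thesis by (rule power2_le_imp_le) (simp add: n2_nonneg)
qed

text \<open>How integrability and boundedness of all bilinear expressions below are obtained.\<close>

lemma l2_form:
  fixes F :: "'x => 'c :: {banach, second_countable_topology}"
  assumes f: "l2 M f" and g: "l2 M g" and F: "F \<in> borel_measurable M"
    and C: "C \<ge> 0" "AE x in M. norm (F x) <= C * (norm (f x) * norm (g x))"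
  shows "integrable M F" "norm (\<integral>x. F x \<partial>M) <= C * (n2 M f * n2 M g)"
proof -
  have i: "integrable M (%x. C * (norm (f x) * norm (g x)))"
    using l2_norm_mult_integrable[OF f g] by simp
  show F': "integrable M F"
    by (rule Bochner_Integration.integrable_bound[OF i F]) (use C in \<open>auto elim!: AE_mp\<close>)
  have "norm (\<integral>x. F x \<partial>M) <= (\<integral>x. norm (F x) \<partial>M)" by (rule integral_norm_bound)
  also have "... <= (\<integral>x. C * (norm (f x) * norm (g x)) \<partial>M)"
    by (rule integral_mono_AE) (use F' i C in auto)
  also have "... <= C * (n2 M f * n2 M g)"
    using mult_left_mono[OF l2_cauchy_schwarz[OF f g] C(1)] by simp
  finally show "norm (\<integral>x. F x \<partial>M) <= C * (n2 M f * n2 M g)" .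
qed

lemma l2_add:
  assumes f: "l2 M f" and g: "l2 M g"
  shows "l2 M (%x. f x + g x)" "n2 M (%x. f x + g x) <= n2 M f + n2 M g"
proof -
  let ?h = "%x. (norm (f x))\<^sup>2 + 2 * (norm (f x) * norm (g x)) + (norm (g x))\<^sup>2"
  have i: "integrable M (%x. (norm (f x))\<^sup>2)" "integrable M (%x. norm (f x) * norm (g x))" "integrable M (%x. (norm (g x))\<^sup>2)"
    using f g l2_norm_mult_integrable[OF f g] by (auto simp: l2_def)
  have ih: "integrable M ?h" using i by auto
  have m: "(%x. f x + g x) \<in> borel_measurable M" using f g by (auto simp: l2_def)
  have le: "(norm (f x + g x))\<^sup>2 <= ?h x" for x
  proof -
    have "(norm (f x + g x))\<^sup>2 <= (norm (f x) + norm (g x))\<^sup>2" by (intro power_mono norm_triangle_ineq) simp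
    then show ?thesis by (simp add: power2_eq_square algebra_simps)
  qed
  have i2: "integrable M (%x. (norm (f x + g x))\<^sup>2)"
    by (rule Bochner_Integration.integrable_bound[OF ih]) (use m le in \<open>auto intro!: AE_I2 order.trans[OF _ abs_ge_self]\<close>)
  with m show "l2 M (%x. f x + g x)" by (simp add: l2_def)
  have "(n2 M (%x. f x + g x))\<^sup>2 <= (\<integral>x. ?h x \<partial>M)"
    unfolding n2_sq by (rule integral_mono[OF i2 ih le])
  also have "... = (n2 M f)\<^sup>2 + 2 * (\<integral>x. norm (f x) * norm (g x) \<partial>M) + (n2 M g)\<^sup>2"
    using i by (simp add: n2_sq)
  also have "... <= (n2 M f + n2 M g)\<^sup>2"
    using l2_cauchy_schwarz[OF f g] by (simp add: power2_sum)
  finally show "n2 M (%x. f x + g x) <= n2 M f + n2 M g"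
    by (rule power2_le_imp_le) (simp add: n2_nonneg)
qed

lemma l2_minus: "l2 M f ==> l2 M (%x. - f x)" "n2 M (%x. - f x) = n2 M f"
  by (auto simp: l2_def n2_def)

lemma l2_diff:
  assumes f: "l2 M f" and g: "l2 M g"
  shows "l2 M (%x. f x - g x)" "n2 M (%x. f x - g x) <= n2 M f + n2 M g"
  using l2_add[OF f l2_minus(1)[OF g]] by (simp_all add: l2_minus(2))

lemma n2_commute: "n2 M (%x. f x - g x) = n2 M (%x. g x - f x)"
  by (simp add: n2_def norm_minus_commute)

lemma l2_triangle3:
  assumes "l2 M f" "l2 M g" "l2 M h"
  shows "n2 M (%x. f x - h x) <= n2 M (%x. f x - g x) + n2 M (%x. g x - h x)"
  using l2_add(2)[OF l2_diff(1)[OF assms(1,2)] l2_diff(1)[OF assms(2,3)]] by simp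

lemma l2_cong_AE:
  assumes "f \<in> borel_measurable M" "g \<in> borel_measurable M" "AE x in M. f x = g x"
  shows "l2 M f \<longleftrightarrow> l2 M g" "n2 M f = n2 M g"
proof -
  have "integrable M (%x. (norm (f x))\<^sup>2) \<longleftrightarrow> integrable M (%x. (norm (g x))\<^sup>2)"
    by (rule integrable_cong_AE) (use assms in \<open>auto elim!: AE_mp\<close>)
  then show "l2 M f \<longleftrightarrow> l2 M g" using assms by (simp add: l2_def)
  have "(\<integral>x. (norm (f x))\<^sup>2 \<partial>M) = (\<integral>x. (norm (g x))\<^sup>2 \<partial>M)"
    by (rule integral_cong_AE) (use assms in \<open>auto elim!: AE_mp\<close>)
  then show "n2 M f = n2 M g" by (simp add: n2_def)
qed

lemma (in prob_space) l2_const: "l2 M (%_. c)"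
  by (simp add: l2_def)

lemma (in prob_space) l2_integrable:
  assumes "l2 M f"
  shows "integrable M f" "(\<integral>x. norm (f x) \<partial>M) <= n2 M f"
proof -
  have 1: "n2 M (%_. 1 :: real) = 1" by (simp add: n2_def prob_space)
  show i: "integrable M f"
    by (rule l2_form(1)[OF assms l2_const[of "1::real"], of f 1]) (use assms in \<open>auto simp: l2_def\<close>)
  show "(\<integral>x. norm (f x) \<partial>M) <= n2 M f"
    using l2_cauchy_schwarz[OF assms l2_const[of "1::real"]] by (simp add: 1)
qed

text \<open>Completeness, with the pointwise limit of the given sequence as the limit: this keeps
  properties such as periodicity, which hold pointwise.\<close>

lemma (in prob_space) l2_complete:
  fixes f :: "nat => 'a => 'b :: {banach, second_countable_topology}"
  assumes f: "!!n. l2 M (f n)" and d: "!!n. n2 M (%x. f (Suc n) x - f n x) <= (1/2) ^ n"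
  defines "g \<equiv> (%x. lim (%n. f n x))"
  shows "l2 M g" "n2 M (%x. f n x - g x) <= 2 * (1/2) ^ n"
proof -
  have [measurable]: "!!n. f n \<in> borel_measurable M" using f by (simp add: l2_def)
  have gm [measurable]: "g \<in> borel_measurable M" unfolding g_def by (rule borel_measurable_lim_metric) measurable
  have dl: "l2 M (%x. f (Suc n) x - f n x)" for n by (intro l2_diff f)
  have "(\<integral>\<^sup>+x. (\<Sum>n. ennreal (norm (f (Suc n) x - f n x))) \<partial>M) = (\<Sum>n. \<integral>\<^sup>+x. ennreal (norm (f (Suc n) x - f n x)) \<partial>M)"
    by (rule nn_integral_suminf) measurable
  also have "... <= (\<Sum>n. ennreal ((1/2) ^ n))"
  proof (intro suminf_le)
    fix n
    have "(\<integral>\<^sup>+x. ennreal (norm (f (Suc n) x - f n x)) \<partial>M) = ennreal (\<integral>x. norm (f (Suc n) x - f n x) \<partial>M)"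
      using l2_integrable(1)[OF dl] by (intro nn_integral_eq_integral) auto
    also have "... <= ennreal ((1/2) ^ n)" using l2_integrable(2)[OF dl[of n]] d[of n] by (intro ennreal_leI) linarith
    finally show "(\<integral>\<^sup>+x. ennreal (norm (f (Suc n) x - f n x)) \<partial>M) <= ennreal ((1/2) ^ n)" .
  qed auto
  also have "... = ennreal (\<Sum>n. (1/2) ^ n)" by (intro suminf_ennreal2 summable_geometric) auto
  also have "... < \<infinity>" by simp
  finally have "AE x in M. (\<Sum>n. ennreal (norm (f (Suc n) x - f n x))) ~= \<infinity>"
    by (intro nn_integral_PInf_AE) auto
  then have conv: "AE x in M. (%n. f n x) \<longlonglongrightarrow> g x"
  proof eventually_elim
    case (elim x)
    then have "summable (%n. norm (f (Suc n) x - f n x))"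
      by (intro summable_suminf_not_top) auto
    then have "summable (%n. f (Suc n) x - f n x)" by (rule summable_norm_cancel)
    then have "convergent (%n. \<Sum>i<n. f (Suc i) x - f i x)" by (simp add: summable_iff_convergent)
    then have "convergent (%n. (\<Sum>i<n. f (Suc i) x - f i x) + f 0 x)"
      by (intro convergent_add convergent_const)
    then have "convergent (%n. f n x)" by (simp add: sum_lessThan_telescope[of "%n. f n x"])
    then show ?case by (simp add: g_def convergent_LIMSEQ_iff)
  qed
  have bound: "n2 M (%x. f n x - f (n + k) x) <= 2 * (1/2) ^ n - 2 * (1/2) ^ (n + k)" for n k
  proof (induction k)
    case (Suc k)
    have "n2 M (%x. f n x - f (n + Suc k) x) <= n2 M (%x. f n x - f (n + k) x) + n2 M (%x. f (n + k) x - f (Suc (n + k)) x)"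
      using l2_triangle3[OF f[of n] f[of "n + k"] f[of "Suc (n + k)"]] by simp
    also have "n2 M (%x. f (n + k) x - f (Suc (n + k)) x) <= (1/2) ^ (n + k)"
      using d[of "n + k"] by (subst n2_commute)
    finally show ?case using Suc by simp
  qed (simp add: n2_def)
  have fin: "(\<integral>\<^sup>+x. ennreal ((norm (f n x - g x))\<^sup>2) \<partial>M) <= ennreal ((2 * (1/2) ^ n)\<^sup>2)" for n
  proof -
    have "(\<integral>\<^sup>+x. ennreal ((norm (f n x - g x))\<^sup>2) \<partial>M) = (\<integral>\<^sup>+x. liminf (%k. ennreal ((norm (f n x - f k x))\<^sup>2)) \<partial>M)"
      using conv
    proof (intro nn_integral_cong_AE, eventually_elim)
      case (elim x)
      then have "(%k. ennreal ((norm (f n x - f k x))\<^sup>2)) \<longlonglongrightarrow> ennreal ((norm (f n x - g x))\<^sup>2)"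
        by (intro tendsto_ennrealI tendsto_power tendsto_norm tendsto_diff tendsto_const)
      then show ?case by (rule lim_imp_Liminf[OF trivial_limit_sequentially, symmetric])
    qed
    also have "... <= liminf (%k. \<integral>\<^sup>+x. ennreal ((norm (f n x - f k x))\<^sup>2) \<partial>M)"
      by (rule nn_integral_liminf) measurable
    also have "... <= ennreal ((2 * (1/2) ^ n)\<^sup>2)"
    proof (rule Liminf_le)
      show "\<forall>\<^sub>F k in sequentially. (\<integral>\<^sup>+x. ennreal ((norm (f n x - f k x))\<^sup>2) \<partial>M) <= ennreal ((2 * (1/2) ^ n)\<^sup>2)"
        using eventually_ge_at_top[of n]
      proof eventually_elim
        case (elim k)
        then obtain j where k: "k = n + j" using le_Suc_ex by blast
        have "(\<integral>\<^sup>+x. ennreal ((norm (f n x - f k x))\<^sup>2) \<partial>M) = ennreal ((n2 M (%x. f n x - f k x))\<^sup>2)"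
          unfolding n2_sq using l2_diff(1)[OF f f] by (intro nn_integral_eq_integral) (auto simp: l2_def)
        also have "... <= ennreal ((2 * (1/2) ^ n)\<^sup>2)"
          using bound[of n j] by (intro ennreal_leI power_mono n2_nonneg) (auto simp: k intro: order.trans)
        finally show ?case .
      qed
    qed simp
    finally show ?thesis .
  qed
  have il: "integrable M (%x. (norm (f n x - g x))\<^sup>2)" for n
  proof (rule integrableI_bounded)
    have "(\<integral>\<^sup>+x. ennreal (norm ((norm (f n x - g x))\<^sup>2)) \<partial>M) <= ennreal ((2 * (1/2) ^ n)\<^sup>2)" using fin[of n] by simp
    also have "... < \<infinity>" by simp
    finally show "(\<integral>\<^sup>+x. ennreal (norm ((norm (f n x - g x))\<^sup>2)) \<partial>M) < \<infinity>" .
  qed measurable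
  then have dg: "l2 M (%x. f n x - g x)" for n by (simp add: l2_def)
  show "l2 M g" using l2_diff(1)[OF f[of 0] dg[of 0]] by simp
  have "ennreal ((n2 M (%x. f n x - g x))\<^sup>2) <= ennreal ((2 * (1/2) ^ n)\<^sup>2)"
    unfolding n2_sq using fin[of n] il[of n] by (simp add: nn_integral_eq_integral)
  then have "(n2 M (%x. f n x - g x))\<^sup>2 <= (2 * (1/2) ^ n)\<^sup>2" by (subst (asm) ennreal_le_iff) auto
  then show "n2 M (%x. f n x - g x) <= 2 * (1/2) ^ n" by (rule power2_le_imp_le) simp
qed


section \<open>The torus\<close>

definition cube :: "(real ^ 'm) set" where
  "cube = {x. \<forall>i. 0 <= x $ i \<and> x $ i < 1}"

lemma cube_borel [measurable]: "(cube :: (real ^ 'm) set) \<in> sets borel"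
proof -
  have "(cube :: (real ^ 'm) set) = (\<Inter>i. {x. 0 <= x $ i \<and> x $ i < 1})" by (auto simp: cube_def)
  also have "... \<in> sets borel"
  proof (intro sets.finite_INT)
    fix i :: 'm
    have "{x :: real ^ 'm. 0 <= x $ i \<and> x $ i < 1} = {x. x $ i \<ge> 0} \<inter> {x. x $ i < 1}" by auto
    also have "... \<in> sets borel"
      by (intro sets.Int borel_closed borel_open closed_halfspace_component_ge_cart open_halfspace_component_lt_cart)
    finally show "{x :: real ^ 'm. 0 <= x $ i \<and> x $ i < 1} \<in> sets borel" .
  qed auto
  finally show ?thesis .
qed

lemma torus_eq: "torus = restrict_space lborel cube"
  by (simp add: torus_def cube_def)

lemma space_torus [simp]: "space torus = cube"
  by (simp add: torus_eq space_restrict_space)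

lemma torus_measurable: "f \<in> borel_measurable borel ==> f \<in> borel_measurable torus"
  unfolding torus_eq by (rule measurable_restrict_space1) simp

lemma torus_measurable_cont: "continuous_on UNIV f ==> f \<in> borel_measurable torus"
  by (intro torus_measurable borel_measurable_continuous_onI)

lemma cube_subset_cbox: "cube \<subseteq> cbox 0 (\<chi> i. 1)"
  by (auto simp: cube_def mem_box_cart less_imp_le)

lemma prob_space_torus: "prob_space (torus :: (real ^ 'm) measure)"
proof (rule prob_spaceI)
  have one: "emeasure lborel (cbox 0 (\<chi> i. 1) :: (real ^ 'm) set) = 1" "emeasure lborel (box 0 (\<chi> i. 1) :: (real ^ 'm) set) = 1"
  proof -
    have b: "(\<chi> i. 1) \<bullet> b = 1" if "b \<in> Basis" for b :: "real ^ 'm"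
      using that by (auto simp: Basis_vec_def inner_axis)
    show "emeasure lborel (cbox 0 (\<chi> i. 1) :: (real ^ 'm) set) = 1"
      by (subst emeasure_lborel_cbox) (auto simp: b)
    show "emeasure lborel (box 0 (\<chi> i. 1) :: (real ^ 'm) set) = 1"
      by (subst emeasure_lborel_box) (auto simp: b)
  qed
  have "emeasure lborel (cube :: (real ^ 'm) set) = 1"
  proof (rule antisym)
    show "emeasure lborel (cube :: (real ^ 'm) set) <= 1"
      unfolding one(1)[symmetric] by (rule emeasure_mono[OF cube_subset_cbox]) simp
    have "box 0 (\<chi> i. 1) \<subseteq> (cube :: (real ^ 'm) set)" by (auto simp: cube_def mem_box_cart less_imp_le)
    then show "1 <= emeasure lborel (cube :: (real ^ 'm) set)"
      unfolding one(2)[symmetric] by (rule emeasure_mono) simp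
  qed
  then show "emeasure torus (space (torus :: (real ^ 'm) measure)) = 1"
    by (simp add: torus_eq emeasure_restrict_space space_restrict_space)
qed

interpretation torus: prob_space torus by (rule prob_space_torus)

lemma torus_bounded_cont:
  fixes f :: "real ^ 'm => 'b :: real_normed_vector"
  assumes "continuous_on UNIV f"
  shows "\<exists>C\<ge>0. \<forall>x\<in>cbox 0 (\<chi> i. 2). norm (f x) <= C"
proof -
  have "compact (f ` cbox 0 (\<chi> i. 2))"
    by (intro compact_continuous_image continuous_on_subset[OF assms] compact_cbox) auto
  then obtain C where "\<forall>y\<in>f ` cbox 0 (\<chi> i. 2). norm y <= C" using compact_imp_bounded bounded_iff by blast
  then show ?thesis by (intro exI[of _ "max 0 C"]) auto
qed

lemma cube_subset_cbox2: "cube \<subseteq> cbox 0 (\<chi> i. 2)"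
proof
  fix x :: "real ^ 'm" assume "x \<in> cube"
  then have "0 <= x $ i \<and> x $ i <= 2" for i unfolding cube_def using spec[of _ i] by (smt (verit) mem_Collect_eq)
  then show "x \<in> cbox 0 (\<chi> i. 2)" by (simp add: mem_box_cart)
qed

lemma torus_cont_mult_integrable:
  fixes f :: "real ^ 'm => real" and w :: "real ^ 'm => 'b :: {banach, second_countable_topology}"
  assumes f: "continuous_on UNIV f" and w: "integrable torus w"
  shows "integrable torus (%x. f x *\<^sub>R w x)"
proof -
  obtain C where C: "C \<ge> 0" "\<forall>x\<in>cbox 0 (\<chi> i. 2). norm (f x) <= C" using torus_bounded_cont[OF f] by auto
  have "integrable torus (%x. C * norm (w x))" using w by simp
  then show ?thesis
  proof (rule Bochner_Integration.integrable_bound)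
    show "(%x. f x *\<^sub>R w x) \<in> borel_measurable torus"
      using torus_measurable_cont[OF f] borel_measurable_integrable[OF w] by measurable
    show "AE x in torus. norm (f x *\<^sub>R w x) <= norm (C * norm (w x))"
      using C cube_subset_cbox2 by (intro AE_I2) (auto simp: abs_mult intro!: mult_right_mono)
  qed
qed

lemma torus_cont_integrable:
  fixes f :: "real ^ 'm => 'b :: {banach, second_countable_topology}"
  assumes f: "continuous_on UNIV f"
  shows "integrable torus f"
proof -
  obtain C where C: "C \<ge> 0" "\<forall>x\<in>cbox 0 (\<chi> i. 2). norm (f x) <= C" using torus_bounded_cont[OF f] by auto
  show ?thesis
    by (rule torus.integrable_const_bound[of _ C])
       (use C cube_subset_cbox2 torus_measurable_cont[OF f] in \<open>auto intro!: AE_I2\<close>)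
qed

text \<open>Stated for continuous functions and one coordinate, as it is differentiated in the shift.\<close>

lemma torus_translate:
  fixes g :: "real ^ 'm => 'b :: {banach, second_countable_topology}"
  assumes g: "continuous_on UNIV g" and per: "periodic g" and t: "0 <= t" "t <= 1"
  shows "(\<integral>x. g (x + t *\<^sub>R axis i 1) \<partial>torus) = (\<integral>x. g x \<partial>torus)"
proof -
  define e where "e = (axis i 1 :: real ^ 'm)"
  have e: "(x + s *\<^sub>R e) $ j = x $ j + (if j = i then s else 0)" for x s j by (simp add: e_def axis_def)
  have e1: "(x - e) $ j = x $ j - (if j = i then 1 else 0)" for x j by (simp add: e_def axis_def)
  have tr: "(\<integral>x. F (x + c) \<partial>lborel) = (\<integral>x. F x \<partial>lborel)" if "F \<in> borel_measurable borel" for F :: "real ^ 'm => 'b" and c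
  proof -
    have "(\<integral>x. F x \<partial>lborel) = (\<integral>x. F x \<partial>distr lborel borel ((+) c))" by (simp only: lborel_distr_plus)
    also have "... = (\<integral>x. F (c + x) \<partial>lborel)" by (rule integral_distr) (use that in auto)
    finally show ?thesis by (simp add: add.commute)
  qed
  have gm [measurable]: "g \<in> borel_measurable borel" using g by (rule borel_measurable_continuous_onI)
  define A where "A = {x \<in> cube. t <= x $ i}"
  define Cc where "Cc = {x \<in> cube. x $ i < t}"
  have mi: "(%x. x $ i) \<in> borel_measurable (borel :: (real ^ 'm) measure)"
    by (intro borel_measurable_continuous_onI continuous_intros)
  have Am [measurable]: "A \<in> sets borel" "Cc \<in> sets borel"
  proof -
    have "A = cube \<inter> {x \<in> space borel. t <= x $ i}" "Cc = cube \<inter> {x \<in> space borel. x $ i < t}" by (auto simp: A_def Cc_def)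
    moreover have "{x \<in> space borel. t <= (x :: real ^ 'm) $ i} \<in> sets borel" "{x \<in> space borel. (x :: real ^ 'm) $ i < t} \<in> sets borel"
      using mi by measurable
    ultimately show "A \<in> sets borel" "Cc \<in> sets borel" by (auto intro!: sets.Int cube_borel)
  qed
  have int: "integrable lborel (%x. indicator S x *\<^sub>R g x)" if "S \<in> sets borel" "S \<subseteq> cbox 0 (\<chi> i. 2)" for S
  proof -
    have "integrable lborel (%x. indicator (cbox 0 (\<chi> i. 2)) x *\<^sub>R g x)"
      by (rule borel_integrable_compact) (auto intro: continuous_on_subset[OF g])
    from integrable_mult_indicator[OF _ this, of S] that(1)
    have "integrable lborel (%x. indicat_real S x *\<^sub>R indicat_real (cbox 0 (\<chi> i. 2)) x *\<^sub>R g x)" by simp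
    moreover have "(%x. indicat_real S x *\<^sub>R indicat_real (cbox 0 (\<chi> i. 2)) x *\<^sub>R g x) = (%x. indicator S x *\<^sub>R g x)"
      using that(2) by (auto simp: indicator_def fun_eq_iff)
    ultimately show ?thesis by simp
  qed
  have A2: "A \<subseteq> cbox 0 (\<chi> i. 2)" "Cc \<subseteq> cbox 0 (\<chi> i. 2)" using cube_subset_cbox2 by (auto simp: A_def Cc_def)
  have B: "{x. x - e \<in> Cc} \<in> sets borel" "{x. x - e \<in> Cc} \<subseteq> cbox 0 (\<chi> i. 2)"
  proof -
    have "(%x. x - e) -` Cc \<inter> space borel \<in> sets borel" by (rule measurable_sets[OF _ Am(2)]) simp
    then show "{x. x - e \<in> Cc} \<in> sets borel" by (simp add: vimage_def)
    show "{x. x - e \<in> Cc} \<subseteq> cbox 0 (\<chi> i. 2)"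
    proof
      fix x assume "x \<in> {x. x - e \<in> Cc}"
      then have "0 <= x $ j - (if j = i then 1 else 0) \<and> x $ j - (if j = i then 1 else 0) < 1" for j
        using e1[of x] by (auto simp: Cc_def cube_def)
      then have "0 <= x $ j \<and> x $ j <= 2" for j by (smt (verit))
      then show "x \<in> cbox 0 (\<chi> i. 2)" by (simp add: mem_box_cart)
    qed
  qed
  have "(\<integral>x. g (x + t *\<^sub>R e) \<partial>torus) = (\<integral>x. indicator cube x *\<^sub>R g (x + t *\<^sub>R e) \<partial>lborel)"
    unfolding torus_eq by (subst integral_restrict_space) auto
  also have "... = (\<integral>x. (%z. indicator cube (z - t *\<^sub>R e) *\<^sub>R g z) (x + t *\<^sub>R e) \<partial>lborel)" by simp
  also have "... = (\<integral>x. indicator cube (x - t *\<^sub>R e) *\<^sub>R g x \<partial>lborel)"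
    by (rule tr) measurable
  also have "... = (\<integral>x. indicator A x *\<^sub>R g x + indicator {x. x - e \<in> Cc} x *\<^sub>R g x \<partial>lborel)"
  proof (intro Bochner_Integration.integral_cong refl)
    fix x
    have ch: "x - t *\<^sub>R e \<in> cube \<longleftrightarrow> (\<forall>j. 0 <= x $ j - (if j = i then t else 0) \<and> x $ j - (if j = i then t else 0) < 1)"
      by (auto simp: cube_def e_def axis_def)
    have "(indicator cube (x - t *\<^sub>R e) :: real) = indicator A x + indicator {x. x - e \<in> Cc} x"
    proof (cases "\<forall>j. j ~= i \<longrightarrow> 0 <= x $ j \<and> x $ j < 1")
      case True
      then have 1: "x - t *\<^sub>R e \<in> cube \<longleftrightarrow> t <= x $ i \<and> x $ i < 1 + t" unfolding ch by (auto split: if_splits)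
      have 2: "x \<in> A \<longleftrightarrow> t <= x $ i \<and> x $ i < 1" using True t by (auto simp: A_def cube_def) (metis order.trans)+
      have 3: "x - e \<in> Cc \<longleftrightarrow> 1 <= x $ i \<and> x $ i < 1 + t" using True t e1[of x]
        by (auto simp: Cc_def cube_def split: if_splits) 
      show ?thesis using 1 2 3 t by (auto simp: indicator_def)
    next
      case False
      then obtain j where j: "j ~= i" "\<not> (0 <= x $ j \<and> x $ j < 1)" by auto
      have "x - e \<notin> Cc"
      proof
        assume "x - e \<in> Cc"
        then have "0 <= (x - e) $ j \<and> (x - e) $ j < 1" unfolding Cc_def cube_def by blast
        then show False using j unfolding e1 by simp
      qed
      moreover have "x - t *\<^sub>R e \<notin> cube" "x \<notin> A"
        using j unfolding ch by (auto simp: A_def cube_def split: if_splits)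
      ultimately have "x - t *\<^sub>R e \<notin> cube" "x \<notin> A" "x - e \<notin> Cc" by auto
      then show ?thesis by simp
    qed
    then show "indicator cube (x - t *\<^sub>R e) *\<^sub>R g x = indicator A x *\<^sub>R g x + indicator {x. x - e \<in> Cc} x *\<^sub>R g x"
      by (simp add: scaleR_add_left)
  qed
  also have "... = (\<integral>x. indicator A x *\<^sub>R g x \<partial>lborel) + (\<integral>x. indicator {x. x - e \<in> Cc} x *\<^sub>R g x \<partial>lborel)"
    by (intro Bochner_Integration.integral_add int Am A2 B)
  also have "(\<integral>x. indicator {x. x - e \<in> Cc} x *\<^sub>R g x \<partial>lborel) = (\<integral>x. indicator {x. x - e \<in> Cc} (x + e) *\<^sub>R g (x + e) \<partial>lborel)"
    by (rule tr[symmetric]) (use B in measurable)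
  also have "... = (\<integral>x. indicator Cc x *\<^sub>R g x \<partial>lborel)"
    using per by (simp add: periodic_def e_def indicator_def)
  also have "(\<integral>x. indicator A x *\<^sub>R g x \<partial>lborel) + ... = (\<integral>x. indicator A x *\<^sub>R g x + indicator Cc x *\<^sub>R g x \<partial>lborel)"
    by (intro Bochner_Integration.integral_add[symmetric] int Am A2)
  also have "... = (\<integral>x. indicator cube x *\<^sub>R g x \<partial>lborel)"
    by (intro Bochner_Integration.integral_cong) (auto simp: A_def Cc_def indicator_def)
  also have "... = (\<integral>x. g x \<partial>torus)"
    unfolding torus_eq by (subst integral_restrict_space) auto
  finally show ?thesis by (simp add: e_def)
qed


section \<open>Fourier analysis on the torus\<close>

definition dfac :: "int ^ 'm => 'm => complex" where
  "dfac k i = 2 * of_real pi * \<i> * of_int (k $ i)"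

definition tfun :: "(int ^ 'm) set => (int ^ 'm => complex) => real ^ 'm => complex" where
  "tfun I w x = (\<Sum>k\<in>I. w k * efun k x)"

definition fc :: "(real ^ 'm => complex) => int ^ 'm => complex" where
  "fc v k = (\<integral>x. v x * cnj (efun k x) \<partial>torus)"

lemma efun_dfac: "efun k x = (\<Prod>j\<in>UNIV. exp (dfac k j * of_real (x $ j)))"
  by (simp add: efun_def dfac_def)

lemma efun_add: "efun (k + l) x = efun k x * efun l x"
  by (simp add: efun_def prod.distrib[symmetric] exp_add[symmetric] algebra_simps)

lemma efun_0 [simp]: "efun 0 x = 1"
  by (simp add: efun_def)

lemma norm_efun [simp]: "norm (efun k x) = 1"
  by (simp add: efun_def prod_norm[symmetric])

lemma cnj_efun: "cnj (efun k x) = efun (- k) x"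
  by (simp add: efun_def exp_cnj)

lemma efun_shift: "efun k (x + t *\<^sub>R axis i 1) = exp (dfac k i * of_real t) * efun k x"
proof -
  have "efun k (x + t *\<^sub>R axis i 1) = (\<Prod>j\<in>UNIV. exp (dfac k j * of_real (x $ j)) * (if j = i then exp (dfac k i * of_real t) else 1))"
    unfolding efun_dfac by (intro prod.cong refl) (simp add: axis_def exp_add[symmetric] algebra_simps)
  also have "... = efun k x * exp (dfac k i * of_real t)"
    unfolding prod.distrib efun_dfac by (simp add: prod.delta)
  finally show ?thesis by simp
qed

lemma exp_dfac_1: "exp (dfac k i) = 1"
proof -
  have "dfac k i = of_int (2 * (k $ i)) * (of_real pi * \<i>)" by (simp add: dfac_def)
  then show ?thesis unfolding exp_eq_1 by (auto simp: intro!: exI[of _ "k $ i"])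
qed

lemma periodic_efun: "periodic (efun k)"
  unfolding periodic_def using efun_shift[of k _ 1] by (simp add: exp_dfac_1)

lemma efun_periodic [simp]: "efun k (x + axis i 1) = efun k x"
  using efun_shift[of k x 1 i] by (simp add: exp_dfac_1)

lemma continuous_efun [continuous_intros]: "continuous_on S (efun k)"
  unfolding efun_def[abs_def] by (intro continuous_intros)

lemma prob_cube [simp]: "measure torus cube = 1"
  using torus.prob_space by simp

lemma integral_efun: "(\<integral>x. efun k x \<partial>torus) = (if k = 0 then 1 else 0)"
proof (cases "k = 0")
  case True
  then show ?thesis by simp
next
  case False
  then obtain i where i: "k $ i ~= 0" by (auto simp: vec_eq_iff)
  define t where "t = 1 / (2 * \<bar>real_of_int (k $ i)\<bar>)"
  have t: "0 <= t" "t <= 1" using i by (auto simp: t_def divide_le_eq) linarith?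
  have e: "exp (dfac k i * of_real t) = -1"
  proof (cases "k $ i > 0")
    case True
    then have "dfac k i * of_real t = of_real pi * \<i>" using i by (simp add: dfac_def t_def)
    then show ?thesis by simp
  next
    case False
    then have "dfac k i * of_real t = - (of_real pi * \<i>)" using i by (simp add: dfac_def t_def)
    then show ?thesis by (simp add: exp_minus)
  qed
  have "(\<integral>x. efun k x \<partial>torus) = (\<integral>x. efun k (x + t *\<^sub>R axis i 1) \<partial>torus)"
    by (rule torus_translate[symmetric]) (use t periodic_efun in \<open>auto intro: continuous_intros\<close>)
  also have "... = - (\<integral>x. efun k x \<partial>torus)" unfolding efun_shift e by simp
  finally show ?thesis using False by simp
qed

lemma efun_orthonormal: "(\<integral>x. efun k x * cnj (efun l x) \<partial>torus) = (if k = l then 1 else 0)"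
  using integral_efun[of "k - l"] by (simp add: cnj_efun efun_add[symmetric])

lemma continuous_tfun [continuous_intros]: "continuous_on S (tfun I w)"
  unfolding tfun_def[abs_def] by (intro continuous_intros)

lemma periodic_tfun: "periodic (tfun I w)"
  by (simp add: periodic_def tfun_def periodic_efun[unfolded periodic_def, rule_format])

lemma l2_bounded:
  assumes "f \<in> borel_measurable torus" "!!x. x \<in> cube ==> norm (f x) <= C"
  shows "l2 torus f"
proof -
  have "integrable torus (%x. (norm (f x))\<^sup>2)"
    by (rule torus.integrable_const_bound[of _ "C\<^sup>2"]) (use assms in \<open>auto intro!: AE_I2 power_mono\<close>)
  then show ?thesis using assms by (simp add: l2_def)
qed

lemma l2_cont:
  fixes f :: "real ^ 'm => 'b :: {banach, second_countable_topology}"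
  assumes "continuous_on UNIV f"
  shows "l2 torus f"
proof -
  obtain C where "\<forall>x\<in>cbox 0 (\<chi> i. 2). norm (f x) <= C" using torus_bounded_cont[OF assms] by auto
  then show ?thesis using cube_subset_cbox2 by (intro l2_bounded[of _ C] torus_measurable_cont assms) auto
qed

lemma l2_tfun: "l2 torus (tfun I w)"
  by (intro l2_cont continuous_intros)

lemma tfun_inner:
  assumes "finite I" "finite J"
  shows "(\<integral>x. tfun I w x * cnj (tfun J v x) \<partial>torus) = (\<Sum>k\<in>I \<inter> J. w k * cnj (v k))"
proof -
  have i: "integrable torus (%x. w k * efun k x * cnj (v l * efun l x))" for k l
    by (intro torus_cont_integrable continuous_intros)
  have "(\<integral>x. tfun I w x * cnj (tfun J v x) \<partial>torus) = (\<integral>x. (\<Sum>k\<in>I. \<Sum>l\<in>J. w k * efun k x * cnj (v l * efun l x)) \<partial>torus)"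
    by (simp add: tfun_def cnj_sum sum_product)
  also have "... = (\<Sum>k\<in>I. \<Sum>l\<in>J. \<integral>x. w k * efun k x * cnj (v l * efun l x) \<partial>torus)"
    using i by (simp add: Bochner_Integration.integral_sum)
  also have "... = (\<Sum>k\<in>I. \<Sum>l\<in>J. w k * cnj (v l) * (\<integral>x. efun k x * cnj (efun l x) \<partial>torus))"
    by (simp add: algebra_simps flip: integral_mult_right_zero)
  also have "... = (\<Sum>k\<in>I. \<Sum>l\<in>J. if l = k then w k * cnj (v k) else 0)"
    by (intro sum.cong refl) (simp add: efun_orthonormal)
  also have "... = (\<Sum>k\<in>I. if k \<in> J then w k * cnj (v k) else 0)"
    using assms by (simp add: sum.delta)
  also have "... = (\<Sum>k\<in>I \<inter> J. w k * cnj (v k))" using assms by (simp add: sum.inter_restrict)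
  finally show ?thesis .
qed

lemma n2_tfun:
  assumes "finite I"
  shows "(n2 torus (tfun I w))\<^sup>2 = (\<Sum>k\<in>I. (norm (w k))\<^sup>2)"
proof -
  have "complex_of_real ((n2 torus (tfun I w))\<^sup>2) = (\<integral>x. of_real ((norm (tfun I w x))\<^sup>2) \<partial>torus)"
    unfolding n2_sq by (rule integral_complex_of_real[symmetric])
  also have "... = (\<integral>x. tfun I w x * cnj (tfun I w x) \<partial>torus)" by (simp only: complex_norm_square)
  also have "... = (\<Sum>k\<in>I. w k * cnj (w k))" using tfun_inner[OF assms assms, of w w] by simp
  also have "... = of_real (\<Sum>k\<in>I. (norm (w k))\<^sup>2)" by (simp only: complex_norm_square of_real_sum)
  finally show ?thesis by (simp only: of_real_eq_iff)
qed

lemma tfun_diff_subset: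
  assumes "finite F" "G \<subseteq> F"
  shows "tfun F w x - tfun G w x = tfun (F - G) w x"
  using sum.subset_diff[OF assms(2,1), of "%k. w k * efun k x"] by (simp add: tfun_def)

lemma fc_tfun: "finite I ==> fc (tfun I w) k = (if k \<in> I then w k else 0)"
  using tfun_inner[of I "{k}" w "%_. 1"] by (auto simp: fc_def tfun_def)

lemma integrable_mult_efun:
  assumes "integrable torus w"
  shows "integrable torus (%x. w x * efun k x)"
proof (rule Bochner_Integration.integrable_bound[OF assms])
  show "(%x. w x * efun k x) \<in> borel_measurable torus"
    using borel_measurable_integrable[OF assms] torus_measurable_cont[OF continuous_efun] by measurable
qed (simp add: norm_mult)

lemma fc_bound: "l2 torus v ==> norm (fc v k) <= n2 torus v"
proof -
  assume v: "l2 torus v"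
  have "norm (fc v k) <= (\<integral>x. norm (v x * cnj (efun k x)) \<partial>torus)" unfolding fc_def by (rule integral_norm_bound)
  also have "... = (\<integral>x. norm (v x) \<partial>torus)" by (simp add: norm_mult)
  also have "... <= n2 torus v" by (rule torus.l2_integrable[OF v])
  finally show ?thesis .
qed

lemma fc_diff:
  assumes "integrable torus v" "integrable torus w"
  shows "fc (%x. v x - w x) k = fc v k - fc w k"
  unfolding fc_def cnj_efun left_diff_distrib
  by (intro Bochner_Integration.integral_diff integrable_mult_efun assms)

subsection \<open>Uniqueness of Fourier coefficients of integrable functions\<close>

inductive_set trigp :: "(real ^ 'm => complex) set" where
  base: "(%x. c * efun k x) \<in> trigp"
| add: "p \<in> trigp ==> q \<in> trigp ==> (%x. p x + q x) \<in> trigp"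

lemma trigp_mult: "p \<in> trigp ==> q \<in> trigp ==> (%x. p x * q x) \<in> trigp"
proof (induction arbitrary: q rule: trigp.induct)
  case (base c k)
  from base.prems show ?case
  proof (induction rule: trigp.induct)
    case (base d l)
    have "(%x. c * efun k x * (d * efun l x)) = (%x. (c * d) * efun (k + l) x)" by (simp add: efun_add mult_ac)
    then show ?case using trigp.base[of "c * d" "k + l"] by simp
  next
    case (add p q)
    from trigp.add[OF add.IH] show ?case by (simp add: algebra_simps)
  qed
next
  case (add p q r)
  from trigp.add[OF add.IH(1)[OF add.prems] add.IH(2)[OF add.prems]] show ?case by (simp add: algebra_simps)
qed

definition tmap :: "real ^ 'm => complex ^ 'm" where
  "tmap x = (\<chi> j. exp (2 * of_real pi * \<i> * of_real (x $ j)))"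

definition tinv :: "complex ^ 'm => real ^ 'm" where
  "tinv z = (\<chi> j. Arg2pi (z $ j) / (2 * pi))"

lemma tinv_tmap: "x \<in> cube ==> tinv (tmap x) = x"
proof -
  assume x: "x \<in> cube"
  have "Arg2pi (exp (2 * of_real pi * \<i> * of_real (x $ j))) = 2 * pi * x $ j" for j
  proof -
    have "2 * pi * x $ j < 2 * pi" "0 <= 2 * pi * x $ j" using x by (auto simp: cube_def)
    then have "Arg2pi (exp (2 * of_real pi * \<i> * of_real (x $ j))) = Im (2 * of_real pi * \<i> * of_real (x $ j))"
      by (intro Arg2pi_exp) auto
    then show ?thesis by simp
  qed
  then show ?thesis by (simp add: tinv_def tmap_def vec_eq_iff)
qed

lemma Arg2pi_measurable: "Arg2pi \<in> borel_measurable borel"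
proof -
  have "(%z. indicator (- \<real>\<^sub>\<ge>\<^sub>0) z *\<^sub>R Arg2pi z) \<in> borel_measurable borel"
    by (rule borel_measurable_continuous_on_indicator)
       (auto intro!: continuous_at_imp_continuous_on continuous_at_Arg2pi simp: borel_closed)
  moreover have "indicator (- \<real>\<^sub>\<ge>\<^sub>0) z *\<^sub>R Arg2pi z = Arg2pi z" for z
  proof (cases "z \<in> \<real>\<^sub>\<ge>\<^sub>0")
    case True
    then have "Arg2pi z = 0" by (auto simp: Arg2pi_eq_0 complex_nonneg_Reals_iff complex_is_Real_iff)
    then show ?thesis by simp
  qed simp
  ultimately show ?thesis by (simp only:)
qed

lemma borel_measurable_vec_lambda:
  fixes f :: "'m :: finite => 'a => 'b :: euclidean_space"
  assumes "!!i. f i \<in> borel_measurable M"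
  shows "(%x. \<chi> i. f i x) \<in> borel_measurable M"
proof (subst borel_measurable_euclidean_space, intro ballI)
  fix b :: "'b ^ 'm" assume "b \<in> Basis"
  then obtain i u where b: "b = axis i u" by (auto simp: Basis_vec_def)
  have "(%x. (\<chi> i. f i x) \<bullet> b) = (%x. f i x \<bullet> u)" by (simp add: b inner_axis)
  then show "(%x. (\<chi> i. f i x) \<bullet> b) \<in> borel_measurable M" using assms[of i] by simp
qed

lemma tinv_measurable: "tinv \<in> borel_measurable borel"
  unfolding tinv_def[abs_def]
proof (rule borel_measurable_vec_lambda)
  fix j :: 'a
  have "(%z :: complex ^ 'a. z $ j) \<in> borel_measurable borel"
    by (intro borel_measurable_continuous_onI continuous_intros)
  from measurable_compose[OF this Arg2pi_measurable]
  show "(%z :: complex ^ 'a. Arg2pi (z $ j) / (2 * pi)) \<in> borel_measurable borel" by measurable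
qed

lemma continuous_tmap: "continuous_on S tmap"
  unfolding tmap_def[abs_def] by (intro continuous_intros)

lemma tmap_nth: "tmap x $ j = efun (axis j 1) x"
proof -
  have "efun (axis j 1) x = (\<Prod>i\<in>UNIV. if i = j then exp (2 * of_real pi * \<i> * of_real (x $ j)) else 1)"
    unfolding efun_def by (intro prod.cong) (auto simp: axis_def)
  then show ?thesis by (simp add: tmap_def prod.delta)
qed

text \<open>Pushed forward to the product of unit circles, a function with vanishing Fourier coefficients
  annihilates all continuous functions by the theorem of Stone and Weierstrass, hence all Borel sets.\<close>

lemma fourier_unique:
  fixes w :: "real ^ 'm => complex"
  assumes w: "integrable torus w" and z: "!!k. (\<integral>x. w x * efun k x \<partial>torus) = 0"
  shows "AE x in torus. w x = 0"
proof -
  define S where "S = tmap ` cbox 0 (\<chi> i. 1 :: real ^ 'm)"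
  define Rg where "Rg = {g :: complex ^ 'm => real. continuous_on S g \<and> (\<exists>p\<in>trigp. \<forall>x. of_real (g (tmap x)) = p x)}"
  have cS: "compact S" unfolding S_def by (intro compact_continuous_image continuous_tmap compact_cbox)
  have tp: "(\<integral>x. w x * p x \<partial>torus) = 0 \<and> integrable torus (%x. w x * p x)" if "p \<in> trigp" for p
    using that
  proof (induction rule: trigp.induct)
    case (base c k)
    have "(%x. w x * (c * efun k x)) = (%x. c * (w x * efun k x))" by (simp add: algebra_simps)
    then show ?case using z[of k] integrable_mult_efun[OF w, of k] by simp
  next
    case (add p q)
    then show ?case by (simp add: distrib_left)
  qed
  have in_S: "tmap x \<in> S" if "x \<in> cube" for x using that cube_subset_cbox by (auto simp: S_def)
  interpret R: function_ring_on Rg S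
  proof
    show "compact S" by (rule cS)
    show "continuous_on S f" if "f \<in> Rg" for f using that by (simp add: Rg_def)
    show "(%x. f x + g x) \<in> Rg" if "f \<in> Rg" "g \<in> Rg" for f g
    proof -
      obtain p q where "p \<in> trigp" "q \<in> trigp" "\<forall>x. of_real (f (tmap x)) = p x" "\<forall>x. of_real (g (tmap x)) = q x"
        using \<open>f \<in> Rg\<close> \<open>g \<in> Rg\<close> by (auto simp: Rg_def)
      with trigp.add[of p q] \<open>f \<in> Rg\<close> \<open>g \<in> Rg\<close> show ?thesis
        by (auto simp: Rg_def intro!: continuous_intros bexI[of _ "%x. p x + q x"])
    qed
    show "(%x. f x * g x) \<in> Rg" if "f \<in> Rg" "g \<in> Rg" for f g
    proof -
      obtain p q where "p \<in> trigp" "q \<in> trigp" "\<forall>x. of_real (f (tmap x)) = p x" "\<forall>x. of_real (g (tmap x)) = q x"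
        using \<open>f \<in> Rg\<close> \<open>g \<in> Rg\<close> by (auto simp: Rg_def)
      with trigp_mult[of p q] \<open>f \<in> Rg\<close> \<open>g \<in> Rg\<close> show ?thesis
        by (auto simp: Rg_def intro!: continuous_intros bexI[of _ "%x. p x * q x"])
    qed
    show "(%_. c) \<in> Rg" for c
      using trigp.base[of "of_real c" 0] by (auto simp: Rg_def intro!: bexI[of _ "%x. of_real c * efun 0 x"])
    have Re_in: "(%z. Re (d * z $ j)) \<in> Rg" for d j
    proof -
      have "(%x. (d / 2) * efun (axis j 1) x + (cnj d / 2) * efun (- axis j 1) x) \<in> trigp"
        by (intro trigp.intros)
      moreover have "of_real (Re (d * tmap x $ j)) = (d / 2) * efun (axis j 1) x + (cnj d / 2) * efun (- axis j 1) x" for x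
      proof -
        have "of_real (Re z) = z / 2 + cnj z / 2" for z by (simp add: complex_eq_iff)
        from this[of "d * tmap x $ j"] show ?thesis unfolding tmap_nth by (simp add: cnj_efun)
      qed
      moreover have "continuous_on S (%z. Re (d * z $ j))" by (intro continuous_intros)
      ultimately show ?thesis unfolding Rg_def by (intro CollectI conjI) (assumption, rule bexI, rule allI)
    qed
    show "\<exists>f\<in>Rg. f x ~= f y" if "x \<in> S" "y \<in> S" "x ~= y" for x y
    proof -
      obtain j where "x $ j ~= y $ j" using \<open>x ~= y\<close> by (auto simp: vec_eq_iff)
      then have "Re (1 * x $ j) ~= Re (1 * y $ j) \<or> Re (- \<i> * x $ j) ~= Re (- \<i> * y $ j)" by (auto simp: complex_eq_iff)
      then show ?thesis using Re_in[of 1 j] Re_in[of "- \<i>" j] by (elim disjE) (intro bexI, assumption, assumption)+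
    qed
  qed
  have tm: "tmap \<in> measurable torus borel" by (rule torus_measurable_cont[OF continuous_tmap])
  have wm: "w \<in> borel_measurable torus" by (rule borel_measurable_integrable[OF w])
  have c0: "(\<integral>x. g (tmap x) *\<^sub>R w x \<partial>torus) = 0" if g: "continuous_on UNIV g" for g :: "complex ^ 'm => real"
  proof -
    have "norm (\<integral>x. g (tmap x) *\<^sub>R w x \<partial>torus) <= e * (\<integral>x. norm (w x) \<partial>torus)" if e: "e > 0" for e
    proof -
      obtain h where h: "h \<in> Rg" "\<forall>x\<in>S. \<bar>g x - h x\<bar> < e"
        using R.Stone_Weierstrass_basic[OF continuous_on_subset[OF g subset_UNIV] e] by auto
      obtain p where p: "p \<in> trigp" "!!x. of_real (h (tmap x)) = p x" using h(1) by (auto simp: Rg_def)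
      have ip: "integrable torus (%x. h (tmap x) *\<^sub>R w x)" "(\<integral>x. h (tmap x) *\<^sub>R w x \<partial>torus) = 0"
        using tp[OF p(1)] by (simp_all add: scaleR_conv_of_real p(2) mult.commute)
      have ig: "integrable torus (%x. g (tmap x) *\<^sub>R w x)"
        by (rule torus_cont_mult_integrable[OF _ w]) (rule continuous_on_compose2[OF g continuous_tmap], simp)
      have "(\<integral>x. g (tmap x) *\<^sub>R w x \<partial>torus) = (\<integral>x. g (tmap x) *\<^sub>R w x - h (tmap x) *\<^sub>R w x \<partial>torus)"
        using ip ig by simp
      also have "norm ... <= (\<integral>x. norm (g (tmap x) *\<^sub>R w x - h (tmap x) *\<^sub>R w x) \<partial>torus)" by (rule integral_norm_bound)
      also have "... <= (\<integral>x. e * norm (w x) \<partial>torus)"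
      proof (rule integral_mono)
        show "norm (g (tmap x) *\<^sub>R w x - h (tmap x) *\<^sub>R w x) <= e * norm (w x)" if "x \<in> space torus" for x
        proof -
          have "\<bar>g (tmap x) - h (tmap x)\<bar> <= e" using h(2) in_S[of x] that by (auto intro: less_imp_le)
          then show ?thesis unfolding scaleR_diff_left[symmetric] norm_scaleR by (rule mult_right_mono) simp
        qed
      qed (use ip ig w in auto)
      finally show ?thesis by simp
    qed
    note * = this
    show ?thesis
    proof (rule ccontr)
      assume "\<not> ?thesis"
      then have pos: "norm (\<integral>x. g (tmap x) *\<^sub>R w x \<partial>torus) > 0" by simp
      let ?W = "\<integral>x. norm (w x) \<partial>torus" let ?N = "norm (\<integral>x. g (tmap x) *\<^sub>R w x \<partial>torus)"
      have W: "?W \<ge> 0" by simp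
      have "?N <= ?N / (2 * (?W + 1)) * ?W" using pos W by (intro * divide_pos_pos mult_pos_pos add_nonneg_pos) auto
      also have "... = ?N * (?W / (2 * (?W + 1)))" by simp
      also have "... < ?N * 1"
      proof (intro mult_strict_left_mono pos)
        have "W / (2 * (W + 1)) < 1" if "W \<ge> 0" for W :: real using that by (simp add: divide_less_eq)
        from this[OF W] show "?W / (2 * (?W + 1)) < 1" .
      qed
      finally show False by simp
    qed
  qed
  have closed0: "(\<integral>x. indicator Cl (tmap x) *\<^sub>R w x \<partial>torus) = 0" if Cl: "closed Cl" for Cl
  proof (cases "Cl = {}")
    case False
    define g where "g n z = max 0 (1 - real n * infdist z Cl)" for n z
    have "(%n. \<integral>x. g n (tmap x) *\<^sub>R w x \<partial>torus) \<longlonglongrightarrow> (\<integral>x. indicator Cl (tmap x) *\<^sub>R w x \<partial>torus)"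
    proof (rule integral_dominated_convergence)
      show "integrable torus (%x. norm (w x))" using w by simp
      show "(%x. indicator Cl (tmap x) *\<^sub>R w x) \<in> borel_measurable torus"
        using measurable_compose[OF tm, of "indicator Cl" borel] Cl wm by (intro borel_measurable_scaleR) (auto simp: borel_closed)
      show "(%x. g n (tmap x) *\<^sub>R w x) \<in> borel_measurable torus" for n
      proof -
        have "g n \<in> borel_measurable borel"
          unfolding g_def by (intro borel_measurable_continuous_onI continuous_intros)
        from measurable_compose[OF tm this] wm show ?thesis by (intro borel_measurable_scaleR)
      qed
      show "AE x in torus. (%n. g n (tmap x) *\<^sub>R w x) \<longlonglongrightarrow> indicator Cl (tmap x) *\<^sub>R w x"
      proof (rule AE_I2, rule tendsto_scaleR[OF _ tendsto_const])
        fix x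
        show "(%n. g n (tmap x)) \<longlonglongrightarrow> indicator Cl (tmap x)"
        proof (cases "tmap x \<in> Cl")
          case True
          then show ?thesis by (simp add: g_def)
        next
          case False
          then have pos: "infdist (tmap x) Cl > 0"
            using in_closed_iff_infdist_zero[OF Cl \<open>Cl ~= {}\<close>, of "tmap x"] infdist_nonneg[of "tmap x" Cl] by simp
          obtain N :: nat where N: "1 / infdist (tmap x) Cl < real N" using reals_Archimedean2 by blast
          have "g n (tmap x) = 0" if "n \<ge> N" for n
          proof -
            have "1 / infdist (tmap x) Cl < real n" using N that by linarith
            then have "1 < real n * infdist (tmap x) Cl" using pos by (simp add: field_simps)
            then show ?thesis by (simp add: g_def)
          qed
          then have "\<forall>\<^sub>F n in sequentially. g n (tmap x) = indicator Cl (tmap x)"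
            using False by (auto intro!: eventually_sequentiallyI[of N])
          then show ?thesis by (rule tendsto_eventually)
        qed
      qed
      show "AE x in torus. norm (g n (tmap x) *\<^sub>R w x) <= norm (w x)" for n
      proof (rule AE_I2)
        fix x
        have "\<bar>g n (tmap x)\<bar> <= 1" using infdist_nonneg[of "tmap x" Cl] by (auto simp: g_def max_def)
        then show "norm (g n (tmap x) *\<^sub>R w x) <= norm (w x)" by (simp add: mult_left_le_one_le)
      qed
    qed
    moreover have "(\<integral>x. g n (tmap x) *\<^sub>R w x \<partial>torus) = 0" for n
      by (rule c0) (auto simp: g_def intro!: continuous_intros)
    ultimately show ?thesis using LIMSEQ_unique[OF _ tendsto_const] by fastforce
  qed simp
  have ii: "integrable torus (%x. indicator B (tmap x) *\<^sub>R w x)" if "B \<in> sets borel" for B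
  proof -
    have "(%x. indicator B (tmap x) *\<^sub>R w x) \<in> borel_measurable torus"
      using measurable_compose[OF tm, of "indicator B" borel] that wm by (intro borel_measurable_scaleR) auto
    from Bochner_Integration.integrable_bound[OF w this] show ?thesis by (auto simp: indicator_def)
  qed
  have borel0: "(\<integral>x. indicator B (tmap x) *\<^sub>R w x \<partial>torus) = 0" if "B \<in> sets borel" for B
  proof -
    have s: "sets (borel :: (complex ^ 'm) measure) = sigma_sets UNIV {C. closed C}"
      by (simp add: borel_eq_closed)
    have "Int_stable {C :: (complex ^ 'm) set. closed C}" "{C :: (complex ^ 'm) set. closed C} \<subseteq> Pow UNIV"
      "B \<in> sigma_sets UNIV {C. closed C}" using that by (auto simp: Int_stable_def s)
    then show ?thesis
    proof (induction rule: sigma_sets_induct_disjoint)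
      case (basic A) then show ?case using closed0 by simp
    next
      case empty show ?case by simp
    next
      case (compl A)
      then have A: "A \<in> sets borel" by (simp add: s)
      have "(\<integral>x. indicator (UNIV - A) (tmap x) *\<^sub>R w x \<partial>torus) = (\<integral>x. w x - indicator A (tmap x) *\<^sub>R w x \<partial>torus)"
        by (intro Bochner_Integration.integral_cong) (auto simp: indicator_def)
      also have "... = 0" using w ii[OF A] compl z[of 0] by simp
      finally show ?case .
    next
      case (union A)
      then have A: "A i \<in> sets borel" for i unfolding s by auto
      have U: "(\<Union>i. A i) \<in> sets borel" using A by blast
      have "(%n. \<integral>x. indicator (\<Union>i<n. A i) (tmap x) *\<^sub>R w x \<partial>torus) \<longlonglongrightarrow> (\<integral>x. indicator (\<Union>i. A i) (tmap x) *\<^sub>R w x \<partial>torus)"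
      proof (rule integral_dominated_convergence)
        show "integrable torus (%x. norm (w x))" using w by simp
        show "(%x. indicator (\<Union>i. A i) (tmap x) *\<^sub>R w x) \<in> borel_measurable torus"
          by (rule borel_measurable_integrable[OF ii[OF U]])
        show "(%x. indicator (\<Union>i<n. A i) (tmap x) *\<^sub>R w x) \<in> borel_measurable torus" for n
          by (rule borel_measurable_integrable[OF ii]) (use A in auto)
        show "AE x in torus. (%n. indicator (\<Union>i<n. A i) (tmap x) *\<^sub>R w x) \<longlonglongrightarrow> indicator (\<Union>i. A i) (tmap x) *\<^sub>R w x"
          by (intro AE_I2 tendsto_scaleR tendsto_const LIMSEQ_indicator_UN)
        show "AE x in torus. norm (indicator (\<Union>i<n. A i) (tmap x) *\<^sub>R w x) <= norm (w x)" for n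
          by (intro AE_I2) (auto simp: indicator_def)
      qed
      moreover have "(\<integral>x. indicator (\<Union>i<n. A i) (tmap x) *\<^sub>R w x \<partial>torus) = 0" for n
      proof -
        have "(\<integral>x. indicator (\<Union>i<n. A i) (tmap x) *\<^sub>R w x \<partial>torus) = (\<integral>x. (\<Sum>i<n. indicator (A i) (tmap x) *\<^sub>R w x) \<partial>torus)"
        proof (intro Bochner_Integration.integral_cong refl)
          fix x
          have "(indicator (\<Union>i<n. A i) (tmap x) :: real) = (\<Sum>i<n. indicator (A i) (tmap x))"
            by (rule indicator_UN_disjoint) (use union in \<open>auto simp: disjoint_family_on_def\<close>)
          then show "indicator (\<Union>i<n. A i) (tmap x) *\<^sub>R w x = (\<Sum>i<n. indicator (A i) (tmap x) *\<^sub>R w x)"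
            by (simp add: scaleR_sum_left)
        qed
        also have "... = 0" using union ii A by (subst Bochner_Integration.integral_sum) auto
        finally show ?thesis .
      qed
      ultimately show ?case using LIMSEQ_unique[OF _ tendsto_const] by fastforce
    qed
  qed
  show ?thesis
  proof (rule torus.density_zero[OF w])
    fix A :: "(real ^ 'm) set" assume A: "A \<in> sets torus"
    then have A': "A \<in> sets borel" "A \<subseteq> cube"
      by (auto simp: torus_eq sets_restrict_space)
    have B: "tinv -` A \<in> sets borel" using measurable_sets[OF tinv_measurable A'(1)] by simp
    have "set_lebesgue_integral torus A w = (\<integral>x. indicator (tinv -` A) (tmap x) *\<^sub>R w x \<partial>torus)"
      unfolding set_lebesgue_integral_def
      by (intro Bochner_Integration.integral_cong) (auto simp: indicator_def tinv_tmap)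
    then show "set_lebesgue_integral torus A w = 0" using borel0[OF B] by simp
  qed
qed


section \<open>Weak derivatives\<close>

lemma smooth_line_deriv:
  assumes "smooth_derivs \<phi> D"
  shows "((%t. D \<alpha> (x + t *\<^sub>R axis i 1)) has_real_derivative D (i # \<alpha>) (x + s *\<^sub>R axis i 1)) (at s)"
proof -
  have "((%t. D \<alpha> ((x + s *\<^sub>R axis i 1) + t *\<^sub>R axis i 1)) has_real_derivative D (i # \<alpha>) (x + s *\<^sub>R axis i 1)) (at 0)"
    using assms unfolding smooth_derivs_def by blast
  then have "((%t. D \<alpha> (x + (t + s) *\<^sub>R axis i 1)) has_real_derivative D (i # \<alpha>) (x + s *\<^sub>R axis i 1)) (at 0)"
    by (simp add: algebra_simps)
  then show ?thesis using DERIV_shift[of "%t. D \<alpha> (x + t *\<^sub>R axis i 1)" "D (i # \<alpha>) (x + s *\<^sub>R axis i 1)" 0 s] by simp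
qed

lemma smooth_cont: "smooth_derivs \<phi> D ==> continuous_on S (D \<alpha>)"
  unfolding smooth_derivs_def using continuous_on_subset by blast

lemma smooth_base: "smooth_derivs \<phi> D ==> D [] = \<phi>"
  by (simp add: smooth_derivs_def)

lemma smooth_cont_base: "smooth_derivs \<phi> D ==> continuous_on S \<phi>"
  using smooth_cont[of \<phi> D S "[]"] smooth_base by metis

text \<open>Integration by parts against an exponential: differentiate the translation invariance of the
  integral of the product at zero.\<close>

lemma efun_by_parts:
  fixes \<phi> :: "real ^ 'm => real"
  assumes per: "periodic \<phi>" and D: "smooth_derivs \<phi> D"
  shows "(\<integral>x. D [i] x *\<^sub>R efun k x \<partial>torus) = - (\<integral>x. \<phi> x *\<^sub>R (dfac k i * efun k x) \<partial>torus)"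
proof -
  let ?e = "axis i 1 :: real ^ 'm"
  define t where "t n = 1 / real (Suc n)" for n
  have t: "0 < t n" "t n <= 1" for n by (auto simp: t_def)
  have t0: "t \<longlonglongrightarrow> 0" unfolding t_def using LIMSEQ_inverse_real_of_nat by (simp add: inverse_eq_divide)
  have \<phi>0: "D [] = \<phi>" using smooth_base[OF D] .
  have c\<phi>: "continuous_on S \<phi>" for S by (rule smooth_cont_base[OF D])
  have cs: "continuous_on S (%x. \<phi> (x + s *\<^sub>R ?e))" for S s
    by (rule continuous_on_compose2[OF c\<phi>[of UNIV]]) (auto intro: continuous_intros)
  obtain C where C: "C \<ge> 0" "\<forall>x\<in>cbox 0 (\<chi> i. 2). norm (D [i] x) <= C"
    using torus_bounded_cont[OF smooth_cont[OF D]] by blast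
  let ?I = "\<integral>x. \<phi> x *\<^sub>R efun k x \<partial>torus"
  have shift: "(\<integral>x. \<phi> (x + s *\<^sub>R ?e) *\<^sub>R efun k x \<partial>torus) = exp (- (dfac k i * of_real s)) * ?I" if "0 <= s" "s <= 1" for s
  proof -
    have "?I = (\<integral>x. \<phi> (x + s *\<^sub>R ?e) *\<^sub>R efun k (x + s *\<^sub>R ?e) \<partial>torus)"
      by (rule torus_translate[symmetric])
         (use that per in \<open>auto simp: periodic_def intro!: continuous_intros c\<phi>\<close>)
    also have "... = (\<integral>x. exp (dfac k i * of_real s) * (\<phi> (x + s *\<^sub>R ?e) *\<^sub>R efun k x) \<partial>torus)"
      unfolding efun_shift by simp
    also have "... = exp (dfac k i * of_real s) * (\<integral>x. \<phi> (x + s *\<^sub>R ?e) *\<^sub>R efun k x \<partial>torus)"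
      by (rule integral_mult_right_zero)
    finally show ?thesis by (simp add: exp_minus field_simps)
  qed
  have "(%n. \<integral>x. ((\<phi> (x + t n *\<^sub>R ?e) - \<phi> x) / t n) *\<^sub>R efun k x \<partial>torus) \<longlonglongrightarrow> (\<integral>x. D [i] x *\<^sub>R efun k x \<partial>torus)"
  proof (rule integral_dominated_convergence)
    show "(%x. D [i] x *\<^sub>R efun k x) \<in> borel_measurable torus"
      by (intro torus_measurable_cont continuous_intros smooth_cont[OF D])
    show "(%x. ((\<phi> (x + t n *\<^sub>R ?e) - \<phi> x) / t n) *\<^sub>R efun k x) \<in> borel_measurable torus" for n
      using t[of n] by (intro torus_measurable_cont continuous_intros cs c\<phi>) auto
    show "integrable torus (%x :: real ^ 'm. C)" by simp
    show "AE x in torus. (%n. ((\<phi> (x + t n *\<^sub>R ?e) - \<phi> x) / t n) *\<^sub>R efun k x) \<longlonglongrightarrow> D [i] x *\<^sub>R efun k x"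
    proof (rule AE_I2, rule tendsto_scaleR[OF _ tendsto_const])
      fix x
      have "((%s. \<phi> (x + s *\<^sub>R ?e)) has_real_derivative D [i] x) (at 0)"
        using smooth_line_deriv[OF D, of "[]" x i 0] by (simp add: \<phi>0)
      then have "((%s. (\<phi> (x + s *\<^sub>R ?e) - \<phi> x) / s) \<longlongrightarrow> D [i] x) (at 0)"
        by (simp add: DERIV_def)
      moreover have "filterlim t (at 0) sequentially"
        using t0 t by (intro filterlim_atI) (auto simp: less_imp_neq[symmetric])
      ultimately show "(%n. (\<phi> (x + t n *\<^sub>R ?e) - \<phi> x) / t n) \<longlonglongrightarrow> D [i] x"
        by (rule filterlim_compose)
    qed
    show "AE x in torus. norm (((\<phi> (x + t n *\<^sub>R ?e) - \<phi> x) / t n) *\<^sub>R efun k x) <= C" for n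
    proof (rule AE_I2)
      fix x :: "real ^ 'm" assume "x \<in> space torus"
      then have x: "x \<in> cube" by simp
      obtain z where z: "0 < z" "z < t n" "\<phi> (x + t n *\<^sub>R ?e) - \<phi> (x + 0 *\<^sub>R ?e) = (t n - 0) * D [i] (x + z *\<^sub>R ?e)"
        using MVT2[of 0 "t n" "%s. \<phi> (x + s *\<^sub>R ?e)" "%s. D [i] (x + s *\<^sub>R ?e)"] t[of n]
          smooth_line_deriv[OF D, of "[]" x i] by (auto simp: \<phi>0)
      have "0 <= (x + z *\<^sub>R ?e) $ j \<and> (x + z *\<^sub>R ?e) $ j <= 2" for j
      proof -
        have "0 <= x $ j" "x $ j < 1" using x by (auto simp: cube_def)
        then show ?thesis using z(1,2) t[of n] by (cases "j = i") (auto simp: axis_def)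
      qed
      then have "x + z *\<^sub>R ?e \<in> cbox 0 (\<chi> i. 2)" by (simp add: mem_box_cart)
      then show "norm (((\<phi> (x + t n *\<^sub>R ?e) - \<phi> x) / t n) *\<^sub>R efun k x) <= C"
        using C(2) z(3) t[of n] by simp
    qed
  qed
  moreover have "(\<integral>x. ((\<phi> (x + t n *\<^sub>R ?e) - \<phi> x) / t n) *\<^sub>R efun k x \<partial>torus) =
      ((exp (- (dfac k i * of_real (t n))) - 1) / of_real (t n)) * ?I" for n
  proof -
    have "(\<integral>x. ((\<phi> (x + t n *\<^sub>R ?e) - \<phi> x) / t n) *\<^sub>R efun k x \<partial>torus) =
        (\<integral>x. (1 / t n) *\<^sub>R (\<phi> (x + t n *\<^sub>R ?e) *\<^sub>R efun k x - \<phi> x *\<^sub>R efun k x) \<partial>torus)"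
      by (intro Bochner_Integration.integral_cong) (auto simp: algebra_simps diff_divide_distrib)
    also have "... = (1 / t n) *\<^sub>R ((\<integral>x. \<phi> (x + t n *\<^sub>R ?e) *\<^sub>R efun k x \<partial>torus) - ?I)"
    proof -
      have "integrable torus (%x. \<phi> (x + t n *\<^sub>R ?e) *\<^sub>R efun k x)" "integrable torus (%x. \<phi> x *\<^sub>R efun k x)"
        by (intro torus_cont_integrable continuous_intros cs c\<phi>)+
      then show ?thesis by simp
    qed
    also have "... = ((exp (- (dfac k i * of_real (t n))) - 1) / of_real (t n)) * ?I"
      unfolding shift[OF less_imp_le[OF t(1)] t(2)] using t[of n]
      by (simp add: scaleR_conv_of_real[of "1 / t n"] field_simps)
    finally show ?thesis .
  qed
  moreover have "(%n. ((exp (- (dfac k i * of_real (t n))) - 1) / of_real (t n)) * ?I) \<longlonglongrightarrow> - dfac k i * ?I"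
  proof (rule tendsto_mult[OF _ tendsto_const])
    have "((%z. exp (- (dfac k i * z))) has_field_derivative - dfac k i) (at 0)"
      by (auto intro!: derivative_eq_intros)
    then have "((%z. (exp (- (dfac k i * z)) - 1) / z) \<longlongrightarrow> - dfac k i) (at 0)"
      by (simp add: DERIV_def)
    moreover have "filterlim (%n. complex_of_real (t n)) (at 0) sequentially"
      using tendsto_of_real[OF t0] t by (intro filterlim_atI) (auto simp: less_imp_neq[symmetric])
    ultimately show "(%n. (exp (- (dfac k i * of_real (t n))) - 1) / of_real (t n)) \<longlonglongrightarrow> - dfac k i"
      by (rule filterlim_compose)
  qed
  ultimately have "(\<integral>x. D [i] x *\<^sub>R efun k x \<partial>torus) = - dfac k i * ?I"
    by (simp only:) (rule LIMSEQ_unique)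
  also have "... = - (\<integral>x. \<phi> x *\<^sub>R (dfac k i * efun k x) \<partial>torus)"
    unfolding mult_scaleR_right[symmetric] integral_mult_right_zero by simp
  finally show ?thesis .
qed

lemma smooth_efun: "smooth_derivs (%x. Re (c * efun k x)) (%\<alpha> x. Re (c * prod_list (map (dfac k) \<alpha>) * efun k x))"
  unfolding smooth_derivs_def
proof (intro conjI allI)
  show "(%x. Re (c * prod_list (map (dfac k) []) * efun k x)) = (%x. Re (c * efun k x))" by simp
  show "continuous_on UNIV (%x. Re (c * prod_list (map (dfac k) \<alpha>) * efun k x))" for \<alpha>
    by (intro continuous_intros)
  fix \<alpha> i x
  let ?p = "c * prod_list (map (dfac k) \<alpha>)"
  have "((%t. ?p * (exp (dfac k i * of_real t) * efun k x)) has_vector_derivative ?p * (dfac k i * efun k x)) (at 0)"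
    by (rule has_vector_derivative_real_field) (auto intro!: derivative_eq_intros)
  then have "((%t. Re (?p * (exp (dfac k i * of_real t) * efun k x))) has_real_derivative Re (?p * (dfac k i * efun k x))) (at 0)"
    unfolding has_real_derivative_iff_has_vector_derivative
    by (rule bounded_linear.has_vector_derivative[OF bounded_linear_Re])
  then show "((%t. Re (?p * efun k (x + t *\<^sub>R axis i 1))) has_real_derivative
      Re (c * prod_list (map (dfac k) (i # \<alpha>)) * efun k x)) (at 0)"
    unfolding efun_shift by (simp add: mult_ac)
qed

lemma periodic_Re_efun: "periodic (%x. Re (c * efun k x))"
  by (simp add: periodic_def periodic_efun[unfolded periodic_def, rule_format])

text \<open>Real and imaginary parts of the exponentials are admissible test functions.\<close>

lemma weak_partial_fourier:
  fixes v w :: "real ^ 'm => complex"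
  assumes w: "weak_partial i v w" and iv: "integrable torus v" and iw: "integrable torus w"
  shows "(\<integral>x. w x * efun k x \<partial>torus) = - dfac k i * (\<integral>x. v x * efun k x \<partial>torus)"
proof -
  have re: "(\<integral>x. Re (c * dfac k i * efun k x) *\<^sub>R v x \<partial>torus) = - (\<integral>x. Re (c * efun k x) *\<^sub>R w x \<partial>torus)" for c
    using w[unfolded weak_partial_def, rule_format, OF conjI[OF periodic_Re_efun smooth_efun[of c k]]] by simp
  have split: "(\<integral>x. g x * (z * efun k x) \<partial>torus) =
      (\<integral>x. Re (z * efun k x) *\<^sub>R g x \<partial>torus) + \<i> * (\<integral>x. Re (- \<i> * z * efun k x) *\<^sub>R g x \<partial>torus)"
    if g: "integrable torus g" for z g
  proof -
    define p where "p x = Re (z * efun k x) *\<^sub>R g x" for x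
    define q where "q x = Re (- \<i> * z * efun k x) *\<^sub>R g x" for x
    have i: "integrable torus p" "integrable torus q"
      unfolding p_def q_def by (intro torus_cont_mult_integrable continuous_intros g)+
    have "(\<integral>x. g x * (z * efun k x) \<partial>torus) = (\<integral>x. p x + \<i> * q x \<partial>torus)"
    proof (intro Bochner_Integration.integral_cong refl)
      fix x
      have "c * y = of_real (Re y) * c + \<i> * (of_real (Re (- \<i> * y)) * c)" for c y
        by (simp add: complex_eq_iff)
      from this[of "g x" "z * efun k x"]
      show "g x * (z * efun k x) = p x + \<i> * q x"
        by (simp add: p_def q_def scaleR_conv_of_real mult.assoc)
    qed
    also have "... = (\<integral>x. p x \<partial>torus) + \<i> * (\<integral>x. q x \<partial>torus)" using i by simp
    finally show ?thesis by (simp only: p_def q_def)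
  qed
  have "(\<integral>x. w x * efun k x \<partial>torus) = (\<integral>x. w x * (1 * efun k x) \<partial>torus)" by simp
  also have "... = - (\<integral>x. v x * (dfac k i * efun k x) \<partial>torus)"
    unfolding split[OF iw] split[OF iv] using re[of 1] re[of "- \<i>"] by simp
  also have "(\<integral>x. v x * (dfac k i * efun k x) \<partial>torus) = dfac k i * (\<integral>x. v x * efun k x \<partial>torus)"
    by (simp add: algebra_simps flip: integral_mult_right_zero)
  finally show ?thesis by simp
qed

text \<open>Two weak derivatives have the same Fourier coefficients.\<close>

lemma weak_partial_unique:
  fixes v w w' :: "real ^ 'm => complex"
  assumes "weak_partial i v w" "weak_partial i v w'" and i: "integrable torus v" "integrable torus w" "integrable torus w'"
  shows "AE x in torus. w x = w' x"
proof -
  have "AE x in torus. w x - w' x = 0"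
  proof (rule fourier_unique)
    show "integrable torus (%x. w x - w' x)" using i by simp
    fix k
    have "(\<integral>x. (w x - w' x) * efun k x \<partial>torus) = (\<integral>x. w x * efun k x \<partial>torus) - (\<integral>x. w' x * efun k x \<partial>torus)"
      unfolding left_diff_distrib by (intro Bochner_Integration.integral_diff integrable_mult_efun i)
    then show "(\<integral>x. (w x - w' x) * efun k x \<partial>torus) = 0"
      using weak_partial_fourier[OF assms(1) i(1,2)] weak_partial_fourier[OF assms(2) i(1,3)] by simp
  qed
  then show ?thesis by eventually_elim simp
qed

lemma weak_partial_of_real:
  fixes v w :: "real ^ 'm => real"
  assumes "weak_partial i v w"
  shows "weak_partial i (%x. complex_of_real (v x)) (%x. complex_of_real (w x))"
  unfolding weak_partial_def
proof (intro allI impI)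
  fix \<phi> :: "real ^ 'm => real" and D :: "'m list => real ^ 'm => real"
  assume "periodic \<phi> \<and> smooth_derivs \<phi> D"
  then have "(\<integral>x. D [i] x * v x \<partial>torus) = - (\<integral>x. \<phi> x * w x \<partial>torus)"
    using assms unfolding weak_partial_def real_scaleR_def by blast
  then have "complex_of_real (\<integral>x. D [i] x * v x \<partial>torus) = complex_of_real (- (\<integral>x. \<phi> x * w x \<partial>torus))" by (simp only:)
  then have "(\<integral>x. complex_of_real (D [i] x * v x) \<partial>torus) = - (\<integral>x. complex_of_real (\<phi> x * w x) \<partial>torus)"
    unfolding integral_complex_of_real of_real_minus .
  then show "(\<integral>x. D [i] x *\<^sub>R complex_of_real (v x) \<partial>torus) = - (\<integral>x. \<phi> x *\<^sub>R complex_of_real (w x) \<partial>torus)"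
    by (simp add: scaleR_conv_of_real)
qed

lemma weak_partial_unique_real:
  fixes v w w' :: "real ^ 'm => real"
  assumes "weak_partial i v w" "weak_partial i v w'" "integrable torus v" "integrable torus w" "integrable torus w'"
  shows "AE x in torus. w x = w' x"
proof -
  have "AE x in torus. complex_of_real (w x) = complex_of_real (w' x)"
    by (rule weak_partial_unique[OF weak_partial_of_real[OF assms(1)] weak_partial_of_real[OF assms(2)]])
       (use assms in auto)
  then show ?thesis by eventually_elim simp
qed

lemma weak_partial_add:
  fixes v w v' w' :: "real ^ 'm => 'b :: {banach, second_countable_topology}"
  assumes "weak_partial i v w" "weak_partial i v' w'"
    and i: "integrable torus v" "integrable torus w" "integrable torus v'" "integrable torus w'"
  shows "weak_partial i (%x. v x + v' x) (%x. w x + w' x)"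
  unfolding weak_partial_def
proof (intro allI impI)
  fix \<phi> :: "real ^ 'm => real" and D :: "'m list => real ^ 'm => real"
  assume a: "periodic \<phi> \<and> smooth_derivs \<phi> D"
  then have c: "continuous_on UNIV (D [i])" "continuous_on UNIV \<phi>" by (auto intro: smooth_cont smooth_cont_base)
  have "(\<integral>x. D [i] x *\<^sub>R (v x + v' x) \<partial>torus) = (\<integral>x. D [i] x *\<^sub>R v x \<partial>torus) + (\<integral>x. D [i] x *\<^sub>R v' x \<partial>torus)"
    unfolding scaleR_add_right by (intro Bochner_Integration.integral_add torus_cont_mult_integrable c i)
  also have "... = - (\<integral>x. \<phi> x *\<^sub>R w x \<partial>torus) + - (\<integral>x. \<phi> x *\<^sub>R w' x \<partial>torus)"
    using assms(1)[unfolded weak_partial_def, rule_format, OF a] assms(2)[unfolded weak_partial_def, rule_format, OF a] by simp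
  also have "... = - (\<integral>x. \<phi> x *\<^sub>R (w x + w' x) \<partial>torus)"
    unfolding scaleR_add_right by (subst Bochner_Integration.integral_add) (auto intro: torus_cont_mult_integrable c i)
  finally show "(\<integral>x. D [i] x *\<^sub>R (v x + v' x) \<partial>torus) = - (\<integral>x. \<phi> x *\<^sub>R (w x + w' x) \<partial>torus)" .
qed

lemma weak_partial_scale:
  fixes v w :: "real ^ 'm => 'b :: {banach, second_countable_topology, real_normed_field}"
  assumes "weak_partial i v w"
  shows "weak_partial i (%x. c * v x) (%x. c * w x)"
  using assms unfolding weak_partial_def mult_scaleR_right[symmetric] integral_mult_right_zero by simp

lemma weak_partial_cnj: "weak_partial i v w ==> weak_partial i (%x. cnj (v x)) (%x. cnj (w x))"
proof -
  assume w: "weak_partial i v w"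
  have c: "(\<integral>x. r x *\<^sub>R cnj (g x) \<partial>torus) = cnj (\<integral>x. r x *\<^sub>R g x \<partial>torus)" for r :: "real ^ 'a => real" and g
    using Bochner_Integration.integral_cnj[of torus "%x. r x *\<^sub>R g x"] by (simp add: scaleR_conv_of_real)
  show ?thesis using w unfolding weak_partial_def c by simp
qed

text \<open>Term by term, from integration by parts against an exponential.\<close>

lemma weak_partial_tfun: "finite I ==> weak_partial i (tfun I w) (tfun I (%k. dfac k i * w k))"
  unfolding weak_partial_def
proof (intro allI impI)
  fix \<phi> :: "real ^ 'a => real" and D :: "'a list => real ^ 'a => real"
  assume I: "finite I" and a: "periodic \<phi> \<and> smooth_derivs \<phi> D"
  have e: "(\<integral>x. r x *\<^sub>R tfun I u x \<partial>torus) = (\<Sum>k\<in>I. u k * (\<integral>x. r x *\<^sub>R efun k x \<partial>torus))"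
    if "continuous_on UNIV r" for r :: "real ^ 'a => real" and u
  proof -
    have "(\<integral>x. r x *\<^sub>R tfun I u x \<partial>torus) = (\<integral>x. (\<Sum>k\<in>I. u k * (r x *\<^sub>R efun k x)) \<partial>torus)"
      by (simp add: tfun_def scaleR_sum_right)
    also have "... = (\<Sum>k\<in>I. \<integral>x. u k * (r x *\<^sub>R efun k x) \<partial>torus)"
      using that by (intro Bochner_Integration.integral_sum integrable_mult_right torus_cont_integrable continuous_intros)
    also have "... = (\<Sum>k\<in>I. u k * (\<integral>x. r x *\<^sub>R efun k x \<partial>torus))" by (simp only: integral_mult_right_zero)
    finally show ?thesis .
  qed
  have "(\<integral>x. D [i] x *\<^sub>R tfun I w x \<partial>torus) = (\<Sum>k\<in>I. w k * - (\<integral>x. \<phi> x *\<^sub>R (dfac k i * efun k x) \<partial>torus))"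
    using a efun_by_parts[of \<phi> D i] by (subst e) (auto intro: smooth_cont)
  also have "... = - (\<Sum>k\<in>I. (dfac k i * w k) * (\<integral>x. \<phi> x *\<^sub>R efun k x \<partial>torus))"
    unfolding mult_scaleR_right[symmetric] integral_mult_right_zero by (simp add: sum_negf mult_ac)
  also have "... = - (\<integral>x. \<phi> x *\<^sub>R tfun I (%k. dfac k i * w k) x \<partial>torus)"
    using a by (subst e) (auto intro: smooth_cont_base)
  finally show "(\<integral>x. D [i] x *\<^sub>R tfun I w x \<partial>torus) = - (\<integral>x. \<phi> x *\<^sub>R tfun I (%k. dfac k i * w k) x \<partial>torus)" .
qed

lemma wpartial_works:
  assumes "periodic w" "integrable torus w" "weak_partial i v w"
  shows "periodic (wpartial i v) \<and> integrable torus (wpartial i v) \<and> weak_partial i v (wpartial i v)"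
  unfolding wpartial_def by (rule someI[of _ w]) (use assms in simp)

lemma wpartial_AE:
  fixes v w :: "real ^ 'm => complex"
  assumes "periodic w" "integrable torus w" "weak_partial i v w" "integrable torus v"
  shows "AE x in torus. wpartial i v x = w x"
  using wpartial_works[OF assms(1-3)] assms by (intro weak_partial_unique[of i v]) auto

lemma wpartial_AE_real:
  fixes v w :: "real ^ 'm => real"
  assumes "periodic w" "integrable torus w" "weak_partial i v w" "integrable torus v"
  shows "AE x in torus. wpartial i v x = w x"
  using wpartial_works[OF assms(1-3)] assms by (intro weak_partial_unique_real[of i v]) auto


section \<open>The space V\<close>

lemma L2_norm_n2: "L2_norm v = n2 torus v"
  by (simp add: L2_norm_def n2_def)

lemma L2_torus_l2: "v \<in> L2_torus \<longleftrightarrow> periodic v \<and> l2 torus v"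
  by (simp add: L2_torus_def l2_def)

lemma l2_cmult:
  fixes f :: "'x => complex"
  assumes "l2 M f"
  shows "l2 M (%x. c * f x)" "n2 M (%x. c * f x) = norm c * n2 M f"
  using assms by (auto simp: l2_def n2_def norm_mult power_mult_distrib real_sqrt_mult intro!: borel_measurable_times)

lemma eventually_superset:
  assumes "finite X" "X \<subseteq> A"
  shows "eventually (%F. finite F \<and> X \<subseteq> F \<and> F \<subseteq> A) (finite_subsets_at_top A)"
  unfolding eventually_finite_subsets_at_top using assms by (intro exI[of _ X]) simp

lemma tfun_cong: "(!!k. k \<in> I ==> w k = w' k) ==> tfun I w = tfun I w'"
  by (auto simp: tfun_def fun_eq_iff)

text \<open>The theorem of Riesz and Fischer, with a periodic representative.\<close>

lemma riesz_fischer: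
  fixes d :: "int ^ 'm => complex"
  assumes "(%k. (norm (d k))\<^sup>2) summable_on A"
  shows "\<exists>g. periodic g \<and> l2 torus g \<and> ((%F. n2 torus (%x. g x - tfun F d x)) \<longlongrightarrow> 0) (finite_subsets_at_top A)"
proof -
  define S where "S = (\<Sum>\<^sub>\<infinity>k\<in>A. (norm (d k))\<^sup>2)"
  have lim: "((%F. \<Sum>k\<in>F. (norm (d k))\<^sup>2) \<longlongrightarrow> S) (finite_subsets_at_top A)"
    using has_sum_infsum[OF assms] by (simp add: has_sum_def S_def)
  have le: "(\<Sum>k\<in>F. (norm (d k))\<^sup>2) <= S" if "finite F" "F \<subseteq> A" for F
    unfolding S_def using that assms by (intro finite_sum_le_infsum) auto
  have "\<exists>H. finite H \<and> H \<subseteq> A \<and> S - ((1/2) ^ n)\<^sup>2 < (\<Sum>k\<in>H. (norm (d k))\<^sup>2)" for n :: nat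
  proof -
    have "\<forall>\<^sub>F F in finite_subsets_at_top A. S - ((1/2) ^ n)\<^sup>2 < (\<Sum>k\<in>F. (norm (d k))\<^sup>2)"
      by (rule order_tendstoD(1)[OF lim]) simp
    then show ?thesis by (auto simp: eventually_finite_subsets_at_top)
  qed
  then have "\<exists>H. \<forall>n::nat. finite (H n) \<and> H n \<subseteq> A \<and> S - ((1/2) ^ n)\<^sup>2 < (\<Sum>k\<in>H n. (norm (d k))\<^sup>2)"
    by (intro choice allI)
  then obtain H where "\<forall>n::nat. finite (H n) \<and> H n \<subseteq> A \<and> S - ((1/2) ^ n)\<^sup>2 < (\<Sum>k\<in>H n. (norm (d k))\<^sup>2)" ..
  then have H: "!!n::nat. finite (H n) \<and> H n \<subseteq> A \<and> S - ((1/2) ^ n)\<^sup>2 < (\<Sum>k\<in>H n. (norm (d k))\<^sup>2)" ..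
  define F where "F n = (\<Union>i\<le>n. H i)" for n
  have F: "finite (F n)" "F n \<subseteq> A" for n using H by (auto simp: F_def)
  have mono: "F n \<subseteq> F (Suc n)" for n unfolding F_def by (rule UN_mono) auto
  have tail: "n2 torus (%x. tfun G d x - tfun (F n) d x) <= (1/2) ^ n" if G: "finite G" "F n \<subseteq> G" "G \<subseteq> A" for G n
  proof -
    have "(n2 torus (%x. tfun G d x - tfun (F n) d x))\<^sup>2 = (\<Sum>k\<in>G - F n. (norm (d k))\<^sup>2)"
      unfolding tfun_diff_subset[OF G(1,2)] using n2_tfun[of "G - F n" d] G by simp
    also have "... = (\<Sum>k\<in>G. (norm (d k))\<^sup>2) - (\<Sum>k\<in>F n. (norm (d k))\<^sup>2)"
      by (rule sum_diff[OF G(1,2)])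
    also have "... <= S - (\<Sum>k\<in>H n. (norm (d k))\<^sup>2)"
      using le[OF G(1,3)] F(1)[of n] by (intro diff_mono sum_mono2) (auto simp: F_def)
    also have "... <= ((1/2) ^ n)\<^sup>2" using H[of n] by simp
    finally show ?thesis by (rule power2_le_imp_le) simp
  qed
  define g where "g x = lim (%n. tfun (F n) d x)" for x
  have d1: "n2 torus (%x. tfun (F (Suc n)) d x - tfun (F n) d x) <= (1/2) ^ n" for n
    by (rule tail[OF F(1) mono F(2)])
  note comp = torus.l2_complete[of "%n. tfun (F n) d", OF l2_tfun d1, folded g_def]
  have "periodic g" unfolding periodic_def g_def by (simp add: tfun_def)
  moreover have "((%G. n2 torus (%x. g x - tfun G d x)) \<longlongrightarrow> 0) (finite_subsets_at_top A)"
  proof (rule tendstoI)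
    fix e :: real assume "e > 0"
    have "(%n. 3 * (1/2) ^ n :: real) \<longlonglongrightarrow> 3 * 0" by (intro tendsto_intros LIMSEQ_power_zero) simp
    then have "\<forall>\<^sub>F n in sequentially. 3 * (1/2) ^ n < e" using \<open>e > 0\<close> by (intro order_tendstoD(2)) auto
    then obtain n where n: "3 * (1/2) ^ n < e" by (auto simp: eventually_sequentially)
    have "\<forall>\<^sub>F G in finite_subsets_at_top A. finite G \<and> F n \<subseteq> G \<and> G \<subseteq> A"
      by (rule eventually_superset[OF F])
    then show "\<forall>\<^sub>F G in finite_subsets_at_top A. dist (n2 torus (%x. g x - tfun G d x)) 0 < e"
    proof eventually_elim
      case (elim G)
      have "n2 torus (%x. g x - tfun G d x) <= n2 torus (%x. g x - tfun (F n) d x) + n2 torus (%x. tfun (F n) d x - tfun G d x)"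
        by (rule l2_triangle3[OF comp(1) l2_tfun l2_tfun])
      also have "... <= 2 * (1/2) ^ n + (1/2) ^ n"
      proof (rule add_mono)
        show "n2 torus (%x. g x - tfun (F n) d x) <= 2 * (1/2) ^ n" using comp(2)[of n] by (subst n2_commute)
        show "n2 torus (%x. tfun (F n) d x - tfun G d x) <= (1/2) ^ n" using tail[of G n] elim by (subst n2_commute) auto
      qed
      also have "... < e" using n by simp
      finally show ?case by (simp add: n2_nonneg)
    qed
  qed
  ultimately show ?thesis using comp(1) by (intro exI[of _ g]) simp
qed

lemma eventually_subset: "eventually (%F. finite F \<and> F \<subseteq> A) (finite_subsets_at_top A)"
  by (auto intro: eventually_finite_subsets_at_top_weakI)

lemma fc_of_limit:
  assumes v: "l2 torus v" and lim: "((%F. n2 torus (%x. v x - tfun F c x)) \<longlongrightarrow> 0) (finite_subsets_at_top A)" and k: "k \<in> A"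
  shows "fc v k = c k"
proof -
  have "norm (fc v k - c k) <= 0"
  proof (rule tendsto_lowerbound[OF lim])
    have "\<forall>\<^sub>F F in finite_subsets_at_top A. finite F \<and> {k} \<subseteq> F \<and> F \<subseteq> A"
      using k by (intro eventually_superset) auto
    then show "\<forall>\<^sub>F F in finite_subsets_at_top A. norm (fc v k - c k) <= n2 torus (%x. v x - tfun F c x)"
    proof eventually_elim
      case (elim F)
      have "fc (%x. v x - tfun F c x) k = fc v k - c k"
        using elim fc_tfun[of F c k] by (subst fc_diff) (auto intro: torus.l2_integrable v l2_tfun)
      then show ?case using fc_bound[OF l2_diff(1)[OF v l2_tfun[of F c]], of k] by simp
    qed
  qed simp
  then show ?thesis by simp
qed

text \<open>The coefficients in an expansion in \<open>V\<close> are necessarily the Fourier coefficients.\<close>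

lemma V_space_alt:
  fixes v :: "real ^ 'm => complex"
  shows "v \<in> V_space \<longleftrightarrow> periodic v \<and> l2 torus v \<and>
    ((%F. n2 torus (%x. v x - tfun F (fc v) x)) \<longlongrightarrow> 0) (finite_subsets_at_top Zstar) \<and>
    (%k. (abs_2 k)\<^sup>2 * (norm (fc v k))\<^sup>2) summable_on Zstar"
proof
  assume "v \<in> V_space"
  then obtain c where v: "periodic v" "l2 torus v" and
    c: "((%F. n2 torus (%x. v x - tfun F c x)) \<longlongrightarrow> 0) (finite_subsets_at_top Zstar)"
    "(%k. (abs_2 k)\<^sup>2 * (norm (c k))\<^sup>2) summable_on Zstar"
    by (auto simp: V_space_def L2_torus_l2 L2_norm_n2 tfun_def)
  have fc: "fc v k = c k" if "k \<in> Zstar" for k using fc_of_limit[OF v(2) c(1) that] .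
  have "\<forall>\<^sub>F F in finite_subsets_at_top (Zstar :: (int ^ 'm) set). n2 torus (%x. v x - tfun F c x) = n2 torus (%x. v x - tfun F (fc v) x)"
    using eventually_subset
  proof eventually_elim
    case (elim F)
    then have "tfun F c = tfun F (fc v)" using fc by (intro tfun_cong) auto
    then show ?case by simp
  qed
  from Lim_transform_eventually[OF c(1) this]
  have "((%F. n2 torus (%x. v x - tfun F (fc v) x)) \<longlongrightarrow> 0) (finite_subsets_at_top Zstar)" .
  moreover have "(%k. (abs_2 k)\<^sup>2 * (norm (fc v k))\<^sup>2) summable_on Zstar"
    using c(2) by (rule summable_on_cong[THEN iffD1, rotated]) (simp add: fc)
  ultimately show "periodic v \<and> l2 torus v \<and>
    ((%F. n2 torus (%x. v x - tfun F (fc v) x)) \<longlongrightarrow> 0) (finite_subsets_at_top Zstar) \<and>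
    (%k. (abs_2 k)\<^sup>2 * (norm (fc v k))\<^sup>2) summable_on Zstar" using v by simp
next
  assume "periodic v \<and> l2 torus v \<and>
    ((%F. n2 torus (%x. v x - tfun F (fc v) x)) \<longlongrightarrow> 0) (finite_subsets_at_top Zstar) \<and>
    (%k. (abs_2 k)\<^sup>2 * (norm (fc v k))\<^sup>2) summable_on Zstar"
  then show "v \<in> V_space"
    unfolding V_space_def L2_torus_l2 L2_norm_n2 tfun_def by auto
qed

lemma V_space_l2: "v \<in> V_space ==> l2 torus v"
  and V_space_periodic: "v \<in> V_space ==> periodic v"
  and V_space_integrable: "v \<in> V_space ==> integrable torus v"
  by (auto simp: V_space_alt intro: torus.l2_integrable)

lemma V_spaceI:
  assumes "periodic v" "l2 torus v"
    "((%F. n2 torus (%x. v x - tfun F c x)) \<longlongrightarrow> 0) (finite_subsets_at_top Zstar)"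
    "(%k. (abs_2 k)\<^sup>2 * (norm (c k))\<^sup>2) summable_on Zstar"
  shows "v \<in> V_space"
  using assms unfolding V_space_def L2_torus_l2 L2_norm_n2 tfun_def by auto

lemma tfun_V_space:
  assumes "finite I" "I \<subseteq> Zstar"
  shows "tfun I w \<in> V_space"
proof (rule V_spaceI[where c = "%k. if k \<in> I then w k else 0"])
  have "\<forall>\<^sub>F F in finite_subsets_at_top Zstar. finite F \<and> I \<subseteq> F \<and> F \<subseteq> Zstar"
    by (rule eventually_superset[OF assms])
  then have "\<forall>\<^sub>F F in finite_subsets_at_top Zstar. n2 torus (%x. tfun I w x - tfun F (%k. if k \<in> I then w k else 0) x) = 0"
  proof eventually_elim
    case (elim F)
    have "tfun F (%k. if k \<in> I then w k else 0) x = tfun I w x" for x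
      unfolding tfun_def using elim assms by (intro sum.mono_neutral_cong_right) auto
    then show ?case by (simp add: n2_def)
  qed
  then show "((%F. n2 torus (%x. tfun I w x - tfun F (%k. if k \<in> I then w k else 0) x)) \<longlongrightarrow> 0) (finite_subsets_at_top Zstar)"
    by (rule tendsto_eventually)
  have "(%k. (abs_2 k)\<^sup>2 * (norm (if k \<in> I then w k else 0))\<^sup>2) summable_on I"
    using assms by (intro summable_on_finite) auto
  then show "(%k. (abs_2 k)\<^sup>2 * (norm (if k \<in> I then w k else 0))\<^sup>2) summable_on Zstar"
    by (rule summable_on_cong_neutral[THEN iffD1, rotated -1]) (use assms in auto)
qed (auto simp: periodic_tfun l2_tfun)

lemma V_space_add:
  assumes v: "v \<in> V_space" and w: "w \<in> V_space"
  shows "(%x. v x + w x) \<in> V_space"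
proof -
  note v' = v[unfolded V_space_alt] and w' = w[unfolded V_space_alt]
  show ?thesis
  proof (rule V_spaceI[where c = "%k. fc v k + fc w k"])
    show "periodic (%x. v x + w x)"
      using V_space_periodic[OF v] V_space_periodic[OF w] by (simp add: periodic_def)
    show "l2 torus (%x. v x + w x)" by (intro l2_add V_space_l2 v w)
    have le: "n2 torus (%x. v x + w x - tfun F (%k. fc v k + fc w k) x) \<le>
        n2 torus (%x. v x - tfun F (fc v) x) + n2 torus (%x. w x - tfun F (fc w) x)" for F
    proof -
      have "(%x. v x + w x - tfun F (%k. fc v k + fc w k) x) = (%x. (v x - tfun F (fc v) x) + (w x - tfun F (fc w) x))"
        by (simp add: tfun_def distrib_right sum.distrib algebra_simps)
      then show ?thesis
        using l2_add(2)[OF l2_diff(1)[OF V_space_l2[OF v] l2_tfun] l2_diff(1)[OF V_space_l2[OF w] l2_tfun], of F "fc v" F "fc w"] by simp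
    qed
    have "((%F. n2 torus (%x. v x - tfun F (fc v) x) + n2 torus (%x. w x - tfun F (fc w) x)) \<longlongrightarrow> 0 + 0) (finite_subsets_at_top Zstar)"
      using v' w' by (intro tendsto_add) auto
    then have l: "((%F. n2 torus (%x. v x - tfun F (fc v) x) + n2 torus (%x. w x - tfun F (fc w) x)) \<longlongrightarrow> 0) (finite_subsets_at_top Zstar)"
      unfolding add_0_left .
    show "((%F. n2 torus (%x. v x + w x - tfun F (%k. fc v k + fc w k) x)) \<longlongrightarrow> 0) (finite_subsets_at_top Zstar)"
      by (rule Lim_null_comparison[OF always_eventually l])
         (unfold real_norm_def abs_of_nonneg[OF n2_nonneg], rule allI, rule le)
    have "(%k. 2 * ((abs_2 k)\<^sup>2 * (norm (fc v k))\<^sup>2) + 2 * ((abs_2 k)\<^sup>2 * (norm (fc w k))\<^sup>2)) summable_on Zstar"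
      using v' w' by (intro summable_on_add summable_on_cmult_right) auto
    then show "(%k. (abs_2 k)\<^sup>2 * (norm (fc v k + fc w k))\<^sup>2) summable_on Zstar"
    proof (rule summable_on_comparison_test)
      fix k
      have "(norm (fc v k + fc w k))\<^sup>2 <= (norm (fc v k) + norm (fc w k))\<^sup>2" by (intro power_mono norm_triangle_ineq) simp
      also have "... <= 2 * (norm (fc v k))\<^sup>2 + 2 * (norm (fc w k))\<^sup>2"
        using sum_squares_bound[of "norm (fc v k)" "norm (fc w k)"] by (simp add: power2_sum)
      finally have "(abs_2 k)\<^sup>2 * (norm (fc v k + fc w k))\<^sup>2 <= (abs_2 k)\<^sup>2 * (2 * (norm (fc v k))\<^sup>2 + 2 * (norm (fc w k))\<^sup>2)"
        by (intro mult_left_mono) auto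
      then show "(abs_2 k)\<^sup>2 * (norm (fc v k + fc w k))\<^sup>2 <= 2 * ((abs_2 k)\<^sup>2 * (norm (fc v k))\<^sup>2) + 2 * ((abs_2 k)\<^sup>2 * (norm (fc w k))\<^sup>2)"
        by (simp add: algebra_simps)
    qed auto
  qed
qed

lemma V_space_scale:
  assumes v: "v \<in> V_space"
  shows "(%x. c * v x) \<in> V_space"
proof -
  note v' = v[unfolded V_space_alt]
  have n2c: "n2 torus (%x. c * u x) = norm c * n2 torus u" for u :: "real ^ 'a => complex"
    by (simp add: n2_def norm_mult power_mult_distrib real_sqrt_mult)
  show ?thesis
  proof (rule V_spaceI[where c = "%k. c * fc v k"])
    show "periodic (%x. c * v x)" using V_space_periodic[OF v] by (simp add: periodic_def)
    show "l2 torus (%x. c * v x)" using V_space_l2[OF v] by (auto simp: l2_def norm_mult power_mult_distrib)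
    have "(%x. c * v x - tfun F (%k. c * fc v k) x) = (%x. c * (v x - tfun F (fc v) x))" for F
      by (simp add: tfun_def sum_distrib_left algebra_simps)
    moreover have "((%F. norm c * n2 torus (%x. v x - tfun F (fc v) x)) \<longlongrightarrow> norm c * 0) (finite_subsets_at_top Zstar)"
      using v' by (intro tendsto_mult tendsto_const) auto
    ultimately show "((%F. n2 torus (%x. c * v x - tfun F (%k. c * fc v k) x)) \<longlongrightarrow> 0) (finite_subsets_at_top Zstar)"
      by (simp add: n2c)
    have "(%k. (norm c)\<^sup>2 * ((abs_2 k)\<^sup>2 * (norm (fc v k))\<^sup>2)) summable_on Zstar"
      using v' by (intro summable_on_cmult_right) auto
    then show "(%k. (abs_2 k)\<^sup>2 * (norm (c * fc v k))\<^sup>2) summable_on Zstar"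
      by (simp add: norm_mult power_mult_distrib mult_ac)
  qed
qed

lemma V_space_diff:
  assumes "v \<in> V_space" "w \<in> V_space"
  shows "(%x. v x - w x) \<in> V_space"
  using V_space_add[OF assms(1) V_space_scale[OF assms(2), of "-1"]] by simp

lemma Zstar_uminus: "(- k \<in> Zstar) = (k \<in> Zstar)"
  by (simp add: Zstar_def)

lemma abs_2_uminus: "abs_2 (- k) = abs_2 k"
proof -
  have "(\<chi> j. real_of_int ((- k) $ j)) = - (\<chi> j. real_of_int (k $ j))" by (simp add: vec_eq_iff)
  then show ?thesis unfolding abs_2_def by simp
qed

lemma cnj_tfun: "cnj (tfun I w x) = tfun (uminus ` I) (%k. cnj (w (- k))) x"
proof -
  have "inj_on uminus I" by (rule inj_onI) simp
  then show ?thesis by (simp add: tfun_def cnj_sum cnj_efun sum.reindex o_def)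
qed

lemma n2_cnj: "n2 M (%x. cnj (f x)) = n2 M f"
  by (simp add: n2_def)

lemma l2_cnj: "l2 M f ==> l2 M (%x. cnj (f x))"
  unfolding l2_def
  using measurable_compose[OF _ borel_measurable_continuous_onI[OF continuous_on_cnj[OF continuous_on_id]], of f M] by auto

lemma V_space_cnj:
  fixes v :: "real ^ 'm => complex"
  assumes v: "v \<in> V_space"
  shows "(%x. cnj (v x)) \<in> V_space"
proof -
  note v' = v[unfolded V_space_alt]
  have im: "uminus ` Zstar = (Zstar :: (int ^ 'm) set)"
  proof
    show "uminus ` Zstar \<subseteq> (Zstar :: (int ^ 'm) set)" by (auto simp: Zstar_uminus)
    show "(Zstar :: (int ^ 'm) set) \<subseteq> uminus ` Zstar"
    proof
      fix k :: "int ^ 'm" assume "k \<in> Zstar"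
      then show "k \<in> uminus ` Zstar" by (intro image_eqI[of _ _ "- k"]) (auto simp: Zstar_uminus)
    qed
  qed
  show ?thesis
  proof (rule V_spaceI[where c = "%k. cnj (fc v (- k))"])
    show "periodic (%x. cnj (v x))" using V_space_periodic[OF v] by (simp add: periodic_def)
    show "l2 torus (%x. cnj (v x))" by (rule l2_cnj[OF V_space_l2[OF v]])
    have eq: "n2 torus (%x. cnj (v x) - tfun F (%k. cnj (fc v (- k))) x) = n2 torus (%x. v x - tfun (uminus ` F) (fc v) x)" for F
    proof -
      have "uminus ` uminus ` F = F" by (simp add: image_image)
      then have "tfun F (%k. cnj (fc v (- k))) x = cnj (tfun (uminus ` F) (fc v) x)" for x
        by (simp add: cnj_tfun)
      then have "(%x. cnj (v x) - tfun F (%k. cnj (fc v (- k))) x) = (%x. cnj (v x - tfun (uminus ` F) (fc v) x))" by simp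
      then show ?thesis by (simp only: n2_cnj)
    qed
    have "filterlim (%F. uminus ` F) (finite_subsets_at_top (Zstar :: (int ^ 'm) set)) (finite_subsets_at_top Zstar)"
    proof -
      have "inj_on uminus (Zstar :: (int ^ 'm) set)" by (rule inj_onI) simp
      from filterlim_compose[OF _ filterlim_ident] show ?thesis
        unfolding filterlim_def le_filter_def eventually_filtermap
      proof (intro allI impI)
        fix P assume "eventually P (finite_subsets_at_top (Zstar :: (int ^ 'm) set))"
        then obtain X where X: "finite X" "X \<subseteq> Zstar" "!!Y. finite Y \<and> X \<subseteq> Y \<and> Y \<subseteq> Zstar ==> P Y"
          by (auto simp: eventually_finite_subsets_at_top)
        have "P (uminus ` Y)" if "finite Y" "uminus ` X \<subseteq> Y" "Y \<subseteq> Zstar" for Y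
        proof (rule X(3), intro conjI)
          show "X \<subseteq> uminus ` Y"
          proof
            fix x assume "x \<in> X"
            then show "x \<in> uminus ` Y" using that(2) by (intro image_eqI[of _ _ "- x"]) auto
          qed
        qed (use that in \<open>auto simp: Zstar_uminus\<close>)
        then show "eventually (%F. P (uminus ` F)) (finite_subsets_at_top Zstar)"
          unfolding eventually_finite_subsets_at_top using X(1,2) by (intro exI[of _ "uminus ` X"]) (auto simp: Zstar_uminus)
      qed
    qed
    from filterlim_compose[OF _ this, of "%F. n2 torus (%x. v x - tfun F (fc v) x)" "nhds 0"] v'
    show "((%F. n2 torus (%x. cnj (v x) - tfun F (%k. cnj (fc v (- k))) x)) \<longlongrightarrow> 0) (finite_subsets_at_top Zstar)"
      unfolding eq by simp
    have "(%k. (abs_2 k)\<^sup>2 * (norm (fc v k))\<^sup>2) summable_on (uminus ` Zstar)" unfolding im using v' by simp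
    then have "((%k. (abs_2 k)\<^sup>2 * (norm (fc v k))\<^sup>2) \<circ> uminus) summable_on Zstar"
      by (subst (asm) summable_on_reindex) (auto intro: inj_onI)
    then show "(%k. (abs_2 k)\<^sup>2 * (norm (cnj (fc v (- k))))\<^sup>2) summable_on Zstar" by (simp add: o_def abs_2_uminus)
  qed
qed

subsection \<open>Gradients\<close>

text \<open>With values in a Euclidean space, so that the statements on square-integrable functions apply.\<close>

definition grad :: "(real ^ 'm => complex) => real ^ 'm => complex ^ 'm" where
  "grad v x = (\<chi> i. wpartial i v x)"

definition gtfun :: "(int ^ 'm) set => (int ^ 'm => complex) => real ^ 'm => complex ^ 'm" where
  "gtfun I w x = (\<chi> i. tfun I (%k. dfac k i * w k) x)"

text \<open>The squared norm of \<open>efun k\<close> in \<open>V\<close>.\<close>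

definition pk :: "int ^ 'm => real" where
  "pk k = 4 * pi\<^sup>2 * (\<Sum>i\<in>UNIV. (real_of_int (k $ i))\<^sup>2)"

lemma pk_abs_2: "pk k = 4 * pi\<^sup>2 * (abs_2 k)\<^sup>2"
  by (simp add: pk_def abs_2_def norm_vec_def L2_set_def sum_nonneg)

lemma norm_dfac_sq: "(norm (dfac k i))\<^sup>2 = 4 * pi\<^sup>2 * (real_of_int (k $ i))\<^sup>2"
  by (simp add: dfac_def norm_mult power_mult_distrib)

lemma sum_dfac: "(\<Sum>i\<in>UNIV. (norm (dfac k i))\<^sup>2) = pk k"
  by (simp add: norm_dfac_sq pk_def sum_distrib_left)

lemma norm_vec_sq: "(norm (z :: complex ^ 'm))\<^sup>2 = (\<Sum>i\<in>UNIV. (norm (z $ i))\<^sup>2)"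
  by (simp add: norm_vec_def L2_set_def sum_nonneg)

text \<open>The differentiated series converges by the summability condition of \<open>V\<close>; its limit is the weak
  derivative because the defining identity is continuous in both functions.\<close>

lemma V_weak_partial:
  fixes v :: "real ^ 'm => complex"
  assumes v: "v \<in> V_space"
  shows "\<exists>g. periodic g \<and> l2 torus g \<and> weak_partial i v g \<and>
    ((%F. n2 torus (%x. g x - tfun F (%k. dfac k i * fc v k) x)) \<longlongrightarrow> 0) (finite_subsets_at_top Zstar)"
proof -
  note v' = v[unfolded V_space_alt]
  let ?T = "finite_subsets_at_top (Zstar :: (int ^ 'm) set)"
  let ?d = "%k. dfac k i * fc v k"
  have "(%k. (4 * pi\<^sup>2) * ((abs_2 k)\<^sup>2 * (norm (fc v k))\<^sup>2)) summable_on Zstar"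
    using v' by (intro summable_on_cmult_right) auto
  then have "(%k. (norm (?d k))\<^sup>2) summable_on Zstar"
  proof (rule summable_on_comparison_test)
    fix k :: "int ^ 'm"
    have "(norm (dfac k i))\<^sup>2 <= (\<Sum>i\<in>UNIV. (norm (dfac k i))\<^sup>2)" by (rule member_le_sum) auto
    then have "(norm (dfac k i))\<^sup>2 * (norm (fc v k))\<^sup>2 <= pk k * (norm (fc v k))\<^sup>2"
      unfolding sum_dfac by (rule mult_right_mono) simp
    then show "(norm (?d k))\<^sup>2 <= (4 * pi\<^sup>2) * ((abs_2 k)\<^sup>2 * (norm (fc v k))\<^sup>2)"
      by (simp add: norm_mult power_mult_distrib pk_abs_2 mult.assoc)
  qed auto
  from riesz_fischer[OF this] obtain g where g: "periodic g" "l2 torus g"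
    "((%F. n2 torus (%x. g x - tfun F ?d x)) \<longlongrightarrow> 0) ?T" by auto
  have "weak_partial i v g"
    unfolding weak_partial_def
  proof (intro allI impI)
    fix \<phi> :: "real ^ 'm => real" and D :: "'m list => real ^ 'm => real"
    assume a: "periodic \<phi> \<and> smooth_derivs \<phi> D"
    have lim: "((%F. \<integral>x. r x *\<^sub>R tfun F c x \<partial>torus) \<longlongrightarrow> (\<integral>x. r x *\<^sub>R u x \<partial>torus)) ?T"
      if r: "continuous_on UNIV r" and u: "l2 torus u" and l: "((%F. n2 torus (%x. u x - tfun F c x)) \<longlongrightarrow> 0) ?T"
      for r :: "real ^ 'm => real" and u c
    proof -
      have b: "norm ((\<integral>x. r x *\<^sub>R tfun F c x \<partial>torus) - (\<integral>x. r x *\<^sub>R u x \<partial>torus)) <= n2 torus r * n2 torus (%x. u x - tfun F c x)" for F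
      proof -
        have d: "l2 torus (%x. u x - tfun F c x)" by (rule l2_diff(1)[OF u l2_tfun])
        have "norm (\<integral>x. r x *\<^sub>R (u x - tfun F c x) \<partial>torus) <= 1 * (n2 torus r * n2 torus (%x. u x - tfun F c x))"
          by (rule l2_form(2)[OF l2_cont[OF r] d])
             (use torus_measurable_cont[OF r] l2_measurable[OF d] in \<open>auto intro!: borel_measurable_scaleR\<close>)
        moreover have "(\<integral>x. r x *\<^sub>R (u x - tfun F c x) \<partial>torus) = (\<integral>x. r x *\<^sub>R u x \<partial>torus) - (\<integral>x. r x *\<^sub>R tfun F c x \<partial>torus)"
          unfolding scaleR_diff_right
          by (intro Bochner_Integration.integral_diff torus_cont_mult_integrable r torus.l2_integrable u l2_tfun)
        ultimately show ?thesis by (simp add: norm_minus_commute)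
      qed
      have "((%F. n2 torus r * n2 torus (%x. u x - tfun F c x)) \<longlongrightarrow> n2 torus r * 0) ?T"
        by (intro tendsto_mult tendsto_const l)
      then have l0: "((%F. n2 torus r * n2 torus (%x. u x - tfun F c x)) \<longlongrightarrow> 0) ?T" unfolding mult_zero_right .
      show ?thesis by (rule LIM_zero_cancel[OF Lim_null_comparison[OF always_eventually l0]]) (rule allI, rule b)
    qed
    have c: "continuous_on UNIV (D [i])" "continuous_on UNIV \<phi>" using a by (auto intro: smooth_cont smooth_cont_base)
    have A: "((%F. \<integral>x. D [i] x *\<^sub>R tfun F (fc v) x \<partial>torus) \<longlongrightarrow> (\<integral>x. D [i] x *\<^sub>R v x \<partial>torus)) ?T"
      using v' by (intro lim[OF c(1)]) auto
    have B: "((%F. - (\<integral>x. \<phi> x *\<^sub>R tfun F ?d x \<partial>torus)) \<longlongrightarrow> - (\<integral>x. \<phi> x *\<^sub>R g x \<partial>torus)) ?T"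
      by (intro tendsto_minus lim[OF c(2)] g)
    have ev: "\<forall>\<^sub>F F in ?T. (\<integral>x. D [i] x *\<^sub>R tfun F (fc v) x \<partial>torus) = - (\<integral>x. \<phi> x *\<^sub>R tfun F ?d x \<partial>torus)"
      using eventually_subset
    proof eventually_elim
      case (elim F)
      then show ?case using weak_partial_tfun[of F i "fc v", unfolded weak_partial_def, rule_format, OF _ a] by simp
    qed
    show "(\<integral>x. D [i] x *\<^sub>R v x \<partial>torus) = - (\<integral>x. \<phi> x *\<^sub>R g x \<partial>torus)"
      by (rule tendsto_unique[OF finite_subsets_at_top_neq_bot Lim_transform_eventually[OF A ev] B])
  qed
  with g show ?thesis by blast
qed

lemma V_wpartial:
  fixes v :: "real ^ 'm => complex"
  assumes v: "v \<in> V_space"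
  shows "periodic (wpartial i v)" "l2 torus (wpartial i v)" "weak_partial i v (wpartial i v)"
    "((%F. n2 torus (%x. wpartial i v x - tfun F (%k. dfac k i * fc v k) x)) \<longlongrightarrow> 0) (finite_subsets_at_top Zstar)"
proof -
  obtain g where g: "periodic g" "l2 torus g" "weak_partial i v g"
    "((%F. n2 torus (%x. g x - tfun F (%k. dfac k i * fc v k) x)) \<longlongrightarrow> 0) (finite_subsets_at_top Zstar)"
    using V_weak_partial[OF v] by blast
  have ig: "integrable torus g" by (rule torus.l2_integrable[OF g(2)])
  note W = wpartial_works[OF g(1) ig g(3)]
  have AE: "AE x in torus. wpartial i v x = g x" by (rule wpartial_AE[OF g(1) ig g(3) V_space_integrable[OF v]])
  show "periodic (wpartial i v)" "weak_partial i v (wpartial i v)" using W by auto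
  have m: "wpartial i v \<in> borel_measurable torus" "g \<in> borel_measurable torus" using W ig by auto
  show "l2 torus (wpartial i v)" using l2_cong_AE(1)[OF m AE] g(2) by simp
  have "n2 torus (%x. wpartial i v x - tfun F (%k. dfac k i * fc v k) x) = n2 torus (%x. g x - tfun F (%k. dfac k i * fc v k) x)" for F
  proof (rule l2_cong_AE(2))
    show "AE x in torus. wpartial i v x - tfun F (%k. dfac k i * fc v k) x = g x - tfun F (%k. dfac k i * fc v k) x"
      using AE by eventually_elim simp
  qed (intro borel_measurable_diff m l2_measurable[OF l2_tfun])+
  then show "((%F. n2 torus (%x. wpartial i v x - tfun F (%k. dfac k i * fc v k) x)) \<longlongrightarrow> 0) (finite_subsets_at_top Zstar)"
    using g(4) by simp
qed

lemma V_wpartial_AE: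
  assumes v: "v \<in> V_space" and "periodic g" "l2 torus g" "weak_partial i v g"
  shows "AE x in torus. wpartial i v x = g x"
  by (rule wpartial_AE[OF assms(2) torus.l2_integrable(1)[OF assms(3)] assms(4) V_space_integrable[OF v]])

lemma l2_vec:
  fixes f :: "'m :: finite => 'x => complex"
  assumes "!!i. l2 M (f i)"
  shows "l2 M (%x. \<chi> i. f i x)" "(n2 M (%x. \<chi> i. f i x))\<^sup>2 = (\<Sum>i\<in>UNIV. (n2 M (f i))\<^sup>2)"
proof -
  show "l2 M (%x. \<chi> i. f i x)"
    using assms unfolding l2_def norm_vec_sq by (auto intro!: borel_measurable_vec_lambda)
  show "(n2 M (%x. \<chi> i. f i x))\<^sup>2 = (\<Sum>i\<in>UNIV. (n2 M (f i))\<^sup>2)"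
    unfolding n2_sq norm_vec_sq using assms by (subst Bochner_Integration.integral_sum) (auto simp: l2_def)
qed

lemma grad_l2: "v \<in> V_space ==> l2 torus (grad v)"
  unfolding grad_def[abs_def] by (intro l2_vec V_wpartial)

lemma V_norm_grad:
  assumes "v \<in> V_space"
  shows "V_norm v = n2 torus (grad v)"
proof -
  have "(n2 torus (grad v))\<^sup>2 = (\<Sum>i\<in>UNIV. (n2 torus (wpartial i v))\<^sup>2)"
    unfolding grad_def[abs_def] by (rule l2_vec(2)[OF V_wpartial(2)[OF assms]])
  then show ?thesis unfolding V_norm_def L2_norm_n2 by (simp add: real_sqrt_unique[OF _ n2_nonneg])
qed

lemma grad_AE:
  assumes v: "v \<in> V_space" and g: "!!i. periodic (g i)" "!!i. l2 torus (g i)" "!!i. weak_partial i v (g i)"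
  shows "AE x in torus. grad v x = (\<chi> i. g i x)"
proof -
  have "AE x in torus. \<forall>i\<in>UNIV. wpartial i v x = g i x"
    by (rule AE_finite_allI) (auto intro: V_wpartial_AE[OF v g])
  then show ?thesis by eventually_elim (simp add: grad_def)
qed

lemma grad_add:
  assumes v: "v \<in> V_space" and w: "w \<in> V_space"
  shows "AE x in torus. grad (%x. v x + w x) x = grad v x + grad w x"
proof -
  have "AE x in torus. grad (%x. v x + w x) x = (\<chi> i. wpartial i v x + wpartial i w x)"
  proof (rule grad_AE[OF V_space_add[OF v w]])
    fix i
    show "periodic (%x. wpartial i v x + wpartial i w x)" using V_wpartial(1)[OF v] V_wpartial(1)[OF w] by (simp add: periodic_def)
    show "l2 torus (%x. wpartial i v x + wpartial i w x)" by (intro l2_add V_wpartial v w)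
    show "weak_partial i (%x. v x + w x) (%x. wpartial i v x + wpartial i w x)"
      by (intro weak_partial_add V_wpartial V_space_integrable torus.l2_integrable v w)
  qed
  then show ?thesis by eventually_elim (simp add: grad_def vec_eq_iff)
qed

lemma grad_scale:
  assumes v: "v \<in> V_space"
  shows "AE x in torus. grad (%x. c * v x) x = c *s grad v x"
proof -
  have "AE x in torus. grad (%x. c * v x) x = (\<chi> i. c * wpartial i v x)"
  proof (rule grad_AE[OF V_space_scale[OF v]])
    fix i
    show "periodic (%x. c * wpartial i v x)" using V_wpartial(1)[OF v] by (simp add: periodic_def)
    show "l2 torus (%x. c * wpartial i v x)" by (rule l2_cmult[OF V_wpartial(2)[OF v]])
    show "weak_partial i (%x. c * v x) (%x. c * wpartial i v x)" by (intro weak_partial_scale V_wpartial v)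
  qed
  then show ?thesis by eventually_elim (simp add: grad_def vec_eq_iff)
qed

lemma grad_diff:
  assumes v: "v \<in> V_space" and w: "w \<in> V_space"
  shows "AE x in torus. grad (%x. v x - w x) x = grad v x - grad w x"
  using grad_add[OF v V_space_scale[OF w, of "-1"]] grad_scale[OF w, of "-1"]
  by eventually_elim (simp add: vec_eq_iff)

lemma grad_cnj:
  assumes v: "v \<in> V_space"
  shows "AE x in torus. grad (%x. cnj (v x)) x = (\<chi> i. cnj (grad v x $ i))"
proof -
  have "AE x in torus. grad (%x. cnj (v x)) x = (\<chi> i. cnj (wpartial i v x))"
  proof (rule grad_AE[OF V_space_cnj[OF v]])
    fix i
    show "periodic (%x. cnj (wpartial i v x))" using V_wpartial(1)[OF v] by (simp add: periodic_def)
    show "l2 torus (%x. cnj (wpartial i v x))" by (rule l2_cnj[OF V_wpartial(2)[OF v]])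
    show "weak_partial i (%x. cnj (v x)) (%x. cnj (wpartial i v x))" by (intro weak_partial_cnj V_wpartial v)
  qed
  then show ?thesis by eventually_elim (simp add: grad_def)
qed

lemma gtfun_l2: "l2 torus (gtfun I w)"
  unfolding gtfun_def[abs_def] by (intro l2_vec l2_tfun)

lemma grad_tfun:
  assumes "finite I" "I \<subseteq> Zstar"
  shows "AE x in torus. grad (tfun I w) x = gtfun I w x"
  unfolding gtfun_def by (rule grad_AE[OF tfun_V_space[OF assms]]) (auto intro: periodic_tfun l2_tfun weak_partial_tfun assms)

lemma n2_gtfun:
  assumes "finite I"
  shows "(n2 torus (gtfun I w))\<^sup>2 = (\<Sum>k\<in>I. pk k * (norm (w k))\<^sup>2)"
proof -
  have "(n2 torus (gtfun I w))\<^sup>2 = (\<Sum>i\<in>UNIV. (n2 torus (tfun I (%k. dfac k i * w k)))\<^sup>2)"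
    unfolding gtfun_def[abs_def] by (rule l2_vec(2)[OF l2_tfun])
  also have "... = (\<Sum>i\<in>UNIV. \<Sum>k\<in>I. (norm (dfac k i))\<^sup>2 * (norm (w k))\<^sup>2)"
    by (simp only: n2_tfun[OF assms] norm_mult power_mult_distrib)
  also have "... = (\<Sum>k\<in>I. pk k * (norm (w k))\<^sup>2)"
    by (subst sum.swap) (simp add: sum_distrib_right[symmetric] sum_dfac)
  finally show ?thesis .
qed

lemma V_norm_tfun:
  assumes "finite I" "I \<subseteq> Zstar"
  shows "(V_norm (tfun I w))\<^sup>2 = (\<Sum>k\<in>I. pk k * (norm (w k))\<^sup>2)"
  unfolding V_norm_grad[OF tfun_V_space[OF assms]] n2_gtfun[OF assms(1), symmetric]
  by (subst l2_cong_AE(2)[OF l2_measurable[OF grad_l2[OF tfun_V_space[OF assms]]] l2_measurable[OF gtfun_l2] grad_tfun[OF assms]]) simp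

lemma V_norm_nonneg: "V_norm v \<ge> 0"
  by (simp add: V_norm_def sum_nonneg)

lemma V_norm_triangle:
  assumes v: "v \<in> V_space" and w: "w \<in> V_space"
  shows "V_norm (%x. v x + w x) <= V_norm v + V_norm w"
proof -
  have "V_norm (%x. v x + w x) = n2 torus (%x. grad v x + grad w x)"
    unfolding V_norm_grad[OF V_space_add[OF v w]]
    by (rule l2_cong_AE(2)[OF _ _ grad_add[OF v w]]) (intro l2_measurable grad_l2 V_space_add v w l2_add)+
  also have "... <= V_norm v + V_norm w"
    unfolding V_norm_grad[OF v] V_norm_grad[OF w] by (rule l2_add(2)[OF grad_l2[OF v] grad_l2[OF w]])
  finally show ?thesis .
qed

lemma V_norm_scale:
  assumes v: "v \<in> V_space"
  shows "V_norm (%x. c * v x) = norm c * V_norm v"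
proof -
  have m: "l2 torus (%x. c *s grad v x)"
  proof -
    have "(%x. c *s grad v x) = (%x. \<chi> i. c * wpartial i v x)" by (auto simp: grad_def vec_eq_iff)
    moreover have "l2 torus (%x. c * wpartial i v x)" for i
      by (rule l2_cmult[OF V_wpartial(2)[OF v]])
    ultimately show ?thesis using l2_vec(1)[of torus "%i x. c * wpartial i v x"] by simp
  qed
  have ns: "norm (c *s z) = norm c * norm z" for z :: "complex ^ 'a"
  proof -
    have "(norm (c *s z))\<^sup>2 = (norm c * norm z)\<^sup>2"
      unfolding power_mult_distrib norm_vec_sq by (simp add: norm_mult power_mult_distrib sum_distrib_left)
    then show ?thesis by (simp add: power2_eq_iff_nonneg)
  qed
  have "V_norm (%x. c * v x) = n2 torus (%x. c *s grad v x)"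
    unfolding V_norm_grad[OF V_space_scale[OF v]]
    by (rule l2_cong_AE(2)[OF _ _ grad_scale[OF v]]) (intro l2_measurable grad_l2 V_space_scale v m)+
  also have "... = norm c * V_norm v"
    unfolding V_norm_grad[OF v] n2_def ns by (simp add: power_mult_distrib real_sqrt_mult)
  finally show ?thesis .
qed

lemma V_norm_diff_commute:
  assumes "v \<in> V_space" "w \<in> V_space"
  shows "V_norm (%x. v x - w x) = V_norm (%x. w x - v x)"
  using V_norm_scale[OF V_space_diff[OF assms], of "-1"] by simp

lemma V_norm_triangle3:
  assumes "u \<in> V_space" "v \<in> V_space" "w \<in> V_space"
  shows "V_norm (%x. u x - w x) <= V_norm (%x. u x - v x) + V_norm (%x. v x - w x)"
  using V_norm_triangle[OF V_space_diff[OF assms(1,2)] V_space_diff[OF assms(2,3)]] by simp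

lemma V_norm_triangle_abs:
  assumes "u \<in> V_space" "v \<in> V_space"
  shows "\<bar>V_norm u - V_norm v\<bar> <= V_norm (%x. u x - v x)"
proof -
  have "V_norm u <= V_norm (%x. u x - v x) + V_norm v"
    using V_norm_triangle[OF V_space_diff[OF assms] assms(2)] by simp
  moreover have "V_norm v <= V_norm (%x. v x - u x) + V_norm u"
    using V_norm_triangle[OF V_space_diff[OF assms(2,1)] assms(1)] by simp
  ultimately show ?thesis using V_norm_diff_commute[OF assms] by linarith
qed

lemma V_tail:
  fixes v :: "real ^ 'm => complex"
  assumes v: "v \<in> V_space"
  shows "((%F. V_norm (%x. v x - tfun F (fc v) x)) \<longlongrightarrow> 0) (finite_subsets_at_top Zstar)"
proof -
  let ?T = "finite_subsets_at_top (Zstar :: (int ^ 'm) set)"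
  let ?g = "%F i x. wpartial i v x - tfun F (%k. dfac k i * fc v k) x"
  have "((%F. sqrt (\<Sum>i\<in>UNIV. (n2 torus (?g F i))\<^sup>2)) \<longlongrightarrow> sqrt (\<Sum>i\<in>(UNIV :: 'm set). 0\<^sup>2)) ?T"
    by (intro tendsto_intros V_wpartial(4)[OF v])
  moreover have "\<forall>\<^sub>F F in ?T. sqrt (\<Sum>i\<in>UNIV. (n2 torus (?g F i))\<^sup>2) = V_norm (%x. v x - tfun F (fc v) x)"
    using eventually_subset
  proof eventually_elim
    case (elim F)
    then have t: "tfun F (fc v) \<in> V_space" by (intro tfun_V_space) auto
    have l: "l2 torus (?g F i)" for i by (intro l2_diff V_wpartial v l2_tfun)
    have "AE x in torus. grad (%x. v x - tfun F (fc v) x) x = (\<chi> i. ?g F i x)"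
      using grad_diff[OF v t] grad_tfun[of F "fc v"] elim
      by (auto elim!: AE_mp simp: grad_def gtfun_def vec_eq_iff)
    then have "V_norm (%x. v x - tfun F (fc v) x) = n2 torus (%x. \<chi> i. ?g F i x)"
      unfolding V_norm_grad[OF V_space_diff[OF v t]]
      by (rule l2_cong_AE(2)[rotated 2]) (intro l2_measurable grad_l2 V_space_diff v t l2_vec l)+
    also have "... = sqrt ((n2 torus (%x. \<chi> i. ?g F i x))\<^sup>2)" by (simp add: n2_nonneg)
    also have "... = sqrt (\<Sum>i\<in>UNIV. (n2 torus (?g F i))\<^sup>2)" unfolding l2_vec(2)[OF l] ..
    finally show ?case by simp
  qed
  ultimately show ?thesis using Lim_transform_eventually by fastforce
qed

lemma V_inner_tfun:
  assumes v: "v \<in> V_space" and I: "finite I" "I \<subseteq> Zstar"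
  shows "V_inner v (tfun I w) = (\<Sum>k\<in>I. of_real (pk k) * (fc v k * cnj (w k)))"
proof -
  have wi: "(\<integral>x. wpartial i v x * cnj (wpartial i (tfun I w) x) \<partial>torus) =
      (\<Sum>k\<in>I. of_real ((norm (dfac k i))\<^sup>2) * (fc v k * cnj (w k)))" for i
  proof -
    let ?g = "tfun I (%k. dfac k i * w k)"
    have i: "integrable torus (wpartial i v)" by (rule torus.l2_integrable[OF V_wpartial(2)[OF v]])
    have AE: "AE x in torus. wpartial i (tfun I w) x = ?g x"
      by (rule V_wpartial_AE[OF tfun_V_space[OF I]]) (auto intro: periodic_tfun l2_tfun weak_partial_tfun I)
    have m: "(%x. cnj (wpartial i (tfun I w) x)) \<in> borel_measurable torus" "(%x. cnj (?g x)) \<in> borel_measurable torus"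
      by (intro l2_measurable l2_cnj V_wpartial tfun_V_space I l2_tfun)+
    have "(\<integral>x. wpartial i v x * cnj (wpartial i (tfun I w) x) \<partial>torus) = (\<integral>x. wpartial i v x * cnj (?g x) \<partial>torus)"
    proof (rule integral_cong_AE)
      show "AE x in torus. wpartial i v x * cnj (wpartial i (tfun I w) x) = wpartial i v x * cnj (?g x)"
        using AE by eventually_elim simp
    qed (use i m in \<open>auto intro!: borel_measurable_times\<close>)
    also have "... = (\<integral>x. (\<Sum>k\<in>I. cnj (dfac k i * w k) * (wpartial i v x * efun (- k) x)) \<partial>torus)"
      by (simp add: tfun_def cnj_sum sum_distrib_left cnj_efun mult_ac)
    also have "... = (\<Sum>k\<in>I. \<integral>x. cnj (dfac k i * w k) * (wpartial i v x * efun (- k) x) \<partial>torus)"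
      by (intro Bochner_Integration.integral_sum integrable_mult_right integrable_mult_efun i)
    also have "... = (\<Sum>k\<in>I. cnj (dfac k i * w k) * (- dfac (- k) i * fc v k))"
    proof (rule sum.cong[OF refl])
      fix k
      have "(\<integral>x. wpartial i v x * efun (- k) x \<partial>torus) = - dfac (- k) i * fc v k"
        using weak_partial_fourier[OF V_wpartial(3)[OF v] V_space_integrable[OF v] i, of "- k"] by (simp add: fc_def cnj_efun)
      then show "(\<integral>x. cnj (dfac k i * w k) * (wpartial i v x * efun (- k) x) \<partial>torus) = cnj (dfac k i * w k) * (- dfac (- k) i * fc v k)"
        by (simp only: integral_mult_right_zero)
    qed
    also have "... = (\<Sum>k\<in>I. of_real ((norm (dfac k i))\<^sup>2) * (fc v k * cnj (w k)))"
    proof (rule sum.cong[OF refl])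
      fix k
      have "- dfac (- k) i = dfac k i" by (simp add: dfac_def)
      then show "cnj (dfac k i * w k) * (- dfac (- k) i * fc v k) = of_real ((norm (dfac k i))\<^sup>2) * (fc v k * cnj (w k))"
        by (simp only: complex_norm_square) simp
    qed
    finally show ?thesis .
  qed
  have "V_inner v (tfun I w) = (\<Sum>k\<in>I. \<Sum>i\<in>UNIV. of_real ((norm (dfac k i))\<^sup>2) * (fc v k * cnj (w k)))"
    unfolding V_inner_def wi by (rule sum.swap)
  also have "... = (\<Sum>k\<in>I. of_real (pk k) * (fc v k * cnj (w k)))"
    unfolding sum_dfac[symmetric] of_real_sum sum_distrib_right ..
  finally show ?thesis .
qed

lemma pk_ge: "k \<in> Zstar ==> pk k \<ge> 4 * pi\<^sup>2 * CARD('m)" for k :: "int ^ 'm"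
proof -
  assume k: "k \<in> Zstar"
  have "(\<Sum>i\<in>(UNIV :: 'm set). 1) <= (\<Sum>i\<in>UNIV. (real_of_int (k $ i))\<^sup>2)"
  proof (rule sum_mono)
    fix i
    have "k $ i ~= 0" using k by (simp add: Zstar_def)
    then have "1 <= \<bar>real_of_int (k $ i)\<bar>" by linarith
    then show "1 <= (real_of_int (k $ i))\<^sup>2" by (metis abs_ge_zero one_le_power power2_abs)
  qed
  then have "real CARD('m) <= (\<Sum>i\<in>UNIV. (real_of_int (k $ i))\<^sup>2)" by simp
  then show ?thesis unfolding pk_def by (intro mult_left_mono) auto
qed

lemma pk_pos: "k \<in> Zstar ==> pk k > 0" for k :: "int ^ 'm"
  using pk_ge[of k] by (smt (verit) mult_pos_pos of_nat_0_less_iff pi_gt_zero zero_less_card_finite zero_less_power)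

lemma fc_V_bound:
  assumes v: "v \<in> V_space" and k: "k \<in> Zstar"
  shows "sqrt (pk k) * norm (fc v k) <= V_norm v"
proof -
  let ?e = "tfun {k} (%_. 1)"
  have e: "?e \<in> V_space" using k by (intro tfun_V_space) auto
  have "of_real (pk k) * fc v k = (\<Sum>i\<in>UNIV. \<integral>x. wpartial i v x * cnj (wpartial i ?e x) \<partial>torus)"
    using V_inner_tfun[OF v, of "{k}" "%_. 1"] k by (simp add: V_inner_def)
  then have "pk k * norm (fc v k) = norm (\<Sum>i\<in>UNIV. \<integral>x. wpartial i v x * cnj (wpartial i ?e x) \<partial>torus)"
    using pk_pos[OF k] by (simp flip: \<open>of_real (pk k) * fc v k = _\<close> add: norm_mult)
  also have "... <= (\<Sum>i\<in>UNIV. n2 torus (wpartial i v) * n2 torus (wpartial i ?e))"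
  proof (rule sum_norm_le)
    fix i
    have l: "l2 torus (wpartial i v)" "l2 torus (wpartial i ?e)" by (intro V_wpartial v e)+
    have "norm (\<integral>x. wpartial i v x * cnj (wpartial i ?e x) \<partial>torus) <= 1 * (n2 torus (wpartial i v) * n2 torus (wpartial i ?e))"
      by (rule l2_form(2)[OF l])
         (use l2_measurable[OF l(1)] l2_measurable[OF l2_cnj[OF l(2)]] in \<open>auto simp: norm_mult intro!: borel_measurable_times\<close>)
    then show "norm (\<integral>x. wpartial i v x * cnj (wpartial i ?e x) \<partial>torus) <= n2 torus (wpartial i v) * n2 torus (wpartial i ?e)" by simp
  qed
  also have "... <= V_norm v * V_norm ?e"
    unfolding V_norm_def L2_norm_n2 L2_set_def[symmetric] by (rule L2_set_mult_ineq[THEN order.trans[rotated]]) (simp add: n2_nonneg)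
  also have "V_norm ?e = sqrt (pk k)"
    using V_norm_tfun[of "{k}" "%_. 1"] k by (simp add: real_sqrt_unique V_norm_nonneg)
  finally have "sqrt (pk k) * (sqrt (pk k) * norm (fc v k)) <= sqrt (pk k) * V_norm v"
    using pk_pos[OF k] by (simp add: mult.assoc[symmetric] mult.commute)
  then show ?thesis using pk_pos[OF k] by simp
qed


section \<open>Finite linear systems\<close>

definition mv :: "'k set => ('k => 'k => complex) => ('k => complex) => 'k => complex" where
  "mv I A w l = (\<Sum>k\<in>I. A l k * w k)"

definition bil :: "'k set => ('k => 'k => complex) => ('k => complex) => ('k => complex) => complex" where
  "bil I A v w = (\<Sum>l\<in>I. cnj (v l) * mv I A w l)"

definition Np :: "'k set => ('k => real) => ('k => complex) => real" where
  "Np I p w = sqrt (\<Sum>k\<in>I. p k * (norm (w k))\<^sup>2)"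

text \<open>One step of Richardson's iteration with step size \<open>\<tau>\<close> contracts with factor \<open>q\<close> in the norm \<open>Np I p\<close>.\<close>

definition contractive :: "'k set => ('k => real) => real => real => ('k => 'k => complex) => bool" where
  "contractive I p \<tau> q A \<longleftrightarrow> (\<forall>v w. norm ((\<Sum>l\<in>I. cnj (v l) * (of_real (p l) * w l)) - of_real \<tau> * bil I A v w) <= q * Np I p v * Np I p w)"

primrec rich :: "'k set => ('k => real) => real => ('k => 'k => complex) => ('k => complex) => nat => 'k => complex" where
  "rich I p \<tau> A G 0 = (%_. 0)"
| "rich I p \<tau> A G (Suc n) = (%l. rich I p \<tau> A G n l - of_real (\<tau> / p l) * (mv I A (rich I p \<tau> A G n) l - G l))"

definition sol :: "'k set => ('k => real) => real => ('k => 'k => complex) => ('k => complex) => 'k => complex" where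
  "sol I p \<tau> A G l = lim (%n. rich I p \<tau> A G n l)"

lemma mv_diff: "mv I A (%k. v k - w k) l = mv I A v l - mv I A w l"
  by (simp add: mv_def algebra_simps sum_subtractf)

lemma mv_scale: "mv I A (%k. c * w k) l = c * mv I A w l"
  by (simp add: mv_def sum_distrib_left mult_ac)

lemma Np_nonneg: "(!!k. k \<in> I ==> p k \<ge> 0) ==> Np I p w \<ge> 0"
  by (simp add: Np_def sum_nonneg)

lemma Np_sq: "(!!k. k \<in> I ==> p k \<ge> 0) ==> (Np I p w)\<^sup>2 = (\<Sum>k\<in>I. p k * (norm (w k))\<^sup>2)"
  by (simp add: Np_def sum_nonneg)

lemma Np_cong: "(!!k. k \<in> I ==> v k = w k) ==> Np I p v = Np I p w"
  by (simp add: Np_def)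

lemma Np_component:
  assumes "finite I" "!!k. k \<in> I ==> p k > 0" "k \<in> I"
  shows "norm (w k) <= Np I p w / sqrt (p k)"
proof -
  have "p k * (norm (w k))\<^sup>2 <= (\<Sum>k\<in>I. p k * (norm (w k))\<^sup>2)"
  proof (rule member_le_sum[OF assms(3) _ assms(1)])
    fix x assume "x \<in> I - {k}"
    then have "p x > 0" using assms(2) by simp
    then show "0 <= p x * (norm (w x))\<^sup>2" by simp
  qed
  then have "sqrt (p k * (norm (w k))\<^sup>2) <= Np I p w" unfolding Np_def by (rule real_sqrt_le_mono)
  then show ?thesis using assms(2)[OF assms(3)] by (simp add: real_sqrt_mult field_simps)
qed

lemma Np_sq_complex:
  assumes "!!k. k \<in> I ==> p k \<ge> 0"
  shows "complex_of_real ((Np I p w)\<^sup>2) = (\<Sum>l\<in>I. cnj (w l) * (of_real (p l) * w l))"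
proof -
  have 1: "(Np I p w)\<^sup>2 = (\<Sum>k\<in>I. p k * (norm (w k))\<^sup>2)" by (rule Np_sq) (rule assms)
  show ?thesis unfolding 1 of_real_sum of_real_mult complex_norm_square by (rule sum.cong[OF refl]) (simp add: mult_ac)
qed

lemma le_of_sq_le_mult:
  fixes x c :: real
  assumes "r * x\<^sup>2 <= c * x" "x \<ge> 0" "c \<ge> 0"
  shows "r * x <= c"
proof (cases "x = 0")
  case False
  then have "x > 0" using assms by simp
  moreover have "(r * x) * x <= c * x" using assms(1) by (simp add: power2_eq_square mult.assoc)
  ultimately show ?thesis by simp
qed (use assms in simp)

text \<open>The Richardson iteration solves the system with geometric convergence. Unlike an abstract
  existence argument it shows how the solution depends on the data: as a uniform limit of
  polynomials in the entries.\<close>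

context
  fixes I :: "'k set" and p :: "'k => real" and \<tau> q :: real and A :: "'k => 'k => complex" and G :: "'k => complex"
  assumes I: "finite I" and p: "!!k. k \<in> I ==> p k > 0" and tau: "\<tau> > 0" and q: "0 <= q" "q < 1"
    and contr: "contractive I p \<tau> q A"
begin

lemma rich_increment:
  "Np I p (%l. rich I p \<tau> A G (Suc n) l - rich I p \<tau> A G n l) <= q ^ n * Np I p (%l. of_real (\<tau> / p l) * G l)"
proof (induction n)
  case 0
  have "Np I p (%l. rich I p \<tau> A G (Suc 0) l - rich I p \<tau> A G 0 l) = Np I p (%l. of_real (\<tau> / p l) * G l)"
    by (rule Np_cong) (simp add: mv_def)
  then show ?case by simp
next
  case (Suc n)
  have p0: "p k \<ge> 0" if "k \<in> I" for k using p[OF that] by simp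
  define e where "e l = rich I p \<tau> A G (Suc n) l - rich I p \<tau> A G n l" for l
  define e' where "e' l = rich I p \<tau> A G (Suc (Suc n)) l - rich I p \<tau> A G (Suc n) l" for l
  have e': "e' l = e l - of_real (\<tau> / p l) * mv I A e l" for l
    unfolding e'_def e_def[abs_def] mv_diff rich.simps(2)[of I p \<tau> A G "Suc n"] rich.simps(2)[of I p \<tau> A G n]
    by (simp add: algebra_simps)
  have "complex_of_real ((Np I p e')\<^sup>2) = (\<Sum>l\<in>I. cnj (e' l) * (of_real (p l) * e' l))"
    by (rule Np_sq_complex) (rule p0)
  also have "... = (\<Sum>l\<in>I. cnj (e' l) * (of_real (p l) * e l) - of_real \<tau> * (cnj (e' l) * mv I A e l))"
  proof (rule sum.cong[OF refl])
    fix l assume "l \<in> I"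
    then have "p l ~= 0" using p by force
    then have "of_real (p l) * e' l = of_real (p l) * e l - of_real \<tau> * mv I A e l"
      unfolding e'[of l] by (simp add: right_diff_distrib)
    then show "cnj (e' l) * (of_real (p l) * e' l) = cnj (e' l) * (of_real (p l) * e l) - of_real \<tau> * (cnj (e' l) * mv I A e l)"
      by (simp only: right_diff_distrib mult.left_commute)
  qed
  also have "... = (\<Sum>l\<in>I. cnj (e' l) * (of_real (p l) * e l)) - of_real \<tau> * bil I A e' e"
    by (simp add: sum_subtractf bil_def sum_distrib_left)
  finally have "norm ((\<Sum>l\<in>I. cnj (e' l) * (of_real (p l) * e l)) - of_real \<tau> * bil I A e' e) = norm (complex_of_real ((Np I p e')\<^sup>2))"
    by (rule arg_cong[OF sym])
  then have "(Np I p e')\<^sup>2 = norm ((\<Sum>l\<in>I. cnj (e' l) * (of_real (p l) * e l)) - of_real \<tau> * bil I A e' e)"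
    unfolding norm_of_real by simp
  also have "... <= q * Np I p e' * Np I p e" using contr unfolding contractive_def by blast
  finally have "1 * (Np I p e')\<^sup>2 <= (q * Np I p e) * Np I p e'" by (simp add: mult_ac)
  then have "1 * Np I p e' <= q * Np I p e"
  proof (rule le_of_sq_le_mult)
    show "0 <= Np I p e'" by (rule Np_nonneg) (rule p0)
    have "0 <= Np I p e" by (rule Np_nonneg) (rule p0)
    then show "0 <= q * Np I p e" using q by simp
  qed
  also have "... <= q * (q ^ n * Np I p (%l. of_real (\<tau> / p l) * G l))"
    using Suc.IH q unfolding e_def by (intro mult_left_mono) auto
  finally show ?case unfolding e'_def by simp
qed

lemma rich_tail:
  assumes l: "l \<in> I"
  shows "(%n. rich I p \<tau> A G n l) \<longlonglongrightarrow> sol I p \<tau> A G l"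
    "norm (rich I p \<tau> A G n l - sol I p \<tau> A G l) <= q ^ n * (Np I p (%l. of_real (\<tau> / p l) * G l) / sqrt (p l) / (1 - q))"
proof -
  let ?w = "%n. rich I p \<tau> A G n l"
  define C where "C = Np I p (%l. of_real (\<tau> / p l) * G l) / sqrt (p l)"
  have d: "norm (?w (Suc n) - ?w n) <= q ^ n * C" for n
  proof -
    have "norm (?w (Suc n) - ?w n) <= Np I p (%l. rich I p \<tau> A G (Suc n) l - rich I p \<tau> A G n l) / sqrt (p l)"
      by (rule Np_component[OF I p l])
    also have "... <= q ^ n * Np I p (%l. of_real (\<tau> / p l) * G l) / sqrt (p l)"
      using rich_increment[of n] p[OF l] by (intro divide_right_mono) auto
    finally show ?thesis by (simp add: C_def)
  qed
  have sq: "summable (%n. q ^ n * C)" using q by (intro summable_mult2 summable_geometric) auto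
  have sm: "summable (%n. norm (?w (Suc n) - ?w n))"
    by (rule summable_comparison_test'[OF sq]) (use d in auto)
  then have s2: "summable (%n. ?w (Suc n) - ?w n)" by (rule summable_norm_cancel)
  have "(%n. (\<Sum>i<n. ?w (Suc i) - ?w i) + ?w 0) \<longlonglongrightarrow> (\<Sum>i. ?w (Suc i) - ?w i) + ?w 0"
    by (intro tendsto_add summable_LIMSEQ s2 tendsto_const)
  then have "?w \<longlonglongrightarrow> (\<Sum>i. ?w (Suc i) - ?w i) + ?w 0" by (simp only: sum_lessThan_telescope[of ?w]) simp
  then have "convergent ?w" by (rule convergentI)
  then show lim: "?w \<longlonglongrightarrow> sol I p \<tau> A G l" unfolding sol_def convergent_LIMSEQ_iff .
  have "(%k. norm (?w n - ?w (k + n))) \<longlonglongrightarrow> norm (?w n - sol I p \<tau> A G l)"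
    by (intro tendsto_intros LIMSEQ_ignore_initial_segment lim)
  moreover have "norm (?w n - ?w (k + n)) <= q ^ n * (C / (1 - q))" for k
  proof -
    have "?w (k + n) - ?w n = (\<Sum>i<k. ?w (Suc (i + n)) - ?w (i + n))"
      by (induction k) auto
    then have "norm (?w n - ?w (k + n)) <= (\<Sum>i<k. norm (?w (Suc (i + n)) - ?w (i + n)))"
      using norm_sum[of "%i. ?w (Suc (i + n)) - ?w (i + n)" "{..<k}"] by (subst norm_minus_commute) simp
    also have "... <= (\<Sum>i<k. q ^ n * C * q ^ i)"
    proof (rule sum_mono)
      fix i
      show "norm (?w (Suc (i + n)) - ?w (i + n)) <= q ^ n * C * q ^ i" using d[of "i + n"] by (simp only: power_add mult_ac)
    qed
    also have "... <= (\<Sum>i. q ^ n * C * q ^ i)"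
    proof (rule sum_le_suminf)
      show "summable (%i. q ^ n * C * q ^ i)" using q by (intro summable_mult summable_geometric) auto
      have "0 <= C" using d[of 0] norm_ge_zero[of "?w (Suc 0) - ?w 0"] by (simp only: power_0 mult_1_left)
      then show "0 <= q ^ n * C * q ^ i" for i using q by simp
    qed simp
    also have "... = q ^ n * C * (1 / (1 - q))"
      using q by (subst suminf_mult) (auto simp: suminf_geometric intro: summable_geometric)
    finally show ?thesis by simp
  qed
  ultimately show "norm (?w n - sol I p \<tau> A G l) <= q ^ n * (Np I p (%l. of_real (\<tau> / p l) * G l) / sqrt (p l) / (1 - q))"
    unfolding C_def by (intro LIMSEQ_le_const2) auto
qed

lemma sol_solves:
  assumes l: "l \<in> I"
  shows "mv I A (sol I p \<tau> A G) l = G l"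
proof -
  let ?w = "%n. rich I p \<tau> A G n"
  have "(%n. ?w (Suc n) l) \<longlonglongrightarrow> sol I p \<tau> A G l" by (rule LIMSEQ_Suc[OF rich_tail(1)[OF l]])
  moreover have "(%n. ?w (Suc n) l) \<longlonglongrightarrow> sol I p \<tau> A G l - of_real (\<tau> / p l) * (mv I A (sol I p \<tau> A G) l - G l)"
    unfolding rich.simps mv_def by (intro tendsto_diff tendsto_mult tendsto_const tendsto_sum rich_tail(1) l)
  ultimately have s: "sol I p \<tau> A G l = sol I p \<tau> A G l - of_real (\<tau> / p l) * (mv I A (sol I p \<tau> A G) l - G l)"
    by (rule LIMSEQ_unique)
  have z: "b = 0" if "a = a - b" for a b :: complex
    using that unfolding eq_diff_eq add_cancel_left_right .
  have e: "of_real (\<tau> / p l) * (mv I A (sol I p \<tau> A G) l - G l) = 0" by (rule z[OF s])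
  have nz: "complex_of_real (\<tau> / p l) ~= 0" unfolding of_real_eq_0_iff using tau p[OF l] by (intro less_imp_neq[symmetric] divide_pos_pos)
  from e have "complex_of_real (\<tau> / p l) = 0 \<or> mv I A (sol I p \<tau> A G) l - G l = 0" by (rule mult_eq_0_iff[THEN iffD1])
  then show ?thesis
  proof
    assume "complex_of_real (\<tau> / p l) = 0"
    with nz show ?thesis ..
  next
    assume "mv I A (sol I p \<tau> A G) l - G l = 0"
    then show ?thesis by (rule right_minus_eq[THEN iffD1])
  qed
qed

end

text \<open>The iterates are polynomial in the data and the convergence is uniform in \<open>y\<close>.\<close>

lemma upc_sol:
  fixes A :: "(nat => real) => 'k => 'k => complex"
  assumes I: "finite I" and p: "!!k. k \<in> I ==> p k > 0" and tau: "\<tau> > 0" and q: "0 <= q" "q < 1"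
    and contr: "!!y. y \<in> Iinf ==> contractive I p \<tau> q (A y)"
    and A: "!!l k. l \<in> I ==> k \<in> I ==> upc (%y. A y l k)" and G: "!!l. l \<in> I ==> upc (%y. G y l)"
    and l: "l \<in> I"
  shows "upc (%y. sol I p \<tau> (A y) (G y) l)"
proof -
  have r: "upc (%y. rich I p \<tau> (A y) (G y) n l)" if "l \<in> I" for n l
    using that
  proof (induction n arbitrary: l)
    case (Suc n)
    then show ?case unfolding rich.simps mv_def
      by (intro upc_diff upc_cmult upc_sum upc_mult A G I) auto
  qed (simp add: upc_const)
  have "\<exists>C\<ge>0. \<forall>y\<in>Iinf. norm (G y k) <= C" if "k \<in> I" for k
    using bm_bound[OF upc_bm[OF G[OF that]]] .
  then have "\<forall>k\<in>I. \<exists>C\<ge>0. \<forall>y\<in>Iinf. norm (G y k) <= C" by (rule ballI)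
  from bchoice[OF this] obtain C where C0: "\<forall>k\<in>I. C k \<ge> 0 \<and> (\<forall>y\<in>Iinf. norm (G y k) <= C k)" ..
  have C: "C k \<ge> 0 \<and> (\<forall>y\<in>Iinf. norm (G y k) <= C k)" if "k \<in> I" for k using C0 that by (rule bspec)
  define D where "D = sqrt (\<Sum>k\<in>I. p k * (\<tau> / p k * C k)\<^sup>2)"
  have D: "Np I p (%l. of_real (\<tau> / p l) * G y l) <= D" if y: "y \<in> Iinf" for y
    unfolding D_def Np_def
  proof (intro real_sqrt_le_mono sum_mono mult_left_mono power_mono)
    fix k assume k: "k \<in> I"
    have "norm (complex_of_real (\<tau> / p k) * G y k) = \<tau> / p k * norm (G y k)"
      using tau p[OF k] by (simp only: norm_mult norm_of_real) simp
    also have "... <= \<tau> / p k * C k" using C[OF k] y tau p[OF k] by (intro mult_left_mono) auto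
    finally show "norm (complex_of_real (\<tau> / p k) * G y k) <= \<tau> / p k * C k" .
    show "0 <= p k" using p[OF k] by simp
  qed simp
  show ?thesis
  proof (rule upc_uniform_limit)
    fix e :: real assume e: "e > 0"
    let ?K = "D / sqrt (p l) / (1 - q)"
    have "(%n. q ^ n * ?K) \<longlonglongrightarrow> 0 * ?K" using q by (intro tendsto_mult tendsto_const LIMSEQ_power_zero) auto
    then have "\<forall>\<^sub>F n in sequentially. q ^ n * ?K < e" using e by (intro order_tendstoD(2)) auto
    then obtain n where n: "q ^ n * ?K < e" using eventually_happens'[OF sequentially_bot] by blast
    have "norm (sol I p \<tau> (A y) (G y) l - rich I p \<tau> (A y) (G y) n l) <= e" if y: "y \<in> Iinf" for y
    proof -
      have "norm (sol I p \<tau> (A y) (G y) l - rich I p \<tau> (A y) (G y) n l) \<le>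
          q ^ n * (Np I p (%l. of_real (\<tau> / p l) * G y l) / sqrt (p l) / (1 - q))"
        using rich_tail(2)[OF I p tau q contr[OF y] l, of "G y" n] by (simp add: norm_minus_commute)
      also have "... <= q ^ n * ?K"
        using D[OF y] q p[OF l] by (intro mult_left_mono divide_right_mono) auto
      finally show ?thesis using n by simp
    qed
    with r[OF l, of n] show "\<exists>h. upc h \<and> (\<forall>y\<in>Iinf. norm (sol I p \<tau> (A y) (G y) l - h y) <= e)"
      by (intro exI[of _ "%y. rich I p \<tau> (A y) (G y) n l"] conjI ballI)
  qed
qed


section \<open>Galerkin matrices of trigonometric polynomials\<close>

definition cdot :: "complex ^ 'm => complex ^ 'm => complex" where
  "cdot a b = (\<Sum>i\<in>UNIV. a $ i * cnj (b $ i))"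

lemma norm_cdot_le: "norm (cdot a b) <= norm a * norm b"
proof -
  have "norm (cdot a b) <= (\<Sum>i\<in>UNIV. norm (a $ i) * norm (b $ i))"
    unfolding cdot_def by (rule sum_norm_le) (simp add: norm_mult)
  also have "... <= norm a * norm b"
    unfolding norm_vec_def using L2_set_mult_ineq[of "%i. norm (a $ i)" "%i. norm (b $ i)" UNIV] by simp
  finally show ?thesis .
qed

lemma cdot_self: "cdot a a = of_real ((norm a)\<^sup>2)"
  unfolding norm_vec_sq of_real_sum complex_norm_square cdot_def ..

lemma cdot_measurable:
  assumes "f \<in> borel_measurable M" "g \<in> borel_measurable M"
  shows "(%x. cdot (f x) (g x)) \<in> borel_measurable M"
proof -
  have c: "(%x. h x $ i) \<in> borel_measurable M" if "h \<in> borel_measurable M" for h :: "'a => complex ^ 'b" and i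
    by (rule measurable_compose[OF that borel_measurable_continuous_onI]) (intro continuous_intros)
  have d: "(%x. cnj (g x $ i)) \<in> borel_measurable M" for i
    by (rule measurable_compose[OF c[OF assms(2)] borel_measurable_continuous_onI]) (intro continuous_intros)
  show ?thesis unfolding cdot_def by (intro borel_measurable_sum borel_measurable_times c d assms)
qed

definition ghat :: "(real ^ 'm => real) => int ^ 'm => complex" where
  "ghat g k = (\<integral>x. of_real (g x) * efun k x \<partial>torus)"

text \<open>The Galerkin matrix of \<open>v \<mapsto> - div (g grad v)\<close> for the exponentials.\<close>

definition Am :: "(real ^ 'm => real) => int ^ 'm => int ^ 'm => complex" where
  "Am g l k = (\<Sum>i\<in>UNIV. dfac k i * cnj (dfac l i)) * ghat g (k - l)"

lemma int_tfun2:
  assumes "integrable torus G" "finite I"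
  shows "(\<integral>x. G x * (tfun I a x * cnj (tfun I v x)) \<partial>torus) =
    (\<Sum>l\<in>I. cnj (v l) * (\<Sum>k\<in>I. (\<integral>x. G x * efun (k - l) x \<partial>torus) * a k))"
    "integrable torus (%x. G x * (tfun I a x * cnj (tfun I v x)))"
proof -
  have e: "G x * (tfun I a x * cnj (tfun I v x)) = (\<Sum>l\<in>I. \<Sum>k\<in>I. (cnj (v l) * a k) * (G x * efun (k - l) x))" for x
  proof -
    have "tfun I a x * cnj (tfun I v x) = (\<Sum>k\<in>I. \<Sum>l\<in>I. (cnj (v l) * a k) * efun (k - l) x)"
      unfolding tfun_def cnj_sum sum_product complex_cnj_mult cnj_efun diff_conv_add_uminus efun_add by (simp add: mult_ac)
    then show ?thesis by (subst sum.swap) (simp add: sum_distrib_left mult_ac)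
  qed
  have i: "integrable torus (%x. (cnj (v l) * a k) * (G x * efun (k - l) x))" for k l
    by (intro integrable_mult_right integrable_mult_efun assms)
  have "(\<integral>x. G x * (tfun I a x * cnj (tfun I v x)) \<partial>torus) = (\<Sum>l\<in>I. \<Sum>k\<in>I. \<integral>x. (cnj (v l) * a k) * (G x * efun (k - l) x) \<partial>torus)"
    unfolding e using i by (simp only: Bochner_Integration.integral_sum Bochner_Integration.integrable_sum)
  also have "... = (\<Sum>l\<in>I. cnj (v l) * (\<Sum>k\<in>I. (\<integral>x. G x * efun (k - l) x \<partial>torus) * a k))"
    unfolding integral_mult_right_zero by (simp add: sum_distrib_left mult_ac)
  finally show "(\<integral>x. G x * (tfun I a x * cnj (tfun I v x)) \<partial>torus) =
    (\<Sum>l\<in>I. cnj (v l) * (\<Sum>k\<in>I. (\<integral>x. G x * efun (k - l) x \<partial>torus) * a k))" .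
  show "integrable torus (%x. G x * (tfun I a x * cnj (tfun I v x)))"
    unfolding e by (intro Bochner_Integration.integrable_sum i)
qed

lemma bil_Am:
  assumes g: "integrable torus g" and I: "finite I"
  shows "bil I (Am g) v w = (\<integral>x. of_real (g x) * cdot (gtfun I w x) (gtfun I v x) \<partial>torus)"
    "integrable torus (%x. of_real (g x) * cdot (gtfun I w x) (gtfun I v x))"
proof -
  have g': "integrable torus (%x. complex_of_real (g x))" using g by simp
  have e: "of_real (g x) * cdot (gtfun I w x) (gtfun I v x) =
      (\<Sum>i\<in>UNIV. of_real (g x) * (tfun I (%k. dfac k i * w k) x * cnj (tfun I (%k. dfac k i * v k) x)))" for x
    by (simp add: cdot_def gtfun_def sum_distrib_left)
  show "integrable torus (%x. of_real (g x) * cdot (gtfun I w x) (gtfun I v x))"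
    unfolding e by (intro Bochner_Integration.integrable_sum int_tfun2(2)[OF g' I])
  have "(\<integral>x. of_real (g x) * cdot (gtfun I w x) (gtfun I v x) \<partial>torus) =
      (\<Sum>i\<in>UNIV. \<Sum>l\<in>I. cnj (dfac l i * v l) * (\<Sum>k\<in>I. ghat g (k - l) * (dfac k i * w k)))"
    unfolding e ghat_def
    by (subst Bochner_Integration.integral_sum[OF int_tfun2(2)[OF g' I]]) (simp only: int_tfun2(1)[OF g' I])
  also have "... = (\<Sum>l\<in>I. \<Sum>i\<in>UNIV. \<Sum>k\<in>I. cnj (v l) * (dfac k i * cnj (dfac l i) * ghat g (k - l) * w k))"
    by (subst sum.swap) (simp add: sum_distrib_left mult_ac)
  also have "... = (\<Sum>l\<in>I. \<Sum>k\<in>I. \<Sum>i\<in>UNIV. cnj (v l) * (dfac k i * cnj (dfac l i) * ghat g (k - l) * w k))"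
    by (intro sum.cong refl sum.swap)
  also have "... = bil I (Am g) v w"
    by (simp add: bil_def mv_def Am_def sum_distrib_left sum_distrib_right mult_ac)
  finally show "bil I (Am g) v w = (\<integral>x. of_real (g x) * cdot (gtfun I w x) (gtfun I v x) \<partial>torus)" by simp
qed

lemma Np_gtfun:
  fixes I :: "(int ^ 'm) set"
  assumes "finite I"
  shows "Np I pk w = n2 torus (gtfun I w)"
  unfolding Np_def n2_gtfun[OF assms, symmetric] by (simp add: n2_nonneg)

lemma bil_Am_bound:
  assumes g: "integrable torus g" and I: "finite I" and C: "C \<ge> 0" "AE x in torus. \<bar>g x\<bar> <= C"
  shows "norm (bil I (Am g) v w) <= C * (Np I pk w * Np I pk v)"
  unfolding bil_Am(1)[OF g I] Np_gtfun[OF I]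
proof (rule l2_form(2)[OF gtfun_l2 gtfun_l2 _ C(1)])
  show "(%x. of_real (g x) * cdot (gtfun I w x) (gtfun I v x)) \<in> borel_measurable torus"
    by (rule borel_measurable_integrable[OF bil_Am(2)[OF g I]])
  show "AE x in torus. norm (of_real (g x) * cdot (gtfun I w x) (gtfun I v x)) <= C * (norm (gtfun I w x) * norm (gtfun I v x))"
    using C(2) by eventually_elim (auto simp: norm_mult intro!: mult_mono norm_cdot_le)
qed

lemma integral_ge_sq:
  fixes G :: "'x => real"
  assumes "l2 M F" "integrable M (%x. G x * (norm (F x))\<^sup>2)" "AE x in M. r <= G x"
  shows "r * (n2 M F)\<^sup>2 <= (\<integral>x. G x * (norm (F x))\<^sup>2 \<partial>M)"
proof -
  have "r * (n2 M F)\<^sup>2 = (\<integral>x. r * (norm (F x))\<^sup>2 \<partial>M)" by (simp add: n2_sq)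
  also have "... <= (\<integral>x. G x * (norm (F x))\<^sup>2 \<partial>M)"
  proof (rule integral_mono_AE)
    show "integrable M (%x. r * (norm (F x))\<^sup>2)" using assms(1) by (simp add: l2_def)
    show "AE x in M. r * (norm (F x))\<^sup>2 <= G x * (norm (F x))\<^sup>2"
      using assms(3) by eventually_elim (rule mult_right_mono, auto)
  qed (rule assms(2))
  finally show ?thesis .
qed

lemma bil_Am_coercive:
  assumes g: "integrable torus g" and I: "finite I" and r: "AE x in torus. r <= g x"
  shows "r * (Np I pk w)\<^sup>2 <= Re (bil I (Am g) w w)"
proof -
  have e: "of_real (g x) * cdot (gtfun I w x) (gtfun I w x) = of_real (g x * (norm (gtfun I w x))\<^sup>2)" for x
    by (simp only: cdot_self of_real_mult)
  have i: "integrable torus (%x. g x * (norm (gtfun I w x))\<^sup>2)"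
    using bil_Am(2)[OF g I, of w w] unfolding e complex_of_real_integrable_eq .
  have "bil I (Am g) w w = of_real (\<integral>x. g x * (norm (gtfun I w x))\<^sup>2 \<partial>torus)"
    unfolding bil_Am(1)[OF g I] e by (rule integral_complex_of_real)
  then show ?thesis unfolding Np_gtfun[OF I] using integral_ge_sq[OF gtfun_l2 i r] by simp
qed

lemma ghat_linear:
  assumes "integrable torus g" "integrable torus h"
  shows "ghat (%x. g x + c * h x) k = ghat g k + of_real c * ghat h k"
proof -
  have i: "integrable torus (%x. complex_of_real (g x))" "integrable torus (%x. complex_of_real (h x))" using assms by auto
  have "ghat (%x. g x + c * h x) k = (\<integral>x. of_real (g x) * efun k x + of_real c * (of_real (h x) * efun k x) \<partial>torus)"
    unfolding ghat_def by (simp add: algebra_simps)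
  also have "... = ghat g k + of_real c * ghat h k"
    unfolding ghat_def by (subst Bochner_Integration.integral_add)
      (auto intro!: integrable_mult_efun integrable_mult_right i simp del: of_real_mult)
  finally show ?thesis .
qed

lemma Am_linear:
  assumes "integrable torus g" "integrable torus h"
  shows "Am (%x. g x + c * h x) l k = Am g l k + of_real c * Am h l k"
  unfolding Am_def ghat_linear[OF assms] by (simp add: algebra_simps)

text \<open>The error matrix of the step is the Galerkin matrix of the coefficient \<open>1 - g / R\<close>, whose
  values lie between 0 and \<open>1 - r / R\<close>.\<close>

lemma Am_contractive:
  assumes g: "integrable torus g" and I: "finite I" and r: "0 < r" and gb: "AE x in torus. r <= g x \<and> g x <= R"
  shows "contractive I pk (1 / R) (1 - r / R) (Am g)" "0 <= 1 - r / R" "1 - r / R < 1" "R > 0"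
proof -
  have "AE x::real^'a in torus. r <= R" using gb by eventually_elim linarith
  then have rR: "r <= R" by (simp add: torus.AE_const)
  then show "0 <= 1 - r / R" "1 - r / R < 1" and R: "R > 0" using r by (auto simp: field_simps)
  show "contractive I pk (1 / R) (1 - r / R) (Am g)"
    unfolding contractive_def
  proof (intro allI)
    fix v w
    have i1: "integrable torus (%x::real^'a. 1 :: real)" by simp
    have lin: "bil I (Am (%x. 1 + (- 1 / R) * g x)) v w = bil I (Am (%x. 1)) v w - of_real (1 / R) * bil I (Am g) v w"
      unfolding bil_def mv_def Am_linear[OF i1 g]
      by (simp add: algebra_simps sum.distrib sum_distrib_left sum_subtractf sum_negf)
    have g1: "ghat (%x. 1) k = (if k = 0 then 1 else 0)" for k :: "int ^ 'a"
      using integral_efun[of k] by (simp add: ghat_def)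
    have "bil I (Am (%x. 1)) v w = (\<Sum>l\<in>I. cnj (v l) * (\<Sum>k\<in>I. if k = l then of_real (pk l) * w l else 0))"
      unfolding bil_def mv_def
      by (intro sum.cong refl arg_cong2[where f = "(*)"])
         (auto simp: Am_def g1 sum_dfac[symmetric] complex_norm_square simp del: of_real_power)
    also have "... = (\<Sum>l\<in>I. cnj (v l) * (of_real (pk l) * w l))" using I by (simp add: sum.delta)
    finally have one: "bil I (Am (%x. 1)) v w = (\<Sum>l\<in>I. cnj (v l) * (of_real (pk l) * w l))" .
    have "norm (bil I (Am (%x. 1 + (- 1 / R) * g x)) v w) <= (1 - r / R) * (Np I pk w * Np I pk v)"
    proof (rule bil_Am_bound[OF _ I])
      show "integrable torus (%x. 1 + (- 1 / R) * g x)" using g by simp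
      show "0 <= 1 - r / R" using rR R by (simp add: field_simps)
      show "AE x in torus. \<bar>1 + (- 1 / R) * g x\<bar> <= 1 - r / R"
        using gb
      proof eventually_elim
        case (elim x)
        then have "r / R <= g x / R" "g x / R <= 1" using R by (auto simp: divide_right_mono)
        then show ?case by simp
      qed
    qed
    then show "norm ((\<Sum>l\<in>I. cnj (v l) * (of_real (pk l) * w l)) - of_real (1 / R) * bil I (Am g) v w) <= (1 - r / R) * Np I pk v * Np I pk w"
      unfolding lin one by (simp add: mult_ac)
  qed
qed

text \<open>Moving one derivative from the test function: the form applied to \<open>w\<close> equals the integral of
  \<open>- div (g grad w)\<close> against the test function.\<close>

lemma bil_Am_parts:
  fixes g :: "real ^ 'm => real" and h :: "'m => real ^ 'm => real"
  assumes g: "integrable torus g" and h: "!!i. integrable torus (h i)" and wp: "!!i. weak_partial i g (h i)" and I: "finite I"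
  shows "bil I (Am g) v w = (\<integral>x. of_real (g x) * (tfun I (%k. of_real (pk k) * w k) x * cnj (tfun I v x)) \<partial>torus)
     - (\<Sum>i\<in>UNIV. \<integral>x. of_real (h i x) * (gtfun I w x $ i * cnj (tfun I v x)) \<partial>torus)"
proof -
  have g': "integrable torus (%x. complex_of_real (g x))" and h': "integrable torus (%x. complex_of_real (h i x))" for i
    using g h by auto
  have hh: "(\<integral>x. of_real (h i x) * efun k x \<partial>torus) = - dfac k i * ghat g k" for i k
    unfolding ghat_def by (rule weak_partial_fourier[OF weak_partial_of_real[OF wp] g' h'])
  have entry: "Am g l k = ghat g (k - l) * of_real (pk k) - (\<Sum>i\<in>UNIV. (- dfac (k - l) i * ghat g (k - l)) * dfac k i)" for l k
  proof -
    have "of_real (pk k) = (\<Sum>i\<in>UNIV. dfac k i * cnj (dfac k i))" by (simp only: sum_dfac[symmetric] of_real_sum complex_norm_square)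
    moreover have "cnj (dfac k i) = - dfac k i" for k :: "int ^ 'm" and i by (simp add: dfac_def)
    moreover have "dfac (k - l) i = dfac k i - dfac l i" for i by (simp add: dfac_def algebra_simps)
    ultimately show ?thesis
      by (simp add: Am_def sum_distrib_left sum_distrib_right sum_subtractf[symmetric]) (rule sum.cong[OF refl], simp add: algebra_simps)
  qed
  have 1: "(\<integral>x. of_real (g x) * (tfun I (%k. of_real (pk k) * w k) x * cnj (tfun I v x)) \<partial>torus) =
      (\<Sum>l\<in>I. cnj (v l) * (\<Sum>k\<in>I. ghat g (k - l) * (of_real (pk k) * w k)))"
    unfolding int_tfun2(1)[OF g' I] ghat_def ..
  have 2: "(\<Sum>i\<in>UNIV. \<integral>x. of_real (h i x) * (gtfun I w x $ i * cnj (tfun I v x)) \<partial>torus) =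
      (\<Sum>l\<in>I. cnj (v l) * (\<Sum>k\<in>I. \<Sum>i\<in>UNIV. (- dfac (k - l) i * ghat g (k - l)) * (dfac k i * w k)))"
  proof -
    have "(\<Sum>i\<in>UNIV. \<integral>x. of_real (h i x) * (gtfun I w x $ i * cnj (tfun I v x)) \<partial>torus) =
        (\<Sum>i\<in>UNIV. \<Sum>l\<in>I. cnj (v l) * (\<Sum>k\<in>I. (- dfac (k - l) i * ghat g (k - l)) * (dfac k i * w k)))"
      by (simp only: gtfun_def vec_lambda_beta int_tfun2(1)[OF h' I] hh)
    also have "... = (\<Sum>l\<in>I. \<Sum>i\<in>UNIV. cnj (v l) * (\<Sum>k\<in>I. (- dfac (k - l) i * ghat g (k - l)) * (dfac k i * w k)))"
      by (rule sum.swap)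
    also have "... = (\<Sum>l\<in>I. cnj (v l) * (\<Sum>k\<in>I. \<Sum>i\<in>UNIV. (- dfac (k - l) i * ghat g (k - l)) * (dfac k i * w k)))"
      unfolding sum_distrib_left[symmetric] by (intro sum.cong refl arg_cong2[where f = "(*)"] sum.swap)
    finally show ?thesis .
  qed
  show ?thesis
    unfolding 1 2 bil_def mv_def sum_subtractf[symmetric] right_diff_distrib[symmetric]
    unfolding entry left_diff_distrib sum_distrib_right by (simp only: mult_ac)
qed

lemma drift_bound:
  fixes h :: "'m => real ^ 'm => real"
  assumes h: "!!i. integrable torus (h i)" and b: "\<beta> \<ge> 0" "!!i. AE x in torus. \<bar>h i x\<bar> <= \<beta>" and I: "finite I"
  shows "norm (\<Sum>i\<in>UNIV. \<integral>x. of_real (h i x) * (gtfun I w x $ i * cnj (tfun I v x)) \<partial>torus)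
    <= \<beta> * sqrt (real CARD('m)) * Np I pk w * n2 torus (tfun I v)"
proof -
  have h': "integrable torus (%x. complex_of_real (h i x))" for i using h by auto
  have i: "integrable torus (%x. of_real (h i x) * (gtfun I w x $ i * cnj (tfun I v x)))" for i
    unfolding gtfun_def vec_lambda_beta by (rule int_tfun2(2)[OF h' I])
  have "(\<Sum>i\<in>UNIV. \<integral>x. of_real (h i x) * (gtfun I w x $ i * cnj (tfun I v x)) \<partial>torus) =
      (\<integral>x. (\<Sum>i\<in>UNIV. of_real (h i x) * (gtfun I w x $ i * cnj (tfun I v x))) \<partial>torus)"
    by (rule Bochner_Integration.integral_sum[symmetric]) (rule i)
  also have "norm ... <= (\<beta> * sqrt (real CARD('m))) * (n2 torus (gtfun I w) * n2 torus (tfun I v))"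
  proof (rule l2_form(2)[OF gtfun_l2 l2_tfun])
    show "(%x. \<Sum>i\<in>UNIV. of_real (h i x) * (gtfun I w x $ i * cnj (tfun I v x))) \<in> borel_measurable torus"
      by (rule borel_measurable_integrable) (intro Bochner_Integration.integrable_sum i)
    show "0 <= \<beta> * sqrt (real CARD('m))" using b by simp
    have "AE x in torus. \<forall>i\<in>UNIV. \<bar>h i x\<bar> <= \<beta>" by (rule AE_finite_allI) (use b in auto)
    then show "AE x in torus. norm (\<Sum>i\<in>UNIV. of_real (h i x) * (gtfun I w x $ i * cnj (tfun I v x)))
        <= \<beta> * sqrt (real CARD('m)) * (norm (gtfun I w x) * norm (tfun I v x))"
    proof eventually_elim
      case (elim x)
      have "norm (\<Sum>i\<in>UNIV. of_real (h i x) * (gtfun I w x $ i * cnj (tfun I v x))) \<le>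
          (\<Sum>i\<in>UNIV. \<beta> * (1 * norm (gtfun I w x $ i)) * norm (tfun I v x))"
        by (rule sum_norm_le) (use elim in \<open>auto simp: norm_mult mult.assoc intro!: mult_right_mono\<close>)
      also have "... = \<beta> * (\<Sum>i\<in>UNIV. \<bar>1\<bar> * \<bar>norm (gtfun I w x $ i)\<bar>) * norm (tfun I v x)"
        by (simp add: sum_distrib_left sum_distrib_right)
      also have "... <= \<beta> * (L2_set (%_. 1) (UNIV :: 'm set) * L2_set (%i. norm (gtfun I w x $ i)) UNIV) * norm (tfun I v x)"
        using b L2_set_mult_ineq[of "%_. 1" "%i. norm (gtfun I w x $ i)" "UNIV :: 'm set"] by (intro mult_right_mono mult_left_mono) auto
      also have "L2_set (%_. 1) (UNIV :: 'm set) = sqrt (real CARD('m))" by (simp add: L2_set_def)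
      finally show ?case by (simp add: norm_vec_def mult_ac)
    qed
  qed
  finally show ?thesis by (simp add: Np_gtfun[OF I] mult_ac)
qed

text \<open>The \<open>L2\<close> norm of the Laplacian of a trigonometric polynomial.\<close>

definition N2p :: "(int ^ 'm) set => (int ^ 'm => complex) => real" where
  "N2p I w = n2 torus (tfun I (%k. of_real (pk k) * w k))"

lemma N2p_nonneg: "N2p I w \<ge> 0"
  by (simp add: N2p_def n2_nonneg)

lemma N2p_sq: "finite I ==> (N2p I w)\<^sup>2 = (\<Sum>k\<in>I. (pk k)\<^sup>2 * (norm (w k))\<^sup>2)"
  by (simp add: N2p_def n2_tfun norm_mult power_mult_distrib)

lemma poincare2:
  fixes I :: "(int ^ 'm) set"
  assumes I: "finite I" "I \<subseteq> Zstar"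
  shows "sqrt (real CARD('m)) * Np I pk w <= N2p I w" "sqrt (real CARD('m)) * n2 torus (tfun I w) <= Np I pk w"
proof -
  have pk: "pk k \<ge> real CARD('m)" if "k \<in> I" for k
  proof -
    have "1 <= pi" using pi_gt3 by linarith
    then have "1 * 1 <= pi * pi" by (intro mult_mono) auto
    then have "1 * real CARD('m) <= (4 * pi\<^sup>2) * real CARD('m)" by (intro mult_right_mono) (auto simp: power2_eq_square)
    also have "... <= pk k" using that I by (intro pk_ge) auto
    finally show ?thesis by simp
  qed
  have pk0: "pk k \<ge> 0" for k :: "int ^ 'm" by (simp add: pk_def sum_nonneg)
  have "(sqrt (real CARD('m)) * Np I pk w)\<^sup>2 = (\<Sum>k\<in>I. real CARD('m) * (pk k * (norm (w k))\<^sup>2))"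
    by (simp add: power_mult_distrib Np_sq pk0 sum_distrib_left)
  also have "... <= (N2p I w)\<^sup>2"
    unfolding N2p_sq[OF I(1)] power2_eq_square[of "pk _"] mult.assoc using pk pk0 by (intro sum_mono mult_right_mono) auto
  finally show "sqrt (real CARD('m)) * Np I pk w <= N2p I w" by (rule power2_le_imp_le) (rule N2p_nonneg)
  have "(sqrt (real CARD('m)) * n2 torus (tfun I w))\<^sup>2 = (\<Sum>k\<in>I. real CARD('m) * (norm (w k))\<^sup>2)"
    by (simp add: power_mult_distrib n2_tfun I sum_distrib_left)
  also have "... <= (Np I pk w)\<^sup>2"
    unfolding Np_sq[OF pk0] using pk by (intro sum_mono mult_right_mono) auto
  finally show "sqrt (real CARD('m)) * n2 torus (tfun I w) <= Np I pk w" by (rule power2_le_imp_le) (rule Np_nonneg[OF pk0])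
qed

lemma bil_Am_bound2:
  fixes g :: "real ^ 'm => real" and h :: "'m => real ^ 'm => real"
  assumes g: "integrable torus g" and h: "!!i. integrable torus (h i)" and wp: "!!i. weak_partial i g (h i)" and I: "finite I"
    and C: "C \<ge> 0" "AE x in torus. \<bar>g x\<bar> <= C" and b: "\<beta> \<ge> 0" "!!i. AE x in torus. \<bar>h i x\<bar> <= \<beta>"
  shows "norm (bil I (Am g) v w) <= (C * N2p I w + \<beta> * sqrt (real CARD('m)) * Np I pk w) * n2 torus (tfun I v)"
proof -
  let ?P = "tfun I (%k. of_real (pk k) * w k)"
  have g': "integrable torus (%x. complex_of_real (g x))" using g by auto
  have "norm (\<integral>x. of_real (g x) * (?P x * cnj (tfun I v x)) \<partial>torus) <= C * (n2 torus ?P * n2 torus (tfun I v))"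
  proof (rule l2_form(2)[OF l2_tfun l2_tfun _ C(1)])
    show "(%x. of_real (g x) * (?P x * cnj (tfun I v x))) \<in> borel_measurable torus"
      by (rule borel_measurable_integrable[OF int_tfun2(2)[OF g' I]])
    show "AE x in torus. norm (of_real (g x) * (?P x * cnj (tfun I v x))) <= C * (norm (?P x) * norm (tfun I v x))"
      using C(2) by eventually_elim (auto simp: norm_mult intro!: mult_right_mono)
  qed
  moreover note drift_bound[OF h b I, of "%i. i" w v]
  ultimately show ?thesis
    unfolding bil_Am_parts[OF g h wp I] N2p_def
    by (intro order.trans[OF norm_triangle_ineq4]) (simp add: algebra_simps)
qed

text \<open>Testing with the Laplacian: control of second derivatives, up to a first order term that involves
  the derivatives of \<open>g\<close>. This is where the regularity of the coefficient enters.\<close>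

lemma bil_Am_coercive2:
  fixes g :: "real ^ 'm => real" and h :: "'m => real ^ 'm => real"
  assumes g: "integrable torus g" and h: "!!i. integrable torus (h i)" and wp: "!!i. weak_partial i g (h i)" and I: "finite I"
    and r: "AE x in torus. r <= g x" and b: "\<beta> \<ge> 0" "!!i. AE x in torus. \<bar>h i x\<bar> <= \<beta>"
  shows "r * (N2p I w)\<^sup>2 <= Re (bil I (Am g) (%k. of_real (pk k) * w k) w) + \<beta> * sqrt (real CARD('m)) * Np I pk w * N2p I w"
proof -
  let ?P = "tfun I (%k. of_real (pk k) * w k)"
  let ?D = "\<Sum>i\<in>UNIV. \<integral>x. of_real (h i x) * (gtfun I w x $ i * cnj (?P x)) \<partial>torus"
  have g': "integrable torus (%x. complex_of_real (g x))" using g by auto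
  have e: "of_real (g x) * (?P x * cnj (?P x)) = of_real (g x * (norm (?P x))\<^sup>2)" for x
    by (simp only: of_real_mult complex_norm_square)
  have i: "integrable torus (%x. g x * (norm (?P x))\<^sup>2)"
    using int_tfun2(2)[OF g' I, of "%k. of_real (pk k) * w k" "%k. of_real (pk k) * w k"] unfolding e complex_of_real_integrable_eq .
  have "bil I (Am g) (%k. of_real (pk k) * w k) w = of_real (\<integral>x. g x * (norm (?P x))\<^sup>2 \<partial>torus) - ?D"
    unfolding bil_Am_parts[OF g h wp I] e integral_complex_of_real ..
  then have "Re (bil I (Am g) (%k. of_real (pk k) * w k) w) = (\<integral>x. g x * (norm (?P x))\<^sup>2 \<partial>torus) - Re ?D" by simp
  moreover have "r * (N2p I w)\<^sup>2 <= (\<integral>x. g x * (norm (?P x))\<^sup>2 \<partial>torus)"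
    unfolding N2p_def by (rule integral_ge_sq[OF l2_tfun i r])
  moreover have "Re ?D <= \<beta> * sqrt (real CARD('m)) * Np I pk w * N2p I w"
    using drift_bound[OF h b I, of "%i. i" w "%k. of_real (pk k) * w k"] complex_Re_le_cmod[of ?D] unfolding N2p_def by linarith
  ultimately show ?thesis by linarith
qed


section \<open>Essentially bounded functions and their weak derivatives\<close>

lemma Linf_measurable: "v \<in> Linf_torus ==> v \<in> borel_measurable torus"
  by (simp add: Linf_torus_def)

lemma Linf_esssup:
  fixes v :: "real ^ 'm => real"
  assumes "v \<in> Linf_torus"
  shows "esssup torus (%x. ereal \<bar>v x\<bar>) = ereal (Linf_norm v)" "0 <= Linf_norm v"
proof -
  have fin: "esssup torus (%x. ereal \<bar>v x\<bar>) < \<infinity>" using assms by (simp add: Linf_torus_def)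
  have "AE x in torus. ereal \<bar>v x\<bar> <= esssup torus (%x. ereal \<bar>v x\<bar>)" by (rule esssup_AE)
  then have "AE x::real^'m in torus. 0 <= esssup torus (%x. ereal \<bar>v x\<bar>)"
    by eventually_elim (rule order_trans[of _ "ereal \<bar>v _\<bar>"], auto)
  then have nn: "0 <= esssup torus (%x. ereal \<bar>v x\<bar>)" by (simp add: torus.AE_const)
  show "esssup torus (%x. ereal \<bar>v x\<bar>) = ereal (Linf_norm v)" "0 <= Linf_norm v"
    unfolding Linf_norm_def using fin nn by (auto simp: ereal_real real_of_ereal_pos)
qed

lemma Linf_AE:
  assumes "v \<in> Linf_torus"
  shows "AE x in torus. \<bar>v x\<bar> <= Linf_norm v"
proof -
  have "AE x in torus. ereal \<bar>v x\<bar> <= esssup torus (%x. ereal \<bar>v x\<bar>)" by (rule esssup_AE)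
  then show ?thesis unfolding Linf_esssup(1)[OF assms] by simp
qed

lemma Linf_integrable:
  assumes "v \<in> Linf_torus"
  shows "integrable torus v"
  by (rule torus.integrable_const_bound[where B = "Linf_norm v"])
     (use Linf_AE[OF assms] Linf_measurable[OF assms] in auto)

lemma Linf_bounded:
  fixes v :: "real ^ 'm => real"
  assumes "periodic v" "v \<in> borel_measurable torus" "AE x in torus. \<bar>v x\<bar> <= C"
  shows "v \<in> Linf_torus" "Linf_norm v <= C"
proof -
  have le: "esssup torus (%x. ereal \<bar>v x\<bar>) <= ereal C"
    by (rule esssup_I) (use assms in auto)
  then have "esssup torus (%x. ereal \<bar>v x\<bar>) < \<infinity>" by (rule le_less_trans) simp
  then show v: "v \<in> Linf_torus" using assms by (simp add: Linf_torus_def)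
  show "Linf_norm v <= C" using le unfolding Linf_esssup(1)[OF v] by simp
qed

lemma W1inf_Linf: "v \<in> W1inf ==> v \<in> Linf_torus"
  by (simp add: W1inf_def)

lemma W1inf_integrable: "v \<in> W1inf ==> integrable torus v"
  by (rule Linf_integrable[OF W1inf_Linf])

text \<open>The weak derivative selected by \<open>wpartial\<close> agrees almost everywhere with a bounded one.\<close>

lemma W1inf_wpartial:
  fixes v :: "real ^ 'm => real"
  assumes v: "v \<in> W1inf"
  shows "wpartial i v \<in> Linf_torus" "weak_partial i v (wpartial i v)" "integrable torus (wpartial i v)"
    "AE x in torus. \<bar>wpartial i v x\<bar> <= W1inf_seminorm v"
proof -
  from v have "\<exists>w\<in>Linf_torus. weak_partial i v w" by (simp add: W1inf_def)
  then obtain w where w: "w \<in> Linf_torus" "weak_partial i v w" ..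
  have pw: "periodic w" using w(1) by (simp add: Linf_torus_def)
  note W = wpartial_works[OF pw Linf_integrable[OF w(1)] w(2)]
  have "AE x in torus. wpartial i v x = w x"
    by (rule wpartial_AE_real[OF pw Linf_integrable[OF w(1)] w(2) W1inf_integrable[OF v]])
  with Linf_AE[OF w(1)] have "AE x in torus. \<bar>wpartial i v x\<bar> <= Linf_norm w" by eventually_elim simp
  then show L: "wpartial i v \<in> Linf_torus" using W by (intro Linf_bounded(1)[where C = "Linf_norm w"]) auto
  show "weak_partial i v (wpartial i v)" "integrable torus (wpartial i v)" using W by auto
  have "Linf_norm (wpartial i v) <= W1inf_seminorm v" unfolding W1inf_seminorm_def by (rule Max_ge) auto
  with Linf_AE[OF L] show "AE x in torus. \<bar>wpartial i v x\<bar> <= W1inf_seminorm v" by (auto elim: eventually_mono)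
qed

lemma W1inf_seminorm_le:
  assumes "!!i. Linf_norm (wpartial i v) <= C"
  shows "W1inf_seminorm v <= C"
  unfolding W1inf_seminorm_def using assms by (subst Max_le_iff) auto

lemma W1inf_seminorm_nonneg: "v \<in> W1inf ==> 0 <= W1inf_seminorm v"
proof -
  assume v: "v \<in> W1inf"
  fix i
  have "0 <= Linf_norm (wpartial i v)" by (rule Linf_esssup(2)[OF W1inf_wpartial(1)[OF v]])
  also have "... <= W1inf_seminorm v" unfolding W1inf_seminorm_def by (rule Max_ge) auto
  finally show ?thesis .
qed

lemma W1inf_linear:
  fixes v w :: "real ^ 'm => real"
  assumes v: "v \<in> W1inf" and w: "w \<in> W1inf"
  shows "(%x. v x + c * w x) \<in> W1inf" "W1inf_seminorm (%x. v x + c * w x) <= W1inf_seminorm v + \<bar>c\<bar> * W1inf_seminorm w"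
proof -
  let ?u = "%x. v x + c * w x"
  have per: "periodic (%x. f x + c * g x)" if "f \<in> Linf_torus" "g \<in> Linf_torus" for f g :: "real ^ 'm => real"
    using that by (simp add: Linf_torus_def periodic_def)
  have bnd: "AE x in torus. \<bar>f x + c * g x\<bar> <= A + \<bar>c\<bar> * B"
    if "AE x in torus. \<bar>f x\<bar> <= A" "AE x in torus. \<bar>g x\<bar> <= B" for f g :: "real ^ 'm => real" and A B
    using that
  proof eventually_elim
    case (elim x)
    have "\<bar>f x + c * g x\<bar> <= \<bar>f x\<bar> + \<bar>c\<bar> * \<bar>g x\<bar>" by (metis abs_mult abs_triangle_ineq)
    also have "... <= A + \<bar>c\<bar> * B" using elim by (intro add_mono mult_left_mono) auto
    finally show ?case .
  qed
  have meas: "(%x. f x + c * g x) \<in> borel_measurable torus" if "f \<in> Linf_torus" "g \<in> Linf_torus" for f g :: "real ^ 'm => real"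
    using Linf_measurable[OF that(1)] Linf_measurable[OF that(2)] by measurable
  note v' = W1inf_Linf[OF v] and w' = W1inf_Linf[OF w]
  have u: "?u \<in> Linf_torus"
    by (rule Linf_bounded(1)[OF per[OF v' w'] meas[OF v' w'] bnd[OF Linf_AE[OF v'] Linf_AE[OF w']]])
  note pv = W1inf_wpartial[OF v] and pw = W1inf_wpartial[OF w]
  define g where "g i x = wpartial i v x + c * wpartial i w x" for i x
  have wp: "weak_partial i ?u (g i)" for i
    unfolding g_def
    by (rule weak_partial_add[OF pv(2) weak_partial_scale[OF pw(2)]])
       (use pv(3) pw(3) W1inf_integrable[OF v] W1inf_integrable[OF w] in auto)
  have gb: "AE x in torus. \<bar>g i x\<bar> <= W1inf_seminorm v + \<bar>c\<bar> * W1inf_seminorm w" for i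
    unfolding g_def by (rule bnd[OF pv(4) pw(4)])
  have gl: "g i \<in> Linf_torus" for i
    unfolding g_def by (rule Linf_bounded(1)[OF per[OF pv(1) pw(1)] meas[OF pv(1) pw(1)] bnd[OF pv(4) pw(4)]])
  show W: "?u \<in> W1inf" using u gl wp by (auto simp: W1inf_def)
  show "W1inf_seminorm ?u <= W1inf_seminorm v + \<bar>c\<bar> * W1inf_seminorm w"
  proof (rule W1inf_seminorm_le)
    fix i
    have "AE x in torus. wpartial i ?u x = g i x"
      by (rule wpartial_AE_real[OF _ Linf_integrable[OF gl] wp W1inf_integrable[OF W]]) (use gl in \<open>simp add: Linf_torus_def\<close>)
    with gb[of i] have "AE x in torus. \<bar>wpartial i ?u x\<bar> <= W1inf_seminorm v + \<bar>c\<bar> * W1inf_seminorm w" by eventually_elim simp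
    then show "Linf_norm (wpartial i ?u) <= W1inf_seminorm v + \<bar>c\<bar> * W1inf_seminorm w"
      using W1inf_wpartial(1)[OF W, of i] by (intro Linf_bounded(2)) (auto simp: Linf_torus_def)
  qed
qed

lemma W1inf_seminorm_triangle_abs:
  fixes v w :: "real ^ 'm => real"
  assumes v: "v \<in> W1inf" and w: "w \<in> W1inf"
  shows "\<bar>W1inf_seminorm v - W1inf_seminorm w\<bar> <= W1inf_norm (%x. v x - w x)"
proof -
  define e where "e x = v x - w x" for x
  have e: "e \<in> W1inf" using W1inf_linear(1)[OF v w, of "-1"] by (simp add: e_def[abs_def])
  have "v = (%x. w x + 1 * e x)" "w = (%x. v x + (-1) * e x)" by (auto simp: e_def)
  then have "W1inf_seminorm v <= W1inf_seminorm w + 1 * W1inf_seminorm e" "W1inf_seminorm w <= W1inf_seminorm v + 1 * W1inf_seminorm e"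
    using W1inf_linear(2)[OF w e, of 1] W1inf_linear(2)[OF v e, of "-1"] by simp_all
  then show ?thesis using Linf_esssup(2)[OF W1inf_Linf[OF e]] unfolding W1inf_norm_def e_def by linarith
qed

text \<open>The seminorm of \<open>a y\<close> is a measurable function of \<open>y\<close>, being a limit of simple functions. Without
  measurability the essential supremum would be infinite by convention and the constant meaningless.\<close>

lemma Linf_W1inf_seminorm_AE:
  assumes a: "a \<in> Linf_W1inf"
  shows "AE y in mu. W1inf_seminorm (a y) <= Linf_W1inf_seminorm a" "0 <= Linf_W1inf_seminorm a"
proof -
  have aW: "a y \<in> W1inf" if "y \<in> Iinf" for y using a that by (simp add: Linf_W1inf_def)
  have "strongly_measurable mu W1inf W1inf_norm a" using a by (simp add: Linf_W1inf_def)
  then obtain h where h: "!!n. simple_function mu (h n) \<and> h n ` space mu \<subseteq> W1inf"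
    "!!y. y \<in> space mu ==> (%n. W1inf_norm (%x. h n y x - a y x)) \<longlonglongrightarrow> 0"
    unfolding strongly_measurable_def by auto
  have meas: "(%y. W1inf_seminorm (a y)) \<in> borel_measurable mu"
  proof (rule borel_measurable_LIMSEQ_real)
    fix n show "(%y. W1inf_seminorm (h n y)) \<in> borel_measurable mu"
      by (rule borel_measurable_simple_function) (use simple_function_compose[of mu "h n" W1inf_seminorm] h(1) in \<open>simp add: comp_def\<close>)
  next
    fix y assume y: "y \<in> space mu"
    have "(%n. W1inf_seminorm (h n y) - W1inf_seminorm (a y)) \<longlonglongrightarrow> 0"
    proof (rule Lim_null_comparison[OF _ h(2)[OF y]])
      show "\<forall>\<^sub>F n in sequentially. norm (W1inf_seminorm (h n y) - W1inf_seminorm (a y)) <= W1inf_norm (%x. h n y x - a y x)"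
        unfolding real_norm_def
        by (rule always_eventually, rule allI, rule W1inf_seminorm_triangle_abs) (use h(1) y aW in \<open>auto simp: space_mu\<close>)
    qed
    then show "(%n. W1inf_seminorm (h n y)) \<longlonglongrightarrow> W1inf_seminorm (a y)" by (rule LIM_zero_cancel)
  qed
  let ?s = "esssup mu (%y. ereal (W1inf_seminorm (a y)))" and ?S = "esssup mu (%y. ereal (W1inf_norm (a y)))"
  have "AE y in mu. ereal (W1inf_norm (a y)) <= ?S" by (rule esssup_AE)
  then have "AE y in mu. ereal (W1inf_seminorm (a y)) <= ?S"
    using AE_space
  proof eventually_elim
    case (elim y)
    have "W1inf_seminorm (a y) <= W1inf_norm (a y)"
      using Linf_esssup(2)[OF W1inf_Linf[OF aW]] elim by (simp add: W1inf_norm_def space_mu)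
    then have "ereal (W1inf_seminorm (a y)) <= ereal (W1inf_norm (a y))" by simp
    then show ?case using elim(1) by (rule order_trans)
  qed
  then have "?s <= ?S" using meas by (intro esssup_I) auto
  moreover have "?S < \<infinity>" using a by (simp add: Linf_W1inf_def)
  ultimately have fin: "?s < \<infinity>" by (rule le_less_trans)
  have AE: "AE y in mu. ereal (W1inf_seminorm (a y)) <= ?s" by (rule esssup_AE)
  then have "AE y in mu. 0 <= ?s"
    using AE_space
  proof eventually_elim
    case (elim y)
    have "0 <= ereal (W1inf_seminorm (a y))" using W1inf_seminorm_nonneg[OF aW] elim by (simp add: space_mu)
    then show ?case using elim(1) by (rule order_trans)
  qed
  then have nn: "0 <= ?s" by (simp add: mu.AE_const)
  have e: "?s = ereal (Linf_W1inf_seminorm a)" unfolding Linf_W1inf_seminorm_def using fin nn by (auto simp: ereal_real)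
  show "AE y in mu. W1inf_seminorm (a y) <= Linf_W1inf_seminorm a" using AE unfolding e by simp
  show "0 <= Linf_W1inf_seminorm a" using nn unfolding e by simp
qed


section \<open>The semidiscrete problem and its derivatives in the parameter\<close>

text \<open>The hypotheses on the data. Below, \<open>\<Gamma>\<close>, \<open>\<alpha>\<close> and \<open>\<beta>\<close> are the norms of \<open>a\<close> and the
  \<open>\<psi> j\<close>, and \<open>M y\<close>, \<open>S j\<close> are the Galerkin matrices of \<open>a y\<close> and \<open>\<psi> j\<close>.\<close>

locale affine_problem =
  fixes f :: "real ^ 'm => complex" and a :: "(nat => real) => real ^ 'm => real"
    and abar :: "real ^ 'm => real" and \<psi> :: "nat => real ^ 'm => real" and r R :: real
  assumes f: "f \<in> L2_torus" and a: "a \<in> Linf_W1inf" and r: "0 < r"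
    and a_bounds: "!!x y. y \<in> Iinf ==> r < a y x \<and> a y x <= R"
    and abar: "abar \<in> W1inf" and psi: "!!j. \<psi> j \<in> W1inf"
    and affine: "!!x y. y \<in> Iinf ==> (%j. y j * \<psi> j x) sums (a y x - abar x)"
    and psi_sum: "summable (%j. Linf_norm (\<psi> j))"
begin

abbreviation \<Gamma> :: real where "\<Gamma> \<equiv> Linf_W1inf_seminorm a"
abbreviation \<alpha> :: "nat => real" where "\<alpha> j \<equiv> Linf_norm (\<psi> j)"
abbreviation \<beta> :: "nat => real" where "\<beta> j \<equiv> W1inf_seminorm (\<psi> j)"
abbreviation M :: "(nat => real) => int ^ 'm => int ^ 'm => complex" where "M y \<equiv> Am (a y)"
abbreviation S :: "nat => int ^ 'm => int ^ 'm => complex" where "S j \<equiv> Am (\<psi> j)"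

lemma alpha_nonneg: "0 <= \<alpha> j" by (rule Linf_esssup(2)[OF W1inf_Linf[OF psi]])
lemma beta_nonneg: "0 <= \<beta> j" by (rule W1inf_seminorm_nonneg[OF psi])
lemma Gamma_nonneg: "0 <= \<Gamma>" by (rule Linf_W1inf_seminorm_AE(2)[OF a])
lemma a_W1inf: "y \<in> Iinf ==> a y \<in> W1inf" using a by (simp add: Linf_W1inf_def)
lemma a_integrable: "y \<in> Iinf ==> integrable torus (a y)" by (rule W1inf_integrable[OF a_W1inf])
lemma psi_integrable: "integrable torus (\<psi> j)" by (rule W1inf_integrable[OF psi])
lemma a_AE: "y \<in> Iinf ==> AE x in torus. r <= a y x \<and> a y x <= R" using a_bounds[of y] by (auto intro: less_imp_le)

lemma zero_Iinf: "(%_. 0) \<in> Iinf" by (simp add: Iinf_def)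

lemma rR: "r <= R" "0 < R"
  using a_bounds[OF zero_Iinf, of 0] r by auto

text \<open>Although the expansion is infinite, changing one coordinate changes one term.\<close>

lemma a_upd:
  assumes y: "y \<in> Iinf" and t: "y(j := t) \<in> Iinf"
  shows "a (y(j := t)) x = a y x + (t - y j) * \<psi> j x"
proof -
  have "(%i. (y(j := t)) i * \<psi> i x - y i * \<psi> i x) sums (a (y(j := t)) x - abar x - (a y x - abar x))"
    by (intro sums_diff affine y t)
  moreover have "(%i. (y(j := t)) i * \<psi> i x - y i * \<psi> i x) = (%i. if i = j then (t - y j) * \<psi> j x else 0)"
    by (auto simp: left_diff_distrib)
  ultimately have "(%i. if i = j then (t - y j) * \<psi> j x else 0) sums (a (y(j := t)) x - abar x - (a y x - abar x))" by simp
  from sums_unique2[OF this sums_single] show ?thesis by simp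
qed

lemma M_upd:
  assumes y: "y \<in> Iinf" and t: "y(j := t) \<in> Iinf"
  shows "M (y(j := t)) l k = M y l k + of_real (t - y j) * S j l k"
proof -
  have "a (y(j := t)) = (%x. a y x + (t - y j) * \<psi> j x)" using a_upd[OF y t] by auto
  then show ?thesis using Am_linear[OF a_integrable[OF y] psi_integrable] by simp
qed

lemma mv_M_upd:
  assumes y: "y \<in> Iinf" and t: "y(j := t) \<in> Iinf"
  shows "mv I (M (y(j := t))) w l = mv I (M y) w l + of_real (t - y j) * mv I (S j) w l"
  unfolding mv_def M_upd[OF y t] distrib_right sum.distrib sum_distrib_left mult.assoc ..

text \<open>Truncation of the affine expansion is uniform in \<open>y\<close> since the norms of the \<open>\<psi> j\<close> are summable.\<close>

lemma ghat_a_upc: "upc (%y. ghat (a y) k)"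
proof (rule upc_uniform_limit)
  fix e :: real assume e: "e > 0"
  have "\<exists>N. \<forall>n\<ge>N. norm (\<Sum>i. \<alpha> (i + n)) < e" by (rule suminf_exist_split[OF e psi_sum])
  then obtain n where n0: "norm (\<Sum>i. \<alpha> (i + n)) < e" by auto
  then have n: "(\<Sum>i. \<alpha> (i + n)) <= e" by simp
  define h where "h y = ghat abar k + (\<Sum>j<n. of_real (y j) * ghat (\<psi> j) k)" for y
  have "upc h" unfolding h_def
    by (intro upc_add upc_const upc_sum upc_mult upc_ypoly[OF ypoly.coord]) auto
  moreover have "norm (ghat (a y) k - h y) <= e" if y: "y \<in> Iinf" for y
  proof -
    define p where "p x = a y x - abar x - (\<Sum>j<n. y j * \<psi> j x)" for x
    have ip: "integrable torus p" unfolding p_def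
      by (intro Bochner_Integration.integrable_diff Bochner_Integration.integrable_sum integrable_mult_right a_integrable y W1inf_integrable abar psi)
    have "AE x in torus. \<forall>j. \<bar>\<psi> j x\<bar> <= \<alpha> j" unfolding AE_all_countable using Linf_AE[OF W1inf_Linf[OF psi]] by auto
    then have pe: "AE x in torus. norm (p x) <= e"
    proof eventually_elim
      case (elim x)
      have "(%i. y (i + n) * \<psi> (i + n) x) sums p x"
        using sums_split_initial_segment[OF affine[OF y, of x], of n] by (simp add: p_def)
      then have eq: "p x = (\<Sum>i. y (i + n) * \<psi> (i + n) x)" by (simp add: sums_iff)
      have b: "norm (y (i + n) * \<psi> (i + n) x) <= \<alpha> (i + n)" for i
      proof -
        have "\<bar>y (i + n)\<bar> <= 1" using y by (auto simp: Iinf_def abs_le_iff minus_le_iff)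
        then have "\<bar>y (i + n)\<bar> * \<bar>\<psi> (i + n) x\<bar> <= 1 * \<alpha> (i + n)" using elim by (intro mult_mono) auto
        then show ?thesis by (simp add: abs_mult)
      qed
      have "norm (p x) <= (\<Sum>i. \<alpha> (i + n))"
        unfolding eq by (rule norm_suminf_le[OF b]) (rule summable_ignore_initial_segment[OF psi_sum])
      then show ?case using n by simp
    qed
    have e1: "ghat abar k + of_real 1 * ghat (%x. \<Sum>j<n. y j * \<psi> j x) k = h y"
    proof -
      have "ghat (%x. \<Sum>j<n. y j * \<psi> j x) k = (\<Sum>j<n. of_real (y j) * ghat (\<psi> j) k)"
      proof (induction n)
        case 0
        then show ?case by (simp add: ghat_def)
      next
        case (Suc n)
        have "ghat (%x. (\<Sum>j<n. y j * \<psi> j x) + y n * \<psi> n x) k = ghat (%x. \<Sum>j<n. y j * \<psi> j x) k + of_real (y n) * ghat (\<psi> n) k"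
          by (intro ghat_linear Bochner_Integration.integrable_sum integrable_mult_right psi_integrable)
        then show ?case using Suc by simp
      qed
      then show ?thesis by (simp add: h_def)
    qed
    have isum: "integrable torus (%x. \<Sum>j<n. y j * \<psi> j x)"
      by (intro Bochner_Integration.integrable_sum integrable_mult_right psi_integrable)
    have "a y = (%x. (abar x + 1 * (\<Sum>j<n. y j * \<psi> j x)) + 1 * p x)" by (auto simp: p_def)
    then have "ghat (a y) k = ghat (%x. (abar x + 1 * (\<Sum>j<n. y j * \<psi> j x)) + 1 * p x) k" by simp
    also have "... = ghat (%x. abar x + 1 * (\<Sum>j<n. y j * \<psi> j x)) k + of_real 1 * ghat p k"
      by (rule ghat_linear) (use W1inf_integrable[OF abar] isum ip in auto)
    also have "ghat (%x. abar x + 1 * (\<Sum>j<n. y j * \<psi> j x)) k = h y"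
      unfolding e1[symmetric] by (rule ghat_linear[OF W1inf_integrable[OF abar] isum])
    finally have "ghat (a y) k - h y = ghat p k" by simp
    also have "norm ... <= (\<integral>x. norm (of_real (p x) * efun k x) \<partial>torus)"
      unfolding ghat_def by (rule integral_norm_bound)
    also have "... <= (\<integral>x. e \<partial>(torus :: (real ^ 'm) measure))"
    proof (rule integral_mono_AE)
      have ipc: "integrable torus (%x. complex_of_real (p x))" using ip by auto
      show "integrable torus (%x. norm (complex_of_real (p x) * efun k x))"
        by (rule integrable_norm[OF integrable_mult_efun[OF ipc]])
      show "AE x in torus. norm (complex_of_real (p x) * efun k x) <= e" using pe by eventually_elim (simp add: norm_mult)
    qed simp
    finally show ?thesis by simp
  qed
  ultimately show "\<exists>h. upc h \<and> (\<forall>y\<in>Iinf. norm (ghat (a y) k - h y) <= e)" by (intro exI[of _ h]) auto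
qed

lemma M_upc: "upc (%y. M y l k)"
  unfolding Am_def by (intro upc_cmult ghat_a_upc)

lemma f_pairing:
  assumes I: "finite I"
  shows "(\<Sum>l\<in>I. cnj (v l) * fc f l) = (\<integral>x. f x * cnj (tfun I v x) \<partial>torus)"
    "norm (\<Sum>l\<in>I. cnj (v l) * fc f l) <= n2 torus f * n2 torus (tfun I v)"
    "integrable torus (%x. f x * cnj (tfun I v x))"
proof -
  have fl: "l2 torus f" using f by (simp add: L2_torus_l2)
  have fi: "integrable torus f" by (rule torus.l2_integrable(1)[OF fl])
  have e: "f x * cnj (tfun I v x) = (\<Sum>l\<in>I. cnj (v l) * (f x * efun (- l) x))" for x
    by (simp add: tfun_def cnj_efun sum_distrib_left mult_ac)
  have i: "integrable torus (%x. f x * efun k x)" for k by (rule integrable_mult_efun[OF fi])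
  show int: "integrable torus (%x. f x * cnj (tfun I v x))" unfolding e by (intro Bochner_Integration.integrable_sum integrable_mult_right i)
  show eq: "(\<Sum>l\<in>I. cnj (v l) * fc f l) = (\<integral>x. f x * cnj (tfun I v x) \<partial>torus)"
    unfolding e fc_def cnj_efun using i by (simp add: Bochner_Integration.integral_sum)
  have "norm (\<integral>x. f x * cnj (tfun I v x) \<partial>torus) <= 1 * (n2 torus f * n2 torus (tfun I v))"
    by (rule l2_form(2)[OF fl l2_tfun]) (auto simp: norm_mult intro: borel_measurable_integrable[OF int])
  then show "norm (\<Sum>l\<in>I. cnj (v l) * fc f l) <= n2 torus f * n2 torus (tfun I v)" unfolding eq by simp
qed

end

text \<open>The equation for the derivative of order \<open>s\<close> plus the unit vector in direction \<open>j\<close> has one copy of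
  \<open>X j s\<close> more than the derivative of the equation of order \<open>s\<close> would suggest. That copy comes from
  differentiating the coefficient.\<close>

lemma sum_unit_shift:
  fixes X :: "nat => (nat => nat) => complex" and j :: nat
  assumes "s \<in> finsupp"
  defines "s' \<equiv> s(j := Suc (s j))"
  shows "(\<Sum>i | s' i ~= 0. of_nat (s' i) * X i (s'(i := s' i - 1))) =
    X j s + (\<Sum>i | s i ~= 0. of_nat (s i) * X i ((s(i := s i - 1))(j := Suc ((s(i := s i - 1)) j))))"
proof -
  let ?J = "insert j {i. s i ~= 0}"
  let ?t = "%i. (s(i := s i - 1))(j := Suc ((s(i := s i - 1)) j))"
  have fin: "finite {i. s i ~= 0}" by (rule finsupp_finite[OF assms(1)])
  have "{i. s' i ~= 0} = ?J" by (auto simp: s'_def)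
  then have "(\<Sum>i | s' i ~= 0. of_nat (s' i) * X i (s'(i := s' i - 1))) = (\<Sum>i\<in>?J. of_nat (s' i) * X i (s'(i := s' i - 1)))" by simp
  also have "... = (\<Sum>i\<in>?J. (if i = j then X j s else 0) + of_nat (s i) * X i (?t i))"
  proof (rule sum.cong[OF refl])
    fix i
    show "of_nat (s' i) * X i (s'(i := s' i - 1)) = (if i = j then X j s else 0) + of_nat (s i) * X i (?t i)"
    proof (cases "i = j")
      case True
      have "s'(j := s' j - 1) = s" by (auto simp: s'_def)
      moreover have "s j ~= 0 ==> ?t j = s" by auto
      ultimately show ?thesis unfolding True by (cases "s j = 0") (auto simp: s'_def algebra_simps)
    next
      case False
      then have "s'(i := s' i - 1) = ?t i" "s' i = s i" by (auto simp: s'_def)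
      then show ?thesis using False by simp
    qed
  qed
  also have "... = X j s + (\<Sum>i\<in>?J. of_nat (s i) * X i (?t i))"
    using fin by (simp only: sum.distrib sum.delta finite_insert insertI1 if_True)
  also have "(\<Sum>i\<in>?J. of_nat (s i) * X i (?t i)) = (\<Sum>i | s i ~= 0. of_nat (s i) * X i (?t i))"
    by (rule sum.mono_neutral_right) (use fin in auto)
  finally show ?thesis .
qed

lemma vector_derivative_quadratic:
  fixes g :: "real => 'b :: real_normed_vector"
  assumes "!!t. t \<in> T ==> norm (g t - g t0 - (t - t0) *\<^sub>R D) <= C * (t - t0)\<^sup>2"
  shows "(g has_vector_derivative D) (at t0 within T)"
  unfolding has_vector_derivative_def
proof (rule has_derivativeI_sandwich[where e = 1 and H = "%t. C * \<bar>t - t0\<bar>"])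
  fix t assume t: "t \<in> T" "t ~= t0"
  have "norm (g t - g t0 - (t - t0) *\<^sub>R D) <= C * \<bar>t - t0\<bar> * \<bar>t - t0\<bar>"
    using assms[OF t(1)] by (simp only: power2_eq_square[of "t - t0"] abs_mult_self_eq mult.assoc)
  then show "norm (g t - g t0 - (t - t0) *\<^sub>R D) / norm (t - t0) <= C * \<bar>t - t0\<bar>"
    using t(2) by (simp add: pos_divide_le_eq)
next
  have "((%t. C * \<bar>t - t0\<bar>) \<longlongrightarrow> C * \<bar>t0 - t0\<bar>) (at t0 within T)" by (intro tendsto_intros)
  then show "((%t. C * \<bar>t - t0\<bar>) \<longlongrightarrow> 0) (at t0 within T)" by simp
qed (auto intro: bounded_linear_scaleR_left)


context affine_problem
begin

text \<open>\<open>W I n s y\<close> solves the equation for the mixed derivative of order \<open>s\<close> of the semidiscrete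
  solution. The recursion runs over \<open>n = msize s\<close>.\<close>

primrec W :: "(int ^ 'm) set => nat => (nat => nat) => (nat => real) => int ^ 'm => complex" where
  "W I 0 = (%s y. sol I pk (1 / R) (M y) (fc f))"
| "W I (Suc n) = (%s y. sol I pk (1 / R) (M y)
     (%l. - (\<Sum>i | s i ~= 0. of_nat (s i) * mv I (S i) (W I n (s(i := s i - 1)) y) l)))"

declare W.simps [simp del]

context
  fixes I :: "(int ^ 'm) set"
  assumes I: "finite I" "I \<subseteq> Zstar"
begin

lemma pk_pos_I: "k \<in> I ==> pk k > 0" using I(2) pk_pos by auto
lemma pk_nonneg_I: "k \<in> I ==> pk k \<ge> 0" using pk_pos_I[of k] by simp

lemma Np_pos: "Np I pk w \<ge> 0" by (rule Np_nonneg) (rule pk_nonneg_I)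

lemmas M_contractive = Am_contractive[OF a_integrable I(1) r a_AE]

lemma one_R: "1 / R > 0" using rR by simp

lemma W_0: "y \<in> Iinf ==> l \<in> I ==> mv I (M y) (W I 0 s y) l = fc f l"
  unfolding W.simps
  by (rule sol_solves[OF I(1) pk_pos_I one_R M_contractive(2,3,1)])

lemma W_Suc: "y \<in> Iinf ==> l \<in> I ==> mv I (M y) (W I (Suc n) s y) l =
    - (\<Sum>i | s i ~= 0. of_nat (s i) * mv I (S i) (W I n (s(i := s i - 1)) y) l)"
  unfolding W.simps
  by (rule sol_solves[OF I(1) pk_pos_I one_R M_contractive(2,3,1)])

lemma W_upc: "s \<in> finsupp ==> k \<in> I ==> upc (%y. W I n s y k)"
proof (induction n arbitrary: s k)
  case 0
  show ?case unfolding W.simps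
    by (rule upc_sol[OF I(1) pk_pos_I one_R M_contractive(2,3)[OF zero_Iinf zero_Iinf] M_contractive(1) M_upc upc_const])
       (use 0 in auto)
next
  case (Suc n)
  have fin: "finite {i. s i ~= 0}" by (rule finsupp_finite[OF Suc.prems(1)])
  show ?case unfolding W.simps
  proof (rule upc_sol[OF I(1) pk_pos_I one_R M_contractive(2,3)[OF zero_Iinf zero_Iinf] M_contractive(1) M_upc])
    fix l assume "l \<in> I"
    show "upc (%y. - (\<Sum>i | s i ~= 0. of_nat (s i) * mv I (S i) (W I n (s(i := s i - 1)) y) l))"
      unfolding mv_def
      by (intro upc_minus upc_sum upc_cmult fin I(1) Suc.IH finsupp_upd Suc.prems(1)) auto
  qed (use Suc.prems in auto)
qed

lemma bil_rhs:
  assumes "!!l. l \<in> I ==> mv I A w l = (\<Sum>i\<in>X. c i * mv I (B i) (e i) l) + c' * mv I B' e' l"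
  shows "bil I A v w = (\<Sum>i\<in>X. c i * bil I (B i) v (e i)) + c' * bil I B' v e'"
proof -
  have "bil I A v w = (\<Sum>l\<in>I. (\<Sum>i\<in>X. c i * (cnj (v l) * mv I (B i) (e i) l)) + c' * (cnj (v l) * mv I B' e' l))"
    unfolding bil_def by (rule sum.cong[OF refl]) (simp add: assms distrib_left sum_distrib_left mult.left_commute)
  also have "... = (\<Sum>i\<in>X. c i * bil I (B i) v (e i)) + c' * bil I B' v e'"
    unfolding sum.distrib bil_def sum_distrib_left by (subst sum.swap) (rule refl)
  finally show ?thesis .
qed

text \<open>Energy estimate: test the equation with its solution.\<close>

lemma energy1:
  assumes y: "y \<in> Iinf" and X: "finite X"
    and eq: "!!l. l \<in> I ==> mv I (M y) w l = (\<Sum>i\<in>X. c i * mv I (S i) (e i) l) + c' * mv I (S j) e' l"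
  shows "r * Np I pk w <= (\<Sum>i\<in>X. norm (c i) * (\<alpha> i * Np I pk (e i))) + norm c' * (\<alpha> j * Np I pk e')"
proof (rule le_of_sq_le_mult)
  have b: "norm (bil I (S i) w v) <= \<alpha> i * (Np I pk v * Np I pk w)" for i v
    by (rule bil_Am_bound[OF psi_integrable I(1) alpha_nonneg Linf_AE[OF W1inf_Linf[OF psi]]])
  have "r * (Np I pk w)\<^sup>2 <= Re (bil I (M y) w w)"
    by (rule bil_Am_coercive[OF a_integrable[OF y] I(1)]) (use a_AE[OF y] in auto)
  also have "... <= norm (bil I (M y) w w)" by (rule complex_Re_le_cmod)
  also have "... = norm ((\<Sum>i\<in>X. c i * bil I (S i) w (e i)) + c' * bil I (S j) w e')" by (subst bil_rhs[OF eq]) auto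
  also have "... <= (\<Sum>i\<in>X. norm (c i) * (\<alpha> i * (Np I pk (e i) * Np I pk w))) + norm c' * (\<alpha> j * (Np I pk e' * Np I pk w))"
    by (intro order_trans[OF norm_triangle_ineq add_mono] sum_norm_le) (auto simp only: norm_mult intro!: mult_left_mono b norm_ge_zero)
  also have "... = ((\<Sum>i\<in>X. norm (c i) * (\<alpha> i * Np I pk (e i))) + norm c' * (\<alpha> j * Np I pk e')) * Np I pk w"
    by (simp only: distrib_right sum_distrib_right mult.assoc)
  finally show "r * (Np I pk w)\<^sup>2 <= ((\<Sum>i\<in>X. norm (c i) * (\<alpha> i * Np I pk (e i))) + norm c' * (\<alpha> j * Np I pk e')) * Np I pk w" .
  show "0 <= (\<Sum>i\<in>X. norm (c i) * (\<alpha> i * Np I pk (e i))) + norm c' * (\<alpha> j * Np I pk e')"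
    by (intro add_nonneg_nonneg sum_nonneg mult_nonneg_nonneg norm_ge_zero alpha_nonneg Np_pos)
qed (rule Np_pos)

text \<open>Second order estimate: test the equation with the Laplacian of its solution.\<close>

lemma energy2:
  assumes y: "y \<in> Iinf" and G: "W1inf_seminorm (a y) <= \<Gamma>" and rhs: "0 <= B" "norm (bil I (M y) (%k. of_real (pk k) * w k) w) <= B * N2p I w"
  shows "r * N2p I w <= B + \<Gamma> * sqrt (real CARD('m)) * Np I pk w"
proof (rule le_of_sq_le_mult)
  note aW = a_W1inf[OF y]
  have h: "AE x in torus. \<bar>wpartial i (a y) x\<bar> <= \<Gamma>" for i
    using W1inf_wpartial(4)[OF aW, of i] by eventually_elim (use G in linarith)
  have "r * (N2p I w)\<^sup>2 <= Re (bil I (M y) (%k. of_real (pk k) * w k) w) + \<Gamma> * sqrt (real CARD('m)) * Np I pk w * N2p I w"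
    by (rule bil_Am_coercive2[OF a_integrable[OF y] W1inf_wpartial(3)[OF aW] W1inf_wpartial(2)[OF aW] I(1) _ Gamma_nonneg h])
       (use a_AE[OF y] in auto)
  also have "... <= B * N2p I w + \<Gamma> * sqrt (real CARD('m)) * Np I pk w * N2p I w"
    using order_trans[OF complex_Re_le_cmod rhs(2)] by simp
  finally show "r * (N2p I w)\<^sup>2 <= (B + \<Gamma> * sqrt (real CARD('m)) * Np I pk w) * N2p I w" by (simp only: distrib_right)
  show "0 <= B + \<Gamma> * sqrt (real CARD('m)) * Np I pk w"
    by (intro add_nonneg_nonneg mult_nonneg_nonneg rhs(1) Gamma_nonneg Np_pos) simp
qed (rule N2p_nonneg)

abbreviation \<delta> :: "nat => real" where "\<delta> j \<equiv> ((\<Gamma> / r + 2) * \<alpha> j + \<beta> j) / r"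
abbreviation K0 :: real where "K0 \<equiv> (1 + \<Gamma> / r) * n2 torus f / r"

lemma delta_nonneg: "0 <= \<delta> j"
  using r Gamma_nonneg alpha_nonneg[of j] beta_nonneg[of j] by simp

lemma W_0_bounds:
  assumes y: "y \<in> Iinf"
  shows "sqrt (real CARD('m)) * Np I pk (W I 0 s y) <= n2 torus f / r"
    "W1inf_seminorm (a y) <= \<Gamma> ==> N2p I (W I 0 s y) <= K0"
proof -
  let ?w = "W I 0 s y" and ?m = "sqrt (real CARD('m))"
  have bil: "bil I (M y) v ?w = (\<Sum>l\<in>I. cnj (v l) * fc f l)" for v
    unfolding bil_def by (rule sum.cong[OF refl]) (simp only: W_0[OF y])
  have m: "?m > 0" by simp
  have "r * (Np I pk ?w)\<^sup>2 <= Re (bil I (M y) ?w ?w)"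
    by (rule bil_Am_coercive[OF a_integrable[OF y] I(1)]) (use a_AE[OF y] in auto)
  also have "... <= norm (bil I (M y) ?w ?w)" by (rule complex_Re_le_cmod)
  also have "... <= n2 torus f * n2 torus (tfun I ?w)" unfolding bil by (rule f_pairing(2)[OF I(1)])
  also have "... <= n2 torus f * (Np I pk ?w / ?m)"
    using poincare2(2)[OF I, of ?w] m by (intro mult_left_mono n2_nonneg) (simp add: field_simps)
  finally have "r * (Np I pk ?w)\<^sup>2 <= (n2 torus f / ?m) * Np I pk ?w" by simp
  then have "r * Np I pk ?w <= n2 torus f / ?m"
    by (rule le_of_sq_le_mult) (intro Np_pos divide_nonneg_nonneg n2_nonneg real_sqrt_ge_zero of_nat_0_le_iff)+
  then show N1: "?m * Np I pk ?w <= n2 torus f / r" using m r by (simp add: field_simps)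
  assume G: "W1inf_seminorm (a y) <= \<Gamma>"
  have "r * N2p I ?w <= n2 torus f + \<Gamma> * ?m * Np I pk ?w"
    by (rule energy2[OF y G n2_nonneg]) (unfold bil N2p_def, rule f_pairing(2)[OF I(1)])
  also have "... <= n2 torus f + \<Gamma> * (n2 torus f / r)"
    unfolding mult.assoc using N1 Gamma_nonneg by (intro add_left_mono mult_left_mono)
  also have "... = r * K0" using r by (simp add: field_simps)
  finally show "N2p I ?w <= K0" by (rule mult_left_le_imp_le) (rule r)
qed

text \<open>The first order estimate enters the second order estimate through the term with \<open>\<Gamma>\<close>; Poincare's
  inequality turns first order norms of the data into second order norms. Together this produces the
  factor \<open>\<delta> i\<close>.\<close>

lemma W_Suc_bound:
  assumes y: "y \<in> Iinf" and G: "W1inf_seminorm (a y) <= \<Gamma>" and s: "s \<in> finsupp"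
  shows "N2p I (W I (Suc n) s y) <= (\<Sum>i | s i ~= 0. real (s i) * (\<delta> i * N2p I (W I n (s(i := s i - 1)) y)))"
proof -
  let ?m = "sqrt (real CARD('m))" and ?w = "W I (Suc n) s y" and ?e = "%i. W I n (s(i := s i - 1)) y" and ?X = "{i. s i ~= 0}"
  have X: "finite ?X" by (rule finsupp_finite[OF s])
  have eq: "mv I (M y) ?w l = (\<Sum>i\<in>?X. (- of_nat (s i)) * mv I (S i) (?e i) l) + 0 * mv I (S 0) (?e 0) l" if "l \<in> I" for l
    unfolding W_Suc[OF y that] by (simp add: sum_negf)
  have N1: "r * Np I pk ?w <= (\<Sum>i\<in>?X. real (s i) * (\<alpha> i * Np I pk (?e i)))"
    using energy1[OF y X eq] by simp
  have N12: "?m * Np I pk (?e i) <= N2p I (?e i)" for i by (rule poincare2(1)[OF I])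
  have m0: "?m \<ge> 0" by simp
  have N1': "r * (?m * Np I pk ?w) <= (\<Sum>i\<in>?X. real (s i) * (\<alpha> i * N2p I (?e i)))"
  proof -
    have "r * (?m * Np I pk ?w) = ?m * (r * Np I pk ?w)" by simp
    also have "... <= ?m * (\<Sum>i\<in>?X. real (s i) * (\<alpha> i * Np I pk (?e i)))" by (rule mult_left_mono[OF N1 m0])
    also have "... = (\<Sum>i\<in>?X. real (s i) * (\<alpha> i * (?m * Np I pk (?e i))))" by (simp only: sum_distrib_left mult.left_commute)
    also have "... <= (\<Sum>i\<in>?X. real (s i) * (\<alpha> i * N2p I (?e i)))"
      by (intro sum_mono mult_left_mono N12 alpha_nonneg) simp
    finally show ?thesis .
  qed
  let ?B = "\<Sum>i\<in>?X. real (s i) * (\<alpha> i * N2p I (?e i) + \<beta> i * N2p I (?e i))"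
  have B: "norm (bil I (M y) (%k. of_real (pk k) * ?w k) ?w) <= ?B * N2p I ?w"
  proof -
    have b: "norm (bil I (S i) v (?e i)) <= (\<alpha> i * N2p I (?e i) + \<beta> i * N2p I (?e i)) * n2 torus (tfun I v)" for i v
    proof -
      have "norm (bil I (S i) v (?e i)) <= (\<alpha> i * N2p I (?e i) + \<beta> i * ?m * Np I pk (?e i)) * n2 torus (tfun I v)"
        by (rule bil_Am_bound2[OF psi_integrable W1inf_wpartial(3)[OF psi] W1inf_wpartial(2)[OF psi] I(1) alpha_nonneg
              Linf_AE[OF W1inf_Linf[OF psi]] beta_nonneg W1inf_wpartial(4)[OF psi]])
      also have "... <= (\<alpha> i * N2p I (?e i) + \<beta> i * N2p I (?e i)) * n2 torus (tfun I v)"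
        unfolding mult.assoc[of "\<beta> i"] by (intro mult_right_mono add_left_mono mult_left_mono N12 beta_nonneg n2_nonneg)
      finally show ?thesis .
    qed
    have "norm (bil I (M y) (%k. of_real (pk k) * ?w k) ?w) = norm (\<Sum>i\<in>?X. (- of_nat (s i)) * bil I (S i) (%k. of_real (pk k) * ?w k) (?e i))"
      by (subst bil_rhs[OF eq]) auto
    also have "... <= (\<Sum>i\<in>?X. real (s i) * ((\<alpha> i * N2p I (?e i) + \<beta> i * N2p I (?e i)) * N2p I ?w))"
    proof (rule sum_norm_le)
      fix i
      show "norm ((- of_nat (s i)) * bil I (S i) (%k. of_real (pk k) * ?w k) (?e i)) \<le>
          real (s i) * ((\<alpha> i * N2p I (?e i) + \<beta> i * N2p I (?e i)) * N2p I ?w)"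
        unfolding N2p_def[of I ?w] norm_mult norm_minus_cancel norm_of_nat by (rule mult_left_mono[OF b of_nat_0_le_iff])
    qed
    also have "... = ?B * N2p I ?w" unfolding sum_distrib_right mult.assoc ..
    finally show ?thesis .
  qed
  have "r * N2p I ?w <= ?B + \<Gamma> * ?m * Np I pk ?w"
    by (rule energy2[OF y G _ B])
       (intro sum_nonneg mult_nonneg_nonneg add_nonneg_nonneg alpha_nonneg beta_nonneg N2p_nonneg of_nat_0_le_iff)
  also have "... = ?B + \<Gamma> / r * (r * (?m * Np I pk ?w))"
  proof -
    have "\<Gamma> * ?m * z = \<Gamma> / r * (r * (?m * z))" for z using r by simp
    then show ?thesis by (rule arg_cong)
  qed
  also have "... <= ?B + \<Gamma> / r * (\<Sum>i\<in>?X. real (s i) * (\<alpha> i * N2p I (?e i)))"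
    by (intro add_left_mono mult_left_mono N1' divide_nonneg_nonneg Gamma_nonneg less_imp_le[OF r])
  also have "... = (\<Sum>i\<in>?X. real (s i) * (((\<Gamma> / r + 1) * \<alpha> i + \<beta> i) * N2p I (?e i)))"
    unfolding sum_distrib_left sum.distrib[symmetric] by (rule sum.cong[OF refl]) (simp add: algebra_simps)
  also have "... <= (\<Sum>i\<in>?X. real (s i) * ((r * \<delta> i) * N2p I (?e i)))"
  proof (intro sum_mono mult_left_mono mult_right_mono N2p_nonneg of_nat_0_le_iff)
    fix i
    have "r * \<delta> i = (\<Gamma> / r + 2) * \<alpha> i + \<beta> i" using r by simp
    then show "(\<Gamma> / r + 1) * \<alpha> i + \<beta> i <= r * \<delta> i" using alpha_nonneg[of i] by (simp add: distrib_right)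
  qed
  also have "... = r * (\<Sum>i\<in>?X. real (s i) * (\<delta> i * N2p I (?e i)))"
    by (simp only: sum_distrib_left mult.assoc mult.left_commute)
  finally show ?thesis by (rule mult_left_le_imp_le) (rule r)
qed

text \<open>The recursion \<open>x s = (\<Sum>i. s i * \<delta> i * x (s - 1\<^sub>i))\<close> has the solution \<open>fact (msize s) * mpow \<delta> s\<close>.\<close>

lemma W_bound:
  assumes y: "y \<in> Iinf" and G: "W1inf_seminorm (a y) <= \<Gamma>"
  shows "s \<in> finsupp ==> msize s = n ==> N2p I (W I n s y) <= fact n * mpow \<delta> s * K0"
proof (induction n arbitrary: s)
  case 0
  have "{j. s j ~= 0} = {}"
    using 0 finsupp_finite[OF 0(1)] by (auto simp: msize_def)
  then have "mpow \<delta> s = 1" by (simp add: mpow_def)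
  then show ?case using W_0_bounds(2)[OF y G, of s] by simp
next
  case (Suc n)
  note s = Suc.prems(1)
  have "N2p I (W I (Suc n) s y) <= (\<Sum>i | s i ~= 0. real (s i) * (\<delta> i * N2p I (W I n (s(i := s i - 1)) y)))"
    by (rule W_Suc_bound[OF y G s])
  also have "... <= (\<Sum>i | s i ~= 0. real (s i) * (\<delta> i * (fact n * mpow \<delta> (s(i := s i - 1)) * K0)))"
  proof (intro sum_mono mult_left_mono Suc.IH finsupp_upd s)
    fix i assume "i \<in> {i. s i ~= 0}"
    then have "msize s = Suc (msize (s(i := s i - 1)))" by (intro msize_dec s) simp
    then show "msize (s(i := s i - 1)) = n" using Suc.prems by simp
  qed (use delta_nonneg in auto)
  also have "... = (\<Sum>i | s i ~= 0. real (s i) * (fact n * mpow \<delta> s * K0))"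
  proof (rule sum.cong[OF refl])
    fix i assume "i \<in> {i. s i ~= 0}"
    then have "mpow \<delta> s = \<delta> i * mpow \<delta> (s(i := s i - 1))" by (intro mpow_dec s) simp
    then show "real (s i) * (\<delta> i * (fact n * mpow \<delta> (s(i := s i - 1)) * K0)) = real (s i) * (fact n * mpow \<delta> s * K0)"
      by (simp only: mult_ac)
  qed
  also have "... = real (msize s) * (fact n * mpow \<delta> s * K0)"
    unfolding msize_def of_nat_sum sum_distrib_right ..
  also have "... = fact (Suc n) * mpow \<delta> s * K0" unfolding Suc.prems(2) fact_Suc by (simp only: mult.assoc of_nat_mult of_nat_fact)
  finally show ?case .
qed

end
end


lemma N2p_L2_set: "finite I ==> N2p I w = L2_set (%k. pk k * norm (w k)) I"
  using N2p_sq[of I w] N2p_nonneg[of I w] unfolding L2_set_def power_mult_distrib by (metis real_sqrt_unique)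

lemma N2p_pairing:
  assumes "finite I"
  shows "norm (\<Sum>k\<in>I. of_real ((pk k)\<^sup>2) * (cnj (v k) * w k)) <= N2p I v * N2p I w"
proof -
  have "norm (\<Sum>k\<in>I. of_real ((pk k)\<^sup>2) * (cnj (v k) * w k)) <= (\<Sum>k\<in>I. \<bar>pk k * norm (v k)\<bar> * \<bar>pk k * norm (w k)\<bar>)"
    by (rule sum_norm_le) (simp add: norm_mult abs_mult power2_eq_square mult_ac)
  also have "... <= N2p I v * N2p I w" unfolding N2p_L2_set[OF assms] by (rule L2_set_mult_ineq)
  finally show ?thesis .
qed

lemma mpow_scale:
  assumes "s \<in> finsupp"
  shows "mpow (%j. x j * c) s = mpow x s * c ^ msize s"
  by (simp add: mpow_def msize_def power_mult_distrib prod.distrib power_sum)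

context affine_problem
begin

context
  fixes I :: "(int ^ 'm) set"
  assumes I: "finite I" "I \<subseteq> Zstar"
begin

lemma mv_lin3: "mv I A (%k. u k - v k - c * w k) l = mv I A u l - mv I A v l - c * mv I A w l"
  by (simp add: mv_diff mv_scale)

text \<open>The remainder of the first order Taylor expansion solves an equation of the same kind, with
  remainders of lower order and one quadratic term on the right.\<close>

lemma W_taylor_equation:
  fixes n s and y :: "nat => real" and j :: nat
  defines "E \<equiv> %n s t k. W I n s (y(j := t)) k - W I n s y k - of_real (t - y j) * W I (Suc n) (s(j := Suc (s j))) y k"
  assumes y: "y \<in> Iinf" and t: "t \<in> {-1..1}" and s: "s \<in> finsupp" "msize s = n" and l: "l \<in> I"
  shows "mv I (M (y(j := t))) (E n s t) l = (\<Sum>i | s i ~= 0. (- of_nat (s i)) * mv I (S i) (E (n - 1) (s(i := s i - 1)) t) l)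
     + (- of_real ((t - y j)\<^sup>2)) * mv I (S j) (W I (Suc n) (s(j := Suc (s j))) y) l"
proof -
  define h where "h = complex_of_real (t - y j)"
  have yt: "y(j := t) \<in> Iinf" by (rule Iinf_upd[OF y t])
  let ?X = "%i \<sigma>. mv I (S i) (W I n \<sigma> y) l" and ?W' = "W I (Suc n) (s(j := Suc (s j))) y"
  let ?sig = "%i. (s(i := s i - 1))(j := Suc ((s(i := s i - 1)) j))"
  have W': "mv I (M y) ?W' l = - (?X j s + (\<Sum>i | s i ~= 0. of_nat (s i) * ?X i (?sig i)))"
    unfolding W_Suc[OF I y l] by (rule arg_cong[where f = uminus], rule sum_unit_shift[OF s(1)])
  have expand: "mv I (M (y(j := t))) (E n s t) l =
      mv I (M (y(j := t))) (W I n s (y(j := t))) l - mv I (M y) (W I n s y) l - h * ?X j s - h * mv I (M y) ?W' l - h\<^sup>2 * mv I (S j) ?W' l"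
    unfolding E_def mv_lin3 mv_M_upd[OF y yt, of I "W I n s y"] mv_M_upd[OF y yt, of I ?W'] h_def[symmetric]
    by (simp add: algebra_simps power2_eq_square)
  have main: "mv I (M (y(j := t))) (W I n s (y(j := t))) l - mv I (M y) (W I n s y) l + h * (\<Sum>i | s i ~= 0. of_nat (s i) * ?X i (?sig i))
      = (\<Sum>i | s i ~= 0. (- of_nat (s i)) * mv I (S i) (E (n - 1) (s(i := s i - 1)) t) l)"
  proof (cases n)
    case 0
    then have "{i. s i ~= 0} = {}" using s finsupp_finite[OF s(1)] by (auto simp: msize_def)
    then show ?thesis unfolding 0 W_0[OF I y l] W_0[OF I yt l] by simp
  next
    case (Suc n')
    have "(\<Sum>i | s i ~= 0. (- of_nat (s i)) * mv I (S i) (E (n - 1) (s(i := s i - 1)) t) l) =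
      (\<Sum>i | s i ~= 0. h * (of_nat (s i) * ?X i (?sig i)) + of_nat (s i) * mv I (S i) (W I n' (s(i := s i - 1)) y) l
         - of_nat (s i) * mv I (S i) (W I n' (s(i := s i - 1)) (y(j := t))) l)"
      unfolding E_def mv_lin3 h_def[symmetric] Suc by (rule sum.cong[OF refl]) (simp add: algebra_simps)
    then show ?thesis unfolding Suc W_Suc[OF I y l] W_Suc[OF I yt l]
      by (simp add: sum.distrib sum_subtractf sum_distrib_left)
  qed
  show ?thesis unfolding expand W' main[symmetric] of_real_power h_def[symmetric] by (simp add: algebra_simps)
qed

text \<open>Induction on the order: remainders of lower order are quadratic, hence so is the right-hand side.\<close>

lemma W_quadratic:
  fixes n s and y :: "nat => real" and j :: nat
  assumes y: "y \<in> Iinf" and s: "s \<in> finsupp" "msize s = n"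
  shows "\<exists>C\<ge>0. \<forall>t\<in>{-1..1}. Np I pk (%k. W I n s (y(j := t)) k - W I n s y k
      - of_real (t - y j) * W I (Suc n) (s(j := Suc (s j))) y k) <= C * (t - y j)\<^sup>2"
  using s
proof (induction n arbitrary: s rule: less_induct)
  case (less n)
  note s = less.prems
  let ?E = "%n s t k. W I n s (y(j := t)) k - W I n s y k - of_real (t - y j) * W I (Suc n) (s(j := Suc (s j))) y k"
  let ?P = "%i C. 0 <= C \<and> (\<forall>t\<in>{-1..1}. Np I pk (?E (n - 1) (s(i := s i - 1)) t) <= C * (t - y j)\<^sup>2)"
  have "\<forall>i\<in>{i. s i ~= 0}. \<exists>C. ?P i C"
  proof
    fix i assume i: "i \<in> {i. s i ~= 0}"
    have "msize s = Suc (msize (s(i := s i - 1)))" using i by (intro msize_dec s) simp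
    then have "n - 1 < n" "msize (s(i := s i - 1)) = n - 1" using s by auto
    from less.IH[OF this(1) finsupp_upd[OF s(1)] this(2)] show "\<exists>C. ?P i C" .
  qed
  from bchoice[OF this] obtain C where C: "\<forall>i\<in>{i. s i ~= 0}. ?P i (C i)" ..
  let ?W' = "W I (Suc n) (s(j := Suc (s j))) y"
  define D where "D = (\<Sum>i | s i ~= 0. real (s i) * (\<alpha> i * C i)) + \<alpha> j * Np I pk ?W'"
  have D0: "D \<ge> 0" unfolding D_def
    by (intro add_nonneg_nonneg sum_nonneg mult_nonneg_nonneg alpha_nonneg Np_pos[OF I] of_nat_0_le_iff) (use C in auto)
  have "Np I pk (?E n s t) <= D / r * (t - y j)\<^sup>2" if t: "t \<in> {-1..1}" for t
  proof -
    have "r * Np I pk (?E n s t) <= (\<Sum>i | s i ~= 0. norm (- of_nat (s i) :: complex) * (\<alpha> i * Np I pk (?E (n - 1) (s(i := s i - 1)) t)))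
        + norm (- complex_of_real ((t - y j)\<^sup>2)) * (\<alpha> j * Np I pk ?W')"
      by (rule energy1[OF I Iinf_upd[OF y t] finsupp_finite[OF s(1)] W_taylor_equation[OF y t s]])
    also have "... = (\<Sum>i | s i ~= 0. real (s i) * (\<alpha> i * Np I pk (?E (n - 1) (s(i := s i - 1)) t))) + (t - y j)\<^sup>2 * (\<alpha> j * Np I pk ?W')"
      unfolding norm_minus_cancel norm_of_nat norm_of_real abs_power2 ..
    also have "... <= (\<Sum>i | s i ~= 0. real (s i) * (\<alpha> i * (C i * (t - y j)\<^sup>2))) + (t - y j)\<^sup>2 * (\<alpha> j * Np I pk ?W')"
      by (intro add_right_mono sum_mono mult_left_mono alpha_nonneg of_nat_0_le_iff) (use C t in blast)
    also have "... = D * (t - y j)\<^sup>2" unfolding D_def distrib_right sum_distrib_right mult.assoc by (simp only: mult_ac)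
    finally show ?thesis using r by (simp add: field_simps)
  qed
  moreover have "D / r \<ge> 0" using D0 r by simp
  ultimately show ?case by (intro exI[of _ "D / r"] conjI ballI)
qed

lemma W_derivative:
  assumes y: "y \<in> Iinf" and t0: "t0 \<in> {-1..1}" and s: "s \<in> finsupp" and k: "k \<in> I"
  shows "((%t. W I (msize s) s (y(j := t)) k) has_vector_derivative
    W I (msize (s(j := Suc (s j)))) (s(j := Suc (s j))) (y(j := t0)) k) (at t0 within {-1..1})"
proof -
  let ?y = "y(j := t0)"
  have y0: "?y \<in> Iinf" by (rule Iinf_upd[OF y t0])
  let ?E = "%t k. W I (msize s) s (?y(j := t)) k - W I (msize s) s ?y k - of_real (t - ?y j) * W I (Suc (msize s)) (s(j := Suc (s j))) ?y k"
  from W_quadratic[OF y0 s refl, of j] obtain C where C: "\<forall>t\<in>{-1..1}. Np I pk (?E t) <= C * (t - ?y j)\<^sup>2" by (elim exE conjE)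
  show ?thesis
  proof (rule vector_derivative_quadratic[where C = "C / sqrt (pk k)"])
    fix t :: real assume t: "t \<in> {-1..1}"
    have "norm (?E t k) <= Np I pk (?E t) / sqrt (pk k)"
      by (rule Np_component[OF I(1) pk_pos_I[OF I] k])
    also have "... <= C * (t - ?y j)\<^sup>2 / sqrt (pk k)"
      using C t pk_pos_I[OF I k] by (intro divide_right_mono) auto
    finally show "norm (W I (msize s) s (y(j := t)) k - W I (msize s) s (y(j := t0)) k
        - (t - t0) *\<^sub>R W I (msize (s(j := Suc (s j)))) (s(j := Suc (s j))) (y(j := t0)) k) <= C / sqrt (pk k) * (t - t0)\<^sup>2"
      by (simp add: msize_inc[OF s] scaleR_conv_of_real)
  qed
qed

abbreviation \<theta> :: "nat => real" where "\<theta> j \<equiv> \<delta> j * (1 / sqrt 3)"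

lemma lcoef_W:
  assumes s: "s \<in> finsupp" and k: "k \<in> I"
  shows "lcoef (%y. W I 0 (%_. 0) y k) s = (\<integral>y. W I (msize s) s y k * of_real (omega s y) \<partial>mu)"
proof -
  have "(\<integral>y. W I (msize (%_. 0)) (%_. 0) y k * of_real (mlegendre s y) \<partial>mu) = (\<integral>y. W I (msize s) s y k * of_real (omega s y) \<partial>mu)"
    by (rule mu_by_parts[where \<phi> = "%s y. W I (msize s) s y k"])
       (use W_derivative[OF _ _ _ k] upc_bm[OF W_upc[OF I _ k]] s in auto)
  then show ?thesis by (simp add: lcoef_def msize_def)
qed

text \<open>Passing from the derivative to the Legendre coefficient gains \<open>(1 / sqrt 3) ^ msize s / mfact s\<close>. This
  turns the factorial bound for derivatives into a multinomial weight. The norm of the integral is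
  estimated by pairing it with itself.\<close>

lemma lcoef_W_bound:
  assumes s: "s \<in> finsupp"
  shows "N2p I (%k. lcoef (%y. W I 0 (%_. 0) y k) s) <= K0 * mcoef \<theta> s"
proof -
  define c where "c k = lcoef (%y. W I 0 (%_. 0) y k) s" for k
  define B where "B = fact (msize s) * mpow \<delta> s * K0"
  have B0: "B \<ge> 0" unfolding B_def using r Gamma_nonneg
    by (intro mult_nonneg_nonneg mpow_nonneg delta_nonneg[OF I] divide_nonneg_nonneg n2_nonneg) auto
  \<comment> \<open>The derivative paired with its own mean, in the inner product of the second order norm.\<close>
  define G where "G y = (\<Sum>k\<in>I. of_real ((pk k)\<^sup>2) * (cnj (c k) * W I (msize s) s y k))" for y
  have bG: "bm G" unfolding G_def
    by (intro bm_sum I(1) bm_mult bm_const upc_bm W_upc I s)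
  have bo: "bm (omega s)" by (rule bm_omega[OF s])
  have "complex_of_real ((N2p I c)\<^sup>2) = (\<Sum>k\<in>I. of_real ((pk k)\<^sup>2) * (cnj (c k) * c k))"
    unfolding N2p_sq[OF I(1)] of_real_sum of_real_mult complex_norm_square by (rule sum.cong[OF refl]) (simp add: mult_ac)
  also have "... = (\<Sum>k\<in>I. \<integral>y. of_real ((pk k)\<^sup>2) * (cnj (c k) * W I (msize s) s y k) * of_real (omega s y) \<partial>mu)"
  proof (rule sum.cong[OF refl])
    fix k assume k: "k \<in> I"
    have "c k = (\<integral>y. W I (msize s) s y k * of_real (omega s y) \<partial>mu)" unfolding c_def by (rule lcoef_W[OF s k])
    then have "of_real ((pk k)\<^sup>2) * (cnj (c k) * c k) = (of_real ((pk k)\<^sup>2) * cnj (c k)) * (\<integral>y. W I (msize s) s y k * of_real (omega s y) \<partial>mu)"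
      by (simp only: mult.assoc)
    also have "... = (\<integral>y. (of_real ((pk k)\<^sup>2) * cnj (c k)) * (W I (msize s) s y k * of_real (omega s y)) \<partial>mu)"
      by (rule integral_mult_right_zero[symmetric])
    finally show "of_real ((pk k)\<^sup>2) * (cnj (c k) * c k) = (\<integral>y. of_real ((pk k)\<^sup>2) * (cnj (c k) * W I (msize s) s y k) * of_real (omega s y) \<partial>mu)"
      by (simp only: mult.assoc)
  qed
  also have "... = (\<integral>y. G y * of_real (omega s y) \<partial>mu)"
    unfolding G_def sum_distrib_right
    by (intro Bochner_Integration.integral_sum[symmetric] bm_integrable bm_mult bm_const bm_of_real bo upc_bm W_upc I s)
  finally have e: "norm (complex_of_real ((N2p I c)\<^sup>2)) = norm (\<integral>y. G y * of_real (omega s y) \<partial>mu)" by (rule arg_cong)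
  have "(N2p I c)\<^sup>2 = norm (complex_of_real ((N2p I c)\<^sup>2))" by (simp only: norm_of_real abs_power2)
  also note e
  also have "norm (\<integral>y. G y * of_real (omega s y) \<partial>mu) <= (\<integral>y. norm (G y * of_real (omega s y)) \<partial>mu)"
    by (rule integral_norm_bound)
  also have "... <= (\<integral>y. (N2p I c * B) * omega s y \<partial>mu)"
  proof (rule integral_mono_AE)
    show "integrable mu (%y. norm (G y * of_real (omega s y)))"
      by (intro integrable_norm bm_integrable bm_mult bm_of_real bG bo)
    show "integrable mu (%y. (N2p I c * B) * omega s y)" by (intro bm_integrable bm_mult bm_const bo)
    show "AE y in mu. norm (G y * of_real (omega s y)) <= (N2p I c * B) * omega s y"
      using Linf_W1inf_seminorm_AE(1)[OF a] AE_space
    proof eventually_elim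
      case (elim y)
      then have y: "y \<in> Iinf" by (simp add: space_mu)
      have "norm (G y) <= N2p I c * N2p I (W I (msize s) s y)" unfolding G_def by (rule N2p_pairing[OF I(1)])
      also have "... <= N2p I c * B"
        unfolding B_def by (intro mult_left_mono W_bound I y elim(1) s refl N2p_nonneg)
      finally have "norm (G y) * omega s y <= (N2p I c * B) * omega s y" by (rule mult_right_mono) (rule omega_nonneg[OF y])
      then show ?case using omega_nonneg[OF y, of s] by (simp add: norm_mult)
    qed
  qed
  also have "... = (B * (\<integral>y. omega s y \<partial>mu)) * N2p I c" by simp
  finally have "1 * (N2p I c)\<^sup>2 <= (B * (\<integral>y. omega s y \<partial>mu)) * N2p I c" by simp
  then have "1 * N2p I c <= B * (\<integral>y. omega s y \<partial>mu)"
  proof (rule le_of_sq_le_mult[OF _ N2p_nonneg])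
    have "0 <= (\<integral>y. omega s y \<partial>mu)"
      by (rule integral_nonneg_AE) (auto simp: space_mu omega_nonneg)
    then show "0 <= B * (\<integral>y. omega s y \<partial>mu)" using B0 by simp
  qed
  also have "... <= B * ((1 / sqrt 3) ^ msize s / real (mfact s))"
    by (rule mult_left_mono[OF integral_omega_le[OF s] B0])
  also have "... = K0 * mcoef \<theta> s"
    unfolding B_def mcoef_def mpow_scale[OF s] by simp
  finally show ?thesis by (simp add: c_def[abs_def])
qed

end
end


section \<open>The energy form and the semidiscrete approximation\<close>

definition aform :: "(real ^ 'm => real) => (real ^ 'm => complex) => (real ^ 'm => complex) => complex" where
  "aform g v w = (\<integral>x. of_real (g x) * cdot (grad v x) (grad w x) \<partial>torus)"

lemma grad_measurable: "v \<in> V_space ==> grad v \<in> borel_measurable torus"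
  by (rule l2_measurable[OF grad_l2])

lemma wpartial_measurable: "v \<in> V_space ==> wpartial i v \<in> borel_measurable torus"
  by (rule l2_measurable[OF V_wpartial(2)])

lemma aform_integrable:
  assumes g: "g \<in> borel_measurable torus" "AE x in torus. \<bar>g x\<bar> <= C" "0 <= C" and v: "v \<in> V_space" and w: "w \<in> V_space"
  shows "integrable torus (%x. of_real (g x) * cdot (grad v x) (grad w x))"
proof (rule l2_form(1)[OF grad_l2[OF v] grad_l2[OF w] _ g(3)])
  have "(%x. complex_of_real (g x)) \<in> borel_measurable torus" using g(1) by measurable
  then show "(%x. of_real (g x) * cdot (grad v x) (grad w x)) \<in> borel_measurable torus"
    by (intro borel_measurable_times cdot_measurable grad_measurable v w)
  show "AE x in torus. norm (of_real (g x) * cdot (grad v x) (grad w x)) <= C * (norm (grad v x) * norm (grad w x))"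
    using g(2) by eventually_elim (auto simp: norm_mult intro!: mult_mono norm_cdot_le)
qed

lemma cdot_diff_left: "cdot (a - b) c = cdot a c - cdot b c"
  by (simp add: cdot_def algebra_simps sum_subtractf)

lemma aform_diff_left:
  assumes g: "g \<in> borel_measurable torus" "AE x in torus. \<bar>g x\<bar> <= C" "0 <= C"
    and u: "u \<in> V_space" and v: "v \<in> V_space" and w: "w \<in> V_space"
  shows "aform g (%x. u x - v x) w = aform g u w - aform g v w"
proof -
  have uv: "(%x. u x - v x) \<in> V_space" by (rule V_space_diff[OF u v])
  have "aform g (%x. u x - v x) w = (\<integral>x. of_real (g x) * cdot (grad u x) (grad w x) - of_real (g x) * cdot (grad v x) (grad w x) \<partial>torus)"
    unfolding aform_def
  proof (rule integral_cong_AE)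
    show "AE x in torus. of_real (g x) * cdot (grad (%x. u x - v x) x) (grad w x) =
        of_real (g x) * cdot (grad u x) (grad w x) - of_real (g x) * cdot (grad v x) (grad w x)"
      using grad_diff[OF u v] by eventually_elim (simp add: cdot_diff_left right_diff_distrib)
  qed (intro borel_measurable_integrable Bochner_Integration.integrable_diff aform_integrable[OF g] uv u v w)+
  also have "... = aform g u w - aform g v w"
    unfolding aform_def by (intro Bochner_Integration.integral_diff aform_integrable[OF g] u v w)
  finally show ?thesis .
qed

text \<open>The bilinear form of the problem, applied to a conjugated test function, is sesquilinear.\<close>

lemma aform_bilinear:
  assumes v: "v \<in> V_space" and w: "w \<in> V_space" and g: "g \<in> borel_measurable torus"
  shows "(\<integral>x. of_real (g x) * (\<Sum>i\<in>UNIV. wpartial i v x * wpartial i (%x. cnj (w x)) x) \<partial>torus) = aform g v w"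
  unfolding aform_def
proof (rule integral_cong_AE)
  have gc: "(%x. complex_of_real (g x)) \<in> borel_measurable torus" using g by measurable
  show "(%x. of_real (g x) * (\<Sum>i\<in>UNIV. wpartial i v x * wpartial i (%x. cnj (w x)) x)) \<in> borel_measurable torus"
    by (intro borel_measurable_times borel_measurable_sum gc wpartial_measurable v V_space_cnj[OF w])
  show "(%x. of_real (g x) * cdot (grad v x) (grad w x)) \<in> borel_measurable torus"
    by (intro borel_measurable_times cdot_measurable gc grad_measurable v w)
  show "AE x in torus. of_real (g x) * (\<Sum>i\<in>UNIV. wpartial i v x * wpartial i (%x. cnj (w x)) x) = of_real (g x) * cdot (grad v x) (grad w x)"
    using grad_cnj[OF w]
  proof eventually_elim
    case (elim x)
    have "wpartial i (%x. cnj (w x)) x = cnj (grad w x $ i)" for i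
      using arg_cong[OF elim, of "%z. z $ i"] by (simp add: grad_def)
    then show ?case by (simp add: cdot_def) (simp add: grad_def)
  qed
qed

lemma norm_add_cdot: "(norm (a + b :: complex ^ 'm))\<^sup>2 = (norm a)\<^sup>2 + (norm b)\<^sup>2 + 2 * Re (cdot a b)"
proof -
  have "(norm (z + w))\<^sup>2 = (norm z)\<^sup>2 + (norm w)\<^sup>2 + 2 * Re (z * cnj w)" for z w :: complex
    unfolding cmod_power2 by (simp add: algebra_simps power2_eq_square)
  then show ?thesis by (simp add: norm_vec_sq cdot_def sum.distrib sum_distrib_left)
qed

text \<open>Expand \<open>g |grad (e + d)|\<^sup>2\<close> pointwise, bound it above by \<open>R\<close> and drop the term with \<open>d\<close>. If \<open>e\<close> is
  orthogonal to \<open>d\<close> in the energy form, this is Cea's lemma with the constant \<open>sqrt (R / r)\<close>.\<close>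

lemma energy_split:
  assumes g: "g \<in> borel_measurable torus" "AE x in torus. r <= g x \<and> g x <= R" and r: "0 < r"
    and e: "e \<in> V_space" and d: "d \<in> V_space"
  shows "r * (V_norm e)\<^sup>2 + 2 * Re (aform g e d) <= R * (V_norm (%x. e x + d x))\<^sup>2"
proof -
  have ed: "(%x. e x + d x) \<in> V_space" by (rule V_space_add[OF e d])
  have "AE x::real^'a in torus. r <= R" using g(2) by eventually_elim linarith
  then have rR: "r <= R" by (simp add: torus.AE_const)
  have gR: "AE x in torus. \<bar>g x\<bar> <= R" using g(2) by eventually_elim (use r in auto)
  have R0: "0 <= R" using rR r by simp
  note int = aform_integrable[OF g(1) gR R0 e d]
  have sq: "integrable torus (%x. (norm (grad v x))\<^sup>2)" if "v \<in> V_space" for v :: "real ^ 'a => complex"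
    using grad_l2[OF that] by (simp add: l2_def)
  have V: "(V_norm v)\<^sup>2 = (\<integral>x. (norm (grad v x))\<^sup>2 \<partial>torus)" if "v \<in> V_space" for v :: "real ^ 'a => complex"
    unfolding V_norm_grad[OF that] n2_sq ..
  have Re: "Re (aform g e d) = (\<integral>x. Re (of_real (g x) * cdot (grad e x) (grad d x)) \<partial>torus)"
    unfolding aform_def by (rule integral_Re[OF int, symmetric])
  have "r * (V_norm e)\<^sup>2 + 2 * Re (aform g e d) =
      (\<integral>x. r * (norm (grad e x))\<^sup>2 + 2 * Re (of_real (g x) * cdot (grad e x) (grad d x)) \<partial>torus)"
    unfolding V[OF e] Re
    unfolding integral_mult_right_zero[symmetric]
    by (intro Bochner_Integration.integral_add[symmetric] integrable_mult_right sq e integrable_Re int)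
  also have "... <= (\<integral>x. R * (norm (grad (%x. e x + d x) x))\<^sup>2 \<partial>torus)"
  proof (rule integral_mono_AE)
    show "integrable torus (%x. r * (norm (grad e x))\<^sup>2 + 2 * Re (of_real (g x) * cdot (grad e x) (grad d x)))"
      by (intro Bochner_Integration.integrable_add integrable_mult_right sq e integrable_Re int)
    show "integrable torus (%x. R * (norm (grad (%x. e x + d x) x))\<^sup>2)" by (intro integrable_mult_right sq ed)
    show "AE x in torus. r * (norm (grad e x))\<^sup>2 + 2 * Re (of_real (g x) * cdot (grad e x) (grad d x)) <= R * (norm (grad (%x. e x + d x) x))\<^sup>2"
      using g(2) grad_add[OF e d]
    proof eventually_elim
      case (elim x)
      have "r * (norm (grad e x))\<^sup>2 <= g x * (norm (grad e x))\<^sup>2" using elim by (intro mult_right_mono) auto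
      moreover have "0 <= g x * (norm (grad d x))\<^sup>2" using elim r by simp
      moreover have "g x * (norm (grad e x + grad d x))\<^sup>2 <= R * (norm (grad e x + grad d x))\<^sup>2" using elim by (intro mult_right_mono) auto
      ultimately have "r * (norm (grad e x))\<^sup>2 + 2 * (g x * Re (cdot (grad e x) (grad d x))) <= R * (norm (grad e x + grad d x))\<^sup>2"
        unfolding norm_add_cdot by (simp add: algebra_simps)
      then show ?case unfolding elim(2) by simp
    qed
  qed
  also have "... = R * (V_norm (%x. e x + d x))\<^sup>2" unfolding V[OF ed] by simp
  finally show ?thesis .
qed

lemma aform_tfun:
  assumes I: "finite I" "I \<subseteq> Zstar" and g: "integrable torus g"
  shows "aform g (tfun I w) (tfun I v) = bil I (Am g) v w"
  unfolding bil_Am(1)[OF g I(1)] aform_def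
proof (rule integral_cong_AE)
  have gc: "(%x. complex_of_real (g x)) \<in> borel_measurable torus" using borel_measurable_integrable[OF g] by measurable
  show "(%x. of_real (g x) * cdot (grad (tfun I w) x) (grad (tfun I v) x)) \<in> borel_measurable torus"
    by (intro borel_measurable_times cdot_measurable gc grad_measurable tfun_V_space I)
  show "(%x. of_real (g x) * cdot (gtfun I w x) (gtfun I v x)) \<in> borel_measurable torus"
    by (rule borel_measurable_integrable[OF bil_Am(2)[OF g I(1)]])
  show "AE x in torus. of_real (g x) * cdot (grad (tfun I w) x) (grad (tfun I v) x) = of_real (g x) * cdot (gtfun I w x) (gtfun I v x)"
    using grad_tfun[OF I, of w] grad_tfun[OF I, of v] by eventually_elim simp
qed

definition box :: "nat => (int ^ 'm) set" where
  "box N = {k. k \<in> Zstar \<and> abs_inf k <= real N}"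

lemma box: "finite (box N)" "box N \<subseteq> Zstar"
  using Zstar_box(1)[of "real N"] by (auto simp: box_def)

lemma box_limit: "filterlim box (finite_subsets_at_top (Zstar :: (int ^ 'm) set)) sequentially"
  unfolding filterlim_finite_subsets_at_top
proof (intro allI impI)
  fix X :: "(int ^ 'm) set" assume X: "finite X \<and> X \<subseteq> Zstar"
  obtain N where N: "!!k. k \<in> X ==> abs_inf k <= real N"
  proof -
    have "abs_inf k <= real (nat \<lceil>\<Sum>k\<in>X. abs_inf k\<rceil>)" if "k \<in> X" for k
    proof -
      have "abs_inf k <= (\<Sum>k\<in>X. abs_inf k)"
      proof (rule member_le_sum[OF that])
        fix l assume "l \<in> X - {k}"
        then have "1 <= abs_inf l" using X by (intro abs_inf_ge_1) auto
        then show "0 <= abs_inf l" by simp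
      qed (use X in simp)
      then show ?thesis using real_nat_ceiling_ge by (rule order_trans)
    qed
    then show ?thesis using that by blast
  qed
  show "\<forall>\<^sub>F N in sequentially. finite (box N) \<and> X \<subseteq> box N \<and> box N \<subseteq> Zstar"
    using eventually_ge_at_top[of N]
  proof eventually_elim
    case (elim n)
    have "X \<subseteq> box n" unfolding box_def using X N elim by (auto intro: order_trans[of _ "real N"])
    then show ?case using box by auto
  qed
qed

context affine_problem
begin

lemma a_measurable: "y \<in> Iinf ==> a y \<in> borel_measurable torus"
  by (rule borel_measurable_integrable[OF a_integrable])

lemma a_abs_le: "y \<in> Iinf ==> AE x in torus. \<bar>a y x\<bar> <= R"
proof (rule AE_I2)
  fix x assume "y \<in> Iinf"
  from a_bounds[OF this, of x] show "\<bar>a y x\<bar> <= R" using r by linarith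
qed

lemma solution_aform:
  assumes u: "parametric_solution a f u" and y: "y \<in> Iinf" and w: "w \<in> V_space"
  shows "u y \<in> V_space" "aform (a y) (u y) w = (\<integral>x. f x * cnj (w x) \<partial>torus)"
proof -
  show uy: "u y \<in> V_space" using u y by (simp add: parametric_solution_def)
  show "aform (a y) (u y) w = (\<integral>x. f x * cnj (w x) \<partial>torus)"
    unfolding aform_bilinear[OF uy w a_measurable[OF y], symmetric]
    by (rule u[unfolded parametric_solution_def, THEN bspec, OF y, THEN conjunct2, THEN bspec, OF V_space_cnj[OF w]])
qed

text \<open>The semidiscrete approximation: Galerkin in space, exact in the parameter.\<close>

definition usd :: "nat => (nat => real) => real ^ 'm => complex" where
  "usd N y = tfun (box N) (W (box N) 0 (%_. 0) y)"

lemma usd_V_space: "usd N y \<in> V_space"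
  unfolding usd_def by (rule tfun_V_space[OF box])

lemma usd_bound:
  assumes y: "y \<in> Iinf"
  shows "V_norm (usd N y) <= n2 torus f / r"
proof -
  let ?w = "W (box N) 0 (%_. 0) y"
  have "(V_norm (usd N y))\<^sup>2 = (Np (box N) pk ?w)\<^sup>2"
    unfolding usd_def V_norm_tfun[OF box] by (rule Np_sq[symmetric]) (rule pk_nonneg_I[OF box])
  then have V: "V_norm (usd N y) = Np (box N) pk ?w" by (rule power2_eq_imp_eq[OF _ V_norm_nonneg Np_pos[OF box]])
  have "1 * Np (box N) pk ?w <= sqrt (real CARD('m)) * Np (box N) pk ?w"
    by (intro mult_right_mono Np_pos[OF box]) (simp add: Suc_leI)
  also have "... <= n2 torus f / r" by (rule W_0_bounds(1)[OF box y])
  finally show ?thesis unfolding V by simp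
qed

text \<open>Cea's lemma for fixed \<open>y\<close>, compared with the truncated Fourier series.\<close>

lemma usd_converges:
  assumes u: "parametric_solution a f u" and y: "y \<in> Iinf"
  shows "(%N. V_norm (%x. usd N y x - u y x)) \<longlonglongrightarrow> 0"
proof -
  have uy: "u y \<in> V_space" by (rule solution_aform(1)[OF u y usd_V_space[of 0 y]])
  have "filterlim (%N. V_norm (%x. u y x - tfun (box N) (fc (u y)) x)) (nhds 0) sequentially"
    by (rule filterlim_compose[OF V_tail[OF uy] box_limit])
  then have lim: "(%N. sqrt (R / r) * V_norm (%x. u y x - tfun (box N) (fc (u y)) x)) \<longlonglongrightarrow> 0"
    by (rule tendsto_mult_right_zero)
  show ?thesis
  proof (rule Lim_null_comparison[OF always_eventually lim], rule allI)
    fix N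
    define I where "I = (box N :: (int ^ 'm) set)"
    have I: "finite I" "I \<subseteq> Zstar" unfolding I_def by (rule box)+
    let ?w = "W I 0 (%_. 0) y" and ?p = "tfun I (fc (u y))"
    let ?e = "%x. u y x - usd N y x" and ?d = "%x. usd N y x - ?p x"
    have d: "?d = tfun I (%k. ?w k - fc (u y) k)"
      by (auto simp: usd_def I_def tfun_def sum_subtractf left_diff_distrib)
    have dV: "?d \<in> V_space" unfolding d by (rule tfun_V_space[OF I])
    have eV: "?e \<in> V_space" by (rule V_space_diff[OF uy usd_V_space])
    have "aform (a y) (usd N y) ?d = aform (a y) (tfun I ?w) (tfun I (%k. ?w k - fc (u y) k))"
      unfolding d by (simp only: usd_def I_def)
    also have "... = (\<Sum>l\<in>I. cnj (?w l - fc (u y) l) * mv I (M y) ?w l)"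
      unfolding aform_tfun[OF I a_integrable[OF y]] bil_def ..
    also have "... = (\<Sum>l\<in>I. cnj (?w l - fc (u y) l) * fc f l)"
      by (rule sum.cong[OF refl]) (simp only: W_0[OF I y])
    also have "... = (\<integral>x. f x * cnj (tfun I (%k. ?w k - fc (u y) k) x) \<partial>torus)" by (rule f_pairing(1)[OF I(1)])
    also have "... = aform (a y) (u y) ?d"
      unfolding d by (rule solution_aform(2)[OF u y dV[unfolded d], symmetric])
    finally have "aform (a y) ?e ?d = 0"
      using aform_diff_left[OF a_measurable[OF y] a_abs_le[OF y] less_imp_le[OF rR(2)] uy usd_V_space dV, of N y] by simp
    moreover have "r * (V_norm ?e)\<^sup>2 + 2 * Re (aform (a y) ?e ?d) <= R * (V_norm (%x. ?e x + ?d x))\<^sup>2"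
      by (rule energy_split[OF a_measurable[OF y] a_AE[OF y] r eV dV])
    ultimately have "r * (V_norm ?e)\<^sup>2 <= R * (V_norm (%x. u y x - ?p x))\<^sup>2" by simp
    then have "(V_norm ?e)\<^sup>2 <= R / r * (V_norm (%x. u y x - ?p x))\<^sup>2" using r by (simp add: field_simps)
    then have "sqrt ((V_norm ?e)\<^sup>2) <= sqrt (R / r * (V_norm (%x. u y x - ?p x))\<^sup>2)" by (rule real_sqrt_le_mono)
    then have "V_norm ?e <= sqrt (R / r) * V_norm (%x. u y x - ?p x)"
      unfolding real_sqrt_mult real_sqrt_abs abs_of_nonneg[OF V_norm_nonneg] .
    then show "norm (V_norm (%x. usd N y x - u y x)) <= sqrt (R / r) * V_norm (%x. u y x - tfun (box N) (fc (u y)) x)"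
      unfolding V_norm_diff_commute[OF uy usd_V_space] I_def real_norm_def abs_of_nonneg[OF V_norm_nonneg] .
  qed
qed

lemma solution_bound:
  assumes u: "parametric_solution a f u" and y: "y \<in> Iinf"
  shows "V_norm (u y) <= n2 torus f / r"
proof -
  have uy: "u y \<in> V_space" by (rule solution_aform(1)[OF u y usd_V_space[of 0 y]])
  have "V_norm (u y) <= n2 torus f / r + V_norm (%x. usd N y x - u y x)" for N
    using V_norm_triangle_abs[OF usd_V_space[of N y] uy] usd_bound[OF y, of N] by linarith
  moreover have "(%N. n2 torus f / r + V_norm (%x. usd N y x - u y x)) \<longlonglongrightarrow> n2 torus f / r + 0"
    by (intro tendsto_add tendsto_const usd_converges u y)
  ultimately show ?thesis by (intro LIMSEQ_le_const[of _ "n2 torus f / r"]) auto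
qed

end


section \<open>Measurability of functions with values in V\<close>

lemma bm_simple_approx:
  fixes g :: "(nat => real) => complex"
  assumes g: "bm g" and e: "e > 0"
  shows "\<exists>F. simple_function mu F \<and> (\<forall>y\<in>Iinf. norm (F y - g y) <= e)"
proof -
  define \<delta> where "\<delta> = e / 2"
  have d: "\<delta> > 0" using e by (simp add: \<delta>_def)
  define q where "q z = \<delta> * of_int \<lfloor>z / \<delta>\<rfloor>" for z :: real
  define F where "F y = Complex (q (Re (g y))) (q (Im (g y)))" for y
  have q: "\<bar>q z - z\<bar> <= \<delta>" for z
  proof -
    have "\<bar>of_int \<lfloor>z / \<delta>\<rfloor> - z / \<delta>\<bar> <= 1" by linarith
    then have "\<delta> * \<bar>of_int \<lfloor>z / \<delta>\<rfloor> - z / \<delta>\<bar> <= \<delta> * 1" using d by (intro mult_left_mono) auto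
    moreover have "q z - z = \<delta> * (of_int \<lfloor>z / \<delta>\<rfloor> - z / \<delta>)" using d by (simp add: q_def right_diff_distrib)
    ultimately show ?thesis using d by (simp add: abs_mult)
  qed
  from g have gm: "g \<in> borel_measurable mu" by (rule bm_measurable)
  obtain C where C: "C \<ge> 0 \<and> (\<forall>y\<in>Iinf. norm (g y) <= C)" using bm_bound[OF g] ..
  let ?G = "(%i. \<delta> * of_int i) ` {\<lfloor>- C / \<delta>\<rfloor>..\<lfloor>C / \<delta>\<rfloor>}"
  have qG: "q z \<in> ?G" if "\<bar>z\<bar> <= C" for z
  proof -
    have "- C / \<delta> <= z / \<delta>" "z / \<delta> <= C / \<delta>" using that d by (intro divide_right_mono; linarith)+
    then have "\<lfloor>z / \<delta>\<rfloor> \<in> {\<lfloor>- C / \<delta>\<rfloor>..\<lfloor>C / \<delta>\<rfloor>}" by (auto intro: floor_mono)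
    then show ?thesis unfolding q_def by (rule imageI)
  qed
  have "simple_function mu F"
  proof (rule simple_function_borel_measurable)
    have "(%y. Re (g y)) \<in> borel_measurable mu" "(%y. Im (g y)) \<in> borel_measurable mu" using gm by auto
    moreover have "(%y. \<delta> * real_of_int \<lfloor>h y / \<delta>\<rfloor>) \<in> borel_measurable mu" if "h \<in> borel_measurable mu" for h
      using measurable_compose[OF borel_measurable_divide[OF that borel_measurable_const[of \<delta>]] borel_measurable_real_floor]
      by (intro borel_measurable_times borel_measurable_const)
    ultimately show "F \<in> borel_measurable mu" unfolding F_def q_def borel_measurable_complex_iff by simp
    have "F ` space mu \<subseteq> (%(u, v). Complex u v) ` (?G \<times> ?G)"
    proof
      fix z assume "z \<in> F ` space mu"
      then obtain y where y: "y \<in> Iinf" "z = F y" by (auto simp: space_mu)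
      have "\<bar>Re (g y)\<bar> <= C" "\<bar>Im (g y)\<bar> <= C"
        using C y abs_Re_le_cmod[of "g y"] abs_Im_le_cmod[of "g y"] by (auto intro: order_trans)
      then have "(q (Re (g y)), q (Im (g y))) \<in> ?G \<times> ?G" by (intro SigmaI qG)
      then show "z \<in> (%(u, v). Complex u v) ` (?G \<times> ?G)" unfolding y(2) F_def by (rule rev_image_eqI) simp
    qed
    then show "finite (F ` space mu)" by (rule finite_subset) simp
  qed
  moreover have "norm (F y - g y) <= e" for y
  proof -
    have "norm (F y - g y) <= \<bar>Re (F y - g y)\<bar> + \<bar>Im (F y - g y)\<bar>" by (rule cmod_le)
    also have "... <= \<delta> + \<delta>" using q[of "Re (g y)"] q[of "Im (g y)"] by (simp add: F_def)
    finally show ?thesis by (simp add: \<delta>_def)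
  qed
  ultimately show ?thesis by (intro exI[of _ F] conjI ballI)
qed

lemma simple_tfun:
  assumes "finite I" "!!k. k \<in> I ==> simple_function mu (F k)"
  shows "simple_function mu (%y. tfun I (%k. F k y))"
  using assms
proof (induction I rule: finite_induct)
  case empty
  then show ?case by (simp add: tfun_def)
next
  case (insert k I)
  have "simple_function mu (%y. (%c v x. c * efun k x + v x) (F k y) (tfun I (%k. F k y)))"
    using insert by (intro simple_function_compose2[where h = "%c v x. c * efun k x + v x"]) auto
  moreover have "tfun (insert k I) (%k. F k y) = (%x. F k y * efun k x + tfun I (%k. F k y) x)" for y
    using insert by (auto simp: tfun_def)
  ultimately show ?case by simp
qed

lemma V_norm_tfun_le:
  assumes I: "finite I" "I \<subseteq> Zstar" and w: "!!k. k \<in> I ==> norm (w k) <= e" and e: "e \<ge> 0"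
  shows "V_norm (tfun I w) <= sqrt (\<Sum>k\<in>I. pk k) * e"
proof (rule power2_le_imp_le)
  have p: "pk k \<ge> 0" for k :: "int ^ 'a" by (simp add: pk_def sum_nonneg)
  have "(V_norm (tfun I w))\<^sup>2 <= (\<Sum>k\<in>I. pk k * e\<^sup>2)"
    unfolding V_norm_tfun[OF I] by (intro sum_mono mult_left_mono power_mono w p) auto
  also have "... = (sqrt (\<Sum>k\<in>I. pk k) * e)\<^sup>2" by (simp add: power_mult_distrib sum_distrib_right sum_nonneg p)
  finally show "(V_norm (tfun I w))\<^sup>2 <= (sqrt (\<Sum>k\<in>I. pk k) * e)\<^sup>2" .
  show "0 <= sqrt (\<Sum>k\<in>I. pk k) * e" using e by (simp add: sum_nonneg p)
qed

lemma tfun_diff: "(%x. tfun I v x - tfun I w x) = tfun I (%k. v k - w k)"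
  by (auto simp: tfun_def sum_subtractf left_diff_distrib)

text \<open>Coefficients are rounded to a grid that is refined as the number of frequencies grows. The
  approximation by simple functions is then uniform in \<open>y\<close> and no exceptional set occurs.\<close>

lemma strongly_measurable_tfun_limit:
  fixes v :: "(nat => real) => real ^ 'm => complex"
  assumes J: "!!N. finite (J N)" "!!N. J N \<subseteq> Zstar" and g: "!!N k. k \<in> J N ==> bm (g N k)"
    and v: "!!y. y \<in> Iinf ==> v y \<in> V_space"
    and lim: "!!y. y \<in> Iinf ==> (%N. V_norm (%x. tfun (J N) (%k. g N k y) x - v y x)) \<longlonglongrightarrow> 0"
  shows "strongly_measurable mu V_space V_norm v"
proof -
  define e where "e N = inverse (real (Suc N)) / (1 + sqrt (\<Sum>k\<in>J N. pk k))" for N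
  have p: "pk k \<ge> 0" for k :: "int ^ 'm" by (simp add: pk_def sum_nonneg)
  have s1: "1 + sqrt (\<Sum>k\<in>J N. pk k) > 0" for N using real_sqrt_ge_zero[of "\<Sum>k\<in>J N. pk k"] p by (simp add: sum_nonneg add_pos_nonneg)
  have e0: "e N > 0" for N unfolding e_def using s1[of N] by simp
  have e1: "sqrt (\<Sum>k\<in>J N. pk k) * e N <= inverse (real (Suc N))" for N
  proof -
    have "sqrt (\<Sum>k\<in>J N. pk k) * e N <= (1 + sqrt (\<Sum>k\<in>J N. pk k)) * e N" using e0[of N] by (intro mult_right_mono) auto
    also have "... = inverse (real (Suc N))" unfolding e_def using s1[of N] by simp
    finally show ?thesis .
  qed
  have "\<forall>p. \<exists>F. snd p \<in> J (fst p) \<longrightarrow> simple_function mu F \<and> (\<forall>y\<in>Iinf. norm (F y - g (fst p) (snd p) y) <= e (fst p))"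
  proof
    fix p
    show "\<exists>F. snd p \<in> J (fst p) \<longrightarrow> simple_function mu F \<and> (\<forall>y\<in>Iinf. norm (F y - g (fst p) (snd p) y) <= e (fst p))"
      using bm_simple_approx[OF g e0, of "snd p" "fst p" "fst p"] by (cases "snd p \<in> J (fst p)") auto
  qed
  from choice[OF this] obtain F0 where F0: "\<forall>p. snd p \<in> J (fst p) \<longrightarrow> simple_function mu (F0 p) \<and> (\<forall>y\<in>Iinf. norm (F0 p y - g (fst p) (snd p) y) <= e (fst p))" ..
  define F where "F N k = F0 (N, k)" for N k
  have F: "simple_function mu (F N k)" "!!y. y \<in> Iinf ==> norm (F N k y - g N k y) <= e N" if "k \<in> J N" for N k
    using F0[rule_format, of "(N, k)"] that by (auto simp: F_def)
  let ?h = "%N y. tfun (J N) (%k. F N k y)"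
  have lim_h: "(%N. V_norm (%x. ?h N y x - v y x)) \<longlonglongrightarrow> 0" if y: "y \<in> Iinf" for y
  proof (rule Lim_null_comparison[OF always_eventually], rule allI)
    fix N
    let ?t = "tfun (J N) (%k. g N k y)"
    have tV: "?t \<in> V_space" and hV: "?h N y \<in> V_space" by (rule tfun_V_space[OF J])+
    have "V_norm (%x. ?h N y x - v y x) <= V_norm (%x. ?h N y x - ?t x) + V_norm (%x. ?t x - v y x)"
      by (rule V_norm_triangle3[OF hV tV v[OF y]])
    also have "V_norm (%x. ?h N y x - ?t x) <= sqrt (\<Sum>k\<in>J N. pk k) * e N"
      unfolding tfun_diff by (rule V_norm_tfun_le[OF J]) (use F(2)[OF _ y] e0[of N] in auto)
    also have "... <= inverse (real (Suc N))" by (rule e1)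
    finally show "norm (V_norm (%x. ?h N y x - v y x)) <= inverse (real (Suc N)) + V_norm (%x. ?t x - v y x)"
      by (simp add: V_norm_nonneg)
  next
    have "(%N. inverse (real (Suc N)) + V_norm (%x. tfun (J N) (%k. g N k y) x - v y x)) \<longlonglongrightarrow> 0 + 0"
      by (intro tendsto_add LIMSEQ_inverse_real_of_nat lim y)
    then show "(%N. inverse (real (Suc N)) + V_norm (%x. tfun (J N) (%k. g N k y) x - v y x)) \<longlonglongrightarrow> 0" by simp
  qed
  show ?thesis unfolding strongly_measurable_def
  proof (intro exI[of _ ?h] conjI allI ballI)
    show "simple_function mu (?h N)" for N by (rule simple_tfun[OF J(1) F(1)])
    show "?h N ` space mu \<subseteq> V_space" for N using tfun_V_space[OF J] by auto
    show "(%N. V_norm (%x. ?h N y x - v y x)) \<longlonglongrightarrow> 0" if "y \<in> space mu" for y using lim_h that by (simp add: space_mu)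
  qed
qed

text \<open>Reduces measurability of scalar quantities to simple functions.\<close>

lemma strongly_measurable_lipschitz:
  fixes \<Phi> :: "(real ^ 'm => complex) => 'b :: {second_countable_topology, banach}"
  assumes sm: "strongly_measurable mu V_space V_norm v" and v: "!!y. y \<in> Iinf ==> v y \<in> V_space"
    and lip: "!!w w'. w \<in> V_space ==> w' \<in> V_space ==> norm (\<Phi> w - \<Phi> w') <= C * V_norm (%x. w x - w' x)"
  shows "(%y. \<Phi> (v y)) \<in> borel_measurable mu"
proof -
  from sm obtain h where h: "!!n. simple_function mu (h n) \<and> h n ` space mu \<subseteq> V_space"
    "!!y. y \<in> space mu ==> (%n. V_norm (%x. h n y x - v y x)) \<longlonglongrightarrow> 0"
    unfolding strongly_measurable_def by auto
  show ?thesis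
  proof (rule borel_measurable_LIMSEQ_metric)
    fix n show "(%y. \<Phi> (h n y)) \<in> borel_measurable mu"
      by (rule borel_measurable_simple_function) (use simple_function_compose[of mu "h n" \<Phi>] h(1) in \<open>simp add: comp_def\<close>)
  next
    fix y assume y: "y \<in> space mu"
    have "(%n. C * V_norm (%x. h n y x - v y x)) \<longlonglongrightarrow> 0" by (rule tendsto_mult_right_zero[OF h(2)[OF y]])
    then have "(%n. \<Phi> (h n y) - \<Phi> (v y)) \<longlonglongrightarrow> 0"
      by (rule Lim_null_comparison[OF always_eventually, rotated])
         (intro allI lip v, use h(1) y in \<open>auto simp: space_mu\<close>)
    then show "(%n. \<Phi> (h n y)) \<longlonglongrightarrow> \<Phi> (v y)" by (rule LIM_zero_cancel)
  qed
qed

lemma L2V_coeff: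
  fixes v :: "(nat => real) => real ^ 'm => complex"
  assumes v: "!!y. y \<in> Iinf ==> v y \<in> V_space" "strongly_measurable mu V_space V_norm v"
  shows "(%y. V_norm (v y)) \<in> borel_measurable mu" "k \<in> Zstar ==> (%y. fc (v y) k) \<in> borel_measurable mu"
proof -
  show "(%y. V_norm (v y)) \<in> borel_measurable mu"
    by (rule strongly_measurable_lipschitz[OF v(2,1), where C = 1]) (auto simp: V_norm_triangle_abs)
  assume k: "k \<in> Zstar"
  show "(%y. fc (v y) k) \<in> borel_measurable mu"
  proof (rule strongly_measurable_lipschitz[OF v(2,1), where C = "1 / sqrt (pk k)"])
    fix w w' :: "real ^ 'm => complex" assume w: "w \<in> V_space" "w' \<in> V_space"
    have "sqrt (pk k) * norm (fc w k - fc w' k) <= V_norm (%x. w x - w' x)"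
      using fc_V_bound[OF V_space_diff[OF w] k] unfolding fc_diff[OF V_space_integrable[OF w(1)] V_space_integrable[OF w(2)]] .
    then show "norm (fc w k - fc w' k) <= 1 / sqrt (pk k) * V_norm (%x. w x - w' x)" using pk_pos[OF k] by (simp add: field_simps)
  qed
qed

lemma L2V_boundedI:
  assumes v: "!!y. y \<in> Iinf ==> v y \<in> V_space" "strongly_measurable mu V_space V_norm v" "!!y. y \<in> Iinf ==> V_norm (v y) <= C"
  shows "v \<in> L2V"
proof -
  have "bm (%y. V_norm (v y))"
    by (rule bmI[OF L2V_coeff(1)[OF v(1,2)], where C = C]) (use v(3) in \<open>auto simp: abs_of_nonneg[OF V_norm_nonneg]\<close>)
  from bm_integrable[OF bm_norm_sq[OF this]] show ?thesis using v by (simp add: L2V_def)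
qed


section \<open>Galerkin spaces\<close>

text \<open>A general element of the Galerkin space, by its coefficients.\<close>

definition gs :: "((int ^ 'm) \<times> (nat => nat)) set => ((int ^ 'm) \<times> (nat => nat) => complex) => (nat => real) => real ^ 'm => complex" where
  "gs E c = (%y x. \<Sum>ks\<in>E. c ks * Lfun ks y x)"

text \<open>The coefficient of \<open>efun k\<close> as a function of the parameter.\<close>

definition gco :: "((int ^ 'm) \<times> (nat => nat)) set => ((int ^ 'm) \<times> (nat => nat) => complex) => int ^ 'm => (nat => real) => complex" where
  "gco E c k y = (\<Sum>s\<in>E `` {k}. c (k, s) * of_real (mlegendre s y))"

lemma partial_sum_gs: "partial_sum_op E v = gs E (legendre_coeff v)"
  by (simp add: partial_sum_op_def gs_def)

lemma galerkin_space_gs: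
  assumes E: "finite E"
  shows "galerkin_space E = range (gs E)"
proof
  have sub: "cfun.subspace (range (gs E))"
  proof (rule cfun.subspaceI)
    have "0 = gs E (%_. 0)" by (simp add: gs_def fun_eq_iff)
    then show "0 \<in> range (gs E)" by (metis rangeI)
    fix x y assume "x \<in> range (gs E)" "y \<in> range (gs E)"
    then obtain c d where "x = gs E c" "y = gs E d" by auto
    then have "x + y = gs E (%ks. c ks + d ks)" by (simp add: gs_def fun_eq_iff distrib_right sum.distrib)
    then show "x + y \<in> range (gs E)" by (metis rangeI)
  next
    fix k x assume "x \<in> range (gs E)"
    then obtain c where "x = gs E c" by auto
    then have "cscale k x = gs E (%ks. k * c ks)" by (simp add: gs_def fun_eq_iff cscale_def sum_distrib_left mult.assoc)
    then show "cscale k x \<in> range (gs E)" by (metis rangeI)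
  qed
  have "Lfun ks \<in> range (gs E)" if "ks \<in> E" for ks
  proof -
    have "Lfun ks = gs E (%l. if l = ks then 1 else 0)"
      using that E by (simp add: gs_def fun_eq_iff if_distrib[where f = "%c. c * _"] sum.delta cong: if_cong)
    then show ?thesis by (metis rangeI)
  qed
  then show "galerkin_space E \<subseteq> range (gs E)"
    unfolding galerkin_space_def by (intro cfun.span_minimal sub) auto
  have "gs E c \<in> galerkin_space E" for c
  proof -
    have "gs E c = (\<Sum>ks\<in>E. cscale (c ks) (Lfun ks))"
    proof -
      have "(\<Sum>ks\<in>F. cscale (c ks) (Lfun ks)) = gs F c" if "finite F" for F
        using that by (induction F rule: finite_induct) (simp_all add: gs_def fun_eq_iff cscale_def)
      then show ?thesis using E by simp
    qed
    then show ?thesis unfolding galerkin_space_def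
      by (simp only:) (intro cfun.span_sum cfun.span_scale cfun.span_base imageI)
  qed
  then show "range (gs E) \<subseteq> galerkin_space E" by auto
qed

context
  fixes E :: "((int ^ 'm) \<times> (nat => nat)) set"
  assumes E: "finite E" "E \<subseteq> Zstar \<times> finsupp"
begin

lemma E_fst: "finite (fst ` E)" "fst ` E \<subseteq> Zstar"
  using E by auto

lemma E_snd: "finite (E `` {k})" "E `` {k} \<subseteq> finsupp"
  using E by (auto intro: finite_Image)

lemma sum_E: "(\<Sum>ks\<in>E. g ks) = (\<Sum>k\<in>fst ` E. \<Sum>s\<in>E `` {k}. g (k, s))"
proof -
  have "E = Sigma (fst ` E) (%k. E `` {k})" by force
  then have "(\<Sum>ks\<in>E. g ks) = (\<Sum>ks\<in>Sigma (fst ` E) (%k. E `` {k}). g ks)" by simp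
  also have "... = (\<Sum>k\<in>fst ` E. \<Sum>s\<in>E `` {k}. g (k, s))"
    using E_fst E_snd by (subst sum.Sigma) (auto simp: split_def)
  finally show ?thesis .
qed

lemma gs_tfun: "gs E c y = tfun (fst ` E) (%k. gco E c k y)"
  by (rule ext) (simp add: gs_def sum_E tfun_def gco_def Lfun_def sum_distrib_left sum_distrib_right mult_ac)

lemma bm_mleg: "s \<in> finsupp ==> bm (%y. complex_of_real (mlegendre s y))"
  by (rule bm_of_real[OF bm_mlegendre])

lemma gco_bm: "bm (gco E c k)"
  unfolding gco_def[abs_def] using E_snd[of k] by (intro bm_sum bm_mult bm_const bm_mleg) auto

lemma gs_V_space: "gs E c y \<in> V_space"
  unfolding gs_tfun by (rule tfun_V_space[OF E_fst])

lemma gs_V_norm: "(V_norm (gs E c y))\<^sup>2 = (\<Sum>k\<in>fst ` E. pk k * (norm (gco E c k y))\<^sup>2)"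
  unfolding gs_tfun by (rule V_norm_tfun[OF E_fst])

lemma gs_L2V: "gs E c \<in> L2V"
proof -
  have zero: "V_norm (%x::real^'m. 0) = 0" using V_norm_tfun[of "{}" undefined] by (simp add: tfun_def[abs_def])
  have sm: "strongly_measurable mu V_space V_norm (gs E c)"
    by (rule strongly_measurable_tfun_limit[where J = "%N. fst ` E" and g = "%N. gco E c", OF E_fst gco_bm gs_V_space])
       (simp add: gs_tfun[symmetric] zero)
  have "bm (%y. \<Sum>k\<in>fst ` E. pk k * (norm (gco E c k y))\<^sup>2)"
    by (intro bm_sum E_fst bm_mult bm_const bm_norm_sq gco_bm)
  then have "integrable mu (%y. (V_norm (gs E c y))\<^sup>2)" unfolding gs_V_norm by (rule bm_integrable)
  then show ?thesis using sm gs_V_space by (simp add: L2V_def)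
qed

lemma gs_L2V_norm: "(L2V_norm (gs E c))\<^sup>2 = (\<Sum>(k, s)\<in>E. pk k * (norm (c (k, s)))\<^sup>2)"
proof -
  have "(\<integral>y. (norm (gco E c k y))\<^sup>2 \<partial>mu) = (\<Sum>s\<in>E `` {k}. (norm (c (k, s)))\<^sup>2)" for k
  proof -
    have "(\<integral>y. (norm (0 - gco E c k y))\<^sup>2 \<partial>mu) = (\<integral>y. (norm (0::complex))\<^sup>2 \<partial>mu) - (\<Sum>s\<in>E `` {k}. (norm (lcoef (%_. 0) s))\<^sup>2)
        + (\<Sum>s\<in>E `` {k}. (norm (lcoef (%_. 0) s - c (k, s)))\<^sup>2)"
      unfolding gco_def by (rule pythagoras[OF bm_const E_snd])
    then show ?thesis by (simp add: lcoef_def)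
  qed
  moreover have "(L2V_norm (gs E c))\<^sup>2 = (\<integral>y. (\<Sum>k\<in>fst ` E. pk k * (norm (gco E c k y))\<^sup>2) \<partial>mu)"
    unfolding L2V_norm_def gs_V_norm[symmetric] by (rule real_sqrt_pow2) (simp add: integral_nonneg_AE)
  moreover have "... = (\<Sum>k\<in>fst ` E. pk k * (\<integral>y. (norm (gco E c k y))\<^sup>2 \<partial>mu))"
    by (subst Bochner_Integration.integral_sum) (auto intro!: bm_integrable bm_mult bm_const bm_norm_sq gco_bm)
  ultimately show ?thesis by (simp add: sum_E sum_distrib_left)
qed

text \<open>By orthogonality, different coefficients give functions at positive distance. Hence the
  basis functions are independent, and the norm separates points of the Galerkin space.\<close>

lemma gs_norm_zero:
  assumes "L2V_norm (gs E c) = 0" "ks \<in> E"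
  shows "c ks = 0"
proof -
  have nn: "0 <= (case ks of (k, s) => pk k * (norm (c (k, s)))\<^sup>2)" if "ks \<in> E" for ks
  proof -
    have "0 < pk (fst ks)" using that E by (intro pk_pos) auto
    then show ?thesis by (cases ks) simp
  qed
  have z: "(\<Sum>(k, s)\<in>E. pk k * (norm (c (k, s)))\<^sup>2) = 0" using gs_L2V_norm[of c] assms(1) by simp
  have "\<forall>ks\<in>E. (case ks of (k, s) => pk k * (norm (c (k, s)))\<^sup>2) = 0"
    by (subst sum_nonneg_eq_0_iff[symmetric]) (rule E(1), rule nn, assumption, rule z)
  then have "(case ks of (k, s) => pk k * (norm (c (k, s)))\<^sup>2) = 0" using assms(2) by (rule bspec)
  moreover have "pk (fst ks) > 0" using assms(2) E by (intro pk_pos) auto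
  ultimately show ?thesis by (cases ks) auto
qed

lemma gs_zero: "gs E c = 0 ==> ks \<in> E ==> c ks = 0"
proof (rule gs_norm_zero)
  assume z: "gs E c = 0"
  have "gs E c = gs E (%_. 0)" unfolding z by (simp add: gs_def fun_eq_iff)
  then have "(L2V_norm (gs E c))\<^sup>2 = 0" unfolding gs_L2V_norm[of "%_. 0"] by (simp add: gs_L2V_norm split_def)
  then show "L2V_norm (gs E c) = 0" by simp
qed

lemma Lfun_inj: "inj_on Lfun E"
proof (rule inj_onI, rule ccontr)
  fix p q assume pq: "p \<in> E" "q \<in> E" "Lfun p = Lfun q" "p ~= q"
  let ?c = "%l. (if l = p then 1 else 0) - (if l = q then 1 else 0) :: complex"
  have "gs E ?c = (%y x. Lfun p y x - Lfun q y x)"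
    using pq E by (simp add: gs_def fun_eq_iff left_diff_distrib sum_subtractf if_distrib[where f = "%c. c * _"] sum.delta cong: if_cong)
  then have "gs E ?c = 0" using pq(3) by (simp add: fun_eq_iff)
  then have "?c p = 0" by (rule gs_zero) (rule pq)
  then show False using pq(4) by simp
qed

lemma galerkin_dim: "cfun.dim (galerkin_space E) = card E"
proof -
  have "cfun.independent (Lfun ` E)"
  proof (rule cfun.independent_if_scalars_zero)
    fix g x assume z: "(\<Sum>x\<in>Lfun ` E. cscale (g x) x) = 0" and x: "x \<in> Lfun ` E"
    have "(\<Sum>x\<in>Lfun ` E. cscale (g x) x) = (\<Sum>ks\<in>E. cscale (g (Lfun ks)) (Lfun ks))"
      by (rule sum.reindex_cong[OF Lfun_inj]) auto
    also have "... = gs E (%ks. g (Lfun ks))"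
    proof -
      have "(\<Sum>ks\<in>F. cscale (g (Lfun ks)) (Lfun ks)) = gs F (%ks. g (Lfun ks))" if "finite F" for F
        using that by (induction F rule: finite_induct) (simp_all add: gs_def fun_eq_iff cscale_def)
      then show ?thesis using E by simp
    qed
    finally have "gs E (%ks. g (Lfun ks)) = 0" using z by simp
    from gs_zero[OF this] x show "g x = 0" by auto
  qed (use E in simp)
  then have "cfun.dim (galerkin_space E) = card (Lfun ` E)"
    unfolding galerkin_space_def by (rule cfun.dim_span_eq_card_independent)
  then show ?thesis using card_image[OF Lfun_inj] by simp
qed

lemma legendre_coeff_fc:
  shows "legendre_coeff v (k, s) = (\<integral>y. fc (v y) k * of_real (mlegendre s y) \<partial>mu)"
proof -
  have "(\<integral>x. v y x * cnj (Lfun (k, s) y x) \<partial>torus) = fc (v y) k * of_real (mlegendre s y)" for y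
  proof -
    have "(\<integral>x. v y x * cnj (Lfun (k, s) y x) \<partial>torus) = (\<integral>x. (v y x * cnj (efun k x)) * of_real (mlegendre s y) \<partial>torus)"
      by (simp add: Lfun_def mult.assoc)
    also have "... = fc (v y) k * of_real (mlegendre s y)" unfolding fc_def by (rule integral_mult_left_zero)
    finally show ?thesis .
  qed
  then show ?thesis by (simp add: legendre_coeff_def)
qed

lemma fc_mult_integrable:
  assumes v: "v \<in> L2V" and k: "k \<in> Zstar" and g: "bm g"
  shows "integrable mu (%y. fc (v y) k * g y)"
proof -
  have vV: "!!y. y \<in> Iinf ==> v y \<in> V_space" and sm: "strongly_measurable mu V_space V_norm v"
    and iv: "integrable mu (%y. (V_norm (v y))\<^sup>2)" using v by (auto simp: L2V_def)
  have m1: "(%y. V_norm (v y)) \<in> borel_measurable mu" by (rule L2V_coeff(1)) (use vV sm in auto)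
  have m2: "(%y. fc (v y) k) \<in> borel_measurable mu" by (rule L2V_coeff(2)) (use vV sm k in auto)
  have l: "l2 mu (%y. V_norm (v y))" unfolding l2_def using m1 iv by simp
  have lg: "l2 mu g" unfolding l2_def using bm_measurable[OF g] bm_integrable[OF bm_norm_sq[OF g]] by simp
  show ?thesis
  proof (rule l2_form(1)[OF l lg])
    show "(%y. fc (v y) k * g y) \<in> borel_measurable mu" by (intro borel_measurable_times m2 bm_measurable g)
    show "0 <= 1 / sqrt (pk k)" using pk_pos[OF k] by simp
    show "AE y in mu. norm (fc (v y) k * g y) <= 1 / sqrt (pk k) * (norm (V_norm (v y)) * norm (g y))"
    proof (rule AE_I2)
      fix y assume "y \<in> space mu"
      then have "sqrt (pk k) * norm (fc (v y) k) <= V_norm (v y)" by (intro fc_V_bound vV k) (simp add: space_mu)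
      then have "norm (fc (v y) k) <= V_norm (v y) / sqrt (pk k)" using pk_pos[OF k] by (simp add: field_simps)
      then have "norm (fc (v y) k) * norm (g y) <= V_norm (v y) / sqrt (pk k) * norm (g y)" by (rule mult_right_mono) simp
      then show "norm (fc (v y) k * g y) <= 1 / sqrt (pk k) * (norm (V_norm (v y)) * norm (g y))"
        by (simp add: norm_mult V_norm_nonneg)
    qed
  qed
qed

lemma gco_lcoef: "s \<in> E `` {k} ==> (\<integral>y. gco E c k y * of_real (mlegendre s y) \<partial>mu) = c (k, s)"
  using lcoef_sum[OF E_snd(1)[of k] E_snd(2)[of k], of s "%s. c (k, s)"] E_snd(2)[of k] by (auto simp: gco_def lcoef_def)

text \<open>The coefficients are taken in \<open>L2\<close> instead of \<open>V\<close>, but the basis functions are orthogonal in both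
  inner products.\<close>

lemma projector: "L2V_orthogonal_projector (partial_sum_op E) (galerkin_space E)"
  unfolding L2V_orthogonal_projector_def galerkin_space_gs[OF E(1)] partial_sum_gs
proof (intro conjI ballI rangeI)
  show "range (gs E) \<subseteq> L2V" using gs_L2V by auto
next
  fix v w :: "(nat => real) => real ^ 'm => complex" assume v: "v \<in> L2V" and "w \<in> range (gs E)"
  then obtain c where w: "w = gs E c" by auto
  let ?p = "legendre_coeff v"
  have vV: "!!y. y \<in> Iinf ==> v y \<in> V_space" using v by (simp add: L2V_def)
  have fcp: "fc (gs E ?p y) k = gco E ?p k y" if "k \<in> fst ` E" for k y
    unfolding gs_tfun using fc_tfun[OF E_fst(1)] that by simp
  have pt: "V_inner ((v - gs E ?p) y) (w y) = (\<Sum>k\<in>fst ` E. of_real (pk k) * (\<Sum>s\<in>E `` {k}. cnj (c (k, s)) *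
      (fc (v y) k * of_real (mlegendre s y) - gco E ?p k y * of_real (mlegendre s y))))" if y: "y \<in> space mu" for y
  proof -
    have y': "y \<in> Iinf" using y by (simp add: space_mu)
    have "(v - gs E ?p) y = (%x. v y x - gs E ?p y x)" by (simp add: fun_eq_iff)
    then have "V_inner ((v - gs E ?p) y) (w y) = (\<Sum>k\<in>fst ` E. of_real (pk k) * (fc (%x. v y x - gs E ?p y x) k * cnj (gco E c k y)))"
      unfolding w gs_tfun[of c] by (simp only: V_inner_tfun[OF V_space_diff[OF vV[OF y'] gs_V_space] E_fst])
    also have "... = (\<Sum>k\<in>fst ` E. of_real (pk k) * (\<Sum>s\<in>E `` {k}. cnj (c (k, s)) *
      (fc (v y) k * of_real (mlegendre s y) - gco E ?p k y * of_real (mlegendre s y))))"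
      unfolding fc_diff[OF V_space_integrable[OF vV[OF y']] V_space_integrable[OF gs_V_space]]
      by (rule sum.cong[OF refl], simp only: fcp gco_def[of E c] cnj_sum complex_cnj_mult complex_cnj_complex_of_real sum_distrib_left left_diff_distrib right_diff_distrib mult_ac)
    finally show ?thesis .
  qed
  have i1: "integrable mu (%y. fc (v y) k * of_real (mlegendre s y))" if "(k, s) \<in> E" for k s
    using that E by (intro fc_mult_integrable[OF v] bm_mleg) auto
  have i2: "integrable mu (%y. gco E ?p k y * of_real (mlegendre s y))" if "(k, s) \<in> E" for k s
    using that E by (intro bm_integrable bm_mult gco_bm bm_mleg) auto
  have "L2V_inner (v - gs E ?p) w = (\<integral>y. (\<Sum>k\<in>fst ` E. of_real (pk k) * (\<Sum>s\<in>E `` {k}. cnj (c (k, s)) *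
      (fc (v y) k * of_real (mlegendre s y) - gco E ?p k y * of_real (mlegendre s y)))) \<partial>mu)"
    unfolding L2V_inner_def by (rule Bochner_Integration.integral_cong[OF refl pt])
  also have "... = (\<Sum>k\<in>fst ` E. of_real (pk k) * (\<Sum>s\<in>E `` {k}. cnj (c (k, s)) *
      (\<integral>y. fc (v y) k * of_real (mlegendre s y) - gco E ?p k y * of_real (mlegendre s y) \<partial>mu)))"
  proof -
    let ?X = "%k s y. fc (v y) k * of_real (mlegendre s y) - gco E ?p k y * of_real (mlegendre s y)"
    have iX: "integrable mu (%y. cnj (c (k, s)) * ?X k s y)" if "(k, s) \<in> E" for k s
      by (intro integrable_mult_right Bochner_Integration.integrable_diff i1 i2 that)
    have iS: "integrable mu (%y. of_real (pk k) * (\<Sum>s\<in>E `` {k}. cnj (c (k, s)) * ?X k s y))" for k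
      by (rule integrable_mult_right, rule Bochner_Integration.integrable_sum, rule iX) simp
    have "(\<integral>y. (\<Sum>k\<in>fst ` E. of_real (pk k) * (\<Sum>s\<in>E `` {k}. cnj (c (k, s)) * ?X k s y)) \<partial>mu)
        = (\<Sum>k\<in>fst ` E. \<integral>y. of_real (pk k) * (\<Sum>s\<in>E `` {k}. cnj (c (k, s)) * ?X k s y) \<partial>mu)"
      by (rule Bochner_Integration.integral_sum) (rule iS)
    also have "... = (\<Sum>k\<in>fst ` E. of_real (pk k) * (\<Sum>s\<in>E `` {k}. cnj (c (k, s)) * (\<integral>y. ?X k s y \<partial>mu)))"
    proof (rule sum.cong[OF refl])
      fix k
      have "(\<integral>y. (\<Sum>s\<in>E `` {k}. cnj (c (k, s)) * ?X k s y) \<partial>mu) = (\<Sum>s\<in>E `` {k}. \<integral>y. cnj (c (k, s)) * ?X k s y \<partial>mu)"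
        by (rule Bochner_Integration.integral_sum) (rule iX, simp)
      then show "(\<integral>y. of_real (pk k) * (\<Sum>s\<in>E `` {k}. cnj (c (k, s)) * ?X k s y) \<partial>mu)
          = of_real (pk k) * (\<Sum>s\<in>E `` {k}. cnj (c (k, s)) * (\<integral>y. ?X k s y \<partial>mu))"
        unfolding integral_mult_right_zero by (rule arg_cong)
    qed
    finally show ?thesis .
  qed
  also have "... = 0"
  proof -
    have "(\<integral>y. fc (v y) k * of_real (mlegendre s y) - gco E ?p k y * of_real (mlegendre s y) \<partial>mu) = 0" if "(k, s) \<in> E" for k s
    proof -
      have "(\<integral>y. gco E ?p k y * of_real (mlegendre s y) \<partial>mu) = ?p (k, s)" by (rule gco_lcoef) (use that in simp)
      then show ?thesis using i1[OF that] i2[OF that] by (simp add: legendre_coeff_fc)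
    qed
    then show ?thesis by simp
  qed
  finally show "L2V_inner (v - gs E ?p) w = 0" .
qed

end

lemma gs_cnj:
  fixes E :: "((int ^ 'm) \<times> (nat => nat)) set"
  assumes sym: "!!k s. (k, s) \<in> E ==> (- k, s) \<in> E"
  shows "(%y x. cnj (gs E c y x)) = gs E (%(k, s). cnj (c (- k, s)))"
proof (intro ext)
  fix y x
  have "cnj (gs E c y x) = (\<Sum>(k, s)\<in>E. cnj (c (k, s)) * Lfun (- k, s) y x)"
    unfolding gs_def cnj_sum by (rule sum.cong[OF refl]) (auto simp: Lfun_def cnj_efun)
  also have "... = (\<Sum>(k, s)\<in>E. cnj (c (- k, s)) * Lfun (k, s) y x)"
    by (rule sum.reindex_bij_witness[where i = "%(k, s). (- k, s)" and j = "%(k, s). (- k, s)"]) (use sym in auto)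
  finally show "cnj (gs E c y x) = gs E (%(k, s). cnj (c (- k, s))) y x" by (simp add: gs_def split_def)
qed


section \<open>The error bound\<close>

lemma V_norm_zero: "V_norm (%x::real^'m. 0) = 0"
  using V_norm_tfun[of "{}" undefined] by (simp add: tfun_def[abs_def])

lemma L2V_l2:
  assumes v: "v \<in> L2V"
  shows "l2 mu (%y. V_norm (v y))" "L2V_norm v = n2 mu (%y. V_norm (v y))"
proof -
  have "(%y. V_norm (v y)) \<in> borel_measurable mu" by (rule L2V_coeff(1)) (use v in \<open>auto simp: L2V_def\<close>)
  then show "l2 mu (%y. V_norm (v y))" using v by (simp add: l2_def L2V_def)
  show "L2V_norm v = n2 mu (%y. V_norm (v y))" by (simp add: L2V_norm_def n2_def)
qed

lemma n2_mono_sum: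
  fixes h f g :: "'x => real"
  assumes h: "l2 M h" and f: "l2 M f" and g: "l2 M g" and le: "!!x. x \<in> space M ==> \<bar>h x\<bar> <= f x + g x"
  shows "n2 M h <= n2 M f + n2 M g"
proof -
  have "n2 M h <= n2 M (%x. f x + g x)"
    unfolding n2_def
  proof (rule real_sqrt_le_mono, rule integral_mono)
    show "integrable M (%x. (norm (h x))\<^sup>2)" using h by (simp add: l2_def)
    show "integrable M (%x. (norm (f x + g x))\<^sup>2)" using l2_add(1)[OF f g] by (simp add: l2_def)
    show "(norm (h x))\<^sup>2 <= (norm (f x + g x))\<^sup>2" if "x \<in> space M" for x
      using le[OF that] by (intro power_mono) auto
  qed
  also have "... <= n2 M f + n2 M g" by (rule l2_add(2)[OF f g])
  finally show ?thesis .
qed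

lemma L2V_diff:
  fixes u v :: "(nat => real) => real ^ 'm => complex"
  assumes u: "u \<in> L2V" and v: "v \<in> L2V"
  shows "u - v \<in> L2V"
proof -
  have uV: "u y \<in> V_space" and vV: "v y \<in> V_space" if "y \<in> Iinf" for y using u v that by (auto simp: L2V_def)
  have ap: "(u - v) y = (%x. u y x - v y x)" for y by (simp add: fun_eq_iff)
  have "strongly_measurable mu V_space V_norm u" using u by (simp add: L2V_def)
  then obtain g where g: "!!n. simple_function mu (g n) \<and> g n ` space mu \<subseteq> V_space"
    "!!y. y \<in> space mu ==> (%n. V_norm (%x. g n y x - u y x)) \<longlonglongrightarrow> 0" unfolding strongly_measurable_def by auto
  have "strongly_measurable mu V_space V_norm v" using v by (simp add: L2V_def)
  then obtain h where h: "!!n. simple_function mu (h n) \<and> h n ` space mu \<subseteq> V_space"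
    "!!y. y \<in> space mu ==> (%n. V_norm (%x. h n y x - v y x)) \<longlonglongrightarrow> 0" unfolding strongly_measurable_def by auto
  let ?k = "%n y x. g n y x - h n y x"
  have gV: "g n y \<in> V_space" and hV: "h n y \<in> V_space" if "y \<in> Iinf" for n y using g(1)[of n] h(1)[of n] that by (auto simp: space_mu)
  have sm: "strongly_measurable mu V_space V_norm (u - v)"
    unfolding strongly_measurable_def
  proof (intro exI[of _ ?k] conjI allI ballI)
    fix n
    show "simple_function mu (?k n)"
      using simple_function_compose2[of mu "g n" "h n" "%p q x. p x - q x"] g(1) h(1) by simp
    show "?k n ` space mu \<subseteq> V_space" using V_space_diff[OF gV hV] by (auto simp: space_mu)
  next
    fix y assume y: "y \<in> space mu"
    then have y': "y \<in> Iinf" by (simp add: space_mu)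
    show "(%n. V_norm (%x. ?k n y x - (u - v) y x)) \<longlonglongrightarrow> 0"
    proof (rule Lim_null_comparison[OF always_eventually], rule allI)
      fix n
      have gu: "(%x. g n y x - u y x) \<in> V_space" and vh: "(%x. v y x - h n y x) \<in> V_space"
        by (rule V_space_diff[OF gV[OF y'] uV[OF y']], rule V_space_diff[OF vV[OF y'] hV[OF y']])
      have "V_norm (%x. ?k n y x - (u - v) y x) = V_norm (%x. (g n y x - u y x) + (v y x - h n y x))"
        by (rule arg_cong[where f = V_norm]) (simp add: fun_eq_iff)
      also have "... <= V_norm (%x. g n y x - u y x) + V_norm (%x. v y x - h n y x)" by (rule V_norm_triangle[OF gu vh])
      also have "V_norm (%x. v y x - h n y x) = V_norm (%x. h n y x - v y x)" by (rule V_norm_diff_commute[OF vV[OF y'] hV[OF y']])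
      finally show "norm (V_norm (%x. ?k n y x - (u - v) y x)) <= V_norm (%x. g n y x - u y x) + V_norm (%x. h n y x - v y x)"
        by (simp add: V_norm_nonneg)
    next
      have "(%n. V_norm (%x. g n y x - u y x) + V_norm (%x. h n y x - v y x)) \<longlonglongrightarrow> 0 + 0" by (intro tendsto_add g(2) h(2) y)
      then show "(%n. V_norm (%x. g n y x - u y x) + V_norm (%x. h n y x - v y x)) \<longlonglongrightarrow> 0" by simp
    qed
  qed
  have mem: "(u - v) y \<in> V_space" if "y \<in> Iinf" for y unfolding ap by (rule V_space_diff[OF uV[OF that] vV[OF that]])
  have "integrable mu (%y. (V_norm ((u - v) y))\<^sup>2)"
  proof (rule Bochner_Integration.integrable_bound)
    have "l2 mu (%y. V_norm (u y) + V_norm (v y))" by (rule l2_add(1)[OF L2V_l2(1)[OF u] L2V_l2(1)[OF v]])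
    then show "integrable mu (%y. (norm (V_norm (u y) + V_norm (v y)))\<^sup>2)" by (simp add: l2_def)
    have "(%y. V_norm ((u - v) y)) \<in> borel_measurable mu" by (rule L2V_coeff(1)[OF mem sm])
    then show "(%y. (V_norm ((u - v) y))\<^sup>2) \<in> borel_measurable mu" by (rule borel_measurable_power)
    show "AE y in mu. norm ((V_norm ((u - v) y))\<^sup>2) <= norm ((norm (V_norm (u y) + V_norm (v y)))\<^sup>2)"
    proof (rule AE_I2)
      fix y assume "y \<in> space mu"
      then have y: "y \<in> Iinf" by (simp add: space_mu)
      have "V_norm ((u - v) y) <= V_norm (u y) + V_norm (v y)"
        using V_norm_triangle3[OF uV[OF y] tfun_V_space[of "{}" undefined] vV[OF y]] V_norm_diff_commute[OF tfun_V_space[of "{}" undefined] vV[OF y]]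
        unfolding ap by (simp add: tfun_def[abs_def])
      then show "norm ((V_norm ((u - v) y))\<^sup>2) <= norm ((norm (V_norm (u y) + V_norm (v y)))\<^sup>2)"
        by (simp add: V_norm_nonneg power_mono)
    qed
  qed
  then show ?thesis using sm mem by (simp add: L2V_def)
qed

lemma L2V_triangle:
  fixes u v w :: "(nat => real) => real ^ 'm => complex"
  assumes u: "u \<in> L2V" and v: "v \<in> L2V" and w: "w \<in> L2V"
  shows "L2V_norm (u - w) <= L2V_norm (u - v) + L2V_norm (v - w)"
  unfolding L2V_l2(2)[OF L2V_diff[OF u w]] L2V_l2(2)[OF L2V_diff[OF u v]] L2V_l2(2)[OF L2V_diff[OF v w]]
proof (rule n2_mono_sum)
  fix y assume "y \<in> space mu"
  then have "u y \<in> V_space" "v y \<in> V_space" "w y \<in> V_space" using u v w by (auto simp: L2V_def space_mu)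
  then show "\<bar>V_norm ((u - w) y)\<bar> <= V_norm ((u - v) y) + V_norm ((v - w) y)"
    using V_norm_triangle3[of "u y" "v y" "w y"] by (simp add: V_norm_nonneg fun_diff_def)
qed (intro L2V_l2(1) L2V_diff u v w)+

lemma pk_ge_inf:
  fixes k :: "int ^ 'm"
  shows "(2 * pi * abs_inf k)\<^sup>2 <= pk k"
proof -
  have "Max (range (%j. \<bar>k $ j\<bar>)) \<in> range (%j. \<bar>k $ j\<bar>)" by (rule Max_in) auto
  then obtain j where j: "Max (range (%j. \<bar>k $ j\<bar>)) = \<bar>k $ j\<bar>" by (rule rangeE)
  have "(abs_inf k)\<^sup>2 = (real_of_int (k $ j))\<^sup>2" by (simp add: abs_inf_def j)
  also have "... <= (\<Sum>i\<in>UNIV. (real_of_int (k $ i))\<^sup>2)" by (rule member_le_sum) auto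
  finally have "(4 * pi\<^sup>2) * (abs_inf k)\<^sup>2 <= pk k" unfolding pk_def by (intro mult_left_mono) auto
  then show ?thesis by (simp add: power_mult_distrib)
qed

lemma mpow_mult: "mpow (%j. x j * y j) s = mpow x s * mpow y s"
  by (simp add: mpow_def power_mult_distrib prod.distrib)

lemma mpow_square: "(mpow x s)\<^sup>2 = mpow (%j. (x j)\<^sup>2) s"
  by (simp add: mpow_def prod_power_distrib power_mult[symmetric] mult.commute)

lemma mpow_inverse: "mpow (%j. inverse (x j)) s = inverse (mpow x s)"
  by (simp add: mpow_def power_inverse prod_inversef[symmetric] comp_def)

context affine_problem
begin

lemma usd_L2V: "usd N \<in> L2V"
proof (rule L2V_boundedI[OF usd_V_space _ usd_bound])
  show "strongly_measurable mu V_space V_norm (usd N)"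
    by (rule strongly_measurable_tfun_limit[where J = "%_. box N" and g = "%_ k y. W (box N) 0 (%_. 0) y k"])
       (use box usd_V_space in \<open>auto simp: usd_def V_norm_zero finsupp_def intro!: upc_bm W_upc[OF box]\<close>)
qed

lemma solution_L2V:
  assumes u: "parametric_solution a f u"
  shows "u \<in> L2V"
proof (rule L2V_boundedI[OF solution_aform(1)[OF u _ usd_V_space[of 0 undefined]] _ solution_bound[OF u]])
  show "strongly_measurable mu V_space V_norm u"
  proof (rule strongly_measurable_tfun_limit[where J = box and g = "%N k y. W (box N) 0 (%_. 0) y k", OF box])
    show "bm (%y. W (box N) 0 (%_. 0) y k)" if "k \<in> box N" for N k
      by (rule upc_bm[OF W_upc[OF box _ that]]) (simp add: finsupp_def)
    show "u y \<in> V_space" if "y \<in> Iinf" for y by (rule solution_aform(1)[OF u that usd_V_space[of 0 y]])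
    show "(%N. V_norm (%x. tfun (box N) (%k. W (box N) 0 (%_. 0) y k) x - u y x)) \<longlonglongrightarrow> 0" if "y \<in> Iinf" for y
      using usd_converges[OF u that] by (simp add: usd_def)
  qed
qed

lemma usd_converges_L2V:
  assumes u: "parametric_solution a f u"
  shows "(%N. L2V_norm (u - usd N)) \<longlonglongrightarrow> 0"
proof -
  have uV: "u y \<in> V_space" if "y \<in> Iinf" for y by (rule solution_aform(1)[OF u that usd_V_space[of 0 y]])
  have eq: "V_norm ((u - usd N) y) = V_norm (%x. usd N y x - u y x)" if "y \<in> Iinf" for N y
    using V_norm_diff_commute[OF uV[OF that] usd_V_space] by (simp add: fun_diff_def)
  have "(%N. \<integral>y. (V_norm ((u - usd N) y))\<^sup>2 \<partial>mu) \<longlonglongrightarrow> (\<integral>y. 0 \<partial>mu)"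
  proof (rule integral_dominated_convergence[where w = "%_. (2 * (n2 torus f / r))\<^sup>2"])
    show "(%y. (V_norm ((u - usd N) y))\<^sup>2) \<in> borel_measurable mu" for N
      by (intro borel_measurable_power l2_measurable[OF L2V_l2(1)] L2V_diff solution_L2V u usd_L2V)
    show "AE y in mu. (%N. (V_norm ((u - usd N) y))\<^sup>2) \<longlonglongrightarrow> 0"
    proof (rule AE_I2)
      fix y assume "y \<in> space mu"
      then have y: "y \<in> Iinf" by (simp add: space_mu)
      have "(%N. (V_norm (%x. usd N y x - u y x))\<^sup>2) \<longlonglongrightarrow> 0\<^sup>2" by (intro tendsto_power usd_converges u y)
      then show "(%N. (V_norm ((u - usd N) y))\<^sup>2) \<longlonglongrightarrow> 0" unfolding eq[OF y] by simp
    qed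
    show "AE y in mu. norm ((V_norm ((u - usd N) y))\<^sup>2) <= (2 * (n2 torus f / r))\<^sup>2" for N
    proof (rule AE_I2)
      fix y assume "y \<in> space mu"
      then have y: "y \<in> Iinf" by (simp add: space_mu)
      have "V_norm (%x. usd N y x - u y x) <= V_norm (%x. usd N y x - 0) + V_norm (%x. 0 - u y x)"
        using V_norm_triangle3[OF usd_V_space tfun_V_space[of "{}" undefined] uV[OF y], of N y] by (simp add: tfun_def[abs_def])
      also have "V_norm (%x. 0 - u y x) = V_norm (%x. u y x - 0)"
        using V_norm_diff_commute[OF tfun_V_space[of "{}" undefined] uV[OF y]] by (simp add: tfun_def[abs_def])
      finally have "V_norm ((u - usd N) y) <= 2 * (n2 torus f / r)"
        unfolding eq[OF y] using usd_bound[OF y, of N] solution_bound[OF u y] by simp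
      then show "norm ((V_norm ((u - usd N) y))\<^sup>2) <= (2 * (n2 torus f / r))\<^sup>2"
        unfolding real_norm_def abs_power2 by (rule power_mono) (rule V_norm_nonneg)
    qed
  qed auto
  then have "(%N. sqrt (\<integral>y. (V_norm ((u - usd N) y))\<^sup>2 \<partial>mu)) \<longlonglongrightarrow> sqrt 0" by (intro tendsto_real_sqrt) simp
  then show ?thesis by (simp add: L2V_norm_def)
qed

lemma usd_coeff_converges:
  assumes u: "parametric_solution a f u" and k: "k \<in> Zstar" and s: "s \<in> finsupp"
  shows "(%N. legendre_coeff (usd N) (k, s)) \<longlonglongrightarrow> legendre_coeff u (k, s)"
proof -
  have uV: "u y \<in> V_space" if "y \<in> Iinf" for y by (rule solution_aform(1)[OF u that usd_V_space[of 0 y]])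
  have bL: "bm (%y. complex_of_real (mlegendre s y))" by (rule bm_of_real[OF bm_mlegendre[OF s]])
  have int: "integrable mu (%y. fc (v y) k * of_real (mlegendre s y))" if "v \<in> L2V" for v :: "(nat => real) => real ^ 'm => complex"
    by (rule fc_mult_integrable[OF _ _ that k bL, of "{}"]) auto
  have lc: "legendre_coeff v (k, s) = (\<integral>y. fc (v y) k * of_real (mlegendre s y) \<partial>mu)" for v :: "(nat => real) => real ^ 'm => complex"
    by (rule legendre_coeff_fc[of "{}"]) auto
  have p: "sqrt (pk k) > 0" using pk_pos[OF k] by simp
  show ?thesis unfolding lc
  proof (rule integral_dominated_convergence[where w = "%y. (n2 torus f / r / sqrt (pk k)) * norm (complex_of_real (mlegendre s y))"])
    show "(%y. fc (u y) k * of_real (mlegendre s y)) \<in> borel_measurable mu"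
      by (rule borel_measurable_integrable[OF int[OF solution_L2V[OF u]]])
    show "(%y. fc (usd N y) k * of_real (mlegendre s y)) \<in> borel_measurable mu" for N
      by (rule borel_measurable_integrable[OF int[OF usd_L2V]])
    show "integrable mu (%y. (n2 torus f / r / sqrt (pk k)) * norm (complex_of_real (mlegendre s y)))"
      by (intro integrable_mult_right integrable_norm bm_integrable bL)
    show "AE y in mu. (%N. fc (usd N y) k * of_real (mlegendre s y)) \<longlonglongrightarrow> fc (u y) k * of_real (mlegendre s y)"
    proof (rule AE_I2)
      fix y assume "y \<in> space mu"
      then have y: "y \<in> Iinf" by (simp add: space_mu)
      have "(%N. V_norm (%x. usd N y x - u y x) / sqrt (pk k)) \<longlonglongrightarrow> 0 / sqrt (pk k)" by (intro tendsto_divide usd_converges u y tendsto_const) (use p in simp)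
      then have l: "(%N. V_norm (%x. usd N y x - u y x) / sqrt (pk k)) \<longlonglongrightarrow> 0" by simp
      have "(%N. fc (usd N y) k - fc (u y) k) \<longlonglongrightarrow> 0"
      proof (rule Lim_null_comparison[OF always_eventually l], rule allI)
        fix N
        show "norm (fc (usd N y) k - fc (u y) k) <= V_norm (%x. usd N y x - u y x) / sqrt (pk k)"
          using fc_V_bound[OF V_space_diff[OF usd_V_space uV[OF y]] k, of N y] p
          unfolding fc_diff[OF V_space_integrable[OF usd_V_space] V_space_integrable[OF uV[OF y]]] by (simp add: pos_le_divide_eq mult.commute)
      qed
      then have "(%N. fc (usd N y) k) \<longlonglongrightarrow> fc (u y) k" by (rule LIM_zero_cancel)
      then show "(%N. fc (usd N y) k * of_real (mlegendre s y)) \<longlonglongrightarrow> fc (u y) k * of_real (mlegendre s y)" by (intro tendsto_mult tendsto_const)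
    qed
    show "AE y in mu. norm (fc (usd N y) k * of_real (mlegendre s y)) <= (n2 torus f / r / sqrt (pk k)) * norm (complex_of_real (mlegendre s y))" for N
    proof (rule AE_I2)
      fix y assume "y \<in> space mu"
      then have y: "y \<in> Iinf" by (simp add: space_mu)
      have "sqrt (pk k) * norm (fc (usd N y) k) <= n2 torus f / r" using fc_V_bound[OF usd_V_space k, of N y] usd_bound[OF y, of N] by linarith
      then have "norm (fc (usd N y) k) <= n2 torus f / r / sqrt (pk k)" using p by (simp only: pos_le_divide_eq mult.commute)
      then show "norm (fc (usd N y) k * of_real (mlegendre s y)) <= (n2 torus f / r / sqrt (pk k)) * norm (complex_of_real (mlegendre s y))"
        unfolding norm_mult by (rule mult_right_mono) simp
    qed
  qed
qed

end


context affine_problem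
begin

text \<open>Outside \<open>E\<close> the weight satisfies \<open>pk k > (2 * pi * T * mcoef b s)\<^sup>2\<close>, which bounds the squared \<open>V\<close> norm of
  the tail by the squares of the second order norms of the Legendre coefficients. These are at
  most \<open>K0 * mcoef \<theta> s\<close>, and the quotient of \<open>mcoef \<theta> s\<close> and \<open>mcoef b s\<close> is \<open>1 / mpow c s\<close>.\<close>

lemma semidiscrete_error:
  fixes c b :: "nat => real" and E :: "((int ^ 'm) \<times> (nat => nat)) set"
  assumes c1: "!!j. c j > 1" and c2: "summable (%j. (inverse (c j))\<^sup>2)" and b: "!!j. b j = c j * \<theta> j" and b0: "!!j. b j > 0"
    and T: "T \<ge> 1" and E: "finite E" "E = E1 b T" and N: "fst ` E \<subseteq> box N"
  shows "L2V_norm (usd N - gs E (legendre_coeff (usd N))) <= K0 / (2 * pi * T) * l2_finsupp_norm_inverse c"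
proof -
  define I where "I = (box N :: (int ^ 'm) set)"
  have I: "finite I" "I \<subseteq> Zstar" unfolding I_def by (rule box)+
  define w where "w k y = W I 0 (%_. 0) y k" for k y
  define cf where "cf k s = lcoef (w k) s" for k s
  define B where "B = K0 / (2 * pi * T)"
  have K0: "K0 \<ge> 0" using r Gamma_nonneg n2_nonneg[of torus f] by (intro divide_nonneg_nonneg mult_nonneg_nonneg add_nonneg_nonneg) auto
  have B0: "B \<ge> 0" unfolding B_def by (rule divide_nonneg_nonneg[OF K0]) (use T in simp)
  have EZ: "E \<subseteq> Zstar \<times> finsupp" unfolding E(2) E1_def by auto
  have pk0: "pk k \<ge> 0" for k :: "int ^ 'm" by (simp add: pk_def sum_nonneg)
  have wupc: "upc (w k)" if "k \<in> I" for k unfolding w_def[abs_def] by (rule W_upc[OF I _ that]) (simp add: finsupp_def)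
  have th0: "\<theta> j > 0" for j
  proof -
    have "0 < c j" using c1[of j] by linarith
    then show ?thesis using b0[of j] unfolding b[of j] by (simp only: zero_less_mult_pos)
  qed
  have lc: "legendre_coeff (usd N) (k, s) = cf k s" if "k \<in> I" for k s
  proof -
    have "legendre_coeff (usd N) (k, s) = (\<integral>y. fc (usd N y) k * of_real (mlegendre s y) \<partial>mu)" by (rule legendre_coeff_fc[of "{}"]) auto
    then show ?thesis using that by (simp add: cf_def lcoef_def w_def usd_def I_def[symmetric] fc_tfun[OF I(1)])
  qed
  let ?e = "%k y. w k y - (\<Sum>s\<in>E `` {k}. cf k s * of_real (mlegendre s y))"
  have err: "(usd N - gs E (legendre_coeff (usd N))) y = tfun I (%k. ?e k y)" for y
  proof -
    have "gs E (legendre_coeff (usd N)) y = tfun I (%k. gco E (legendre_coeff (usd N)) k y)"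
      unfolding gs_tfun[OF E(1) EZ] tfun_def
    proof (intro ext sum.mono_neutral_left I(1) N[folded I_def] ballI)
      fix x k assume "k \<in> I - fst ` E"
      then have "E `` {k} = {}" by force
      then show "gco E (legendre_coeff (usd N)) k y * efun k x = 0" by (simp add: gco_def)
    qed
    also have "... = tfun I (%k. \<Sum>s\<in>E `` {k}. cf k s * of_real (mlegendre s y))"
      by (rule tfun_cong) (simp add: gco_def lc)
    finally have g: "gs E (legendre_coeff (usd N)) y = tfun I (%k. \<Sum>s\<in>E `` {k}. cf k s * of_real (mlegendre s y))" .
    have "usd N y = tfun I (%k. w k y)" unfolding usd_def I_def[symmetric] w_def ..
    then show ?thesis unfolding fun_diff_def using g tfun_diff[of I "%k. w k y"] by simp
  qed
  have Es: "finite (E `` {k})" "E `` {k} \<subseteq> finsupp" for k using E_snd[OF E(1) EZ] by auto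
  have be: "bm (?e k)" if "k \<in> I" for k
  proof -
    have "bm (%y. w k y + (\<Sum>s\<in>E `` {k}. (- cf k s) * of_real (mlegendre s y)))"
      by (intro bm_add upc_bm[OF wupc] that bm_sum bm_mult bm_const bm_of_real bm_mlegendre Es(1)) (use Es(2) in auto)
    then show ?thesis by (simp add: sum_negf)
  qed
  have sq: "(L2V_norm (usd N - gs E (legendre_coeff (usd N))))\<^sup>2 = (\<Sum>k\<in>I. pk k * (\<integral>y. (norm (?e k y))\<^sup>2 \<partial>mu))"
  proof -
    have "(L2V_norm (usd N - gs E (legendre_coeff (usd N))))\<^sup>2 = (\<integral>y. (\<Sum>k\<in>I. pk k * (norm (?e k y))\<^sup>2) \<partial>mu)"
      unfolding L2V_norm_def err V_norm_tfun[OF I] by (rule real_sqrt_pow2) (simp add: integral_nonneg_AE sum_nonneg pk0)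
    also have "... = (\<Sum>k\<in>I. \<integral>y. pk k * (norm (?e k y))\<^sup>2 \<partial>mu)"
      by (rule Bochner_Integration.integral_sum) (intro bm_integrable bm_mult bm_const bm_norm_sq be)
    finally show ?thesis by simp
  qed
  let ?x = "%j. (inverse (c j))\<^sup>2"
  have xs: "mpow ?x summable_on finsupp"
  proof (rule summable_mpow[OF _ _ c2])
    show "(inverse (c j))\<^sup>2 < 1" for j using c1[of j] by (simp add: power_less_one_iff inverse_less_1_iff)
  qed simp
  have l2: "l2_finsupp_norm_inverse c = sqrt (infsum (mpow ?x) finsupp)"
    unfolding l2_finsupp_norm_inverse_def mpow_square ..
  have outside: "pk k * (norm (cf k s))\<^sup>2 <= (pk k)\<^sup>2 * (norm (cf k s))\<^sup>2 / (2 * pi * T * mcoef b s)\<^sup>2"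
    if "k \<in> I" "s \<in> finsupp" "(k, s) \<notin> E" for k s
  proof -
    have m: "mcoef b s > 0" by (rule mcoef_pos[OF b0])
    have "\<not> rho1 b k s <= T" using that I(2) unfolding E(2) E1_def by auto
    then have "T * mcoef b s < abs_inf k" unfolding rho1_eq using m by (simp add: pos_less_divide_eq not_le)
    then have "(2 * pi) * (T * mcoef b s) <= (2 * pi) * abs_inf k" by (intro mult_left_mono) auto
    then have "(2 * pi * T * mcoef b s)\<^sup>2 <= (2 * pi * abs_inf k)\<^sup>2" using m T by (intro power_mono) (auto simp: mult.assoc)
    also have "... <= pk k" by (rule pk_ge_inf)
    finally have "(2 * pi * T * mcoef b s)\<^sup>2 * (pk k * (norm (cf k s))\<^sup>2) <= pk k * (pk k * (norm (cf k s))\<^sup>2)"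
      by (rule mult_right_mono) (simp add: pk0)
    moreover have "(2 * pi * T * mcoef b s)\<^sup>2 > 0" using m T by simp
    ultimately show ?thesis by (simp only: pos_le_divide_eq power2_eq_square[of "pk k"] mult_ac)
  qed
  have column: "(\<Sum>k\<in>I. (pk k)\<^sup>2 * (norm (cf k s))\<^sup>2 / (2 * pi * T * mcoef b s)\<^sup>2) <= B\<^sup>2 * mpow ?x s" if s: "s \<in> finsupp" for s
  proof -
    have m: "mcoef b s > 0" by (rule mcoef_pos[OF b0])
    have mt: "mcoef \<theta> s > 0" by (rule mcoef_pos[OF th0])
    have c0: "mpow c s > 0" by (rule mpow_pos) (use c1 in \<open>auto intro: order.strict_trans[of 0 1]\<close>)
    have mb: "mcoef b s = mpow c s * mcoef \<theta> s"
    proof -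
      have "b = (%j. c j * \<theta> j)" using b by auto
      then show ?thesis unfolding mcoef_def by (simp only: mpow_mult mult_ac)
    qed
    have "N2p I (%k. cf k s) <= K0 * mcoef \<theta> s"
      unfolding cf_def w_def[abs_def] by (rule lcoef_W_bound[OF I s])
    then have "(N2p I (%k. cf k s))\<^sup>2 <= (K0 * mcoef \<theta> s)\<^sup>2" by (rule power_mono) (rule N2p_nonneg)
    then have "(\<Sum>k\<in>I. (pk k)\<^sup>2 * (norm (cf k s))\<^sup>2) / (2 * pi * T * mcoef b s)\<^sup>2 <= (K0 * mcoef \<theta> s)\<^sup>2 / (2 * pi * T * mcoef b s)\<^sup>2"
      unfolding N2p_sq[OF I(1)] by (rule divide_right_mono) simp
    also have "... = (B * inverse (mpow c s))\<^sup>2"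
      unfolding power_divide[symmetric] mb B_def
      using mt c0 T by (intro arg_cong[where f = "%x. x\<^sup>2"]) (simp add: divide_simps)
    also have "... = B\<^sup>2 * mpow ?x s" unfolding power_mult_distrib mpow_inverse[symmetric] mpow_square ..
    finally show ?thesis by (simp only: sum_divide_distrib)
  qed
  have bound: "(\<Sum>k\<in>I. pk k * (\<integral>y. (norm (?e k y))\<^sup>2 \<partial>mu)) <= B\<^sup>2 * infsum (mpow ?x) finsupp + e" if e: "e > 0" for e
  proof -
    \<comment> \<open>The share of the error \<open>e\<close> allowed in each Fourier coefficient; the 1 avoids division by zero.\<close>
  define e' where "e' = e / (1 + (\<Sum>k\<in>I. pk k))"
    have p1: "1 + (\<Sum>k\<in>I. pk k) > 0" using pk0 by (simp add: add_pos_nonneg sum_nonneg)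
    have e': "e' > 0" unfolding e'_def using e p1 by simp
    have "\<forall>k\<in>I. \<exists>S. finite S \<and> S \<subseteq> finsupp \<and> E `` {k} \<subseteq> S \<and>
      (\<integral>y. (norm (?e k y))\<^sup>2 \<partial>mu) <= e' + (\<Sum>s\<in>S - E `` {k}. (norm (cf k s))\<^sup>2)"
      unfolding cf_def by (intro ballI parseval_approx wupc Es e')
    from bchoice[OF this] obtain S where S: "\<forall>k\<in>I. finite (S k) \<and> S k \<subseteq> finsupp \<and> E `` {k} \<subseteq> S k \<and>
      (\<integral>y. (norm (?e k y))\<^sup>2 \<partial>mu) <= e' + (\<Sum>s\<in>S k - E `` {k}. (norm (cf k s))\<^sup>2)" ..
    define U where "U = (\<Union>k\<in>I. S k)"
    have U: "finite U" "U \<subseteq> finsupp" unfolding U_def using S I(1) by auto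
    have "(\<Sum>k\<in>I. pk k * (\<integral>y. (norm (?e k y))\<^sup>2 \<partial>mu)) <= (\<Sum>k\<in>I. pk k * e' + (\<Sum>s\<in>U. (pk k)\<^sup>2 * (norm (cf k s))\<^sup>2 / (2 * pi * T * mcoef b s)\<^sup>2))"
    proof (rule sum_mono)
      fix k assume k: "k \<in> I"
      have "pk k * (\<integral>y. (norm (?e k y))\<^sup>2 \<partial>mu) <= pk k * (e' + (\<Sum>s\<in>S k - E `` {k}. (norm (cf k s))\<^sup>2))"
        using S k pk0[of k] by (intro mult_left_mono) auto
      also have "... = pk k * e' + (\<Sum>s\<in>S k - E `` {k}. pk k * (norm (cf k s))\<^sup>2)" by (simp add: distrib_left sum_distrib_left)
      also have "... <= pk k * e' + (\<Sum>s\<in>S k - E `` {k}. (pk k)\<^sup>2 * (norm (cf k s))\<^sup>2 / (2 * pi * T * mcoef b s)\<^sup>2)"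
        using S k by (intro add_left_mono sum_mono outside) auto
      also have "... <= pk k * e' + (\<Sum>s\<in>U. (pk k)\<^sup>2 * (norm (cf k s))\<^sup>2 / (2 * pi * T * mcoef b s)\<^sup>2)"
        using k by (intro add_left_mono sum_mono2 U(1)) (auto simp: U_def)
      finally show "pk k * (\<integral>y. (norm (?e k y))\<^sup>2 \<partial>mu) <= pk k * e' + (\<Sum>s\<in>U. (pk k)\<^sup>2 * (norm (cf k s))\<^sup>2 / (2 * pi * T * mcoef b s)\<^sup>2)" .
    qed
    also have "... = (\<Sum>k\<in>I. pk k) * e' + (\<Sum>s\<in>U. \<Sum>k\<in>I. (pk k)\<^sup>2 * (norm (cf k s))\<^sup>2 / (2 * pi * T * mcoef b s)\<^sup>2)"
      unfolding sum.distrib sum_distrib_right by (subst sum.swap) (rule refl)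
    also have "... <= e + (\<Sum>s\<in>U. B\<^sup>2 * mpow ?x s)"
    proof (rule add_mono)
      have "(\<Sum>k\<in>I. pk k) * e' <= (1 + (\<Sum>k\<in>I. pk k)) * e'" using e' by (intro mult_right_mono) auto
      also have "... = e" unfolding e'_def using p1 by simp
      finally show "(\<Sum>k\<in>I. pk k) * e' <= e" .
      show "(\<Sum>s\<in>U. \<Sum>k\<in>I. (pk k)\<^sup>2 * (norm (cf k s))\<^sup>2 / (2 * pi * T * mcoef b s)\<^sup>2) <= (\<Sum>s\<in>U. B\<^sup>2 * mpow ?x s)"
        using U(2) by (intro sum_mono column) auto
    qed
    also have "(\<Sum>s\<in>U. B\<^sup>2 * mpow ?x s) <= B\<^sup>2 * infsum (mpow ?x) finsupp"
      unfolding sum_distrib_left[symmetric]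
      by (intro mult_left_mono finite_sum_le_infsum xs U mpow_nonneg) auto
    finally show ?thesis by simp
  qed
  then have "(L2V_norm (usd N - gs E (legendre_coeff (usd N))))\<^sup>2 <= B\<^sup>2 * infsum (mpow ?x) finsupp"
    unfolding sq by (rule field_le_epsilon)
  then have "sqrt ((L2V_norm (usd N - gs E (legendre_coeff (usd N))))\<^sup>2) <= sqrt (B\<^sup>2 * infsum (mpow ?x) finsupp)" by (rule real_sqrt_le_mono)
  then show ?thesis unfolding l2 B_def[symmetric] real_sqrt_mult real_sqrt_abs abs_of_nonneg[OF B0] by linarith
qed

text \<open>The bound does not depend on the semidiscretization parameter \<open>N\<close>, and both the functions and their
  finitely many coefficients converge.\<close>

lemma projection_error:
  fixes c b :: "nat => real" and E :: "((int ^ 'm) \<times> (nat => nat)) set"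
  assumes u: "parametric_solution a f u" and c1: "!!j. c j > 1" and c2: "summable (%j. (inverse (c j))\<^sup>2)"
    and b: "!!j. b j = c j * \<theta> j" and b0: "!!j. b j > 0" and T: "T \<ge> 1" and E: "finite E" "E = E1 b T"
  shows "L2V_norm (u - gs E (legendre_coeff u)) <= K0 / (2 * pi * T) * l2_finsupp_norm_inverse c"
proof -
  have EZ: "E \<subseteq> Zstar \<times> finsupp" unfolding E(2) E1_def by auto
  let ?c = "%N. legendre_coeff (usd N)" and ?B = "K0 / (2 * pi * T) * l2_finsupp_norm_inverse c"
  have uL: "u \<in> L2V" by (rule solution_L2V[OF u])
  have gL: "gs E c' \<in> L2V" for c' by (rule gs_L2V[OF E(1) EZ])
  have tri: "L2V_norm (u - gs E (legendre_coeff u)) <= L2V_norm (u - usd N) + L2V_norm (usd N - gs E (?c N)) + L2V_norm (gs E (?c N) - gs E (legendre_coeff u))" for N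
  proof -
    have "L2V_norm (u - gs E (legendre_coeff u)) <= L2V_norm (u - usd N) + L2V_norm (usd N - gs E (legendre_coeff u))"
      by (rule L2V_triangle[OF uL usd_L2V gL])
    moreover have "L2V_norm (usd N - gs E (legendre_coeff u)) <= L2V_norm (usd N - gs E (?c N)) + L2V_norm (gs E (?c N) - gs E (legendre_coeff u))"
      by (rule L2V_triangle[OF usd_L2V gL gL])
    ultimately show ?thesis by linarith
  qed
  have g0: "(%N. L2V_norm (gs E (?c N) - gs E (legendre_coeff u))) \<longlonglongrightarrow> 0"
  proof -
    have eq: "gs E (?c N) - gs E (legendre_coeff u) = gs E (%ks. ?c N ks - legendre_coeff u ks)" for N
      by (simp add: gs_def fun_eq_iff left_diff_distrib sum_subtractf)
    have "(%N. \<Sum>(k, s)\<in>E. pk k * (norm (?c N (k, s) - legendre_coeff u (k, s)))\<^sup>2) \<longlonglongrightarrow> (\<Sum>(k, s)\<in>E. pk k * (norm (0::complex))\<^sup>2)"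
      unfolding split_def
    proof (rule tendsto_sum)
      fix p assume "p \<in> E"
      then have "(%N. ?c N (fst p, snd p)) \<longlonglongrightarrow> legendre_coeff u (fst p, snd p)" using EZ by (intro usd_coeff_converges u) auto
      then have "(%N. ?c N (fst p, snd p) - legendre_coeff u (fst p, snd p)) \<longlonglongrightarrow> 0" by (rule LIM_zero)
      then show "(%N. pk (fst p) * (norm (?c N (fst p, snd p) - legendre_coeff u (fst p, snd p)))\<^sup>2) \<longlonglongrightarrow> pk (fst p) * (norm (0::complex))\<^sup>2"
        by (intro tendsto_intros)
    qed
    then have "(%N. (L2V_norm (gs E (?c N) - gs E (legendre_coeff u)))\<^sup>2) \<longlonglongrightarrow> 0"
      unfolding eq gs_L2V_norm[OF E(1) EZ] by (simp add: split_def)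
    then have "(%N. sqrt ((L2V_norm (gs E (?c N) - gs E (legendre_coeff u)))\<^sup>2)) \<longlonglongrightarrow> sqrt 0" by (rule tendsto_real_sqrt)
    then show ?thesis by (simp add: tendsto_rabs_zero_iff)
  qed
  have "(%N. L2V_norm (u - usd N) + ?B + L2V_norm (gs E (?c N) - gs E (legendre_coeff u))) \<longlonglongrightarrow> 0 + ?B + 0"
    by (intro tendsto_add tendsto_const g0 usd_converges_L2V u)
  moreover have "\<forall>\<^sub>F N in sequentially. L2V_norm (u - gs E (legendre_coeff u)) <= L2V_norm (u - usd N) + ?B + L2V_norm (gs E (?c N) - gs E (legendre_coeff u))"
  proof -
    have "\<forall>X :: (int ^ 'm) set. finite X \<and> X \<subseteq> Zstar \<longrightarrow> (\<forall>\<^sub>F N in sequentially. finite (box N :: (int ^ 'm) set) \<and> X \<subseteq> box N \<and> (box N :: (int ^ 'm) set) \<subseteq> Zstar)"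
      using box_limit unfolding filterlim_finite_subsets_at_top .
    from spec[OF this, of "fst ` E"]
    have "\<forall>\<^sub>F N in sequentially. finite (box N :: (int ^ 'm) set) \<and> fst ` E \<subseteq> box N \<and> (box N :: (int ^ 'm) set) \<subseteq> Zstar"
      by (rule mp) (intro conjI E_fst[OF E(1) EZ])
    then show ?thesis
    proof eventually_elim
      case (elim N)
      then show ?case using tri[of N] semidiscrete_error[OF c1 c2 b b0 T E, of N] by linarith
    qed
  qed
  ultimately have "L2V_norm (u - gs E (legendre_coeff u)) <= 0 + ?B + 0" by (intro tendsto_lowerbound) auto
  then show ?thesis by simp
qed

text \<open>Galerkin orthogonality holds only after integration over the parameter, so the pointwise energy
  inequality is integrated before the mixed term vanishes. The symmetry of \<open>E\<close> makes the space closed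
  under conjugation, as is needed to pass from the bilinear to the sesquilinear form.\<close>

lemma galerkin_quasi_optimal:
  fixes E :: "((int ^ 'm) \<times> (nat => nat)) set"
  assumes u: "parametric_solution a f u" and E: "finite E" "E \<subseteq> Zstar \<times> finsupp"
    and sym: "!!k s. (k, s) \<in> E ==> (- k, s) \<in> E" and un: "galerkin_approximation a f E un"
  shows "L2V_norm (u - un) <= sqrt (R / r) * L2V_norm (u - gs E p)"
proof -
  have "un \<in> range (gs E)" using un unfolding galerkin_approximation_def galerkin_space_gs[OF E(1)] by simp
  then obtain q where q: "un = gs E q" by (rule rangeE)
  define D where "D = gs E (%ks. q ks - p ks)"
  define Dc where "Dc = (%y x. cnj (D y x))"
  have conj: "(%y x. cnj (gs E c y x)) = gs E (%(k, s). cnj (c (- k, s)))" for c by (rule gs_cnj[OF sym])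
  have Dc: "Dc \<in> galerkin_space E" unfolding galerkin_space_gs[OF E(1)] Dc_def D_def conj by (rule rangeI)
  let ?K = "fst ` E"
  note K = E_fst[OF E]
  have DV: "D y \<in> V_space" and unV: "un y \<in> V_space" for y unfolding D_def q by (rule gs_V_space[OF E])+
  have Dt: "D y = tfun ?K (%k. gco E (%ks. q ks - p ks) k y)" and unt: "un y = tfun ?K (%k. gco E q k y)" for y
    unfolding D_def q by (rule gs_tfun[OF E])+
  have uL: "u \<in> L2V" by (rule solution_L2V[OF u])
  have uV: "u y \<in> V_space" if "y \<in> Iinf" for y using uL that by (simp add: L2V_def)
  define Q1 where "Q1 y = (\<integral>x. f x * cnj (D y x) \<partial>torus)" for y
  define Q2 where "Q2 y = aform (a y) (un y) (D y)" for y
  have i1: "integrable mu Q1"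
  proof -
    have "Q1 = (%y. \<Sum>l\<in>?K. cnj (gco E (%ks. q ks - p ks) l y) * fc f l)"
      unfolding Q1_def Dt f_pairing(1)[OF K(1)] ..
    then show ?thesis by (simp only:) (intro bm_integrable bm_sum bm_mult bm_cnj gco_bm[OF E] bm_const K)
  qed
  have Q2: "Q2 y = bil ?K (M y) (%k. gco E (%ks. q ks - p ks) k y) (%k. gco E q k y)" if "y \<in> Iinf" for y
    unfolding Q2_def Dt unt by (rule aform_tfun[OF K a_integrable[OF that]])
  have i2: "integrable mu Q2"
  proof -
    have "integrable mu (%y. bil ?K (M y) (%k. gco E (%ks. q ks - p ks) k y) (%k. gco E q k y))"
      unfolding bil_def mv_def by (intro bm_integrable bm_sum bm_mult bm_cnj gco_bm[OF E] upc_bm M_upc K)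
    moreover have "integrable mu Q2 \<longleftrightarrow> integrable mu (%y. bil ?K (M y) (%k. gco E (%ks. q ks - p ks) k y) (%k. gco E q k y))"
      by (rule Bochner_Integration.integrable_cong[OF refl]) (simp add: Q2 space_mu)
    ultimately show ?thesis by simp
  qed
  have "galerkin_form a un Dc = (\<integral>y. Q2 y \<partial>mu)"
    unfolding galerkin_form_def Q2_def Dc_def
    by (rule Bochner_Integration.integral_cong[OF refl], rule aform_bilinear[OF unV DV a_measurable]) (simp add: space_mu)
  moreover have "galerkin_rhs f Dc = (\<integral>y. Q1 y \<partial>mu)" unfolding galerkin_rhs_def Q1_def Dc_def ..
  moreover have "galerkin_form a un Dc = galerkin_rhs f Dc" using un Dc unfolding galerkin_approximation_def by (elim conjE bspec)
  ultimately have orth: "(\<integral>y. Q1 y - Q2 y \<partial>mu) = 0" using i1 i2 by simp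
  have sqV: "integrable mu (%y. (V_norm (v y))\<^sup>2)" "(\<integral>y. (V_norm (v y))\<^sup>2 \<partial>mu) = (L2V_norm v)\<^sup>2" if "v \<in> L2V" for v :: "(nat => real) => real ^ 'm => complex"
    using that by (auto simp: L2V_def L2V_norm_def integral_nonneg_AE)
  have e1: "u - un \<in> L2V" and e2: "u - gs E p \<in> L2V" unfolding q by (intro L2V_diff uL gs_L2V[OF E])+
  have pt: "r * (V_norm ((u - un) y))\<^sup>2 + 2 * Re (Q1 y - Q2 y) <= R * (V_norm ((u - gs E p) y))\<^sup>2" if y: "y \<in> Iinf" for y
  proof -
    have eV: "(%x. u y x - un y x) \<in> V_space" by (rule V_space_diff[OF uV[OF y] unV])
    have "aform (a y) (%x. u y x - un y x) (D y) = Q1 y - Q2 y"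
      unfolding aform_diff_left[OF a_measurable[OF y] a_abs_le[OF y] less_imp_le[OF rR(2)] uV[OF y] unV DV]
        solution_aform(2)[OF u y DV] Q1_def Q2_def ..
    moreover have "r * (V_norm (%x. u y x - un y x))\<^sup>2 + 2 * Re (aform (a y) (%x. u y x - un y x) (D y)) <= R * (V_norm (%x. (u y x - un y x) + D y x))\<^sup>2"
      by (rule energy_split[OF a_measurable[OF y] a_AE[OF y] r eV DV])
    moreover have "(%x. (u y x - un y x) + D y x) = (u - gs E p) y"
      by (simp add: fun_eq_iff q D_def gs_def left_diff_distrib sum_subtractf)
    moreover have "(%x. u y x - un y x) = (u - un) y" by (simp add: fun_eq_iff)
    ultimately show ?thesis by simp
  qed
  have "(\<integral>y. r * (V_norm ((u - un) y))\<^sup>2 + 2 * Re (Q1 y - Q2 y) \<partial>mu) <= (\<integral>y. R * (V_norm ((u - gs E p) y))\<^sup>2 \<partial>mu)"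
  proof (rule integral_mono)
    show "integrable mu (%y. r * (V_norm ((u - un) y))\<^sup>2 + 2 * Re (Q1 y - Q2 y))"
      by (intro Bochner_Integration.integrable_add integrable_mult_right sqV e1 integrable_Re Bochner_Integration.integrable_diff i1 i2)
    show "integrable mu (%y. R * (V_norm ((u - gs E p) y))\<^sup>2)" by (intro integrable_mult_right sqV e2)
  qed (rule pt, simp only: space_mu)
  also have "(\<integral>y. r * (V_norm ((u - un) y))\<^sup>2 + 2 * Re (Q1 y - Q2 y) \<partial>mu) = r * (L2V_norm (u - un))\<^sup>2 + 2 * Re (\<integral>y. Q1 y - Q2 y \<partial>mu)"
  proof -
    have iQ: "integrable mu (%y. Q1 y - Q2 y)" by (intro Bochner_Integration.integrable_diff i1 i2)
    have "(\<integral>y. r * (V_norm ((u - un) y))\<^sup>2 + 2 * Re (Q1 y - Q2 y) \<partial>mu) = (\<integral>y. r * (V_norm ((u - un) y))\<^sup>2 \<partial>mu) + (\<integral>y. 2 * Re (Q1 y - Q2 y) \<partial>mu)"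
      by (intro Bochner_Integration.integral_add integrable_mult_right sqV e1 integrable_Re iQ)
    then show ?thesis unfolding integral_mult_right_zero sqV(2)[OF e1] integral_Re[OF iQ] .
  qed
  finally have "r * (L2V_norm (u - un))\<^sup>2 <= R * (L2V_norm (u - gs E p))\<^sup>2"
    unfolding orth integral_mult_right_zero sqV(2)[OF e2] by simp
  then have "(L2V_norm (u - un))\<^sup>2 <= R / r * (L2V_norm (u - gs E p))\<^sup>2" using r by (simp add: field_simps)
  then have s: "sqrt ((L2V_norm (u - un))\<^sup>2) <= sqrt (R / r * (L2V_norm (u - gs E p))\<^sup>2)" by (rule real_sqrt_le_mono)
  have nn: "L2V_norm v \<ge> 0" for v :: "(nat => real) => real ^ 'm => complex" by (simp add: L2V_norm_def integral_nonneg_AE)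
  show ?thesis using s unfolding real_sqrt_mult[of "R / r"] real_sqrt_abs abs_of_nonneg[OF nn] .
qed

end

lemma E1_uminus: "(k, s) \<in> E1 b T ==> (- k, s) \<in> E1 b T"
  by (simp add: E1_def Zstar_uminus rho1_def abs_inf_def)

text \<open>The number \<open>9/4\<close> in \<open>C\<close> exceeds the factor 2 of the counting bound.\<close>

lemma rate_from_cardinality:
  fixes T C \<Sigma> :: real and m n :: nat
  assumes m: "m \<ge> 1" and n: "n > 0" "real n <= (2 * T) ^ m * \<Sigma>" and C: "C = (3 / 2) ^ (2 * m) * \<Sigma>" and T: "T \<ge> 1" and S: "\<Sigma> \<ge> 0"
  shows "1 / T <= C powr (1 / real m) * real n powr (- 1 / real m)"
proof -
  have T0: "T > 0" using T by simp
  have "(3 / 2) ^ (2 * m) = (9 / 4 :: real) ^ m" by (simp add: power_mult power2_eq_square)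
  then have C': "C = (9 / 4) ^ m * \<Sigma>" using C by simp
  have "real n <= (2 * T) ^ m * \<Sigma>" by (rule n)
  also have "... = 2 ^ m * \<Sigma> * T ^ m" by (simp add: power_mult_distrib)
  also have "... <= (9 / 4) ^ m * \<Sigma> * T ^ m" using T0 S by (intro mult_right_mono power_mono) auto
  finally have nC: "real n <= C * T ^ m" unfolding C' .
  have C0: "C > 0"
  proof (rule ccontr)
    assume "\<not> C > 0"
    then have "C * T ^ m <= 0" using T0 by (simp add: mult_nonpos_nonneg)
    then show False using nC n(1) by simp
  qed
  have "real n powr (1 / real m) <= (C * T ^ m) powr (1 / real m)" by (rule powr_mono2) (use nC in auto)
  also have "... = C powr (1 / real m) * T"
  proof -
    have "(T ^ m) powr (1 / real m) = T" using T0 m by (simp add: powr_realpow[symmetric] powr_powr)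
    then show ?thesis using C0 T0 by (simp add: powr_mult)
  qed
  finally have "real n powr (1 / real m) <= C powr (1 / real m) * T" .
  moreover have "real n powr (1 / real m) > 0" using n(1) by simp
  moreover have "1 / T <= c * inverse x" if "x <= c * T" "x > 0" for x c using that T0 by (simp add: field_simps)
  moreover have "real n powr (- 1 / real m) = inverse (real n powr (1 / real m))" by (simp add: powr_minus[symmetric])
  ultimately show ?thesis by simp
qed

theorem theorem6p3:
  fixes f :: "real ^ 'm \<Rightarrow> complex"
    and a :: "(nat \<Rightarrow> real) \<Rightarrow> real ^ 'm \<Rightarrow> real"
    and abar :: "real ^ 'm \<Rightarrow> real"
    and \<psi> :: "nat \<Rightarrow> real ^ 'm \<Rightarrow> real"
    and u un :: "(nat \<Rightarrow> real) \<Rightarrow> real ^ 'm \<Rightarrow> complex"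
    and b c d :: "nat \<Rightarrow> real"
    and r R K T B C :: real
    and m n :: nat
    and E :: "((int ^ 'm) \<times> (nat \<Rightarrow> nat)) set"
  assumes m: "m = CARD('m)"
    and f: "f \<in> L2_torus"
    and a: "a \<in> Linf_W1inf"
    and r: "0 < r"
    and a_bounds: "\<And>x y. y \<in> Iinf \<Longrightarrow> r < a y x \<and> a y x \<le> R"
    and abar: "abar \<in> W1inf"
    and psi: "\<And>j. \<psi> j \<in> W1inf"
    and affine: "\<And>x y. y \<in> Iinf \<Longrightarrow> (\<lambda>j. y j * \<psi> j x) sums (a y x - abar x)"
    and u: "parametric_solution a f u"
    and K: "K = 1 / r * (1 + (1 + Linf_W1inf_seminorm a / r)) * L2_norm f"
    and d: "\<And>j. d j = 1 / (r * sqrt 3) *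
              ((Linf_W1inf_seminorm a / r + 2) * Linf_norm (\<psi> j) + W1inf_seminorm (\<psi> j))"
    and c_gt_1: "\<And>j. c j > 1"
    and c_l2: "summable (\<lambda>j. (inverse (c j))\<^sup>2)"
    and b: "\<And>j. b j = c j * d j"
    and b_pos: "\<And>j. b j > 0"
    and b_l1: "summable (\<lambda>j. \<bar>b j\<bar>)"
    and b_norm_1: "m = 1 \<Longrightarrow> (\<Sum>j. \<bar>b j\<bar>) < 1"
    and b_norm: "m > 1 \<Longrightarrow> (\<Sum>j. \<bar>b j\<bar>) \<le> 1"
    and C: "C = (3 / 2) ^ (2 * m) *
              (\<Sum>\<^sub>\<infinity>s\<in>finsupp. (fact (msize s) / real (mfact s) * mpow b s) ^ m)"
    and B: "B = 4 * pi * C powr (1 / real m) * sqrt (real m * R / r) * K * l2_finsupp_norm_inverse c"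
    and T: "T \<ge> 1"
    and E: "E = E1 b T"
    and n: "n = card E"
    and un: "galerkin_approximation a f E un"
  shows "finite E \<and> u \<in> L2V \<and>
    L2V_orthogonal_projector (partial_sum_op E) (galerkin_space E) \<and>
    cfun.dim (galerkin_space E) = n \<and>
    (\<forall>w\<in>galerkin_space E. L2V_norm w = 0 \<longrightarrow> w = 0) \<and>
    L2V_norm (u - un) \<le> sqrt (R / r) * L2V_norm (u - partial_sum_op E u) \<and>
    sqrt (R / r) * L2V_norm (u - partial_sum_op E u) \<le> B * real n powr (- 1 / real m)"
proof -
  let ?G = "Linf_W1inf_seminorm a"
  have G0: "0 <= ?G" by (rule Linf_W1inf_seminorm_AE(2)[OF a])
  have al: "0 <= Linf_norm (\<psi> j)" for j by (rule Linf_esssup(2)[OF W1inf_Linf[OF psi]])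
  have be: "0 <= W1inf_seminorm (\<psi> j)" for j by (rule W1inf_seminorm_nonneg[OF psi])
  have sb: "summable b" using b_l1 b_pos by (simp add: abs_of_pos)
  have sumb: "(\<Sum>j. \<bar>b j\<bar>) = (\<Sum>j. b j)" using b_pos by (simp add: abs_of_pos)
  have "summable (%j. Linf_norm (\<psi> j))"
  proof (rule summable_comparison_test'[OF summable_mult[OF sb, of "r * sqrt 3"]])
    fix j :: nat
    have c0: "0 < c j" using c_gt_1[of j] by linarith
    have d0: "0 < d j" using b_pos[of j] c0 unfolding b by (simp only: zero_less_mult_pos)
    have "1 * d j <= c j * d j" using c_gt_1[of j] d0 by (intro mult_right_mono) auto
    then have db: "d j <= b j" by (simp add: b)
    have "1 * Linf_norm (\<psi> j) <= (?G / r + 2) * Linf_norm (\<psi> j)"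
      using G0 r al[of j] by (intro mult_right_mono) (auto intro: add_nonneg_nonneg order_trans[of 1 2])
    then have "Linf_norm (\<psi> j) <= (?G / r + 2) * Linf_norm (\<psi> j) + W1inf_seminorm (\<psi> j)" using be[of j] by simp
    also have "... = r * sqrt 3 * d j" unfolding d using r by simp
    also have "... <= r * sqrt 3 * b j" using db r by (intro mult_left_mono) auto
    finally show "norm (Linf_norm (\<psi> j)) <= r * sqrt 3 * b j" using al[of j] by simp
  qed
  then interpret affine_problem f a abar \<psi> r R
    by unfold_locales (use f a r a_bounds abar psi affine in auto)
  have bth: "b j = c j * \<theta> j" for j unfolding b d by simp
  have m1: "m \<ge> 1" unfolding m by (simp add: Suc_leI)
  have summ: "(%s. mcoef b s ^ CARD('m)) summable_on finsupp"
    unfolding m[symmetric] by (rule summable_mcoef_power[OF b_pos sb m1]) (use b_norm_1 b_norm sumb in auto)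
  let ?\<Sigma> = "\<Sum>\<^sub>\<infinity>s\<in>finsupp. mcoef b s ^ m"
  have fin: "finite E" unfolding E by (rule E1_card(1)[OF b_pos T summ])
  have nE: "real n <= (2 * T) ^ m * ?\<Sigma>" "n > 0"
    unfolding n E m using E1_card(2,3)[OF b_pos T summ] by auto
  have EZ: "E \<subseteq> Zstar \<times> finsupp" unfolding E E1_def by auto
  have S0: "?\<Sigma> \<ge> 0" by (rule infsum_nonneg) (simp add: mcoef_nonneg less_imp_le[OF b_pos])
  have "C = (3 / 2) ^ (2 * m) * ?\<Sigma>" unfolding C mcoef_def ..
  note rate = rate_from_cardinality[OF m1 nE(2,1) this T S0]
  have sym: "(- k, s) \<in> E" if "(k, s) \<in> E" for k s using that unfolding E by (rule E1_uminus)
  have quasi: "L2V_norm (u - un) <= sqrt (R / r) * L2V_norm (u - partial_sum_op E u)"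
    unfolding partial_sum_gs by (rule galerkin_quasi_optimal[OF u fin EZ sym un])
  let ?L = "l2_finsupp_norm_inverse c" and ?X = "C powr (1 / real m) * real n powr (- 1 / real m)"
  have L0: "?L \<ge> 0" unfolding l2_finsupp_norm_inverse_def by (intro real_sqrt_ge_zero infsum_nonneg) simp
  have nf: "0 <= n2 torus f" by (rule n2_nonneg)
  have KK: "K0 <= K"
  proof -
    have "K0 = 1 / r * (1 + ?G / r) * n2 torus f" by simp
    also have "... <= K" unfolding K L2_norm_n2 using r G0 by (intro mult_right_mono mult_left_mono nf) auto
    finally show ?thesis .
  qed
  have K0: "0 <= K0" using r G0 nf by (intro divide_nonneg_nonneg mult_nonneg_nonneg add_nonneg_nonneg) auto
  let ?P = "sqrt (R / r) * K * ?L"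
  have sR: "0 <= sqrt (R / r)" using r rR by simp
  have P0: "0 <= ?P" using sR KK K0 L0 by (intro mult_nonneg_nonneg) auto
  have err: "L2V_norm (u - partial_sum_op E u) <= K0 / (2 * pi * T) * ?L"
    unfolding partial_sum_gs by (rule projection_error[OF u c_gt_1 c_l2 bth b_pos T fin E])
  have "sqrt (R / r) * L2V_norm (u - partial_sum_op E u) <= sqrt (R / r) * (K0 / (2 * pi * T) * ?L)"
    by (rule mult_left_mono[OF err sR])
  also have "... <= sqrt (R / r) * (K / (2 * pi * T) * ?L)"
    using T KK by (intro mult_left_mono[OF _ sR] mult_right_mono[OF _ L0] divide_right_mono) auto
  also have "... = ?P * (1 / (2 * pi) * (1 / T))" by simp
  also have "... <= ?P * (1 * ?X)"
    using T pi_gt3 by (intro mult_left_mono[OF _ P0] mult_mono rate) (auto simp: field_simps)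
  also have "... <= (4 * pi * sqrt (real m)) * (?P * (1 * ?X))"
  proof -
    have "1 * 1 <= (4 * pi) * sqrt (real m)" using m1 pi_gt3 by (intro mult_mono) auto
    then have "1 * (?P * (1 * ?X)) <= (4 * pi * sqrt (real m)) * (?P * (1 * ?X))"
      using P0 by (intro mult_right_mono) auto
    then show ?thesis by simp
  qed
  also have "... = B * real n powr (- 1 / real m)"
  proof -
    have "sqrt (real m * R / r) = sqrt (real m) * sqrt (R / r)" by (simp add: real_sqrt_mult[symmetric])
    then show ?thesis unfolding B by (simp only: mult_ac mult_1)
  qed
  finally have main: "sqrt (R / r) * L2V_norm (u - partial_sum_op E u) <= B * real n powr (- 1 / real m)" .
  have zero: "\<forall>w\<in>galerkin_space E. L2V_norm w = 0 \<longrightarrow> w = 0"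
  proof (intro ballI impI)
    fix w assume "w \<in> galerkin_space E" and w0: "L2V_norm w = 0"
    then have "w \<in> range (gs E)" unfolding galerkin_space_gs[OF fin] by simp
    then obtain q where q: "w = gs E q" by (rule rangeE)
    have "q ks = 0" if "ks \<in> E" for ks by (rule gs_norm_zero[OF fin EZ w0[unfolded q] that])
    then show "w = 0" unfolding q gs_def by (simp add: fun_eq_iff)
  qed
  have dim: "cfun.dim (galerkin_space E) = n" unfolding n by (rule galerkin_dim[OF fin EZ])
  show ?thesis
    using fin solution_L2V[OF u] projector[OF fin EZ] dim zero quasi main by (intro conjI)
qed

end
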